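(* Let $$\kappa_0 = \lim_{p\to\infty} \frac1p\,\#\{z\in\mathbb{C} : |z| = 1 \text{ and } f_p(z) = 0\},$$ where $p$ runs through primes. (This limit exists.) Then $$0.500813 > \kappa_0 > 0.500668.$$
   Context: For an odd prime $p$, $\left(\frac{\cdot}{p}\right)$ denotes the Legendre symbol and the Fekete polynomial is $f_p(t) := \sum_{a=0}^{p-1} \left(\frac{a}{p}\right) t^a$. *)

theory Defs
  imports "HOL-Number_Theory.Number_Theory" "HOL-Computational_Algebra.Polynomial" Complex_Main
begin

definition fekete :: "nat \<Rightarrow> complex poly" where
  "fekete p = (\<Sum>a = 0..p - 1. monom (of_int (Legendre (int a) (int p))) a)"

(* Each zero is counted once, regardless of multiplicity. *)
definition unit_circle_zeros :: "nat \<Rightarrow> complex set" where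
  "unit_circle_zeros p = {z. cmod z = 1 \<and> poly (fekete p) z = 0}"

(* "p tends to infinity through the odd primes"; f_p is only defined for odd p. This filter is not
   bot, as there are infinitely many primes, so limits of real functions along it are unique. *)
definition odd_primes_at_top :: "nat filter" where
  "odd_primes_at_top = inf at_top (principal {p. prime p \<and> odd p})"

end

theory Submission
  imports Defs "HOL-Analysis.Analysis"
begin

text \<open>
  Why the theorem holds. At a point of the unit circle that is not a $p$-th root of unity, expanding the geometric
  sums in $f_p$ against the Legendre symbol writes $f_p$ as a nonzero factor times a combination of cotangents with poles
  at the $p$-th roots of unity and coefficients the values of the symbol (\<open>fekete_zero_iff_cot_sum\<close>). The zeros
  are therefore counted on the arcs between neighbouring roots of unity. If the symbols at the two ends of an arc agree,
  the cotangent sum changes sign and the arc carries exactly one zero (\<open>card_arc_zeros_same\<close>). If they differ, the sum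
  tends to infinity with the same sign at both ends, and there are two zeros if it dips through $0$ in between
  and none if it stays on one side (\<open>card_arc_zeros_opposite\<close>); divided differences of the cotangent exclude any further zero.

  On an arc with opposite end signs, the rescaled sum in the coordinate $0 < x < 1$ is close to the model function
  $1/x + 1/(1-x) + \sum_i \pm 1/|x+i|$, whose signs are the relative Legendre symbols at the nearby roots of
  unity: the distant terms are small in mean square over the arcs (\<open>card_large_tail\<close>). For any fixed finite
  set of indices the sign patterns are equidistributed as $p \to \infty$ (\<open>pattern_equidistributed\<close>), because
  Legendre symbols of products of distinct linear factors sum to $o(p)$ over a period. That cancellation
  is proved by Stepanov's method (\<open>stepanov_count\<close>). So the density of zeros is $1/2$
  (half of the arcs, one zero each) plus the limiting probability that the model function with fair random signs takes a
  negative value (half of the arcs, two zeros each). Passing to the limit needs that the minimum of the model rarely lies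
  in a short interval around $0$; this anticoncentration comes from the signs at the indices $4^r$
  (\<open>sprob_infimum_in_short_interval\<close>). The outcome is \<open>zero_density_limit\<close>.

  It remains to estimate that probability. At $x = 1/2$ the model equals $4 + 2S$ with $S = \sum_i \pm 1/|2i+1|$, so
  $P(S < -2)$ is a lower bound. Conversely, a second order expansion at $1/2$ shows that the model can be
  negative somewhere only if $S < -1.991$, or if the sum $S'$ without its two largest terms is at most $-1.964$
  (\<open>dips_le_tail_prob\<close>); the second event has probability below $0.000084$ by an exponential moment bound.
  The numbers $P(|S| > c)$ come from Fourier analysis: a square wave of period $4c$ in $S$ has the expectation
  $\sum_m (-1)^m \varphi_m/(2m+1)$, where $\varphi_m = \prod_j \cos^2((2m+1)\pi/(2c(2j+1)))$ (\<open>tail_prob_fourier\<close>).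
  The $\varphi_m$ decay exponentially in $m$, so a few of them suffice. The first twenty factors of these
  are computed in integer fixed-point arithmetic rounded in the safe direction; the remaining factors lie between
  explicit exponentials.
\<close>

section \<open>Integer polynomials modulo a prime\<close>

subsection \<open>Polynomials modulo a prime\<close>

lemma prime_const_poly: "prime p \<Longrightarrow> prime_elem [:int p:]"
  by (simp add: prime_elem_const_poly_iff)

lemma const_dvd_poly_eval: "[:c:] dvd F \<Longrightarrow> (c::int) dvd poly F x"
  by (metis dvdE dvd_triv_left poly_mult poly_pCons mult_zero_right poly_0 add.right_neutral)

lemma const_dvd_linear_iff:
  fixes G :: "int poly"
  assumes "c dvd poly G x"
  shows "[:c:] dvd G - [:-x, 1:] * synthetic_div G x"
proof -
  have "G - [:-x, 1:] * synthetic_div G x = [:poly G x:]"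
    using synthetic_div_correct'[of x G] by (metis add_diff_cancel_left')
  then show ?thesis using assms by simp
qed

lemma not_const_dvd_linear: "prime p \<Longrightarrow> \<not> [:int p:] dvd [:x, 1:]"
  unfolding const_poly_dvd_iff
  by (auto intro!: exI[of _ 1] dest: prime_gt_1_nat)

lemma telescope_factor: "(F - M * G) + M * (G - L * B) = F - (L * M) * (B :: 'a :: comm_ring_1)"
  by (simp add: algebra_simps)

text \<open>A factor that does not vanish at $y$ modulo $p$ is coprime to $X - y$, so the full power of $X - y$ has to
  divide the cofactor.\<close>
lemma linear_power_cancel_mod:
  fixes A N G :: "int poly"
  assumes p: "prime p" and N: "\<not> int p dvd poly N y"
    and "[:int p:] dvd [:-y, 1:] ^ l * A - N * G"
  shows "\<exists>B. [:int p:] dvd G - [:-y, 1:] ^ l * B"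
  using assms(3)
proof (induction l arbitrary: G)
  case 0
  show ?case by (rule exI[of _ G]) simp
next
  case (Suc l)
  have "int p dvd poly ([:-y, 1:] ^ Suc l * A - N * G) y"
    using Suc.prems by (rule const_dvd_poly_eval)
  then have "int p dvd poly N y * poly G y" by simp
  with N p have "int p dvd poly G y" by (simp add: prime_dvd_mult_iff)
  define G1 where "G1 = synthetic_div G y"
  have G1: "[:int p:] dvd G - [:-y, 1:] * G1"
    unfolding G1_def using \<open>int p dvd poly G y\<close> by (rule const_dvd_linear_iff)
  have "[:int p:] dvd ([:-y, 1:] ^ Suc l * A - N * G) + N * (G - [:-y, 1:] * G1)"
    using Suc.prems G1 by (intro dvd_add dvd_mult)
  also have "\<dots> = [:-y, 1:] * ([:-y, 1:] ^ l * A - N * G1)"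
    using telescope_factor[of "[:-y, 1:] ^ Suc l * A" N G "[:-y, 1:]" G1]
    by (simp only: power_Suc mult.assoc right_diff_distrib)
  finally have "[:int p:] dvd [:-y, 1:] ^ l * A - N * G1"
    using prime_const_poly[OF p] not_const_dvd_linear[OF p] prime_elem_dvd_mult_iff by blast
  from Suc.IH[OF this] obtain B where B: "[:int p:] dvd G1 - [:-y, 1:] ^ l * B" by blast
  have "[:int p:] dvd (G - [:-y, 1:] * G1) + [:-y, 1:] * (G1 - [:-y, 1:] ^ l * B)"
    using G1 B by (intro dvd_add dvd_mult)
  also have "\<dots> = G - [:-y, 1:] ^ Suc l * B"
    by (simp only: telescope_factor power_Suc2)
  finally show ?case by blast
qed

text \<open>Dropping leading terms divisible by $p$ makes the degree of the representative the degree modulo $p$.\<close>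
lemma reduce_coeffs_mod:
  fixes G :: "int poly"
  assumes "p > (0::int)"
  obtains G' where "[:p:] dvd G - G'" "G' = 0 \<or> \<not> p dvd lead_coeff G'"
proof
  let ?G = "map_poly (\<lambda>c. c mod p) G"
  have c: "coeff ?G n = coeff G n mod p" for n by (simp add: coeff_map_poly)
  show "[:p:] dvd G - ?G" unfolding const_poly_dvd_iff by (simp add: c)
  have "?G \<noteq> 0 \<Longrightarrow> \<not> p dvd lead_coeff ?G"
    using c[of "degree ?G"] leading_coeff_neq_0[of ?G] by (metis mod_mod_trivial mod_0_imp_dvd dvd_imp_mod_0)
  then show "?G = 0 \<or> \<not> p dvd lead_coeff ?G" by blast
qed

lemma degree_monic_factor_mod:
  fixes F M G :: "int poly"
  assumes p: "p > 0" and M: "lead_coeff M = 1" and "[:p:] dvd F - M * G" "\<not> [:p:] dvd F"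
  shows "degree M \<le> degree F"
proof (rule ccontr)
  assume less: "\<not> degree M \<le> degree F"
  obtain G' where G': "[:p:] dvd G - G'" "G' = 0 \<or> \<not> p dvd lead_coeff G'"
    using reduce_coeffs_mod[OF p] by blast
  have "[:p:] dvd (F - M * G) + M * (G - G')" using assms G' by (intro dvd_add dvd_mult)
  also have "\<dots> = F - M * G'" by (simp add: algebra_simps)
  finally have d: "[:p:] dvd F - M * G'" .
  then have "G' \<noteq> 0" using assms(4) by auto
  then have "coeff (F - M * G') (degree M + degree G') = - lead_coeff G'"
    using less M by (simp add: coeff_mult_degree_sum coeff_eq_0)
  moreover have "p dvd coeff (F - M * G') (degree M + degree G')"
    using d unfolding const_poly_dvd_iff by blast
  ultimately show False using G'(2) \<open>G' \<noteq> 0\<close> by simp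
qed

text \<open>Roots distinct modulo $p$ can be split off one after the other, each with its multiplicity; a polynomial
  that does not vanish modulo $p$ leaves room for only as many as its degree allows.\<close>
lemma card_multiple_roots_mod:
  fixes F :: "int poly"
  assumes p: "prime p" and fin: "finite S" and F: "\<not> [:int p:] dvd F"
    and inj: "\<And>x y. x \<in> S \<Longrightarrow> y \<in> S \<Longrightarrow> int p dvd x - y \<Longrightarrow> x = y"
    and roots: "\<And>x. x \<in> S \<Longrightarrow> \<exists>G. [:int p:] dvd F - [:-x, 1:] ^ l * G"
  shows "l * card S \<le> degree F"
proof -
  define M where "M U = (\<Prod>x\<in>U. [:-x, 1:])" for U :: "int set"
  have "\<exists>G. [:int p:] dvd F - M S ^ l * G" using fin inj roots
  proof (induction S)
    case empty
    show ?case by (rule exI[of _ F]) (simp add: M_def)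
  next
    case (insert y S)
    then obtain G where G: "[:int p:] dvd F - M S ^ l * G" by blast
    from insert.prems obtain A where A: "[:int p:] dvd F - [:-y, 1:] ^ l * A" by blast
    have "[:int p:] dvd (F - M S ^ l * G) - (F - [:-y, 1:] ^ l * A)" using G A by (rule dvd_diff)
    then have *: "[:int p:] dvd [:-y, 1:] ^ l * A - M S ^ l * G" by simp
    have "\<not> int p dvd poly [:-x, 1:] y" if "x \<in> S" for x
      using insert.prems(1)[of y x] that insert.hyps by auto
    then have "\<not> int p dvd poly (M S ^ l) y"
      using p insert.hyps(1) unfolding M_def
      by (auto simp: poly_prod prime_dvd_prod_iff dest!: prime_dvd_power[rotated])
    from linear_power_cancel_mod[OF p this *] obtain B
      where B: "[:int p:] dvd G - [:-y, 1:] ^ l * B" by blast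
    have "[:int p:] dvd (F - M S ^ l * G) + M S ^ l * (G - [:-y, 1:] ^ l * B)"
      using G B by (intro dvd_add dvd_mult)
    also have "\<dots> = F - ([:-y, 1:] * M S) ^ l * B"
      by (simp only: power_mult_distrib telescope_factor)
    also have "[:-y, 1:] * M S = M (insert y S)" using insert.hyps by (simp add: M_def)
    finally show ?case by blast
  qed
  then obtain G where G: "[:int p:] dvd F - M S ^ l * G" by blast
  have "lead_coeff (M S ^ l) = 1" by (simp add: M_def lead_coeff_power lead_coeff_prod)
  with G F p have "degree (M S ^ l) \<le> degree F"
    by (intro degree_monic_factor_mod[of "int p"]) (auto simp: prime_gt_0_nat)
  moreover have "degree (M S ^ l) = l * card S"
    unfolding M_def by (subst degree_power_eq) (auto simp: degree_prod_eq_sum_degree fin)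
  ultimately show ?thesis by simp
qed

lemma pderiv_funpow_linear_power:
  fixes G :: "int poly"
  shows "poly ((pderiv ^^ l) ([:-x, 1:] ^ l * G)) x = fact l * poly G x"
proof (induction l arbitrary: G)
  case (Suc l)
  have "pderiv ([:-x, 1:] ^ Suc l * G) = [:-x, 1:] ^ l * (smult (of_nat (Suc l)) G + [:-x, 1:] * pderiv G)"
    by (simp only: pderiv_mult pderiv_power_Suc) (simp add: pderiv_pCons algebra_simps)
  then have "(pderiv ^^ Suc l) ([:-x, 1:] ^ Suc l * G)
      = (pderiv ^^ l) ([:-x, 1:] ^ l * (smult (of_nat (Suc l)) G + [:-x, 1:] * pderiv G))"
    by (simp only: funpow_Suc_right o_apply)
  then show ?case by (simp only: Suc.IH) (simp add: algebra_simps)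
qed auto

lemma pderiv_funpow_const_dvd:
  fixes F :: "int poly"
  shows "[:c:] dvd F \<Longrightarrow> [:c:] dvd (pderiv ^^ k) F"
proof (induction k)
  case (Suc k)
  then obtain H where "(pderiv ^^ k) F = smult c H" by auto
  then have "(pderiv ^^ Suc k) F = [:c:] * pderiv H" by (simp add: pderiv_smult)
  then show ?case by (metis dvd_triv_left)
qed auto

text \<open>Taylor expansion at $x$: the factorials up to $(p-1)!$ are units modulo $p$, so vanishing derivatives mean
  vanishing coefficients.\<close>
lemma multiple_root_mod:
  fixes F :: "int poly"
  assumes p: "prime p" and "l \<le> p" and "\<And>k. k < l \<Longrightarrow> int p dvd poly ((pderiv ^^ k) F) x"
  shows "\<exists>G. [:int p:] dvd F - [:-x, 1:] ^ l * G"
  using assms(2,3)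
proof (induction l)
  case 0
  show ?case by (rule exI[of _ F]) simp
next
  case (Suc l)
  then obtain G where G: "[:int p:] dvd F - [:-x, 1:] ^ l * G" by auto
  have "int p dvd poly ((pderiv ^^ l) (F - [:-x, 1:] ^ l * G)) x"
    by (intro const_dvd_poly_eval pderiv_funpow_const_dvd G)
  moreover have "(pderiv ^^ l) F = (pderiv ^^ l) (F - [:-x, 1:] ^ l * G) + (pderiv ^^ l) ([:-x, 1:] ^ l * G)"
    by (simp flip: higher_pderiv_add)
  moreover have "int p dvd poly ((pderiv ^^ l) F) x" using Suc.prems by auto
  ultimately have "int p dvd poly ((pderiv ^^ l) ([:-x, 1:] ^ l * G)) x"
    by (simp add: dvd_add_right_iff)
  then have "int p dvd fact l * poly G x" by (simp add: pderiv_funpow_linear_power)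
  moreover have "\<not> int p dvd fact l"
    using p Suc.prems(1) prime_dvd_fact_iff[OF p, of l]
    by (metis Suc_le_eq int_dvd_int_iff leD of_nat_fact)
  ultimately have "int p dvd poly G x" using p by (simp add: prime_dvd_mult_iff)
  then have G1: "[:int p:] dvd G - [:-x, 1:] * synthetic_div G x" by (rule const_dvd_linear_iff)
  have "[:int p:] dvd (F - [:-x, 1:] ^ l * G) + [:-x, 1:] ^ l * (G - [:-x, 1:] * synthetic_div G x)"
    using G G1 by (intro dvd_add dvd_mult)
  also have "\<dots> = F - [:-x, 1:] ^ Suc l * synthetic_div G x"
    by (simp only: telescope_factor power_Suc)
  finally show ?case by blast
qed

section \<open>Stepanov's method\<close>

text \<open>Siegel's pigeonhole argument replaces linear algebra over the field with $p$ elements: with more unknowns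
  than equations two assignments collide, and their difference is a nontrivial solution.\<close>
lemma linear_system_mod:
  fixes \<Phi> :: "('i \<Rightarrow> int) \<Rightarrow> 'c \<Rightarrow> int" and p :: int
  assumes p: "p > 1" and fin: "finite I" "finite C" and card: "card C < card I"
    and diff: "\<And>u v c. \<Phi> (\<lambda>i. u i - v i) c = \<Phi> u c - \<Phi> v c"
  shows "\<exists>v. (\<exists>i\<in>I. \<not> p dvd v i) \<and> (\<forall>c\<in>C. p dvd \<Phi> v c)"
proof -
  let ?U = "PiE I (\<lambda>_. {0..<p})" and ?V = "PiE C (\<lambda>_. {0..<p})"
  define h where "h v = restrict (\<lambda>c. \<Phi> v c mod p) C" for v
  have "card ?V = nat p ^ card C" "card ?U = nat p ^ card I"
    using fin by (simp_all add: card_PiE)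
  then have "card ?V < card ?U" using p card by simp
  moreover have "h ` ?U \<subseteq> ?V" using p by (auto simp: h_def)
  moreover have "finite ?U" "finite ?V" using fin by (auto intro: finite_PiE)
  ultimately have "\<not> inj_on h ?U" using card_inj_on_le[of h ?U ?V] by linarith
  then obtain u v where uv: "u \<in> ?U" "v \<in> ?U" "h u = h v" "u \<noteq> v" unfolding inj_on_def by blast
  then obtain i where i: "i \<in> I" "u i \<noteq> v i" by (metis PiE_ext)
  have "u i \<in> {0..<p}" "v i \<in> {0..<p}" using uv i by (auto simp: PiE_def Pi_def)
  then have "\<bar>u i - v i\<bar> < p" by auto
  then have "\<not> p dvd u i - v i" using i(2) zdvd_not_zless[of "\<bar>u i - v i\<bar>" p] by auto
  moreover have "p dvd \<Phi> (\<lambda>i. u i - v i) c" if "c \<in> C" for c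
    using fun_cong[OF uv(3), of c] that by (simp add: h_def diff mod_eq_dvd_iff)
  ultimately show ?thesis using i(1) by (intro exI[of _ "\<lambda>i. u i - v i"]) auto
qed

text \<open>The cofactor left when $f^{m-k}$ is taken out of the $k$-th derivative of $f^m q$.\<close>
fun power_deriv_cofactor :: "int poly \<Rightarrow> nat \<Rightarrow> nat \<Rightarrow> int poly \<Rightarrow> int poly" where
  "power_deriv_cofactor f m 0 q = q"
| "power_deriv_cofactor f m (Suc k) q =
     smult (int (m - k)) (pderiv f * power_deriv_cofactor f m k q) + f * pderiv (power_deriv_cofactor f m k q)"

lemma pderiv_funpow_power_mult:
  "k \<le> m \<Longrightarrow> (pderiv ^^ k) (f ^ m * q) = f ^ (m - k) * power_deriv_cofactor f m k q"
proof (induction k)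
  case (Suc k)
  then obtain r where r: "m - k = Suc r" "m - Suc k = r" by (metis Suc_diff_Suc Suc_le_lessD)
  show ?case using Suc r
    by (simp add: pderiv_mult pderiv_power_Suc algebra_simps del: power_Suc) (simp add: algebra_simps)
qed auto

lemma power_deriv_cofactor_diff:
  "power_deriv_cofactor f m k (q - r) = power_deriv_cofactor f m k q - power_deriv_cofactor f m k r"
  by (induction k) (simp_all add: pderiv_diff right_diff_distrib smult_diff_right)

lemma degree_power_deriv_cofactor:
  "degree (power_deriv_cofactor f m k q) \<le> degree q + k * degree f"
proof (induction k)
  case (Suc k)
  let ?c = "power_deriv_cofactor f m k q"
  have "degree (smult (int (m - k)) (pderiv f * ?c)) \<le> degree (pderiv f) + degree ?c"
    by (meson degree_mult_le degree_smult_le order_trans)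
  also have "\<dots> \<le> degree f + (degree q + k * degree f)"
    using Suc by (simp add: degree_pderiv)
  finally have 1: "degree (smult (int (m - k)) (pderiv f * ?c)) \<le> degree q + Suc k * degree f" by simp
  have "degree (f * pderiv ?c) \<le> degree f + degree (pderiv ?c)" by (rule degree_mult_le)
  also have "\<dots> \<le> degree f + (degree q + k * degree f)"
    using Suc by (simp add: degree_pderiv)
  finally have 2: "degree (f * pderiv ?c) \<le> degree q + Suc k * degree f" by simp
  show ?case using 1 2 by (simp only: power_deriv_cofactor.simps degree_add_le)
qed simp

text \<open>Powers of $X^p$ behave as constants under differentiation modulo $p$.\<close>
lemma pderiv_funpow_monom_mod:
  fixes W :: "int poly"
  shows "[:int p:] dvd (pderiv ^^ k) (W * monom 1 (j * p)) - (pderiv ^^ k) W * monom 1 (j * p)"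
proof (induction k)
  case (Suc k)
  let ?X = "monom 1 (j * p) :: int poly"
  let ?D = "(pderiv ^^ k) (W * ?X) - (pderiv ^^ k) W * ?X"
  have 1: "[:int p:] dvd pderiv ?D" using pderiv_funpow_const_dvd[OF Suc, of 1] by simp
  have "int p dvd int (j * p)" by simp
  then have "[:int p:] dvd pderiv ?X" unfolding const_poly_dvd_iff
    by (simp add: coeff_pderiv coeff_monom) (metis of_nat_Suc of_nat_mult dvd_triv_right)
  then have "[:int p:] dvd pderiv ?D + (pderiv ^^ k) W * pderiv ?X" using 1 by (intro dvd_add dvd_mult)
  also have "\<dots> = (pderiv ^^ Suc k) (W * ?X) - (pderiv ^^ Suc k) W * ?X"
    by (simp add: pderiv_diff pderiv_mult algebra_simps)
  finally show ?case .
qed simp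

lemma const_dvd_sum: "(\<And>j. j \<in> A \<Longrightarrow> [:c:] dvd F j - G j) \<Longrightarrow> [:c:] dvd (\<Sum>j\<in>A. F j) - (\<Sum>j\<in>A. G j :: 'a :: idom poly)"
  by (subst sum_subtractf[symmetric]) (rule dvd_sum)

lemma fermat_power_int:
  assumes "prime p" shows "[x ^ (j * p) = x ^ j] (mod int p)"
proof -
  have "[x ^ p = x] (mod int p)"
  proof (cases "int p dvd x")
    case True
    then show ?thesis using assms
      by (metis cong_0_iff cong_sym cong_trans dvd_power_same dvd_trans dvd_power prime_gt_0_nat)
  next
    case False
    have "[x ^ (p - 1) = 1] (mod int p)"
    proof -
      have "[(x mod int p) ^ (p - 1) = 1] (mod int p)"
      proof -
        define a where "a = nat (x mod int p)"
        have a: "int a = x mod int p" using assms by (simp add: a_def prime_gt_0_nat)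
        then have "\<not> p dvd a" using False by (metis dvd_mod_iff dvd_refl int_dvd_int_iff)
        then have "[a ^ (p - 1) = 1] (mod p)" using assms fermat_theorem by blast
        then show ?thesis using a by (metis cong_int_iff of_nat_1 of_nat_power)
      qed
      then show ?thesis by (metis cong_mod_left cong_pow cong_def mod_mod_trivial power_mod)
    qed
    then have "[x * x ^ (p - 1) = x * 1] (mod int p)" by (rule cong_scalar_left)
    moreover have "x * x ^ (p - 1) = x ^ p" using assms prime_gt_0_nat by (metis power_minus_mult mult.commute)
    ultimately show ?thesis by simp
  qed
  then have "[(x ^ p) ^ j = x ^ j] (mod int p)" by (rule cong_pow)
  then show ?thesis by (simp add: power_mult[symmetric] mult.commute)
qed

text \<open>Descent: a simple root of $f$ modulo $p$ forces the two sides of $q^2 f = c r^2$ to have orders of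
  vanishing of different parity at that root.\<close>
lemma nonsquare_descent_mod:
  fixes f q r :: "int poly"
  assumes p: "prime p" and c: "\<not> int p dvd c"
    and f: "f = [:-x, 1:] * f1" "\<not> int p dvd poly f1 x"
    and eq: "[:int p:] dvd q\<^sup>2 * f - smult c (r\<^sup>2)"
  shows "[:int p:] dvd q \<and> [:int p:] dvd r"
  using eq
proof (induction "degree q" arbitrary: q r rule: less_induct)
  case less
  let ?P = "[:int p:]" and ?X = "[:-x, 1:]"
  note prime = prime_const_poly[OF p] and nX = not_const_dvd_linear[OF p]
  have cancelX: "?P dvd ?X * A \<Longrightarrow> ?P dvd A" for A
    using prime nX prime_elem_dvd_mult_iff by blast
  have "int p dvd poly (q\<^sup>2 * f - smult c (r\<^sup>2)) x" using less.prems by (rule const_dvd_poly_eval)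
  then have "int p dvd c * (poly r x)\<^sup>2" by (simp add: f)
  then have "int p dvd poly r x" using c p by (auto simp: prime_dvd_mult_iff dest: prime_dvd_power[rotated])
  define r1 where "r1 = synthetic_div r x"
  have r1: "?P dvd r - ?X * r1" unfolding r1_def using \<open>int p dvd poly r x\<close> by (rule const_dvd_linear_iff)
  have ring: "(q\<^sup>2 * (X * f1) - C * r\<^sup>2) + C * (r + X * r1) * (r - X * r1) = X * (q\<^sup>2 * f1 - C * (X * r1\<^sup>2))"
    for X C r r1 :: "int poly" by (simp add: power2_eq_square algebra_simps)
  have "?P dvd (q\<^sup>2 * f - smult c (r\<^sup>2)) + smult c (r + ?X * r1) * (r - ?X * r1)"
    using less.prems r1 by (intro dvd_add dvd_mult)
  also have "\<dots> = ?X * (q\<^sup>2 * f1 - smult c (?X * r1\<^sup>2))"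
    using ring[of ?X "[:c:]" r r1] unfolding f(1) by simp
  finally have e1: "?P dvd q\<^sup>2 * f1 - smult c (?X * r1\<^sup>2)" by (rule cancelX)
  have "int p dvd poly (q\<^sup>2 * f1 - smult c (?X * r1\<^sup>2)) x" using e1 by (rule const_dvd_poly_eval)
  then have "int p dvd (poly q x)\<^sup>2 * poly f1 x" by simp
  then have qx: "int p dvd poly q x" using f(2) p by (auto simp: prime_dvd_mult_iff dest: prime_dvd_power[rotated])
  define q1 where "q1 = synthetic_div q x"
  have q1: "?P dvd q - ?X * q1" unfolding q1_def using qx by (rule const_dvd_linear_iff)
  have ring2: "(q\<^sup>2 * f1 - C * (X * r1\<^sup>2)) - (q + X * q1) * f1 * (q - X * q1) = X * (q1\<^sup>2 * (X * f1) - C * r1\<^sup>2)"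
    for X C q1 r1 :: "int poly" by (simp add: power2_eq_square algebra_simps)
  have "?P dvd (q\<^sup>2 * f1 - smult c (?X * r1\<^sup>2)) - (q + ?X * q1) * f1 * (q - ?X * q1)"
    by (rule dvd_diff[OF e1 dvd_mult[OF q1]])
  also have "\<dots> = ?X * (q1\<^sup>2 * f - smult c (r1\<^sup>2))"
    using ring2[of "[:c:]" ?X r1 q1] unfolding f(1) by simp
  finally have e2: "?P dvd q1\<^sup>2 * f - smult c (r1\<^sup>2)" by (rule cancelX)
  have "?P dvd q1 \<and> ?P dvd r1"
  proof (cases "degree q = 0")
    case True
    then have "q1 = 0" by (simp add: q1_def synthetic_div_eq_0_iff)
    then have "?P dvd [:c:] * r1\<^sup>2" using e2 by simp
    then have "?P dvd r1" using prime c
      by (metis const_poly_dvd_const_poly_iff prime_elem_dvd_mult_iff prime_elem_dvd_power)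
    then show ?thesis using \<open>q1 = 0\<close> by simp
  next
    case False
    then have "degree q1 < degree q" by (simp add: q1_def degree_synthetic_div)
    then show ?thesis using less.hyps e2 by blast
  qed
  then have "?P dvd (q - ?X * q1) + ?X * q1" "?P dvd (r - ?X * r1) + ?X * r1"
    using dvd_add[OF q1 dvd_mult] dvd_add[OF r1 dvd_mult] by blast+
  then show ?case by (simp only: diff_add_cancel)
qed

lemma prime_dvd_choose:
  fixes p :: nat
  assumes "prime p" "0 < k" "k < p" shows "p dvd p choose k"
proof -
  have "p dvd fact k * fact (p - k) * (p choose k)"
    using assms by (simp add: binomial_fact_lemma prime_gt_0_nat dvd_fact)
  moreover have "\<not> p dvd fact k" "\<not> p dvd fact (p - k)"
    using assms by (auto simp: prime_dvd_fact_iff)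
  ultimately show ?thesis using assms(1) prime_dvd_mult_nat by blast
qed

lemma poly_add_power_prime_mod:
  fixes A B :: "int poly"
  assumes "prime p" shows "[:int p:] dvd (A + B) ^ p - (A ^ p + B ^ p)"
proof -
  have "p > 0" using assms prime_gt_0_nat by blast
  have "(A + B) ^ p = (\<Sum>k\<le>p. of_nat (p choose k) * A ^ k * B ^ (p - k))" by (rule binomial_ring)
  also have "{..p} = insert 0 (insert p {1..<p})" by auto
  also have "(\<Sum>k\<in>\<dots>. of_nat (p choose k) * A ^ k * B ^ (p - k))
      = A ^ p + B ^ p + (\<Sum>k\<in>{1..<p}. of_nat (p choose k) * A ^ k * B ^ (p - k))"
    using \<open>p > 0\<close> by simp
  finally have "(A + B) ^ p - (A ^ p + B ^ p) = (\<Sum>k\<in>{1..<p}. of_nat (p choose k) * A ^ k * B ^ (p - k))"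
    by simp
  also have "[:int p:] dvd \<dots>"
  proof (intro dvd_sum dvd_mult2)
    fix k assume "k \<in> {1..<p}"
    then have "int p dvd int (p choose k)" using prime_dvd_choose[of p k] assms by simp
    then show "[:int p:] dvd of_nat (p choose k)" by (simp add: of_nat_poly)
  qed
  finally show ?thesis .
qed

text \<open>Raising to the $p$-th power is additive modulo $p$, so $f^p$ is a polynomial in $X^p$ with constant term
  $f(0)^p \equiv f(0)$.\<close>
lemma linear_product_power_prime_mod:
  assumes p: "prime p" and "finite T"
  shows "\<exists>Z. [:int p:] dvd (\<Prod>t\<in>T. [:t, 1:]) ^ p - ([:\<Prod>T:] + monom 1 p * Z)"
  using assms(2)
proof (induction T)
  case empty
  show ?case by (rule exI[of _ 0]) (simp add: pCons_one)
next
  case (insert t T)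
  then obtain Z where Z: "[:int p:] dvd (\<Prod>t\<in>T. [:t, 1:]) ^ p - ([:\<Prod>T:] + monom 1 p * Z)" by blast
  let ?f = "\<Prod>t\<in>T. [:t, 1:]" and ?X = "monom 1 p :: int poly"
  have "[:int p:] dvd ([:t:] + monom 1 1) ^ p - ([:t:] ^ p + monom 1 1 ^ p)"
    by (rule poly_add_power_prime_mod[OF p])
  moreover have "[:t:] + monom 1 1 = [:t, 1:]" by (simp add: monom_altdef)
  moreover have "monom 1 1 ^ p = ?X" by (simp add: monom_power)
  moreover have "[:t:] ^ p = [:t ^ p:]" by (rule poly_const_pow)
  ultimately have "[:int p:] dvd [:t, 1:] ^ p - ([:t ^ p:] + ?X)" by simp
  moreover have "int p dvd t ^ p - t"
    using fermat_power_int[OF p, of t 1] by (simp add: cong_iff_dvd_diff)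
  then have "[:int p:] dvd [:t ^ p - t:]" by simp
  ultimately have "[:int p:] dvd [:t, 1:] ^ p - ([:t ^ p:] + ?X) + [:t ^ p - t:]" by (rule dvd_add)
  also have "\<dots> = [:t, 1:] ^ p - ([:t:] + ?X)" by simp
  finally have 1: "[:int p:] dvd [:t, 1:] ^ p - ([:t:] + ?X)" .
  have "[:int p:] dvd ?f ^ p * ([:t, 1:] ^ p - ([:t:] + ?X)) + ([:t:] + ?X) * (?f ^ p - ([:\<Prod>T:] + ?X * Z))"
    using 1 Z by (intro dvd_add dvd_mult)
  also have "\<dots> = [:t, 1:] ^ p * ?f ^ p - ([:t:] * [:\<Prod>T:] + ?X * ([:t:] * Z + [:\<Prod>T:] + ?X * Z))"
  proof -
    have "F * (L - (C + X)) + (C + X) * (F - (D + X * Z)) = L * F - (C * D + X * (C * Z + D + X * Z))"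
      for F L C X D Z :: "int poly" by (simp add: algebra_simps)
    then show ?thesis .
  qed
  also have "[:t, 1:] ^ p * ?f ^ p = (\<Prod>t\<in>insert t T. [:t, 1:]) ^ p"
    by (subst prod.insert[OF insert.hyps]) (simp only: power_mult_distrib)
  also have "[:t:] * [:\<Prod>T:] = [:\<Prod>(insert t T):]" using insert.hyps by simp
  finally show ?case by blast
qed

lemma const_dvd_low_degree:
  fixes A V :: "int poly"
  assumes "[:c:] dvd A - monom 1 m * V" "degree A < m"
  shows "[:c:] dvd A"
  unfolding const_poly_dvd_iff
proof
  fix n
  have "c dvd coeff (A - monom 1 m * V) n" using assms(1) unfolding const_poly_dvd_iff by blast
  then show "c dvd coeff A n"
    using assms(2) by (cases "n < m") (auto simp: coeff_monom_mult coeff_eq_0)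
qed

text \<open>The auxiliary polynomial of Stepanov's method does not vanish identically. With $q_k + f^h r_k$ the lowest block
  that survives modulo $p$, multiplication by $(q_k - f^h r_k) f$ gives $q_k^2 f - r_k^2 f^p$, which is congruent to $0$
  modulo $X^p$. As $f^p$ is constant modulo $X^p$ and the degrees stay below $p$, this means $q_k^2 f \equiv c r_k^2$
  exactly, and $f$ has a simple root.\<close>
lemma auxiliary_nonzero_mod:
  fixes q r :: "nat \<Rightarrow> int poly"
  assumes p: "prime p" "p = 2 * h + 1" and T: "finite T" "T \<noteq> {}"
    and inj: "\<And>x y. x \<in> T \<Longrightarrow> y \<in> T \<Longrightarrow> int p dvd x - y \<Longrightarrow> x = y"
    and nz: "\<And>t. t \<in> T \<Longrightarrow> \<not> int p dvd t"
    and f: "f = (\<Prod>t\<in>T. [:t, 1:])"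
    and deg: "\<And>j. 2 * degree (q j) + card T < p" "\<And>j. 2 * degree (r j) < p"
    and dvd: "[:int p:] dvd (\<Sum>j<N. (q j + f ^ h * r j) * monom 1 (j * p))"
    and "j < N"
  shows "[:int p:] dvd q j \<and> [:int p:] dvd r j"
  using \<open>j < N\<close>
proof (induction j rule: less_induct)
  case (less k)
  let ?P = "[:int p:]"
  note prime = prime_const_poly[OF p(1)]
  define g where "g j = q j + f ^ h * r j" for j
  define Y where "Y = (\<Sum>j\<in>{k<..<N}. g j * monom 1 ((j - k - 1) * p))"
  have split: "{..<N} = {..<k} \<union> insert k {k<..<N}" using less.prems by auto
  have "?P dvd (\<Sum>j<k. g j * monom 1 (j * p))"
    using less by (intro dvd_sum dvd_mult2) (auto simp: g_def)
  moreover have "(\<Sum>j<N. g j * monom 1 (j * p)) = (\<Sum>j<k. g j * monom 1 (j * p)) + monom 1 (k * p) * (g k + monom 1 p * Y)"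
  proof -
    have "(\<Sum>j\<in>{k<..<N}. g j * monom 1 (j * p)) = monom 1 (k * p) * (monom 1 p * Y)"
      unfolding Y_def sum_distrib_left
    proof (rule sum.cong)
      fix j assume "j \<in> {k<..<N}"
      then obtain i where j: "j = k + 1 + i" by (metis Suc_eq_plus1 greaterThanLessThan_iff less_iff_Suc_add add_Suc)
      show "g j * monom 1 (j * p) = monom 1 (k * p) * (monom 1 p * (g j * monom 1 ((j - k - 1) * p)))"
        proof -
        have "monom 1 (j * p) = monom 1 (k * p) * (monom 1 p * monom 1 ((j - k - 1) * p) :: int poly)"
          unfolding j by (simp add: mult_monom algebra_simps)
        then show ?thesis by (simp only: mult.left_commute)
      qed
    qed simp
    then show ?thesis unfolding split
      by (subst sum.union_disjoint) (auto simp: algebra_simps)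
  qed
  moreover have "?P dvd (\<Sum>j<N. g j * monom 1 (j * p))" using dvd by (simp add: g_def)
  ultimately have "?P dvd monom 1 (k * p) * (g k + monom 1 p * Y)" by (simp add: dvd_add_right_iff)
  moreover have "\<not> ?P dvd monom 1 (k * p)"
    using p(1) by (auto simp: const_poly_dvd_iff dest: prime_gt_1_nat intro!: exI[of _ "k * p"])
  ultimately have g0: "?P dvd g k + monom 1 p * Y" using prime prime_elem_dvd_mult_iff by blast
  obtain Z where Z: "?P dvd f ^ p - ([:\<Prod>T:] + monom 1 p * Z)"
    using linear_product_power_prime_mod[OF p(1) T(1)] unfolding f by blast
  define A where "A = (q k)\<^sup>2 * f - smult (\<Prod>T) ((r k)\<^sup>2)"
  have "?P dvd (q k - f ^ h * r k) * f * (g k + monom 1 p * Y) + (r k)\<^sup>2 * (f ^ p - ([:\<Prod>T:] + monom 1 p * Z))"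
    by (rule dvd_add[OF dvd_mult[OF g0] dvd_mult[OF Z]])
  also have "\<dots> = A - monom 1 p * ((r k)\<^sup>2 * Z - (q k - f ^ h * r k) * f * Y)"
  proof -
    have "(q - F * r) * f * ((q + F * r) + X * Y) + r\<^sup>2 * (f * F * F - (C + X * Z))
       = q\<^sup>2 * f - C * r\<^sup>2 - X * (r\<^sup>2 * Z - (q - F * r) * f * Y)" for q F r f X Y Z C :: "int poly"
      by (simp add: power2_eq_square algebra_simps)
    moreover have "p = 1 + h + h" using p(2) by simp
    then have "f ^ p = f * f ^ h * f ^ h" by (simp only: power_add power_one_right)
    ultimately show ?thesis by (simp add: A_def g_def)
  qed
  finally have "?P dvd A - monom 1 p * ((r k)\<^sup>2 * Z - (q k - f ^ h * r k) * f * Y)" .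
  moreover have "degree A < p"
  proof -
    have "degree f = card T" unfolding f by (subst degree_prod_eq_sum_degree) auto
    then have "degree ((q k)\<^sup>2 * f) < p"
      using degree_mult_le[of "(q k)\<^sup>2" f] degree_power_le[of "q k" 2] deg(1)[of k] by simp
    moreover have "degree (smult (\<Prod>T) ((r k)\<^sup>2)) < p"
      using degree_smult_le[of "\<Prod>T" "(r k)\<^sup>2"] degree_power_le[of "r k" 2] deg(2)[of k] by simp
    ultimately show ?thesis unfolding A_def by (rule degree_diff_less)
  qed
  ultimately have A: "?P dvd A" by (rule const_dvd_low_degree)
  obtain t where t: "t \<in> T" using T by blast
  define f1 where "f1 = (\<Prod>u\<in>T - {t}. [:u, 1:])"
  have f_split: "f = [:- (- t), 1:] * f1" unfolding f f1_def using T t by (simp add: prod.remove)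
  have f1: "\<not> int p dvd poly f1 (- t)"
    unfolding f1_def poly_prod using p(1) T inj t by (auto simp: prime_dvd_prod_iff)
  have c: "\<not> int p dvd \<Prod>T" using p(1) T nz by (auto simp: prime_dvd_prod_iff)
  show ?case by (rule nonsquare_descent_mod[OF p(1) c f_split f1 A[unfolded A_def]])
qed

text \<open>Stepanov's method with multiplicity $2s$. Values of $f$ at points of $S$ satisfy $f(x)^h = a$ and
  $x^p = x$, so the derivatives of $F = f^{2s} \sum_j (q_j + f^h r_j) X^{jp}$ at these points are values of polynomials of
  low degree, linear in the unknown coefficients of $q_j$ and $r_j$. There are more unknowns than equations,
  hence some $F$ that does not vanish modulo $p$ has a zero of order $2s$ at every point of $S$; its degree bounds the
  size of $S$.\<close>
lemma stepanov_count:
  fixes T S :: "int set" and p n s d h :: nat and a :: int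
  assumes p: "prime p" "p = 2 * h + 1" and T: "finite T" "T \<noteq> {}" and n: "n = card T"
    and inj: "\<And>x y. x \<in> T \<Longrightarrow> y \<in> T \<Longrightarrow> int p dvd x - y \<Longrightarrow> x = y"
    and nz: "\<And>t. t \<in> T \<Longrightarrow> \<not> int p dvd t"
    and s: "2 * s \<le> p" and d: "d > 0" "2 * d + n \<le> p + 1" "2 * s * (d + 2 * s * n + s + 1) < 2 * (s + 1) * d"
    and S: "S \<subseteq> {0..<int p}"
    and pow: "\<And>x. x \<in> S \<Longrightarrow> [(\<Prod>t\<in>T. x + t) ^ h = a] (mod int p)"
  shows "2 * s * card S \<le> n * (2 * s + h) + d + s * p"
proof -
  let ?P = "[:int p:]" and ?l = "2 * s"
  note prime = prime_const_poly[OF p(1)]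
  define f where "f = (\<Prod>t\<in>T. [:t, 1:])"
  have degf: "degree f = n" unfolding f_def n by (subst degree_prod_eq_sum_degree) (auto simp: T)
  have monic: "lead_coeff f = 1" by (simp add: f_def lead_coeff_prod)
  define pl :: "bool \<Rightarrow> (nat \<times> nat \<times> bool \<Rightarrow> int) \<Rightarrow> nat \<Rightarrow> int poly"
    where "pl b v j = (\<Sum>i<d. monom (v (j, i, b)) i)" for b v j
  have pl_diff: "pl b (\<lambda>i. u i - v i) j = pl b u j - pl b v j" for b u v j
    by (simp add: pl_def sum_subtractf flip: diff_monom)
  have pl_deg: "degree (pl b v j) \<le> d - 1" for b v j
    unfolding pl_def by (intro degree_sum_le) (auto intro!: order_trans[OF degree_monom_le])
  have pl_coeff: "coeff (pl b v j) i = v (j, i, b)" if "i < d" for b v j i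
    using that by (simp add: pl_def coeff_sum coeff_monom)
  define Q where "Q v k j = power_deriv_cofactor f ?l k (pl True v j)" for v k j
  define R where "R v k j = power_deriv_cofactor f (?l + h) k (pl False v j)" for v k j
  \<comment> \<open>at points of \<open>S\<close>, the $k$-th derivative of the auxiliary polynomial without its power of $f$\<close>
  define \<sigma> where "\<sigma> v k = (\<Sum>j<s+1. monom 1 j * (Q v k j + smult a (R v k j)))" for v k
  \<comment> \<open>bound for the number of coefficients of each \<open>\<sigma> v k\<close>\<close>
  define D where "D = d + ?l * n + s + 1"
  define \<Phi> where "\<Phi> v = (\<lambda>(k, i). coeff (\<sigma> v k) i)" for v
  have deg\<sigma>: "degree (\<sigma> v k) < D" if "k < ?l" for v k
  proof -
    have "degree (monom 1 j * (Q v k j + smult a (R v k j))) \<le> s + (d + ?l * n)" if "j < s + 1" for j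
    proof -
      have kn: "k * n \<le> ?l * n" using \<open>k < ?l\<close> by simp
      have "degree (Q v k j) \<le> d + ?l * n"
        using degree_power_deriv_cofactor[of f ?l k "pl True v j"] pl_deg[of True v j] kn
        unfolding Q_def degf by linarith
      moreover have "degree (R v k j) \<le> d + ?l * n"
        using degree_power_deriv_cofactor[of f "?l + h" k "pl False v j"] pl_deg[of False v j] kn
        unfolding R_def degf by linarith
      ultimately have "degree (Q v k j + smult a (R v k j)) \<le> d + ?l * n"
        by (intro degree_add_le order_trans[OF degree_smult_le])
      moreover have "degree (monom 1 j :: int poly) \<le> s" using that by (simp add: degree_monom_eq)
      ultimately show ?thesis by (meson add_mono degree_mult_le order_trans)
    qed
    then have "degree (\<sigma> v k) \<le> s + (d + ?l * n)" unfolding \<sigma>_def by (intro degree_sum_le) auto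
    then show ?thesis by (simp add: D_def)
  qed
  have "\<exists>v. (\<exists>i\<in>{..<s+1} \<times> {..<d} \<times> UNIV. \<not> int p dvd v i) \<and> (\<forall>c\<in>{..<?l} \<times> {..<D}. int p dvd \<Phi> v c)"
  proof (rule linear_system_mod)
    show "int p > 1" using p(1) prime_gt_1_nat by auto
    show "card ({..<?l} \<times> {..<D}) < card ({..<s+1} \<times> {..<d} \<times> (UNIV :: bool set))"
      using d(3) by (simp add: D_def card_cartesian_product algebra_simps)
    show "\<Phi> (\<lambda>i. u i - v i) c = \<Phi> u c - \<Phi> v c" for u v c
      by (cases c) (simp add: \<Phi>_def \<sigma>_def Q_def R_def pl_diff power_deriv_cofactor_diff smult_diff_right
          algebra_simps sum_subtractf coeff_sum sum.distrib)
  qed auto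
  then obtain v where v: "\<exists>i\<in>{..<s+1} \<times> {..<d} \<times> UNIV. \<not> int p dvd v i"
    and \<Phi>: "\<And>k i. k < ?l \<Longrightarrow> i < D \<Longrightarrow> int p dvd coeff (\<sigma> v k) i"
    by (auto simp: \<Phi>_def)
  have \<sigma>0: "?P dvd \<sigma> v k" if "k < ?l" for k
    unfolding const_poly_dvd_iff
  proof
    fix i show "int p dvd coeff (\<sigma> v k) i"
      using \<Phi>[OF that, of i] deg\<sigma>[OF that, of v] by (cases "i < D") (auto simp: coeff_eq_0)
  qed
  let ?q = "pl True v" and ?r = "pl False v"
  define W where "W = (\<Sum>j<s+1. (?q j + f ^ h * ?r j) * monom 1 (j * p))"
  define F where "F = (\<Sum>j<s+1. (f ^ ?l * ?q j + f ^ (?l + h) * ?r j) * monom 1 (j * p))"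
  have FW: "F = f ^ ?l * W"
    unfolding F_def W_def sum_distrib_left by (intro sum.cong) (auto simp: algebra_simps power_add)
  have "\<not> ?P dvd W"
  proof
    assume "?P dvd W"
    moreover have "2 * degree (?q j) + card T < p" "2 * degree (?r j) < p" for j
      using pl_deg[of True v j] pl_deg[of False v j] d n by linarith+
    ultimately have "?P dvd ?q j \<and> ?P dvd ?r j" if "j < s + 1" for j
      using auxiliary_nonzero_mod[OF p T inj nz f_def, of ?q ?r "s + 1" j] that by (simp add: W_def)
    moreover obtain j i b where "j < s + 1" "i < d" "\<not> int p dvd v (j, i, b)" using v by auto
    ultimately have "?P dvd pl b v j" by (cases b) auto
    then have "int p dvd coeff (pl b v j) i" by (simp only: const_poly_dvd_iff)
    then show False using \<open>i < d\<close> \<open>\<not> int p dvd v (j, i, b)\<close> by (simp add: pl_coeff)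
  qed
  moreover have "\<not> ?P dvd f"
    using monic p(1) unfolding const_poly_dvd_iff by (auto dest: prime_gt_1_nat intro!: exI[of _ "degree f"])
  ultimately have F0: "\<not> ?P dvd F"
    unfolding FW using prime prime_elem_dvd_mult_iff prime_elem_dvd_power by blast
  have roots: "\<exists>G. ?P dvd F - [:-x, 1:] ^ ?l * G" if x: "x \<in> S" for x
  proof (rule multiple_root_mod[OF p(1) s])
    fix k assume k: "k < ?l"
    let ?f = "poly f x"
    have pf: "poly f x = (\<Prod>t\<in>T. x + t)" by (simp add: f_def poly_prod add.commute)
    have "?P dvd (pderiv ^^ k) F - (\<Sum>j<s+1. (pderiv ^^ k) (f ^ ?l * ?q j + f ^ (?l + h) * ?r j) * monom 1 (j * p))"
      unfolding F_def higher_pderiv_sum by (intro const_dvd_sum pderiv_funpow_monom_mod)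
    also have "(\<Sum>j<s+1. (pderiv ^^ k) (f ^ ?l * ?q j + f ^ (?l + h) * ?r j) * monom 1 (j * p))
        = (\<Sum>j<s+1. (f ^ (?l - k) * Q v k j + f ^ (?l + h - k) * R v k j) * monom 1 (j * p))"
      using k by (simp add: higher_pderiv_add pderiv_funpow_power_mult Q_def R_def)
    finally have "[poly ((pderiv ^^ k) F) x
        = poly (\<Sum>j<s+1. (f ^ (?l - k) * Q v k j + f ^ (?l + h - k) * R v k j) * monom 1 (j * p)) x] (mod int p)"
      unfolding cong_iff_dvd_diff poly_diff[symmetric] by (rule const_dvd_poly_eval)
    also have "poly (\<Sum>j<s+1. (f ^ (?l - k) * Q v k j + f ^ (?l + h - k) * R v k j) * monom 1 (j * p)) x
        = (\<Sum>j<s+1. (?f ^ (?l - k) * (poly (Q v k j) x + ?f ^ h * poly (R v k j) x)) * x ^ (j * p))"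
    proof -
      have "?f ^ (?l + h - k) = ?f ^ (?l - k) * ?f ^ h" using k by (simp flip: power_add)
      then show ?thesis by (simp add: poly_sum poly_monom algebra_simps)
    qed
    also have "[\<dots> = (\<Sum>j<s+1. (?f ^ (?l - k) * (poly (Q v k j) x + a * poly (R v k j) x)) * x ^ j)] (mod int p)"
      using pow[OF x] unfolding pf
      by (intro cong_sum cong_mult cong_add cong_refl fermat_power_int[OF p(1)])
    also have "(\<Sum>j<s+1. (?f ^ (?l - k) * (poly (Q v k j) x + a * poly (R v k j) x)) * x ^ j)
        = ?f ^ (?l - k) * poly (\<sigma> v k) x"
      unfolding \<sigma>_def by (simp add: poly_sum poly_monom sum_distrib_left algebra_simps)
    also have "[\<dots> = 0] (mod int p)"
      using const_dvd_poly_eval[OF \<sigma>0[OF k], of x] by (simp add: cong_0_iff)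
    finally show "int p dvd poly ((pderiv ^^ k) F) x" by (simp add: cong_0_iff)
  qed
  have "finite S" using S by (rule finite_subset) simp
  have "?l * card S \<le> degree F"
  proof (rule card_multiple_roots_mod[OF p(1) \<open>finite S\<close> F0 _ roots])
    fix x y assume xy: "x \<in> S" "y \<in> S" "int p dvd x - y"
    have "x \<in> {0..<int p}" "y \<in> {0..<int p}" using S xy by blast+
    then have "\<bar>x - y\<bar> < int p" by auto
    then show "x = y" using xy(3) zdvd_not_zless[of "\<bar>x - y\<bar>" "int p"] by force
  qed
  also have "degree F \<le> n * (?l + h) + d + s * p"
  proof -
    have "degree ((f ^ ?l * ?q j + f ^ (?l + h) * ?r j) * monom 1 (j * p)) \<le> n * (?l + h) + d + s * p"
      if "j < s + 1" for j
    proof -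
      have "degree (f ^ ?l * ?q j) \<le> n * ?l + d"
        using degree_mult_le[of "f ^ ?l" "?q j"] degree_power_le[of f ?l] pl_deg[of True v j] degf
        by (auto simp: algebra_simps)
      moreover have "degree (f ^ (?l + h) * ?r j) \<le> n * (?l + h) + d"
        using degree_mult_le[of "f ^ (?l + h)" "?r j"] degree_power_le[of f "?l + h"] pl_deg[of False v j] degf
        by (auto simp: algebra_simps)
      ultimately have "degree (f ^ ?l * ?q j + f ^ (?l + h) * ?r j) \<le> n * (?l + h) + d"
        by (intro degree_add_le) (auto simp: algebra_simps)
      moreover have "degree (monom 1 (j * p) :: int poly) \<le> s * p" using that by (simp add: degree_monom_eq)
      ultimately show ?thesis by (meson add_mono degree_mult_le order_trans)
    qed
    then show ?thesis unfolding F_def by (intro degree_sum_le) auto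
  qed
  finally show ?thesis .
qed

section \<open>The Legendre symbol and its character sums\<close>

text \<open>Real valued, since the symbols serve as coefficients and signs of real sums.\<close>
definition legendre_symbol :: "nat \<Rightarrow> int \<Rightarrow> real" where
  "legendre_symbol p a = of_int (Legendre a (int p))"

lemma Legendre_cong: "[a = b] (mod p) \<Longrightarrow> Legendre a p = Legendre b p"
  unfolding Legendre_def QuadRes_def Cong.cong_def by simp

lemma legendre_symbol_mod: "legendre_symbol p (a mod int p + b) = legendre_symbol p (a + b)"
  unfolding legendre_symbol_def
  by (rule arg_cong[of _ _ of_int], rule Legendre_cong) (simp add: Cong.cong_def mod_add_left_eq)

lemma legendre_symbol_mod0: "legendre_symbol p (a mod int p) = legendre_symbol p a"
  using legendre_symbol_mod[of p a 0] by simp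

lemma legendre_symbol_cases: "legendre_symbol p a \<in> {-1, 0, 1}"
  by (simp add: legendre_symbol_def Legendre_def)

lemma legendre_symbol_eq_0_iff: "legendre_symbol p a = 0 \<longleftrightarrow> int p dvd a"
  by (simp add: legendre_symbol_def Legendre_def cong_0_iff)

lemma legendre_symbol_abs: "\<not> int p dvd a \<Longrightarrow> \<bar>legendre_symbol p a\<bar> = 1"
  using legendre_symbol_cases[of p a] legendre_symbol_eq_0_iff[of p a] by auto

lemma legendre_symbol_abs_le: "\<bar>legendre_symbol p a\<bar> \<le> 1"
  using legendre_symbol_cases[of p a] by auto

lemma int_eq_of_cong_small: "[a = b] (mod int p) \<Longrightarrow> p > 2 \<Longrightarrow> a \<in> {-1, 0, 1} \<Longrightarrow> b \<in> {-1, 0, 1} \<Longrightarrow> a = b"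
proof -
  assume "[a = b] (mod int p)" and p: "p > 2" and ab: "a \<in> {-1, 0, 1}" "b \<in> {-1, 0, 1}"
  then have "int p dvd a - b" by (simp add: cong_iff_dvd_diff)
  moreover have "\<bar>a - b\<bar> < int p" using p ab by auto
  ultimately show "a = b" using zdvd_not_zless[of "\<bar>a - b\<bar>" "int p"] by force
qed

lemma Legendre_cases: "Legendre a p \<in> {-1, 0, 1}" by (simp add: Legendre_def)

lemma Legendre_eq_iff_cong_power:
  assumes "prime p" "p > 2" "c \<in> {-1, 0, 1}"
  shows "Legendre a (int p) = c \<longleftrightarrow> [a ^ ((p - 1) div 2) = c] (mod int p)"
proof -
  have e: "[Legendre a (int p) = a ^ ((p - 1) div 2)] (mod int p)"
    by (rule euler_criterion) (use assms in auto)
  then show ?thesis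
    using int_eq_of_cong_small[OF _ assms(2) Legendre_cases assms(3), of a "int p"]
    by (metis cong_sym cong_trans)
qed

lemma legendre_symbol_mult:
  assumes "prime p" "p > 2"
  shows "legendre_symbol p (a * b) = legendre_symbol p a * legendre_symbol p b"
proof -
  have e: "[Legendre x (int p) = x ^ ((p - 1) div 2)] (mod int p)" for x
    by (rule euler_criterion) (use assms in auto)
  have "Legendre a (int p) * Legendre b (int p) \<in> {-1, 0, 1}"
    using Legendre_cases[of a "int p"] Legendre_cases[of b "int p"] by auto
  moreover have "[(a * b) ^ ((p - 1) div 2) = Legendre a (int p) * Legendre b (int p)] (mod int p)"
    unfolding power_mult_distrib by (intro cong_mult cong_sym[OF e])
  ultimately have "Legendre (a * b) (int p) = Legendre a (int p) * Legendre b (int p)"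
    using Legendre_eq_iff_cong_power[OF assms] by blast
  then show ?thesis by (simp add: legendre_symbol_def)
qed

lemma legendre_symbol_prod:
  assumes "prime p" "p > 2" "finite T"
  shows "legendre_symbol p (\<Prod>t\<in>T. f t) = (\<Prod>t\<in>T. legendre_symbol p (f t))"
  using assms(3)
proof (induction T)
  case empty
  have "QuadRes (int p) 1" unfolding QuadRes_def by (rule exI[of _ 1]) simp
  moreover have "\<not> [1 = 0] (mod int p)" using assms by (simp add: cong_0_iff)
  ultimately show ?case by (simp add: legendre_symbol_def Legendre_def)
qed (simp add: legendre_symbol_mult[OF assms(1,2)])

text \<open>An affine map with invertible slope permutes the residues.\<close>
lemma sum_residues_affine:
  fixes g :: "int \<Rightarrow> 'a :: comm_monoid_add"
  assumes p: "prime p" and u: "\<not> int p dvd u" and g: "\<And>x. g (x mod int p) = g x"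
  shows "(\<Sum>K\<in>{0..<int p}. g (u * K + c)) = (\<Sum>K\<in>{0..<int p}. g K)"
proof -
  let ?h = "\<lambda>K. (u * K + c) mod int p"
  have p0: "int p > 0" using p prime_gt_0_nat by simp
  have "inj_on ?h {0..<int p}"
  proof (rule inj_onI)
    fix x y assume xy: "x \<in> {0..<int p}" "y \<in> {0..<int p}" "?h x = ?h y"
    then have "int p dvd u * (x - y)" by (simp add: mod_eq_dvd_iff algebra_simps)
    then have "int p dvd x - y" using u p by (simp add: prime_dvd_mult_iff)
    moreover have "\<bar>x - y\<bar> < int p" using xy by auto
    ultimately show "x = y" using zdvd_not_zless[of "\<bar>x - y\<bar>" "int p"] by force
  qed
  moreover have "?h ` {0..<int p} \<subseteq> {0..<int p}" using p0 by auto
  ultimately have "bij_betw ?h {0..<int p} {0..<int p}"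
    using endo_inj_surj[of "{0..<int p}" ?h] by (simp add: bij_betw_def)
  then have "(\<Sum>K\<in>{0..<int p}. g (?h K)) = (\<Sum>K\<in>{0..<int p}. g K)" by (rule sum.reindex_bij_betw)
  then show ?thesis by (simp add: g)
qed

text \<open>If every nonzero residue were a square, squaring would permute the nonzero residues, although it identifies $1$ and $-1$.\<close>
lemma legendre_symbol_nonresidue:
  assumes p: "prime p" "p > 2"
  obtains u where "legendre_symbol p u = -1" "\<not> int p dvd u"
proof -
  let ?A = "{1..<int p}"
  have "\<exists>u\<in>?A. \<not> QuadRes (int p) u"
  proof (rule ccontr)
    assume "\<not> ?thesis"
    then have all: "\<And>u. u \<in> ?A \<Longrightarrow> QuadRes (int p) u" by blast
    have "?A \<subseteq> (\<lambda>x. x\<^sup>2 mod int p) ` ?A"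
    proof
      fix u assume u: "u \<in> ?A"
      then obtain y where y: "[y\<^sup>2 = u] (mod int p)" using all unfolding QuadRes_def by blast
      then have "y\<^sup>2 mod int p = u" using u by (simp add: Cong.cong_def)
      then have e: "(y mod int p)\<^sup>2 mod int p = u" by (simp add: power_mod)
      then have "y mod int p \<noteq> 0" using u by (auto simp: power2_eq_square)
      then have "y mod int p \<in> ?A" 
      proof -
        have "0 \<le> y mod int p" "y mod int p < int p" using p by simp_all
        then show ?thesis using \<open>y mod int p \<noteq> 0\<close> by auto
      qed
      then show "u \<in> (\<lambda>x. x\<^sup>2 mod int p) ` ?A" using e by blast
    qed
    then have "card ?A \<le> card ((\<lambda>x. x\<^sup>2 mod int p) ` ?A)" by (intro card_mono) auto
    then have "inj_on (\<lambda>x. x\<^sup>2 mod int p) ?A"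
      by (intro eq_card_imp_inj_on antisym card_image_le) auto
    moreover have "(int p - 1)\<^sup>2 mod int p = 1\<^sup>2 mod int p"
      unfolding mod_eq_dvd_iff by (simp add: power2_eq_square algebra_simps)
    ultimately have "int p - 1 = 1" using p by (auto simp: inj_on_def)
    then show False using p by simp
  qed
  then obtain u where u: "u \<in> ?A" "\<not> QuadRes (int p) u" by blast
  then have "\<not> int p dvd u" by (auto dest: zdvd_imp_le)
  then show ?thesis using u that[of u] by (simp add: legendre_symbol_def Legendre_def cong_0_iff)
qed

text \<open>Multiplication by a nonresidue permutes the residues and changes the sign of the sum.\<close>
lemma legendre_symbol_sum:
  assumes p: "prime p" "p > 2"
  shows "(\<Sum>K\<in>{0..<int p}. legendre_symbol p K) = 0"
proof -
  obtain u where u: "legendre_symbol p u = -1" "\<not> int p dvd u" using legendre_symbol_nonresidue[OF p] by blast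
  have "(\<Sum>K\<in>{0..<int p}. legendre_symbol p (u * K + 0)) = (\<Sum>K\<in>{0..<int p}. legendre_symbol p K)"
    using u by (intro sum_residues_affine p legendre_symbol_mod0)
  then have "- (\<Sum>K\<in>{0..<int p}. legendre_symbol p K) = (\<Sum>K\<in>{0..<int p}. legendre_symbol p K)"
    by (simp add: legendre_symbol_mult[OF p] u sum_negf)
  then show ?thesis by simp
qed

text \<open>Scaling shows that the correlation is the same for all $t \not\equiv 0$. Summed over a full period of $t$ the
  correlations give $0$, and the one at $t = 0$ is $p - 1$.\<close>
lemma legendre_symbol_correlation:
  assumes p: "prime p" "p > 2" and t: "\<not> int p dvd t"
  shows "(\<Sum>K\<in>{0..<int p}. legendre_symbol p K * legendre_symbol p (K + t)) = -1"
proof -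
  let ?c = "legendre_symbol p" and ?A = "{0..<int p}"
  define C where "C t = (\<Sum>K\<in>?A. ?c K * ?c (K + t))" for t
  have C: "C u = C 1" if u: "\<not> int p dvd u" for u
  proof -
    have "C u = (\<Sum>K\<in>?A. ?c (u * K + 0) * ?c (u * K + 0 + u))"
      unfolding C_def
      by (rule sum_residues_affine[where g = "\<lambda>K. ?c K * ?c (K + u)", symmetric, OF p(1) u])
         (simp only: legendre_symbol_mod legendre_symbol_mod0)
    also have "\<dots> = (\<Sum>K\<in>?A. ?c K * ?c (K + 1))"
    proof (rule sum.cong[OF refl])
      fix K
      have e: "u * K + 0 = u * K" "u * K + u = u * (K + 1)" by (simp_all add: algebra_simps)
      have "?c (u * K + 0) * ?c (u * K + 0 + u) = (?c u * ?c u) * (?c K * ?c (K + 1))"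
        unfolding e legendre_symbol_mult[OF p] by (simp only: mult_ac)
      also have "?c u * ?c u = 1" using legendre_symbol_abs[OF u] by (simp add: abs_if split: if_splits)
      finally show "?c (u * K + 0) * ?c (u * K + 0 + u) = ?c K * ?c (K + 1)" by simp
    qed
    finally show ?thesis by (simp add: C_def)
  qed
  have "(\<Sum>u\<in>?A. C u) = (\<Sum>K\<in>?A. ?c K * (\<Sum>u\<in>?A. ?c (1 * u + K)))"
    unfolding C_def sum_distrib_left by (subst sum.swap) (simp only: mult_1 add.commute)
  also have "\<dots> = (\<Sum>K\<in>?A. ?c K * 0)"
  proof (intro sum.cong refl arg_cong2[of _ _ _ _ "(*)"])
    fix K
    have "\<not> int p dvd 1" using p(2) by simp
    then have "(\<Sum>u\<in>?A. ?c (1 * u + K)) = (\<Sum>u\<in>?A. ?c u)"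
      by (rule sum_residues_affine[where g = ?c, OF p(1)]) (rule legendre_symbol_mod0)
    then show "(\<Sum>u\<in>?A. ?c (1 * u + K)) = 0" using legendre_symbol_sum[OF p] by simp
  qed
  also have "\<dots> = 0" by simp
  finally have "(\<Sum>u\<in>?A. C u) = 0" .
  moreover have A: "?A = insert 0 {1..<int p}" using p by auto
  have "(\<Sum>u\<in>?A. C u) = C 0 + (\<Sum>u\<in>{1..<int p}. C 1)"
  proof -
    have "C u = C 1" if "u \<in> {1..<int p}" for u
      using that zdvd_imp_le[of "int p" u] by (intro C) auto
    then have "(\<Sum>u\<in>{1..<int p}. C u) = (\<Sum>u\<in>{1..<int p}. C 1)" by (rule sum.cong[OF refl])
    then show ?thesis unfolding A by (subst sum.insert) auto
  qed
  moreover have "C 0 = real p - 1"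
  proof -
    have "?c K * ?c K = 1" if "K \<in> {1..<int p}" for K
    proof -
      have "\<not> int p dvd K" using that zdvd_imp_le[of "int p" K] by auto
      then show ?thesis using legendre_symbol_abs[of p K] by (simp add: abs_if split: if_splits)
    qed
    moreover have "?c 0 = 0" by (simp add: legendre_symbol_eq_0_iff)
    ultimately have "C 0 = real (card {1..<int p})" unfolding C_def A by simp
    then show ?thesis using p(2) by (simp add: of_nat_diff)
  qed
  moreover have "real (card {1..<int p}) = real p - 1" using p(2) by (simp add: of_nat_diff)
  ultimately have "(real p - 1) + (real p - 1) * C 1 = 0" by simp
  then have "(real p - 1) * (C 1 + 1) = 0" by (simp only: distrib_left mult_1_right add.commute)
  moreover have "real p - 1 \<noteq> 0" using p(2) by simp
  ultimately have "C 1 = -1" by auto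
  then show ?thesis using C[OF t] by (simp only: C_def)
qed

lemma eventually_odd_primes_at_top:
  "eventually P odd_primes_at_top \<longleftrightarrow> (\<exists>N. \<forall>p\<ge>N. prime p \<longrightarrow> p > 2 \<longrightarrow> P p)"
proof -
  have "prime p \<and> odd p \<longleftrightarrow> prime p \<and> p > 2" for p :: nat
    using prime_odd_nat[of p] prime_ge_2_nat[of p] by (cases "p = 2") auto
  then show ?thesis
    unfolding odd_primes_at_top_def eventually_inf_principal eventually_at_top_linorder by auto
qed

text \<open>Stepanov's method bounds each level set of the symbol by about $p/2$ from above; as the level sets make
  up the whole period, the two nonzero ones have almost the same size.\<close>
lemma legendre_symbol_product_sum_bound:
  fixes T :: "int set"
  assumes p: "prime p" "p > 2" and T: "finite T" "T \<noteq> {}" "T \<subseteq> {1..<int p}"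
    and s: "s \<ge> 1" and large: "p \<ge> card T + 2 * s * (2 * s * card T + s + 1) + 2"
  shows "\<bar>\<Sum>K\<in>{0..<int p}. \<Prod>t\<in>T. legendre_symbol p (K + t)\<bar> \<le> 3 * card T + (card T + 1) * p / (2 * s)"
proof -
  let ?A = "{0..<int p}"
  define n where "n = card T"
  define h where "h = (p - 1) div 2"
  define d where "d = (p + 1 - n) div 2"
  define f where "f K = (\<Prod>t\<in>T. K + t)" for K
  define S where "S c = {K \<in> ?A. Legendre (f K) (int p) = c}" for c
  have "odd p" using p prime_odd_nat by blast
  then have h: "p = 2 * h + 1" by (simp add: h_def)
  have n1: "n \<ge> 1" using T by (simp add: n_def Suc_leI card_gt_0_iff)
  have d2: "2 * d \<le> p + 1 - n" "p - n \<le> 2 * d" unfolding d_def by linarith+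
  have bnd: "real (card (S c)) \<le> n + (n + 1) * p / (4 * s) + p / 2" if c: "c \<in> {-1, 0, 1}" for c
  proof -
    have "2 * s * card (S c) \<le> n * (2 * s + h) + d + s * p"
    proof (rule stepanov_count[OF p(1) h T(1,2) n_def])
      show "x = y" if "x \<in> T" "y \<in> T" "int p dvd x - y" for x y
      proof -
        have "x \<in> {1..<int p}" "y \<in> {1..<int p}" using that T by blast+
        then have "\<bar>x - y\<bar> < int p" by auto
        then show ?thesis using that(3) zdvd_not_zless[of "\<bar>x - y\<bar>" "int p"] by force
      qed
      show "\<not> int p dvd t" if "t \<in> T" for t
      proof -
        have "t \<in> {1..<int p}" using that T by blast
        then show ?thesis using zdvd_not_zless[of t "int p"] by auto
      qed
      have sl: "s * (2 * s * n + s + 1) + s * (2 * s * n + s + 1) + n + 2 \<le> p"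
        using large by (simp add: n_def algebra_simps)
      have "s \<le> s * (2 * s * n + s + 1)" by simp
      then show "2 * s \<le> p" using sl by linarith
      show "d > 0" using sl d2 by linarith
      show "2 * d + n \<le> p + 1" using d2 sl by linarith
      have "s * (2 * s * n + s + 1) < d" using sl d2 by linarith
      then show "2 * s * (d + 2 * s * n + s + 1) < 2 * (s + 1) * d" by (simp add: algebra_simps)
      show "S c \<subseteq> ?A" by (auto simp: S_def)
      show "[(\<Prod>t\<in>T. x + t) ^ h = c] (mod int p)" if "x \<in> S c" for x
        using that Legendre_eq_iff_cong_power[OF p c, of "f x"] by (simp add: S_def f_def h_def)
    qed
    then have "real (2 * s * card (S c)) \<le> real (n * (2 * s + h) + d + s * p)" by (simp only: of_nat_le_iff)
    moreover have "real h \<le> p / 2" "real d \<le> p / 2" using h d2 n1 by linarith+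
    then have "real n * h \<le> n * (p / 2)" by (intro mult_left_mono) auto
    ultimately have "2 * s * card (S c) \<le> n * (2 * s) + (n + 1) * p / 2 + s * p"
      using \<open>real d \<le> p / 2\<close> by (simp add: field_simps)
    then show ?thesis using s by (simp add: field_simps)
  qed
  have fin: "finite (S c)" for c by (rule finite_subset[of _ ?A]) (auto simp: S_def)
  have "S 0 \<subseteq> (\<lambda>t. (- t) mod int p) ` T"
  proof
    fix K assume K: "K \<in> S 0"
    then have "legendre_symbol p (f K) = 0" by (simp add: S_def legendre_symbol_def)
    then have "int p dvd f K" by (simp add: legendre_symbol_eq_0_iff)
    then obtain t where t: "t \<in> T" "int p dvd K + t"
      unfolding f_def using p T by (auto simp: prime_dvd_prod_iff)
    then have "int p dvd K - (- t)" by simp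
    then have "K mod int p = (- t) mod int p" unfolding mod_eq_dvd_iff .
    moreover have "K mod int p = K" using K by (simp add: S_def)
    ultimately show "K \<in> (\<lambda>t. (- t) mod int p) ` T" using t by auto
  qed
  then have S0: "card (S 0) \<le> n" unfolding n_def using T by (meson card_image_le card_mono finite_imageI order_trans)
  have A: "?A = S 1 \<union> S (-1) \<union> S 0" using Legendre_cases by (auto simp: S_def)
  have "card ?A = card (S 1) + card (S (-1)) + card (S 0)"
    unfolding A by (subst card_Un_disjoint, simp_all add: fin, force simp: S_def)+
  then have tot: "real p = card (S 1) + card (S (-1)) + card (S 0)" by simp
  have "(\<Sum>K\<in>?A. \<Prod>t\<in>T. legendre_symbol p (K + t)) = (\<Sum>K\<in>?A. legendre_symbol p (f K))"
    unfolding f_def by (simp add: legendre_symbol_prod[OF p T(1)])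
  also have "\<dots> = (\<Sum>K\<in>S 1. legendre_symbol p (f K)) + (\<Sum>K\<in>S (-1). legendre_symbol p (f K)) + (\<Sum>K\<in>S 0. legendre_symbol p (f K))"
    unfolding A by (subst sum.union_disjoint, simp_all add: fin, force simp: S_def)+
  also have "\<dots> = real (card (S 1)) - card (S (-1))"
    by (simp add: S_def legendre_symbol_def)
  finally have "(\<Sum>K\<in>?A. \<Prod>t\<in>T. legendre_symbol p (K + t)) = real (card (S 1)) - card (S (-1))" .
  moreover have "\<bar>real (card (S 1)) - card (S (-1))\<bar> \<le> 3 * n + (n + 1) * p / (2 * s)"
  proof -
    define E where "E = (n + 1) * p / (4 * s)"
    have "(n + 1) * p / (2 * s) = 2 * E" unfolding E_def using s by (simp add: field_simps)
    moreover have "real (card (S 1)) \<le> n + E + p / 2" "real (card (S (-1))) \<le> n + E + p / 2"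
      using bnd unfolding E_def by blast+
    moreover have "real (card (S 0)) \<le> n" using S0 by simp
    ultimately show ?thesis using tot unfolding abs_le_iff by linarith
  qed
  ultimately show ?thesis by (simp add: n_def)
qed

lemma legendre_symbol_product_sum_tendsto:
  fixes T :: "int set"
  assumes T: "finite T" "T \<noteq> {}"
  shows "((\<lambda>p. (\<Sum>K\<in>{0..<int p}. \<Prod>t\<in>T. legendre_symbol p (K + t)) / p) \<longlongrightarrow> 0) odd_primes_at_top"
proof (rule tendstoI)
  fix e :: real assume e: "e > 0"
  \<comment> \<open>translation moves the shifts into the range from $1$ to $p - 1$\<close>
  define c where "c = 1 - Min T"
  define T' where "T' = (\<lambda>t. t + c) ` T"
  define n where "n = card T"
  have n: "card T' = n" unfolding T'_def n_def by (rule card_image) (auto simp: inj_on_def)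
  obtain s :: nat where s: "real s > (n + 1) / e" using reals_Archimedean2 by blast
  have s1: "s \<ge> 1" using s e by (cases s) (auto simp: field_simps)
  obtain N1 :: nat where N1: "real N1 > 6 * n / e" using reals_Archimedean2 by blast
  define N where "N = n + 2 * s * (2 * s * n + s + 1) + 2 + N1 + nat (Max T') + 1"
  show "\<forall>\<^sub>F p in odd_primes_at_top. dist ((\<Sum>K\<in>{0..<int p}. \<Prod>t\<in>T. legendre_symbol p (K + t)) / p) 0 < e"
    unfolding eventually_odd_primes_at_top
  proof (intro exI[of _ N] allI impI)
    fix p assume pN: "p \<ge> N" and p: "prime p" "p > 2"
    let ?g = "\<lambda>K. \<Prod>t\<in>T. legendre_symbol p (K + t)"
    have T': "finite T'" "T' \<noteq> {}" using T by (auto simp: T'_def)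
    have "T' \<subseteq> {1..<int p}"
    proof
      fix x assume x: "x \<in> T'"
      then have "x \<ge> 1" using T by (auto simp: T'_def c_def)
      moreover have "x \<le> Max T'" using x T' by simp
      moreover have "Max T' < int p" using pN unfolding N_def by linarith
      ultimately show "x \<in> {1..<int p}" by simp
    qed
    then have "\<bar>\<Sum>K\<in>{0..<int p}. \<Prod>t\<in>T'. legendre_symbol p (K + t)\<bar> \<le> 3 * n + (n + 1) * p / (2 * s)"
      using legendre_symbol_product_sum_bound[OF p T' _ s1] pN unfolding n N_def by simp
    also have "(\<Sum>K\<in>{0..<int p}. \<Prod>t\<in>T'. legendre_symbol p (K + t)) = (\<Sum>K\<in>{0..<int p}. ?g (1 * K + c))"
    proof (intro sum.cong refl)
      fix K show "(\<Prod>t\<in>T'. legendre_symbol p (K + t)) = ?g (1 * K + c)"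
        unfolding T'_def by (subst prod.reindex) (auto simp: inj_on_def algebra_simps)
    qed
    also have "\<dots> = (\<Sum>K\<in>{0..<int p}. ?g K)"
      using p by (intro sum_residues_affine) (auto simp: legendre_symbol_mod)
    finally have b: "\<bar>\<Sum>K\<in>{0..<int p}. ?g K\<bar> \<le> 3 * n + (n + 1) * p / (2 * s)" .
    have p0: "real p > 0" using p by simp
    have "real N1 \<le> p" using pN unfolding N_def by linarith
    then have "6 * n / e < p" using N1 by linarith
    then have n3: "3 * n < p * e / 2" using e by (simp add: field_simps)
    have "(n + 1) / s < e" using s s1 e by (simp add: field_simps)
    then have n1: "p / 2 * ((n + 1) / s) < p / 2 * e" using p0 by (intro mult_strict_left_mono) auto
    have "(n + 1) * p / (2 * s) = p / 2 * ((n + 1) / s)" by (simp add: field_simps)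
    then have "(n + 1) * p / (2 * s) < p / 2 * e" using n1 by (simp only:)
    with b n3 have "\<bar>\<Sum>K\<in>{0..<int p}. ?g K\<bar> < p * e" by linarith
    then show "dist ((\<Sum>K\<in>{0..<int p}. ?g K) / p) 0 < e"
      using p0 by (simp add: dist_real_def abs_divide field_simps)
  qed
qed

section \<open>Identities and estimates for the cotangent\<close>

lemma x_cos_le_sin:
  assumes "0 \<le> x" "x \<le> pi / 2" shows "x * cos x \<le> sin (x :: real)"
proof (cases "x = pi / 2")
  case True
  show ?thesis unfolding True by simp
next
  case False
  then have x: "x < pi / 2" using assms by auto
  then have "x \<le> tan x" using abs_tan_ge[of x] assms tan_gt_zero[of x] by (cases "x = 0") auto
  moreover have "cos x > 0" using x assms by (simp add: cos_gt_zero_pi)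
  ultimately show ?thesis by (simp add: tan_def field_simps)
qed

lemma jordan_sin:
  assumes "0 \<le> u" "u \<le> pi / 2" shows "2 / pi * u \<le> sin u"
proof (cases "u = 0")
  case False
  then have u: "0 < u" using assms by simp
  have "sin (pi / 2) / (pi / 2) \<le> sin u / u"
  proof (rule DERIV_nonpos_imp_nonincreasing[OF assms(2)])
    fix x assume x: "u \<le> x" "x \<le> pi / 2"
    then have "x > 0" using u by simp
    then have "DERIV (\<lambda>x. sin x / x) x :> (x * cos x - sin x) / x\<^sup>2"
      by (auto intro!: derivative_eq_intros simp: power2_eq_square field_simps)
    moreover have "(x * cos x - sin x) / x\<^sup>2 \<le> 0"
      using x_cos_le_sin[of x] x \<open>x > 0\<close> by (intro divide_nonpos_pos) auto
    ultimately show "\<exists>y. DERIV (\<lambda>x. sin x / x) x :> y \<and> y \<le> 0" by blast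
  qed
  then show ?thesis using u by (simp add: field_simps)
qed simp

lemma abs_cot_minus_inverse:
  fixes u :: real
  assumes "0 < \<bar>u\<bar>" "\<bar>u\<bar> \<le> 1" shows "\<bar>cot u - 1 / u\<bar> \<le> \<bar>u\<bar>"
proof -
  have main: "\<bar>cot u - 1 / u\<bar> \<le> u" if u: "0 < u" "u \<le> 1" for u :: real
  proof -
    have pi: "u < pi / 2" "u < pi" using u pi_gt3 by linarith+
    have s: "sin u > 0" using u pi by (intro sin_gt_zero)
    have "2 / pi * u \<le> sin u" using u pi by (intro jordan_sin) auto
    moreover have "1 / 2 * u \<le> 2 / pi * u" using u pi_less_4 by (intro mult_right_mono) (auto simp: field_simps)
    ultimately have s2: "u / 2 \<le> sin u" by linarith
    have "1 - cos u \<le> u\<^sup>2 / 2"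
      using cos_times_cos[of "u/2" "u/2"] sin_x_le_x[of "u/2"] cos_double_sin[of "u/2"] u
        power_mono[of "sin (u/2)" "u/2" 2] sin_ge_zero[of "u/2"] pi by (simp add: power2_eq_square)
    then have "u * (1 - cos u) \<le> u * (u\<^sup>2 / 2)" using u by (intro mult_left_mono) auto
    then have up: "sin u - u * cos u \<le> u * (u * (u / 2))"
      using sin_x_le_x[of u] u by (simp add: algebra_simps power2_eq_square)
    also have "\<dots> \<le> u * (u * sin u)" using s2 u by (intro mult_left_mono) auto
    finally have 1: "sin u - u * cos u \<le> u * (u * sin u)" .
    have 2: "u * cos u \<le> sin u" using u pi by (intro x_cos_le_sin) auto
    have "cot u - 1 / u = - ((sin u - u * cos u) / (u * sin u))"
      using s u by (simp add: cot_def field_simps)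
    moreover have "(sin u - u * cos u) / (u * sin u) \<le> u" "(sin u - u * cos u) / (u * sin u) \<ge> 0"
      using 1 2 s u by (simp_all add: divide_simps algebra_simps)
    ultimately show ?thesis by simp
  qed
  show ?thesis
  proof (cases "u > 0")
    case True then show ?thesis using main[of u] assms by simp
  next
    case False
    then show ?thesis using main[of "-u"] assms by (simp add: abs_minus_commute)
  qed
qed

lemma cot_diff:
  assumes "sin A \<noteq> 0" "sin B \<noteq> 0"
  shows "cot A - cot B = sin (B - A) / (sin A * sin (B :: real))"
  using assms by (simp add: cot_def sin_diff field_simps)

text \<open>Partial fractions in $\cot(u_k + \alpha)$: a second divided difference of the cotangent. It has a single
  term, whose sign can be followed.\<close>
lemma cot_divided_difference3:
  fixes a u v w :: real
  assumes s: "sin (u + a) \<noteq> 0" "sin (v + a) \<noteq> 0" "sin (w + a) \<noteq> 0"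
    and d: "sin (u - v) \<noteq> 0" "sin (u - w) \<noteq> 0" "sin (v - w) \<noteq> 0"
  shows "cos u / (sin (v - u) * sin (w - u)) * cot (u + a) + cos v / (sin (u - v) * sin (w - v)) * cot (v + a)
       + cos w / (sin (u - w) * sin (v - w)) * cot (w + a) = cos a / (sin (u + a) * sin (v + a) * sin (w + a))"
proof -
  define U V W where "U = u + a" and "V = v + a" and "W = w + a"
  define p q r where "p = cot U" and "q = cot V" and "r = cot W"
  have sd: "sin (Y - X) = sin X * sin Y * (cot X - cot Y)" if "sin X \<noteq> 0" "sin Y \<noteq> 0" for X Y :: real
    using that by (simp add: sin_diff cot_def field_simps)
  have cc: "cos (X - a) = sin X * (cos a * cot X + sin a)" if "sin X \<noteq> 0" for X :: real
    using that by (simp add: cos_diff cot_def field_simps)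
  have S: "sin U \<noteq> 0" "sin V \<noteq> 0" "sin W \<noteq> 0" using s by (simp_all add: U_def V_def W_def)
  have e: "u = U - a" "v = V - a" "w = W - a" by (simp_all add: U_def V_def W_def)
  have D: "p \<noteq> q" "p \<noteq> r" "q \<noteq> r"
    using d sd[OF S(2) S(1)] sd[OF S(3) S(1)] sd[OF S(3) S(2)] by (auto simp: e p_def q_def r_def)
  have i1: "p / ((p - q) * (p - r)) + q / ((q - p) * (q - r)) + r / ((r - p) * (r - q)) = 0"
    and i2: "p * p / ((p - q) * (p - r)) + q * q / ((q - p) * (q - r)) + r * r / ((r - p) * (r - q)) = 1"
    using D by (simp add: divide_simps, simp add: algebra_simps)+
  let ?S = "sin U * sin V * sin W"
  have g: "(x * (cos a * c + sin a)) / ((x * y * d) * (x * z * d')) * c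
      = (cos a * (c * c / (d * d')) + sin a * (c / (d * d'))) / (x * y * z)"
    if "x \<noteq> 0" "y \<noteq> 0" "z \<noteq> 0" "d \<noteq> 0" "d' \<noteq> 0" for x y z c d d' :: real
    using that by (simp add: field_simps)
  have "cos u / (sin (v - u) * sin (w - u)) * cot (u + a) + cos v / (sin (u - v) * sin (w - v)) * cot (v + a)
       + cos w / (sin (u - w) * sin (v - w)) * cot (w + a)
     = (cos a * (p * p / ((p - q) * (p - r))) + sin a * (p / ((p - q) * (p - r)))) / ?S
     + (cos a * (q * q / ((q - p) * (q - r))) + sin a * (q / ((q - p) * (q - r)))) / ?S
     + (cos a * (r * r / ((r - p) * (r - q))) + sin a * (r / ((r - p) * (r - q)))) / ?S"
    using g[OF S(1) S(2) S(3), of "p - q" "p - r" p] g[OF S(2) S(1) S(3), of "q - p" "q - r" q]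
      g[OF S(3) S(1) S(2), of "r - p" "r - q" r] D
    by (simp add: e cc[OF S(1)] cc[OF S(2)] cc[OF S(3)] sd[OF S(1) S(2)] sd[OF S(1) S(3)] sd[OF S(2) S(1)]
        sd[OF S(2) S(3)] sd[OF S(3) S(1)] sd[OF S(3) S(2)] flip: p_def q_def r_def) (simp only: mult_ac)
  also have "\<dots> = (cos a * (p * p / ((p - q) * (p - r)) + q * q / ((q - p) * (q - r)) + r * r / ((r - p) * (r - q)))
     + sin a * (p / ((p - q) * (p - r)) + q / ((q - p) * (q - r)) + r / ((r - p) * (r - q)))) / ?S"
    by (simp only: distrib_left add_divide_distrib add_ac)
  also have "\<dots> = cos a / ?S" by (simp only: i1 i2 mult_1_right mult_zero_right add_0_right)
  finally show ?thesis by (simp add: U_def V_def W_def)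
qed

lemma sum_inverse_squares:
  "m \<ge> 2 \<Longrightarrow> (\<Sum>j=m..n. 1 / (real j)\<^sup>2) \<le> 1 / (real m - 1 / 2)"
proof -
  assume m: "m \<ge> 2"
  have "(\<Sum>j=m..n. 1 / (real j)\<^sup>2) \<le> 1 / (real m - 1 / 2) - 1 / (real n + 1 / 2)" if "m \<le> n" for n
    using that
  proof (induction n rule: dec_induct)
    case base
    show ?case using m by (simp add: divide_simps power2_eq_square) (simp add: algebra_simps)
  next
    case (step n)
    have "1 / (real (Suc n))\<^sup>2 \<le> 1 / (real n + 1 / 2) - 1 / (real (Suc n) + 1 / 2)"
      by (simp add: divide_simps power2_eq_square) (simp add: algebra_simps)
    then show ?case using step by simp
  qed
  moreover have "1 / (real n + 1 / 2) \<ge> 0" by simp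
  ultimately show ?thesis using m by (cases "m \<le> n") (smt (verit), simp)
qed

section \<open>Fekete polynomials as sums of cotangents\<close>

definition circle_point :: "nat \<Rightarrow> real \<Rightarrow> complex" where
  "circle_point p y = cis (2 * pi * y / p)"

lemma cis_eq_1_iff: "cis t = 1 \<longleftrightarrow> (\<exists>n::int. t = n * 2 * pi)"
  unfolding cos_one_2pi_int[symmetric]
  by (auto simp: complex_eq_iff) (metis cos_one_sin_zero)

lemma circle_point_eq_1_iff: "p > 0 \<Longrightarrow> circle_point p y = 1 \<longleftrightarrow> (\<exists>n::int. y = of_int n * real p)"
  unfolding circle_point_def cis_eq_1_iff by (auto simp: field_simps)

lemma circle_point_add: "circle_point p (x + y) = circle_point p x * circle_point p y"
  by (simp add: circle_point_def cis_mult add_divide_distrib distrib_left)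

lemma circle_point_minus: "circle_point p (- y) = cnj (circle_point p y)"
  by (simp add: circle_point_def cis_cnj)

lemma circle_point_power: "circle_point p y ^ n = circle_point p (n * y)"
  by (simp add: circle_point_def Complex.DeMoivre algebra_simps)

lemma circle_point_mod: "p > 0 \<Longrightarrow> circle_point p (of_int (a mod int p)) = circle_point p (of_int a)"
proof -
  assume p: "p > 0"
  have "real_of_int a = of_int (a mod int p) + of_int (a div int p) * real p"
    by (metis add.commute div_mult_mod_eq of_int_add of_int_mult of_int_of_nat_eq)
  moreover have "circle_point p (of_int (a div int p) * real p) = 1"
    using p by (auto simp: circle_point_eq_1_iff)
  ultimately show ?thesis by (simp add: circle_point_add)
qed

lemma inj_circle_point: "p > 0 \<Longrightarrow> inj_on (circle_point p) {0..<real p}"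
proof (rule inj_onI)
  fix x y assume p: "p > 0" and xy: "x \<in> {0..<real p}" "y \<in> {0..<real p}" "circle_point p x = circle_point p y"
  have "circle_point p (x - y) * circle_point p y = circle_point p y"
    using xy by (simp flip: circle_point_add)
  then have "circle_point p (x - y) = 1" by (simp add: circle_point_def)
  then obtain n :: int where n: "x - y = n * p" using p circle_point_eq_1_iff by auto
  moreover have "\<bar>x - y\<bar> < p" using xy by auto
  ultimately have "\<bar>real_of_int n\<bar> * real p < 1 * real p" using p by (simp add: abs_mult)
  then have "\<bar>real_of_int n\<bar> < 1" using p by (simp only: mult_less_cancel_right)
  then have "n = 0" by linarith
  then show "x = y" using n by simp
qed

lemma poly_fekete:
  assumes "p > 0"
  shows "poly (fekete p) z = (\<Sum>a<p. of_real (legendre_symbol p (int a)) * z ^ a)"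
proof -
  have "{0..p - 1} = {..<p}" using assms by auto
  then show ?thesis by (simp add: fekete_def poly_sum poly_monom legendre_symbol_def)
qed

definition gauss_sum :: "nat \<Rightarrow> complex" where
  "gauss_sum p = (\<Sum>k\<in>{0..<int p}. of_real (legendre_symbol p k) * circle_point p (- of_int k))"

lemma gauss_sum_twist:
  assumes p: "prime p" "p > 2"
  shows "(\<Sum>k\<in>{0..<int p}. of_real (legendre_symbol p k) * circle_point p (- of_int (m * k)))
    = of_real (legendre_symbol p m) * gauss_sum p"
proof (cases "int p dvd m")
  case True
  have "circle_point p (- of_int (m * k)) = 1" for k
  proof -
    obtain q where "m = int p * q" using True by blast
    then have "- real_of_int (m * k) = of_int (- (q * k)) * real p" by simp
    then show ?thesis using p by (subst circle_point_eq_1_iff) (auto intro!: exI[of _ "- (q * k)"])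
  qed
  moreover have "legendre_symbol p m = 0" using True by (simp add: legendre_symbol_eq_0_iff)
  ultimately show ?thesis using legendre_symbol_sum[OF p] by (simp flip: of_real_sum)
next
  case False
  let ?g = "\<lambda>k. of_real (legendre_symbol p k) * circle_point p (- of_int k)"
  have p0: "p > 0" using p by simp
  have cmod: "circle_point p (- of_int (k mod int p)) = circle_point p (- of_int k)" for k
    unfolding circle_point_minus circle_point_mod[OF p0] ..
  have "gauss_sum p = (\<Sum>k\<in>{0..<int p}. ?g (m * k + 0))"
    unfolding gauss_sum_def
    by (rule sum_residues_affine[symmetric, OF p(1) False]) (simp only: cmod legendre_symbol_mod0)
  also have "\<dots> = of_real (legendre_symbol p m) * (\<Sum>k\<in>{0..<int p}. of_real (legendre_symbol p k) * circle_point p (- of_int (m * k)))"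
    unfolding sum_distrib_left by (simp add: legendre_symbol_mult[OF p] mult_ac)
  finally have g: "gauss_sum p = of_real (legendre_symbol p m) * (\<Sum>k\<in>{0..<int p}. of_real (legendre_symbol p k) * circle_point p (- of_int (m * k)))" .
  have "legendre_symbol p m * legendre_symbol p m = 1"
    using legendre_symbol_abs[OF False] by (metis abs_mult_self_eq mult_1)
  then have "of_real (legendre_symbol p m) * of_real (legendre_symbol p m) = (1 :: complex)"
    by (simp flip: of_real_mult)
  then show ?thesis unfolding g by (simp flip: mult.assoc)
qed

text \<open>Otherwise all Fourier coefficients of the symbol would vanish by \<open>gauss_sum_twist\<close>, and Fourier inversion would
  give the value $0$ at $1$.\<close>
lemma gauss_sum_nonzero:
  assumes p: "prime p" "p > 2"
  shows "gauss_sum p \<noteq> 0"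
proof
  assume 0: "gauss_sum p = 0"
  have p0: "p > 0" using p by simp
  have geo: "(\<Sum>m<p. circle_point p (of_int (int m * (1 - k)))) = (if k = 1 then of_nat p else 0)"
    if k: "k \<in> {0..<int p}" for k
  proof (cases "k = 1")
    case False
    let ?r = "circle_point p (of_int (1 - k))"
    have "?r \<noteq> 1"
    proof
      assume "?r = 1"
      then obtain n :: int where "real_of_int (1 - k) = of_int n * real p" using circle_point_eq_1_iff[OF p0] by blast
      then have "1 - k = n * int p" by (metis of_int_eq_iff of_int_mult of_int_of_nat_eq)
      then have "int p dvd 1 - k" by simp
      moreover have "\<bar>1 - k\<bar> < int p" using k p(2) by auto
      ultimately show False using False zdvd_not_zless[of "\<bar>1 - k\<bar>" "int p"] by force
    qed
    moreover have "?r ^ p = 1" unfolding circle_point_power circle_point_eq_1_iff[OF p0]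
      by (intro exI[of _ "1 - k"]) simp
    moreover have "circle_point p (of_int (int m * (1 - k))) = ?r ^ m" for m
      by (simp add: circle_point_power)
    ultimately show ?thesis using False by (simp add: sum_gp_strict)
  qed (simp add: circle_point_def)
  have "0 = (\<Sum>m<p. (\<Sum>k\<in>{0..<int p}. of_real (legendre_symbol p k) * circle_point p (- of_int (int m * k))) * circle_point p (of_int (int m)))"
    by (simp only: gauss_sum_twist[OF p] 0 mult_zero_left mult_zero_right sum.neutral_const)
  also have "\<dots> = (\<Sum>k\<in>{0..<int p}. of_real (legendre_symbol p k) * (\<Sum>m<p. circle_point p (of_int (int m * (1 - k)))))"
    unfolding sum_distrib_right sum_distrib_left
  proof (subst sum.swap, intro sum.cong refl)
    fix k m
    have "circle_point p (of_int (int m * (1 - k))) = circle_point p (- of_int (int m * k)) * circle_point p (of_int (int m))"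
      unfolding circle_point_add[symmetric] by (simp add: algebra_simps)
    then show "of_real (legendre_symbol p k) * circle_point p (- of_int (int m * k)) * circle_point p (of_int (int m))
      = of_real (legendre_symbol p k) * circle_point p (of_int (int m * (1 - k)))" by (simp only: mult.assoc)
  qed
  also have "\<dots> = (\<Sum>k\<in>{0..<int p}. of_real (legendre_symbol p k) * (if k = 1 then of_nat p else 0))"
    by (intro sum.cong refl) (simp only: geo)
  also have "\<dots> = of_real (legendre_symbol p 1) * of_nat p" using p(2) by (simp add: if_distrib sum.delta cong: if_cong)
  finally have "legendre_symbol p 1 = 0" using p(2) by simp
  then show False using p(2) by (simp add: legendre_symbol_eq_0_iff)
qed

lemma cot_partial_fraction:
  assumes "cis (2 * v) \<noteq> 1"
  shows "1 / (cis (2 * v) - 1) = - 1 / 2 - \<i> / 2 * of_real (cot v)"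
proof -
  have "sin v \<noteq> 0" using assms unfolding cis_eq_1_iff sin_zero_iff_int2 by (auto simp: algebra_simps)
  then have "cot v * sin v = cos v" by (simp add: cot_def)
  then have cot: "complex_of_real (cot v) * of_real (sin v) = of_real (cos v)" by (metis of_real_mult)
  have "cis (2 * v) - 1 = 2 * \<i> * of_real (sin v) * cis v"
    by (simp add: complex_eq_iff cos_double_sin sin_double power2_eq_square)
  then have "(cis (2 * v) - 1) * (- 1 / 2 - \<i> / 2 * of_real (cot v))
     = cis v * (of_real (cot v) * of_real (sin v) - \<i> * of_real (sin v))"
    by (simp add: algebra_simps)
  also have "\<dots> = 1" unfolding cot by (simp add: complex_eq_iff flip: power2_eq_square)
  finally have "(cis (2 * v) - 1) * (- 1 / 2 - \<i> / 2 * of_real (cot v)) = 1" .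
  moreover have "cis (2 * v) - 1 \<noteq> 0" using assms by simp
  ultimately show ?thesis by (metis nonzero_mult_div_cancel_left)
qed

text \<open>Inserting the Fourier expansion of the Legendre symbol and summing geometric series turns the polynomial into a
  Gauss sum times a combination of cotangents.\<close>
lemma fekete_zero_iff_cot_sum:
  assumes p: "prime p" "p > 2" and y: "y \<notin> \<int>"
  shows "poly (fekete p) (circle_point p y) = 0 \<longleftrightarrow>
    (\<Sum>k\<in>{0..<int p}. legendre_symbol p k * cot (pi * (y - k) / p)) = 0"
proof -
  have p0: "p > 0" using p by simp
  let ?z = "circle_point p y" and ?A = "{0..<int p}"
  let ?c = "\<lambda>k. complex_of_real (legendre_symbol p k)"
  define W where "W k = circle_point p (y - of_int k)" for k
  have W1: "W k \<noteq> 1" for k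
    unfolding W_def circle_point_eq_1_iff[OF p0]
    using y by (metis Ints_of_int diff_add_cancel of_int_add of_int_mult of_int_of_nat_eq)
  have Wp: "W k ^ p = ?z ^ p" for k
  proof -
    have "circle_point p (- (of_int k * real p)) = 1"
      unfolding circle_point_eq_1_iff[OF p0] by (rule exI[of _ "-k"]) simp
    moreover have "real p * (y - of_int k) = real p * y + (- (of_int k * real p))" by (simp add: algebra_simps)
    ultimately show ?thesis
      unfolding W_def circle_point_power by (simp only: circle_point_add mult_1_right)
  qed
  define S where "S = (\<Sum>k\<in>?A. legendre_symbol p k * cot (pi * (y - k) / p))"
  have zp: "?z ^ p \<noteq> 1"
    unfolding circle_point_power circle_point_eq_1_iff[OF p0] using y p0 by (auto simp: mult.commute)
  have "(?z ^ p - 1) * (\<Sum>k\<in>?A. ?c k * (1 / (W k - 1))) = (\<Sum>k\<in>?A. ?c k * (\<Sum>m<p. W k ^ m))"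
    by (subst sum_distrib_left, intro sum.cong refl) (simp add: geometric_sum[OF W1] Wp)
  also have "\<dots> = (\<Sum>m<p. ?z ^ m * (\<Sum>k\<in>?A. ?c k * circle_point p (- of_int (int m * k))))"
    unfolding sum_distrib_left
  proof (subst sum.swap, intro sum.cong refl)
    fix m k
    have "W k ^ m = ?z ^ m * circle_point p (- of_int (int m * k))"
      by (simp add: W_def circle_point_power algebra_simps flip: circle_point_add)
    then show "?c k * W k ^ m = ?z ^ m * (?c k * circle_point p (- of_int (int m * k)))" by simp
  qed
  also have "\<dots> = (\<Sum>m<p. ?z ^ m * (?c (int m) * gauss_sum p))"
    by (simp only: gauss_sum_twist[OF p])
  also have "\<dots> = gauss_sum p * poly (fekete p) ?z"
    by (simp only: poly_fekete[OF p0] sum_distrib_left mult_ac)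
  finally have main: "(?z ^ p - 1) * (\<Sum>k\<in>?A. ?c k * (1 / (W k - 1))) = gauss_sum p * poly (fekete p) ?z" .
  have "1 / (W k - 1) = - 1 / 2 - \<i> / 2 * of_real (cot (pi * (y - k) / p))" for k :: int
  proof -
    have "W k = cis (2 * (pi * (y - k) / p))" by (simp add: W_def circle_point_def mult.assoc)
    then show ?thesis using cot_partial_fraction[of "pi * (y - k) / p"] W1[of k] by simp
  qed
  moreover have gen: "c * (- 1 / 2 - \<i> / 2 * t) = (- 1 / 2) * c + (- \<i> / 2) * (c * t)" for c t :: complex
    by (simp add: algebra_simps)
  ultimately have "(\<Sum>k\<in>?A. ?c k * (1 / (W k - 1)))
     = (\<Sum>k\<in>?A. (- 1 / 2) * ?c k) + (\<Sum>k\<in>?A. (- \<i> / 2) * (?c k * of_real (cot (pi * (y - k) / p))))"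
    unfolding sum.distrib[symmetric] by (simp only: gen)
  also have "(\<Sum>k\<in>?A. (- 1 / 2) * ?c k) = 0"
    unfolding sum_distrib_left[symmetric] of_real_sum[symmetric] legendre_symbol_sum[OF p] by simp
  also have "(\<Sum>k\<in>?A. (- \<i> / 2) * (?c k * of_real (cot (pi * (y - k) / p))))
     = (- \<i> / 2) * of_real (\<Sum>k\<in>?A. legendre_symbol p k * cot (pi * (y - k) / p))"
    by (simp add: sum_distrib_left)
  finally have "(\<Sum>k\<in>?A. ?c k * (1 / (W k - 1))) = (- \<i> / 2) * of_real S" unfolding S_def by simp
  then have "(?z ^ p - 1) * ((- \<i> / 2) * of_real S) = gauss_sum p * poly (fekete p) ?z" using main by (simp only:)
  then have "poly (fekete p) ?z = 0 \<longleftrightarrow> S = 0" using zp gauss_sum_nonzero[OF p] by auto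
  then show ?thesis by (simp only: S_def)
qed

section \<open>Zeros on the arcs between roots of unity\<close>

text \<open>The cotangent sum in the coordinate $x$ of the arc from $e(K/p)$ to $e((K+1)/p)$. The summation range is centred so
  that the poles at the two ends of the arc are those with the indices $0$ and $-1$.\<close>
definition cot_sum :: "nat \<Rightarrow> int \<Rightarrow> real \<Rightarrow> real" where
  "cot_sum p K x = (\<Sum>i\<in>{- int (p div 2)..int (p div 2)}.
     legendre_symbol p (K - i) * cot (pi * (x + of_int i) / p))"

definition arc_zeros :: "nat \<Rightarrow> int \<Rightarrow> real set" where
  "arc_zeros p K = {x \<in> {0<..<1}. cot_sum p K x = 0}"

lemma cot_add_int_pi: "cot (x + of_int n * pi) = cot (x :: real)"
proof -
  have "sin (of_int n * pi) = 0" by (simp add: mult.commute)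
  moreover from this have "cos (of_int n * pi) \<noteq> 0" by (metis sin_cos_squared_add power_zero_numeral add_0 zero_neq_one)
  ultimately show ?thesis by (simp add: cot_def sin_add cos_add)
qed

lemma cot_sum_residues:
  assumes p: "prime p" "p > 2"
  shows "cot_sum p K x = (\<Sum>k\<in>{0..<int p}. legendre_symbol p k * cot (pi * (of_int K + x - of_int k) / p))"
proof -
  define m where "m = int (p div 2)"
  let ?g = "\<lambda>k. legendre_symbol p k * cot (pi * (of_int K + x - of_int k) / p)"
  have pm: "int p = 2 * m + 1"
    using p prime_odd_nat[of p] unfolding m_def by (metis odd_two_times_div_two_succ of_nat_Suc of_nat_mult of_nat_numeral Suc_eq_plus1 add.commute)
  have per: "?g (k mod int p) = ?g k" for k
  proof -
    have "real_of_int k = of_int (k mod int p) + of_int (k div int p) * real p"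
      by (metis add.commute div_mult_mod_eq of_int_add of_int_mult of_int_of_nat_eq)
    then have "pi * (of_int K + x - of_int (k mod int p)) / p
      = pi * (of_int K + x - of_int k) / p + of_int (k div int p) * pi"
      using p(2) by (simp add: field_simps)
    then show ?thesis by (simp only: cot_add_int_pi legendre_symbol_mod0)
  qed
  have "cot_sum p K x = (\<Sum>k\<in>{0..<int p}. ?g (-1 * k + (K + m)))"
    unfolding cot_sum_def m_def[symmetric]
    by (rule sum.reindex_bij_witness[of _ "\<lambda>k. k - m" "\<lambda>i. i + m"])
       (auto simp: pm algebra_simps)
  also have "\<dots> = (\<Sum>k\<in>{0..<int p}. ?g k)"
    using p(2) per by (intro sum_residues_affine[OF p(1)]) auto
  finally show ?thesis .
qed

lemma arc_zeros_iff:
  assumes p: "prime p" "p > 2" and x: "0 < x" "x < 1"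
  shows "x \<in> arc_zeros p K \<longleftrightarrow> poly (fekete p) (circle_point p (of_int K + x)) = 0"
proof -
  have "of_int K + x \<notin> \<int>"
  proof
    assume "of_int K + x \<in> \<int>"
    then have "x \<in> \<int>" by (metis Ints_diff Ints_of_int add_diff_cancel_left')
    then show False using x by (auto elim!: Ints_cases)
  qed
  then show ?thesis
    using x by (simp add: arc_zeros_def cot_sum_residues[OF p] fekete_zero_iff_cot_sum[OF p])
qed

lemma fekete_at_root_of_unity:
  assumes p: "prime p" "p > 2"
  shows "poly (fekete p) (circle_point p (of_int K)) = 0 \<longleftrightarrow> int p dvd K"
proof -
  have "poly (fekete p) (circle_point p (of_int K))
    = (\<Sum>a<p. of_real (legendre_symbol p (int a)) * circle_point p (- of_int (- K * int a)))"
    using p by (simp add: poly_fekete circle_point_power mult.commute)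
  also have "\<dots> = (\<Sum>k\<in>{0..<int p}. of_real (legendre_symbol p k) * circle_point p (- of_int (- K * k)))"
    by (rule sum.reindex_bij_witness[of _ nat int]) auto
  also have "\<dots> = of_real (legendre_symbol p (- K)) * gauss_sum p" by (rule gauss_sum_twist[OF p])
  finally show ?thesis using gauss_sum_nonzero[OF p] by (simp add: legendre_symbol_eq_0_iff)
qed

lemma fekete_nonzero:
  assumes p: "prime p" "p > 2" shows "fekete p \<noteq> 0"
proof
  assume "fekete p = 0"
  then have "poly (fekete p) (circle_point p (of_int 1)) = 0" by simp
  then show False using p fekete_at_root_of_unity[OF p, of 1] by simp
qed

lemma circle_point_surj:
  assumes "cmod z = 1" "p > 0"
  obtains y where "0 \<le> y" "y < real p" "z = circle_point p y"
proof -
  obtain t where t: "0 \<le> t" "t < 2 * pi" "z = Complex (cos t) (sin t)"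
    using complex_unimodular_polar[OF assms(1)] by blast
  show ?thesis
  proof (rule that[of "t * p / (2 * pi)"])
    show "0 \<le> t * p / (2 * pi)" using t by simp
    show "t * p / (2 * pi) < p" using t assms(2) by (simp add: divide_simps mult.commute)
    show "z = circle_point p (t * p / (2 * pi))"
      using t assms(2) by (simp add: circle_point_def complex_eq_iff)
  qed
qed

text \<open>Among the $p$-th roots of unity only $1$ is a zero (\<open>fekete_at_root_of_unity\<close>); all other zeros lie
  inside the arcs.\<close>
lemma card_unit_circle_zeros:
  assumes p: "prime p" "p > 2"
  shows "card (unit_circle_zeros p) = 1 + (\<Sum>K\<in>{0..<int p}. card (arc_zeros p K))"
    and "finite (arc_zeros p K)"
proof -
  have p0: "p > 0" using p by simp
  define h where "h = (\<lambda>(K :: int, x). circle_point p (of_int K + x))"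
  define D where "D = (SIGMA K:{0..<int p}. arc_zeros p K)"
  have fin: "finite {z. poly (fekete p) z = 0}" by (rule poly_roots_finite[OF fekete_nonzero[OF p]])
  have x01: "0 < x \<and> x < 1" if "x \<in> arc_zeros p K" for x K using that by (simp add: arc_zeros_def)
  have range: "of_int K + x \<in> {0..<real p}" if "K \<in> {0..<int p}" "x \<in> {0..<1}" for K x
  proof -
    have "K + 1 \<le> int p" using that by simp
    then have "real_of_int (K + 1) \<le> real_of_int (int p)" by (simp only: of_int_le_iff)
    moreover have "0 \<le> real_of_int K" "0 \<le> x" "x < 1" using that by simp_all
    ultimately show ?thesis by simp
  qed
  have fin_arc: "finite (arc_zeros p K)" for K
  proof -
    have "(\<lambda>x. circle_point p (of_int K + x)) ` arc_zeros p K \<subseteq> {z. poly (fekete p) z = 0}"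
    proof
      fix z assume "z \<in> (\<lambda>x. circle_point p (of_int K + x)) ` arc_zeros p K"
      then obtain x where x: "x \<in> arc_zeros p K" "z = circle_point p (of_int K + x)" by blast
      then show "z \<in> {z. poly (fekete p) z = 0}" using arc_zeros_iff[OF p, of x K] x01[OF x(1)] by simp
    qed
    moreover have "inj_on (\<lambda>x. circle_point p (of_int K + x)) (arc_zeros p K)"
    proof (rule inj_onI)
      fix x y assume xy: "x \<in> arc_zeros p K" "y \<in> arc_zeros p K"
        "circle_point p (of_int K + x) = circle_point p (of_int K + y)"
      moreover have "circle_point p (of_int K) \<noteq> 0" by (simp add: circle_point_def)
      ultimately have "circle_point p x = circle_point p y" by (simp add: circle_point_add)
      moreover have "x \<in> {0..<real p}" "y \<in> {0..<real p}" using x01[OF xy(1)] x01[OF xy(2)] p by auto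
      ultimately show "x = y" using inj_circle_point[OF p0] by (auto dest: inj_onD)
    qed
    ultimately show ?thesis using fin by (meson finite_imageD finite_subset)
  qed
  have sub: "0 \<le> (K :: int) \<Longrightarrow> K < int p \<Longrightarrow> x \<in> arc_zeros p K \<Longrightarrow> of_int K + x \<in> {0..<real p} \<and> \<lfloor>of_int K + x\<rfloor> = K" for K x
    using range[of K x] x01[of x K] by (auto simp: floor_eq_iff)
  have inj: "inj_on h D"
  proof (rule inj_onI)
    fix a b assume ab: "a \<in> D" "b \<in> D" "h a = h b"
    obtain K x L y where e: "a = (K, x)" "b = (L, y)" by (cases a, cases b)
    have 1: "of_int K + x \<in> {0..<real p} \<and> \<lfloor>of_int K + x\<rfloor> = K"
      and 2: "of_int L + y \<in> {0..<real p} \<and> \<lfloor>of_int L + y\<rfloor> = L"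
      using ab sub[of K x] sub[of L y] by (auto simp: e D_def)
    then have "of_int K + x = of_int L + y"
      using ab(3) inj_onD[OF inj_circle_point[OF p0]] by (simp add: e h_def)
    then show "a = b" using 1 2 by (simp add: e)
  qed
  have "unit_circle_zeros p = insert 1 (h ` D)"
  proof (intro equalityI subsetI)
    fix z assume "z \<in> unit_circle_zeros p"
    then have z: "cmod z = 1" "poly (fekete p) z = 0" by (auto simp: unit_circle_zeros_def)
    obtain y where y: "0 \<le> y" "y < real p" "z = circle_point p y" by (rule circle_point_surj[OF z(1) p0])
    define K where "K = \<lfloor>y\<rfloor>"
    have K: "K \<in> {0..<int p}" using y by (auto simp: K_def floor_less_iff)
    define x where "x = y - of_int K"
    have x: "0 \<le> x" "x < 1" "y = of_int K + x" unfolding x_def K_def by linarith+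
    show "z \<in> insert 1 (h ` D)"
    proof (cases "x = 0")
      case True
      then have "int p dvd K" using z y x fekete_at_root_of_unity[OF p] by simp
      then have "K = 0" using K by (auto dest: zdvd_imp_le)
      then show ?thesis using True x y by (simp add: circle_point_def)
    next
      case False
      then have "x \<in> arc_zeros p K" using arc_zeros_iff[OF p, of x K] x y z by auto
      then have "(K, x) \<in> D" using K by (simp add: D_def)
      moreover have "z = h (K, x)" using x(3) y(3) by (simp add: h_def)
      ultimately show ?thesis by blast
    qed
  next
    fix z assume "z \<in> insert 1 (h ` D)"
    moreover have "1 \<in> unit_circle_zeros p"
      using fekete_at_root_of_unity[OF p, of 0] by (simp add: unit_circle_zeros_def circle_point_def)
    moreover have "h a \<in> unit_circle_zeros p" if a: "a \<in> D" for a
    proof -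
      obtain K x where e: "a = (K, x)" "x \<in> arc_zeros p K" using a by (auto simp: D_def)
      show ?thesis using arc_zeros_iff[OF p, of x K] x01[OF e(2)] e
        unfolding unit_circle_zeros_def h_def circle_point_def by simp
    qed
    ultimately show "z \<in> unit_circle_zeros p" by blast
  qed
  moreover have "1 \<notin> h ` D"
  proof
    assume "1 \<in> h ` D"
    then obtain K x where Kx: "K \<in> {0..<int p}" "x \<in> arc_zeros p K" "circle_point p (of_int K + x) = circle_point p 0"
      by (auto simp: D_def h_def circle_point_def)
    then have "of_int K + x = 0"
      using sub[of K x] p0 inj_onD[OF inj_circle_point[OF p0], of "of_int K + x" 0] by auto
    moreover have "0 \<le> real_of_int K" using Kx(1) by simp
    ultimately show False using x01[OF Kx(2)] by linarith
  qed
  moreover have "finite D" unfolding D_def using fin_arc by auto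
  moreover have "card D = (\<Sum>K\<in>{0..<int p}. card (arc_zeros p K))"
    unfolding D_def using fin_arc by (intro card_SigmaI) auto
  ultimately show "card (unit_circle_zeros p) = 1 + (\<Sum>K\<in>{0..<int p}. card (arc_zeros p K))"
    using inj by (simp add: card_image)
  show "finite (arc_zeros p K)" by (rule fin_arc)
qed

text \<open>Complex conjugation exchanges the two arcs at $1$.\<close>
lemma card_arc_zeros_reflect:
  assumes p: "prime p" "p > 2"
  shows "card (arc_zeros p (int p - 1)) = card (arc_zeros p 0)"
proof -
  have p0: "p > 0" using p by simp
  have cnj: "poly (fekete p) (cnj z) = cnj (poly (fekete p) z)" for z
    by (simp add: poly_fekete[OF p0])
  have iff: "1 - x \<in> arc_zeros p (int p - 1) \<longleftrightarrow> x \<in> arc_zeros p 0" if x: "0 < x" "x < 1" for x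
  proof -
    have "circle_point p (of_int (int p - 1) + (1 - x)) = circle_point p (real p * 1) * circle_point p (- x)"
      by (simp flip: circle_point_add)
    also have "circle_point p (real p * 1) = 1" using p0 by (simp add: circle_point_def)
    finally have "circle_point p (of_int (int p - 1) + (1 - x)) = cnj (circle_point p x)"
      by (simp add: circle_point_minus)
    then show ?thesis using arc_zeros_iff[OF p, of "1 - x" "int p - 1"] arc_zeros_iff[OF p, of x 0] x
      by (simp add: cnj)
  qed
  have x01: "0 < x \<and> x < 1" if "x \<in> arc_zeros p K" for x K using that by (simp add: arc_zeros_def)
  have iff_sub: "(\<lambda>x. 1 - x) ` arc_zeros p (int p - 1) \<subseteq> arc_zeros p 0"
    "(\<lambda>x. 1 - x) ` arc_zeros p 0 \<subseteq> arc_zeros p (int p - 1)"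
  proof safe
    fix x assume "x \<in> arc_zeros p (int p - 1)"
    then show "1 - x \<in> arc_zeros p 0" using iff[of "1 - x"] x01[of x "int p - 1"] by simp
  next
    fix x assume "x \<in> arc_zeros p 0"
    then show "1 - x \<in> arc_zeros p (int p - 1)" using iff[of x] x01[of x 0] by simp
  qed
  have "bij_betw (\<lambda>x. 1 - x) (arc_zeros p (int p - 1)) (arc_zeros p 0)"
    by (rule bij_betw_byWitness[where f' = "\<lambda>x. 1 - x"])
       (use iff_sub in auto)
  then show ?thesis by (rule bij_betw_same_card)
qed

section \<open>Upper bounds for the number of zeros on an arc\<close>

lemma pi_fraction_le_half:
  assumes "real p > 0" "y \<le> real p / 2" shows "pi * y / p \<le> pi / 2"
proof -
  have "pi * y / p \<le> pi * (real p / 2) / p" using assms by (intro divide_right_mono mult_left_mono) auto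
  then show ?thesis using assms by simp
qed

lemma sin_arc_lower:
  fixes p :: nat and x :: real and j :: int
  assumes p: "odd p" and x: "0 \<le> x" "x \<le> 1" and j: "0 \<le> j" "j \<le> int (p div 2)"
  shows "2 * of_int j / real p \<le> sin (pi * (of_int j + x) / p)"
proof -
  have pm: "int p = 2 * int (p div 2) + 1" using p by presburger
  have pr: "real p > 0" using p by (cases p) auto
  have jr: "real_of_int j \<le> (real p - 1) / 2"
  proof -
    have "2 * j + 1 \<le> int p" using j pm by linarith
    then have "real_of_int (2 * j + 1) \<le> real_of_int (int p)" by (simp only: of_int_le_iff)
    then show ?thesis by simp
  qed
  have j0: "real_of_int j \<ge> 0" using j by simp
  show ?thesis
  proof (cases "of_int j + x \<le> real p / 2")
    case True
    have "2 / pi * (pi * (of_int j + x) / p) \<le> sin (pi * (of_int j + x) / p)"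
      using True x j0 pr by (intro jordan_sin pi_fraction_le_half) auto
    moreover have "2 / pi * (pi * (of_int j + x) / p) = 2 * (of_int j + x) / p" using pr by (simp add: field_simps)
    moreover have "2 * of_int j / real p \<le> 2 * (of_int j + x) / p" using x pr by (intro divide_right_mono) auto
    ultimately show ?thesis by linarith
  next
    case False
    let ?y = "p - (of_int j + x)"
    have y: "?y \<ge> of_int j" "?y \<le> real p / 2" using False jr x by (auto simp: field_simps)
    have e: "pi * ?y / p = pi - pi * (of_int j + x) / p" using pr by (simp add: field_simps)
    have "2 / pi * (pi * ?y / p) \<le> sin (pi * ?y / p)"
      using y j0 pr by (intro jordan_sin pi_fraction_le_half) auto
    moreover have "2 / pi * (pi * ?y / p) = 2 * ?y / p" using pr by (simp add: field_simps)
    moreover have "2 * of_int j / real p \<le> 2 * ?y / p" using y pr by (intro divide_right_mono) auto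
    ultimately show ?thesis unfolding e by simp
  qed
qed

text \<open>The distance from the unit interval to the pole of the $i$-th cotangent, which lies at $-i$.\<close>
definition gap :: "int \<Rightarrow> int" where "gap i = (if i \<ge> 0 then i else - 1 - i)"

lemma abs_sin_arc_lower:
  assumes p: "odd p" and x: "0 < x" "x < 1" and i: "i \<in> {- int (p div 2)..int (p div 2)}"
  shows "2 * of_int (gap i) / real p \<le> \<bar>sin (pi * (x + of_int i) / p)\<bar>"
proof (cases "i \<ge> 0")
  case True
  then show ?thesis
    using sin_arc_lower[OF p, of x i] x i by (simp add: gap_def add.commute)
next
  case False
  have "pi * (of_int (- 1 - i) + (1 - x)) / p = - (pi * (x + of_int i) / p)"
    by (simp add: minus_divide_left right_diff_distrib distrib_left)
  then have "sin (pi * (of_int (- 1 - i) + (1 - x)) / p) = - sin (pi * (x + of_int i) / p)" by (simp only: sin_minus)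
  then show ?thesis
    using sin_arc_lower[OF p, of "1 - x" "- 1 - i"] x i False by (simp add: gap_def)
qed

lemma sin_arc_nonzero:
  fixes p :: nat
  assumes p: "p > 2" and x: "0 < x" "x < 1"
  shows "sin (pi * (x + of_int i) / p) \<noteq> 0"
proof
  assume "sin (pi * (x + of_int i) / p) = 0"
  then obtain n :: int where "pi * (x + of_int i) / p = of_int n * pi" unfolding sin_zero_iff_int2 by blast
  then have "pi * (x + of_int i) = pi * (of_int n * p)" using p by (simp add: field_simps)
  then have "x + of_int i = of_int n * p" by (simp only: mult_cancel_left pi_neq_zero simp_thms)
  then have "x = of_int (n * int p - i)" by simp
  then have "x \<in> \<int>" by (metis Ints_of_int)
  then show False using x by (auto elim!: Ints_cases)
qed

lemma sin_diff_nonzero: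
  fixes p :: nat
  assumes p: "p > 2" and "0 < x" "x < 1" "0 < y" "y < 1" "x \<noteq> y"
  shows "sin (pi * x / p - pi * y / p) \<noteq> 0"
proof
  assume "sin (pi * x / p - pi * y / p) = 0"
  then obtain n :: int where "pi * x / p - pi * y / p = of_int n * pi" unfolding sin_zero_iff_int2 by blast
  then have "pi * (x - y) = pi * (of_int n * p)" using p by (simp add: field_simps)
  then have e: "x - y = of_int n * p" by (simp only: mult_cancel_left pi_neq_zero simp_thms)
  have "\<bar>x - y\<bar> < 1" using assms by auto
  then have "\<bar>real_of_int n\<bar> * p < 1" unfolding e by (simp add: abs_mult)
  moreover have "\<bar>real_of_int n\<bar> * 1 \<le> \<bar>real_of_int n\<bar> * p" using p by (intro mult_left_mono) auto
  ultimately have "n = 0" by linarith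
  then show False using e assms by simp
qed

text \<open>Two zeros in one arc: the first divided difference of \<open>cot_sum\<close> vanishes.\<close>
lemma two_zeros_identity:
  fixes p :: nat
  assumes p: "p > 2" and z: "x \<in> arc_zeros p K" "y \<in> arc_zeros p K" "x \<noteq> y"
  shows "(\<Sum>i\<in>{- int (p div 2)..int (p div 2)}.
     legendre_symbol p (K - i) / (sin (pi * (x + of_int i) / p) * sin (pi * (y + of_int i) / p))) = 0"
proof -
  let ?s = "\<lambda>x i. sin (pi * (x + of_int i) / p)"
  have x: "0 < x" "x < 1" "0 < y" "y < 1" using z by (auto simp: arc_zeros_def)
  let ?d = "sin (pi * y / p - pi * x / p)"
  have "cot (pi * (x + of_int i) / p) - cot (pi * (y + of_int i) / p) = ?d / (?s x i * ?s y i)" for i :: int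
  proof -
    have "pi * (y + of_int i) / p - pi * (x + of_int i) / p = pi * y / p - pi * x / p"
      by (simp add: add_divide_distrib distrib_left)
    then show ?thesis
      using cot_diff[OF sin_arc_nonzero[OF p x(1,2), of i] sin_arc_nonzero[OF p x(3,4), of i]] by simp
  qed
  then have "cot_sum p K x - cot_sum p K y = (\<Sum>i\<in>{- int (p div 2)..int (p div 2)}.
     legendre_symbol p (K - i) * (?d / (?s x i * ?s y i)))"
    unfolding cot_sum_def sum_subtractf[symmetric] right_diff_distrib[symmetric] by simp
  also have "\<dots> = ?d * (\<Sum>i\<in>{- int (p div 2)..int (p div 2)}. legendre_symbol p (K - i) / (?s x i * ?s y i))"
    unfolding sum_distrib_left by (simp add: mult_ac)
  finally show ?thesis
    using z sin_diff_nonzero[OF p, of y x] x by (simp add: arc_zeros_def)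
qed

text \<open>Three zeros in one arc: the second divided difference vanishes, taken in a form that is symmetric in the poles.\<close>
lemma three_zeros_identity:
  fixes p :: nat
  assumes p: "p > 2" and z: "x \<in> arc_zeros p K" "y \<in> arc_zeros p K" "z \<in> arc_zeros p K" "x \<noteq> y" "x \<noteq> z" "y \<noteq> z"
  shows "(\<Sum>i\<in>{- int (p div 2)..int (p div 2)}. legendre_symbol p (K - i) *
     (cos (pi * (of_int i + 1 / 2) / p) / (sin (pi * (x + of_int i) / p) * sin (pi * (y + of_int i) / p) * sin (pi * (z + of_int i) / p)))) = 0"
proof -
  let ?s = "\<lambda>x i. sin (pi * (x + of_int i) / p)"
  have x: "0 < x" "x < 1" "0 < y" "y < 1" "0 < z" "z < 1" using z by (auto simp: arc_zeros_def)
  define u where "u x = pi * (x - 1 / 2) / p" for x :: real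
  have ud: "sin (u a - u b) \<noteq> 0" if "0 < a" "a < 1" "0 < b" "b < 1" "a \<noteq> b" for a b
  proof -
    have "u a - u b = pi * a / p - pi * b / p"
      unfolding u_def diff_divide_distrib[symmetric] right_diff_distrib[symmetric] by simp
    then show ?thesis using sin_diff_nonzero[OF p that] by simp
  qed
  have ua: "u a + pi * (of_int i + 1 / 2) / p = pi * (a + of_int i) / p" for a and i :: int
    unfolding u_def add_divide_distrib[symmetric] distrib_left[symmetric] by simp
  define A B C where "A = cos (u x) / (sin (u y - u x) * sin (u z - u x))"
    and "B = cos (u y) / (sin (u x - u y) * sin (u z - u y))"
    and "C = cos (u z) / (sin (u x - u z) * sin (u y - u z))"
  have "A * cot (pi * (x + of_int i) / p) + B * cot (pi * (y + of_int i) / p) + C * cot (pi * (z + of_int i) / p)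
      = cos (pi * (of_int i + 1 / 2) / p) / (?s x i * ?s y i * ?s z i)" for i :: int
    using cot_divided_difference3[of "u x" "pi * (of_int i + 1 / 2) / p" "u y" "u z"]
      ud[of x y] ud[of x z] ud[of y z] sin_arc_nonzero[OF p] x z(4-6)
    by (simp add: ua A_def B_def C_def)
  then have "(\<Sum>i\<in>{- int (p div 2)..int (p div 2)}. legendre_symbol p (K - i) *
     (cos (pi * (of_int i + 1 / 2) / p) / (?s x i * ?s y i * ?s z i)))
    = (\<Sum>i\<in>{- int (p div 2)..int (p div 2)}. legendre_symbol p (K - i) *
     (A * cot (pi * (x + of_int i) / p) + B * cot (pi * (y + of_int i) / p) + C * cot (pi * (z + of_int i) / p)))"
    by simp
  also have "\<dots> = A * cot_sum p K x + B * cot_sum p K y + C * cot_sum p K z"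
    unfolding cot_sum_def by (simp add: sum_distrib_left sum.distrib algebra_simps)
  also have "\<dots> = 0" using z by (simp add: arc_zeros_def)
  finally show ?thesis .
qed

lemma sum_gap_inverse_squares:
  assumes "m \<ge> (0::int)"
  shows "(\<Sum>i\<in>{-m..m} - {-2,-1,0,1}. 1 / (of_int (gap i))\<^sup>2) \<le> (4 / 3 :: real)"
proof -
  have half: "(\<Sum>j\<in>{2..m}. 1 / (of_int j)\<^sup>2) \<le> (2 / 3 :: real)"
  proof -
    have "(\<Sum>j\<in>{2..m}. 1 / (of_int j)\<^sup>2) = (\<Sum>j=2..nat m. 1 / (real j)\<^sup>2)"
      by (rule sum.reindex_bij_witness[of _ int nat]) auto
    also have "\<dots> \<le> 1 / (real 2 - 1 / 2)" by (rule sum_inverse_squares) simp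
    finally show ?thesis by simp
  qed
  have "{-m..m} - {-2,-1,0,1} \<subseteq> {2..m} \<union> {-m-1..-3}" by auto
  then have "(\<Sum>i\<in>{-m..m} - {-2,-1,0,1}. 1 / (of_int (gap i))\<^sup>2) \<le> (\<Sum>i\<in>{2..m} \<union> {-m-1..-3}. 1 / (of_int (gap i))\<^sup>2 :: real)"
    by (intro sum_mono2) auto
  also have "\<dots> = (\<Sum>i\<in>{2..m}. 1 / (of_int (gap i))\<^sup>2) + (\<Sum>i\<in>{-m-1..-3}. 1 / (of_int (gap i))\<^sup>2)"
    by (intro sum.union_disjoint) auto
  also have "(\<Sum>i\<in>{2..m}. 1 / (of_int (gap i))\<^sup>2) = (\<Sum>j\<in>{2..m}. 1 / (of_int j)\<^sup>2 :: real)"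
    by (intro sum.cong) (auto simp: gap_def)
  also have "(\<Sum>i\<in>{-m-1..-3}. 1 / (of_int (gap i))\<^sup>2) = (\<Sum>j\<in>{2..m}. 1 / (of_int j)\<^sup>2 :: real)"
    by (rule sum.reindex_bij_witness[of _ "\<lambda>j. - 1 - j" "\<lambda>i. - 1 - i"]) (auto simp: gap_def)
  finally show ?thesis using half by simp
qed

lemma inverse_products_lower:
  fixes P Q c :: real
  assumes "P > 0" "Q > 0" "c > 0" "P * Q * c\<^sup>2 \<le> 1"
  shows "2 * c \<le> 1 / P + 1 / Q"
proof (rule power2_le_imp_le)
  have "(2 * c)\<^sup>2 * (P * Q) \<le> 4" using assms by (simp add: power2_eq_square mult_ac)
  then have "(2 * c)\<^sup>2 \<le> 4 / (P * Q)" using assms by (simp add: field_simps)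
  also have "4 / (P * Q) \<le> (1 / P + 1 / Q)\<^sup>2"
  proof -
    have "(1 / P + 1 / Q)\<^sup>2 - 4 / (P * Q) = (1 / P - 1 / Q)\<^sup>2"
      using assms by (simp add: power2_eq_square field_simps)
    then show ?thesis using zero_le_power2[of "1 / P - 1 / Q"] by linarith
  qed
  finally show "(2 * c)\<^sup>2 \<le> (1 / P + 1 / Q)\<^sup>2" .
  show "0 \<le> 1 / P + 1 / Q" using assms by simp
qed

lemma x_one_minus_x_le: "x * (1 - x) \<le> (1 / 4 :: real)"
  using zero_le_power2[of "x - 1 / 2"] by (simp add: power2_eq_square algebra_simps)

lemma gap_cases:
  "i \<in> {-m..m} - {-1,0} \<Longrightarrow> gap i \<ge> 1" by (auto simp: gap_def)

lemma abs_legendre_quotient_le: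
  "\<bar>u\<bar> \<le> (1::real) \<Longrightarrow> 0 < d \<Longrightarrow> d \<le> \<bar>v\<bar> \<Longrightarrow> \<bar>u / v\<bar> \<le> 1 / d"
  by (auto simp: abs_divide intro!: frac_le)

lemma abs_legendre_quotient2_le:
  assumes "\<bar>u\<bar> \<le> (1::real)" "0 < a" "a \<le> \<bar>v\<bar>" "0 < b" "b \<le> \<bar>w\<bar>"
  shows "\<bar>u / (v * w)\<bar> \<le> 1 / (a * b)"
  using assms unfolding abs_mult[of v w, symmetric]
  by (intro abs_legendre_quotient_le) (auto simp: abs_mult intro!: mult_mono)

lemma split_main_terms:
  fixes f :: "int \<Rightarrow> real"
  assumes "m \<ge> 1"
  shows "(\<Sum>i\<in>{-m..m}. f i) = f 0 + f (-1) + (\<Sum>i\<in>{-m..m} - {-1, 0}. f i)"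
proof -
  have "(\<Sum>i\<in>{-m..m}. f i) = (\<Sum>i\<in>{-1,0}. f i) + (\<Sum>i\<in>{-m..m} - {-1, 0}. f i)"
    using assms by (subst add.commute, intro sum.subset_diff) auto
  then show ?thesis by simp
qed

text \<open>The arcs at whose two ends the Legendre symbol does not vanish. The lower bound on $p$ leaves room for the numerical
  estimates.\<close>
locale arc =
  fixes p :: nat and K :: int
  assumes p: "prime p" "p \<ge> 11" and K: "\<not> int p dvd K" "\<not> int p dvd K + 1"
begin

abbreviation "m \<equiv> int (p div 2)"
abbreviation "s x i \<equiv> sin (pi * (x + of_int i) / p)"
abbreviation "c i \<equiv> legendre_symbol p (K - i)"

lemma pos: "odd p" "real p > 0" "p > 2" "m \<ge> 5"
  using p prime_odd_nat[of p] by auto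

lemma s_lower: "0 < x \<Longrightarrow> x < 1 \<Longrightarrow> i \<in> {-m..m} \<Longrightarrow> 2 * of_int (gap i) / p \<le> \<bar>s x i\<bar>"
  using abs_sin_arc_lower[OF pos(1)] by blast

lemma s0: "0 < x \<Longrightarrow> x < 1 \<Longrightarrow> 0 < s x 0 \<and> s x 0 \<le> pi * x / p"
  using pos sin_x_le_x[of "pi * x / p"] p
  by (auto intro!: sin_gt_zero simp: field_simps)

lemma s_neg1: "s x (-1) = - s (1 - x) 0"
proof -
  have "pi * (x + of_int (-1)) / p = - (pi * (1 - x + of_int 0) / p)"
    by (simp add: minus_divide_left right_diff_distrib)
  then show ?thesis by (simp only: sin_minus)
qed

lemma c_abs: "\<bar>c 0\<bar> = 1" "\<bar>c (-1)\<bar> = 1" "\<bar>c i\<bar> \<le> 1"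
  using legendre_symbol_abs[OF K(1)] legendre_symbol_abs[OF K(2)] legendre_symbol_abs_le by auto

lemma arc_zerosD: "x \<in> arc_zeros p K \<Longrightarrow> 0 < x \<and> x < 1" by (simp add: arc_zeros_def)

lemma fin: "finite (arc_zeros p K)" using card_unit_circle_zeros(2)[OF p(1) pos(3)] .

text \<open>Equal signs at both ends: in the two-zero identity the two nearest poles contribute with equal
  signs at least $8 p^2/\pi^2$, all others together less than that.\<close>
lemma card_arc_zeros_le_1:
  assumes same: "c 0 = c (-1)"
  shows "card (arc_zeros p K) \<le> 1"
proof (rule ccontr)
  assume "\<not> ?thesis"
  then have "\<exists>x\<in>arc_zeros p K. \<exists>y\<in>arc_zeros p K. x \<noteq> y"
    using card_le_Suc0_iff_eq[OF fin] by auto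
  then obtain x y where z: "x \<in> arc_zeros p K" "y \<in> arc_zeros p K" "x \<noteq> y" by blast
  have x: "0 < x" "x < 1" "0 < y" "y < 1" using z arc_zerosD by auto
  let ?f = "\<lambda>i. c i / (s x i * s y i)"
  have eq: "?f 0 + ?f (-1) + (\<Sum>i\<in>{-m..m} - {-1, 0}. ?f i) = 0"
    using two_zeros_identity[OF pos(3) z] split_main_terms[of m ?f] pos by simp
  have x1: "0 < 1 - x" "1 - x < 1" "0 < 1 - y" "1 - y < 1" using x by auto
  have lo: "p\<^sup>2 / pi\<^sup>2 * (1 / (u * v)) \<le> 1 / (s u 0 * s v 0)" if "0 < u" "u < 1" "0 < v" "v < 1" for u v
  proof -
    have "s u 0 * s v 0 \<le> (pi * u / p) * (pi * v / p)" using s0[of u] s0[of v] that by (intro mult_mono) auto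
    moreover have "s u 0 * s v 0 > 0" using s0[of u] s0[of v] that by simp
    ultimately have "1 / ((pi * u / p) * (pi * v / p)) \<le> 1 / (s u 0 * s v 0)" by (intro frac_le) auto
    then show ?thesis using pos that by (simp add: power2_eq_square field_simps)
  qed
  have "8 \<le> 1 / (x * y) + 1 / ((1 - x) * (1 - y))"
  proof -
    have "(x * (1 - x)) * (y * (1 - y)) \<le> 1 / 4 * (1 / 4)"
      using x by (intro mult_mono x_one_minus_x_le) auto
    then have "x * y * ((1 - x) * (1 - y)) * 4\<^sup>2 \<le> 1" by (simp add: mult_ac)
    then show ?thesis using inverse_products_lower[of "x * y" "(1 - x) * (1 - y)" 4] x by simp
  qed
  then have "p\<^sup>2 / pi\<^sup>2 * 8 \<le> p\<^sup>2 / pi\<^sup>2 * (1 / (x * y) + 1 / ((1 - x) * (1 - y)))"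
    by (intro mult_left_mono) auto
  also have "\<dots> \<le> 1 / (s x 0 * s y 0) + 1 / (s x (-1) * s y (-1))"
  proof -
    have "s x (-1) * s y (-1) = s (1 - x) 0 * s (1 - y) 0" by (simp only: s_neg1 minus_mult_minus)
    then show ?thesis
      using add_mono[OF lo[OF x] lo[OF x1]] by (simp only: distrib_left[of "p\<^sup>2 / pi\<^sup>2"])
  qed
  also have "\<dots> = \<bar>?f 0 + ?f (-1)\<bar>"
  proof -
    have "?f 0 + ?f (-1) = c 0 * (1 / (s x 0 * s y 0) + 1 / (s x (-1) * s y (-1)))"
      by (simp only: same[symmetric] distrib_left[of "c 0"] times_divide_eq_right mult_1_right)
    moreover have "1 / (s x 0 * s y 0) + 1 / (s x (-1) * s y (-1)) \<ge> 0"
      unfolding s_neg1 using s0 x x1 by (auto intro!: add_nonneg_nonneg simp: less_imp_le)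
    ultimately show ?thesis using c_abs(1) by (simp only: abs_mult abs_of_nonneg mult_1)
  qed
  also have "\<dots> \<le> \<bar>\<Sum>i\<in>{-m..m} - {-1, 0}. ?f i\<bar>" using eq by linarith
  also have "\<dots> \<le> (\<Sum>i\<in>{-m..m} - {-1, 0}. \<bar>?f i\<bar>)" by (rule sum_abs)
  also have "\<dots> = \<bar>?f 1\<bar> + \<bar>?f (-2)\<bar> + (\<Sum>i\<in>{-m..m} - {-2,-1,0,1}. \<bar>?f i\<bar>)"
  proof -
    have "{-m..m} - {-1, 0} = insert 1 (insert (-2) ({-m..m} - {-2,-1,0,1}))" using pos(4) by auto
    then show ?thesis by simp
  qed
  also have "\<dots> \<le> p\<^sup>2 / 4 * (1 / ((1 + x) * (1 + y))) + p\<^sup>2 / 4 * (1 / ((2 - x) * (2 - y)))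
      + p\<^sup>2 / 4 * (\<Sum>i\<in>{-m..m} - {-2,-1,0,1}. 1 / (of_int (gap i))\<^sup>2)"
  proof (intro add_mono)
    have j: "2 * w / p \<le> sin (pi * w / p)" if "0 \<le> w" "w \<le> 2" for w
      using jordan_sin[of "pi * w / p"] pi_fraction_le_half[of p w] that p(2) by (simp add: field_simps)
    have q: "1 / ((2 * a / p) * (2 * b / p)) = p\<^sup>2 / 4 * (1 / (a * b))" for a b
      by (simp add: power2_eq_square)
    have "\<bar>?f 1\<bar> \<le> 1 / ((2 * (1 + x) / p) * (2 * (1 + y) / p))"
      using order_trans[OF j[of "1 + x"] abs_ge_self] order_trans[OF j[of "1 + y"] abs_ge_self] x pos c_abs(3)
      by (intro abs_legendre_quotient2_le) (auto simp: add.commute)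
    then show "\<bar>?f 1\<bar> \<le> p\<^sup>2 / 4 * (1 / ((1 + x) * (1 + y)))" unfolding q .
    have neg: "s u (-2) = - sin (pi * (2 - u) / p)" for u
    proof -
      have "pi * (u + of_int (-2)) / p = - (pi * (2 - u) / p)" by (simp add: minus_divide_left right_diff_distrib)
      then show ?thesis by (simp only: sin_minus)
    qed
    have "\<bar>?f (-2)\<bar> \<le> 1 / ((2 * (2 - x) / p) * (2 * (2 - y) / p))"
      unfolding neg using order_trans[OF j[of "2 - x"] abs_ge_self] order_trans[OF j[of "2 - y"] abs_ge_self] x pos legendre_symbol_abs_le
      by (intro abs_legendre_quotient2_le) auto
    then show "\<bar>?f (-2)\<bar> \<le> p\<^sup>2 / 4 * (1 / ((2 - x) * (2 - y)))" unfolding q .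
    show "(\<Sum>i\<in>{-m..m} - {-2,-1,0,1}. \<bar>?f i\<bar>) \<le> p\<^sup>2 / 4 * (\<Sum>i\<in>{-m..m} - {-2,-1,0,1}. 1 / (of_int (gap i))\<^sup>2)"
      unfolding sum_distrib_left
    proof (intro sum_mono)
      fix i assume i: "i \<in> {-m..m} - {-2,-1,0,1}"
      then have g: "real_of_int (gap i) \<ge> 1" using gap_cases[of i m] by auto
      have "\<bar>?f i\<bar> \<le> 1 / ((2 * of_int (gap i) / p) * (2 * of_int (gap i) / p))"
        using s_lower[of x i] s_lower[of y i] x i g pos c_abs(3)
        by (intro abs_legendre_quotient2_le) auto
      then show "\<bar>?f i\<bar> \<le> p\<^sup>2 / 4 * (1 / (of_int (gap i))\<^sup>2)" by (simp add: power2_eq_square)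
    qed
  qed
  also have "\<dots> \<le> p\<^sup>2 / 4 * (5 / 4) + p\<^sup>2 / 4 * (4 / 3)"
  proof -
    have a: "1 / ((1 + x) * (1 + y)) \<le> (1 - x / 2) * (1 - y / 2)"
    proof -
      have "1 \<le> (1 + u) * (1 - u / 2)" if "0 < u" "u < 1" for u :: real
        using that mult_left_le[of u u] by (simp add: algebra_simps)
      from mult_mono[OF this this, of x y] have "1 \<le> ((1 + x) * (1 - x / 2)) * ((1 + y) * (1 - y / 2))" using x by simp
      then show ?thesis using x by (simp add: divide_le_eq mult_ac)
    qed
    have b: "1 / ((2 - x) * (2 - y)) \<le> (1 + x) / 2 * ((1 + y) / 2)"
    proof -
      have "1 \<le> (2 - u) * ((1 + u) / 2)" if "0 < u" "u < 1" for u :: real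
        using that mult_left_le[of u u] by (simp add: algebra_simps)
      from mult_mono[OF this this, of x y] have "1 \<le> ((2 - x) * ((1 + x) / 2)) * ((2 - y) * ((1 + y) / 2))" using x by simp
      then show ?thesis using x by (simp add: divide_le_eq mult_ac)
    qed
    have "x * y \<le> x" "x * y \<le> y" using x by (simp_all add: mult_left_le mult_left_le_one_le)
    moreover have "(1 - x / 2) * (1 - y / 2) + (1 + x) / 2 * ((1 + y) / 2) = 5 / 4 - x / 4 - y / 4 + x * y / 2"
      by (simp add: field_simps)
    ultimately have "(1 - x / 2) * (1 - y / 2) + (1 + x) / 2 * ((1 + y) / 2) \<le> 5 / 4" by linarith
    then have "1 / ((1 + x) * (1 + y)) + 1 / ((2 - x) * (2 - y)) \<le> 5 / 4" using a b by linarith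
    then have "p\<^sup>2 / 4 * (1 / ((1 + x) * (1 + y)) + 1 / ((2 - x) * (2 - y))) \<le> p\<^sup>2 / 4 * (5 / 4)"
      by (intro mult_left_mono) auto
    moreover have "p\<^sup>2 / 4 * (\<Sum>i\<in>{-m..m} - {-2,-1,0,1}. 1 / (of_int (gap i))\<^sup>2) \<le> p\<^sup>2 / 4 * (4 / 3)"
      using sum_gap_inverse_squares[of m] by (intro mult_left_mono) auto
    ultimately show ?thesis by (simp only: distrib_left)
  qed
  finally have "(real p)\<^sup>2 * (8 / pi\<^sup>2) \<le> (real p)\<^sup>2 * (31 / 48)" by simp
  then have "8 / pi\<^sup>2 \<le> 31 / 48" using pos by (simp only: mult_le_cancel_left_pos zero_less_power)
  moreover have "pi\<^sup>2 < 10" using pi_approx mult_strict_mono[of pi "3.15" pi "3.15"] by (simp add: power2_eq_square)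
  ultimately show False by (simp add: divide_le_eq)
qed

text \<open>Every sine is negative at the index $-1$, and the three of them in the three-zero identity make up for the opposite
  symbols: the two nearest poles again contribute with equal signs and outweigh all others.\<close>
lemma card_arc_zeros_le_2:
  assumes opp: "c 0 = - c (-1)"
  shows "card (arc_zeros p K) \<le> 2"
proof (rule ccontr)
  assume "\<not> ?thesis"
  then have "3 \<le> card (arc_zeros p K)" by simp
  then obtain Z where "Z \<subseteq> arc_zeros p K" "card Z = 3" by (metis obtain_subset_with_card_n)
  then obtain x y z where z: "x \<in> arc_zeros p K" "y \<in> arc_zeros p K" "z \<in> arc_zeros p K" "x \<noteq> y" "x \<noteq> z" "y \<noteq> z"
    by (auto simp: card_3_iff)
  have x: "0 < x" "x < 1" "0 < y" "y < 1" "0 < z" "z < 1" using z arc_zerosD by auto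
  have x1: "0 < 1 - x" "1 - x < 1" "0 < 1 - y" "1 - y < 1" "0 < 1 - z" "1 - z < 1" using x by auto
  let ?g = "\<lambda>i. cos (pi * (of_int i + 1 / 2) / p)"
  let ?f = "\<lambda>i. c i * (?g i / (s x i * s y i * s z i))"
  define \<gamma> where "\<gamma> = ?g 0"
  have \<gamma>': "?g (-1) = \<gamma>"
  proof -
    have "pi * (of_int (-1) + 1 / 2) / p = - (pi * (of_int 0 + 1 / 2) / p)" by simp
    then show ?thesis unfolding \<gamma>_def by (simp only: cos_minus)
  qed
  have \<gamma>: "\<gamma> \<ge> 9 / 10"
  proof -
    let ?u = "pi / (4 * p)"
    have "\<gamma> = cos (2 * ?u)" by (simp add: \<gamma>_def field_simps)
    also have "\<dots> = 1 - 2 * (sin ?u)\<^sup>2" by (rule cos_double_sin)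
    finally have \<gamma>: "\<gamma> = 1 - 2 * (sin ?u)\<^sup>2" .
    have "?u \<le> 1 / 10" using p pi_less_4 by (simp add: field_simps)
    moreover have u: "0 \<le> ?u" by simp
    moreover have "sin ?u \<le> ?u" using u by (rule sin_x_le_x)
    moreover have "0 \<le> sin ?u" using u \<open>?u \<le> 1 / 10\<close> pi_gt3 by (intro sin_ge_zero) auto
    ultimately have "(sin ?u)\<^sup>2 \<le> (1 / 10)\<^sup>2" by (intro power_mono) linarith+
    then show ?thesis unfolding \<gamma> by (simp add: power2_eq_square)
  qed
  have eq: "?f 0 + ?f (-1) + (\<Sum>i\<in>{-m..m} - {-1, 0}. ?f i) = 0"
    using three_zeros_identity[OF pos(3) z] split_main_terms[of m ?f] pos by simp
  have lo: "p ^ 3 / pi ^ 3 * (1 / (u * v * w)) \<le> 1 / (s u 0 * s v 0 * s w 0)"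
    if "0 < u" "u < 1" "0 < v" "v < 1" "0 < w" "w < 1" for u v w
  proof -
    have "s u 0 * s v 0 * s w 0 \<le> (pi * u / p) * (pi * v / p) * (pi * w / p)"
      using s0[of u] s0[of v] s0[of w] that by (intro mult_mono) auto
    moreover have "s u 0 * s v 0 * s w 0 > 0" using s0[of u] s0[of v] s0[of w] that by simp
    ultimately have "1 / ((pi * u / p) * (pi * v / p) * (pi * w / p)) \<le> 1 / (s u 0 * s v 0 * s w 0)" by (intro frac_le) auto
    then show ?thesis using pos that by (simp add: power3_eq_cube field_simps)
  qed
  have "16 \<le> 1 / (x * y * z) + 1 / ((1 - x) * (1 - y) * (1 - z))"
  proof -
    have "(x * (1 - x)) * (y * (1 - y)) * (z * (1 - z)) \<le> 1 / 4 * (1 / 4) * (1 / 4)"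
      using x by (intro mult_mono x_one_minus_x_le) auto
    then have "x * y * z * ((1 - x) * (1 - y) * (1 - z)) * 8\<^sup>2 \<le> 1" by (simp add: mult_ac)
    then show ?thesis using inverse_products_lower[of "x * y * z" "(1 - x) * (1 - y) * (1 - z)" 8] x by simp
  qed
  then have "p ^ 3 / pi ^ 3 * 16 \<le> p ^ 3 / pi ^ 3 * (1 / (x * y * z) + 1 / ((1 - x) * (1 - y) * (1 - z)))"
    by (intro mult_left_mono) auto
  also have "\<dots> \<le> 1 / (s x 0 * s y 0 * s z 0) - 1 / (s x (-1) * s y (-1) * s z (-1))"
  proof -
    have "s x (-1) * s y (-1) * s z (-1) = - (s (1 - x) 0 * s (1 - y) 0 * s (1 - z) 0)"
      by (simp only: s_neg1 mult_minus_left mult_minus_right minus_minus)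
    then show ?thesis
      using add_mono[OF lo[OF x] lo[OF x1]]
      by (simp only: distrib_left[of "p ^ 3 / pi ^ 3"] divide_minus_right diff_minus_eq_add)
  qed
  finally have L: "p ^ 3 / pi ^ 3 * 16 \<le> 1 / (s x 0 * s y 0 * s z 0) - 1 / (s x (-1) * s y (-1) * s z (-1))" .
  have "9 / 10 * (p ^ 3 / pi ^ 3 * 16) \<le> \<gamma> * (1 / (s x 0 * s y 0 * s z 0) - 1 / (s x (-1) * s y (-1) * s z (-1)))"
    using \<gamma> L by (intro mult_mono) auto
  also have "\<dots> = c 0 * (c 0 * (\<gamma> * (1 / (s x 0 * s y 0 * s z 0) - 1 / (s x (-1) * s y (-1) * s z (-1)))))"
    using c_abs(1) by (auto simp: abs_if split: if_splits)
  also have "c 0 * (\<gamma> * (1 / (s x 0 * s y 0 * s z 0) - 1 / (s x (-1) * s y (-1) * s z (-1)))) = ?f 0 + ?f (-1)"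
    unfolding \<gamma>' unfolding \<gamma>_def[symmetric] using opp by (simp add: algebra_simps)
  also have "c 0 * (?f 0 + ?f (-1)) \<le> \<bar>c 0 * (?f 0 + ?f (-1))\<bar>" by (rule abs_ge_self)
  also have "\<dots> = \<bar>?f 0 + ?f (-1)\<bar>" using c_abs(1) by (simp only: abs_mult mult_1)
  also have "\<dots> \<le> \<bar>\<Sum>i\<in>{-m..m} - {-1, 0}. ?f i\<bar>" using eq by linarith
  also have "\<dots> \<le> (\<Sum>i\<in>{-m..m} - {-1, 0}. \<bar>?f i\<bar>)" by (rule sum_abs)
  also have "\<dots> \<le> (\<Sum>i\<in>{-m..m} - {-1, 0}. p ^ 3 / 8 * (1 / (of_int (gap i))\<^sup>2))"
  proof (intro sum_mono)
    fix i assume i: "i \<in> {-m..m} - {-1,0}"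
    then have g: "real_of_int (gap i) \<ge> 1" using gap_cases[of i m] by auto
    let ?t = "2 * of_int (gap i) / real p"
    have "\<bar>?f i\<bar> = \<bar>(c i * ?g i) / (s x i * s y i * s z i)\<bar>" by simp
    also have "\<dots> \<le> 1 / (?t * ?t * ?t)"
    proof (rule abs_legendre_quotient_le)
      show "\<bar>c i * ?g i\<bar> \<le> 1" using c_abs(3)[of i] unfolding abs_mult by (intro mult_le_one) auto
      show "0 < ?t * ?t * ?t" using g pos by simp
      show "?t * ?t * ?t \<le> \<bar>s x i * s y i * s z i\<bar>"
        unfolding abs_mult using s_lower[of x i] s_lower[of y i] s_lower[of z i] x i g pos
        by (intro mult_mono) auto
    qed
    also have "\<dots> = p ^ 3 / 8 * (1 / (of_int (gap i))\<^sup>2 * (1 / of_int (gap i)))"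
      by (simp add: power2_eq_square power3_eq_cube)
    also have "\<dots> \<le> p ^ 3 / 8 * (1 / (of_int (gap i))\<^sup>2 * 1)"
      using g by (intro mult_left_mono) auto
    finally show "\<bar>?f i\<bar> \<le> p ^ 3 / 8 * (1 / (of_int (gap i))\<^sup>2)" by simp
  qed
  also have "\<dots> = p ^ 3 / 8 * (\<Sum>i\<in>{-m..m} - {-1, 0}. 1 / (of_int (gap i))\<^sup>2)" by (simp only: sum_distrib_left)
  also have "(\<Sum>i\<in>{-m..m} - {-1, 0}. 1 / (of_int (gap i))\<^sup>2 :: real) = 2 + (\<Sum>i\<in>{-m..m} - {-2,-1,0,1}. 1 / (of_int (gap i))\<^sup>2)"
  proof -
    have "{-m..m} - {-1, 0} = insert 1 (insert (-2) ({-m..m} - {-2,-1,0,1}))" using pos(4) by auto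
    then show ?thesis by (simp add: gap_def)
  qed
  also have "p ^ 3 / 8 * \<dots> \<le> p ^ 3 / 8 * (2 + 4 / 3)"
    using sum_gap_inverse_squares[of m] by (intro mult_left_mono) auto
  finally have "(real p) ^ 3 * (144 / 10 / pi ^ 3) \<le> (real p) ^ 3 * (5 / 12)" by simp
  then have "144 / 10 / pi ^ 3 \<le> 5 / 12" using pos by (simp only: mult_le_cancel_left_pos zero_less_power)
  moreover have "pi ^ 3 < 34" using pi_approx mult_strict_mono[of pi "3.15" "pi * pi" "3.15 * 3.15"] mult_strict_mono[of pi "3.15" pi "3.15"]
    by (simp add: power3_eq_cube)
  ultimately show False by (simp add: divide_le_eq)
qed

end

section \<open>The exact number of zeros on an arc\<close>

lemma cot_upper: "0 < u \<Longrightarrow> u \<le> pi / 2 \<Longrightarrow> cot u \<le> 1 / (u :: real)"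
  using x_cos_le_sin[of u] sin_gt_zero[of u] by (simp add: cot_def field_simps)

lemma cot_lower: "0 < u \<Longrightarrow> u \<le> 1 \<Longrightarrow> 1 / u - 1 \<le> cot (u :: real)"
  using abs_cot_minus_inverse[of u] by simp

context arc begin

lemma cot_bound:
  assumes x: "0 < x" "x < 1" and i: "i \<in> {-m..m} - {-1, 0}"
  shows "\<bar>cot (pi * (x + of_int i) / p)\<bar> \<le> p"
proof -
  have "gap i \<ge> 1" using i gap_cases by blast
  then have g: "real_of_int (gap i) \<ge> 1" by simp
  have "1 / p \<le> 2 * of_int (gap i) / p" using g pos by (intro divide_right_mono) auto
  also have "\<dots> \<le> \<bar>s x i\<bar>" using s_lower[OF x] i by simp
  finally have "1 / p \<le> \<bar>s x i\<bar>" .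
  then have "\<bar>cos (pi * (x + of_int i) / p) / s x i\<bar> \<le> 1 / (1 / p)"
    using pos by (intro abs_legendre_quotient_le) auto
  then show ?thesis by (simp add: cot_def)
qed

lemma cot_sum_ends:
  assumes x: "0 < x" "x < 1"
  shows "\<bar>cot_sum p K x - (c 0 * cot (pi * x / p) - c (-1) * cot (pi * (1 - x) / p))\<bar> \<le> p\<^sup>2"
proof -
  let ?f = "\<lambda>i. c i * cot (pi * (x + of_int i) / p)"
  have "cot (pi * (x + of_int (-1)) / p) = - cot (pi * (1 - x) / p)"
  proof -
    have "pi * (x + of_int (-1)) / p = - (pi * (1 - x) / p)" by (simp add: minus_divide_left right_diff_distrib)
    then show ?thesis by (simp only: cot_minus)
  qed
  then have "cot_sum p K x - (c 0 * cot (pi * x / p) - c (-1) * cot (pi * (1 - x) / p)) = (\<Sum>i\<in>{-m..m} - {-1, 0}. ?f i)"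
    using split_main_terms[of m ?f] pos by (simp add: cot_sum_def)
  also have "\<bar>\<dots>\<bar> \<le> (\<Sum>i\<in>{-m..m} - {-1, 0}. \<bar>?f i\<bar>)" by (rule sum_abs)
  also have "\<dots> \<le> (\<Sum>i\<in>{-m..m} - {-1, 0}. real p)"
  proof -
    have "\<bar>?f i\<bar> \<le> 1 * real p" if "i \<in> {-m..m} - {-1, 0}" for i
      unfolding abs_mult using cot_bound[OF x that] c_abs(3) by (intro mult_mono) auto
    then show ?thesis using sum_mono[of "{-m..m} - {-1, 0}" "\<lambda>i. \<bar>?f i\<bar>" "\<lambda>_. real p"] by simp
  qed
  also have "\<dots> \<le> (\<Sum>i\<in>{-m..m}. real p)" by (intro sum_mono2) auto
  also have "\<dots> = (real p)\<^sup>2"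
  proof -
    have "nat (m + 1 + m) = p" using pos(1) by (auto elim!: oddE)
    then show ?thesis by (simp add: power2_eq_square)
  qed
  finally show ?thesis by simp
qed

text \<open>The pole at the end dominates any fixed bound, uniformly in the coefficients; the reflection $x \mapsto 1 - x$
  gives the other end.\<close>
lemma near_ends:
  assumes e: "0 < e" "e \<le> 1 / 2"
  obtains x where "0 < x" "x < e"
    "\<And>a b. \<bar>a\<bar> = 1 \<Longrightarrow> \<bar>b\<bar> \<le> 1 \<Longrightarrow> a * (a * cot (pi * x / p) - b * cot (pi * (1 - x) / p)) > p\<^sup>2"
proof -
  define M where "M = (real p)\<^sup>2 + p + 2 + p / (pi * e)"
  define x where "x = p / (pi * M)"
  have M: "M > 0" "M \<ge> p" using pos e by (auto simp: M_def intro!: add_nonneg_pos add_nonneg_nonneg)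
  have x0: "0 < x" using M pos by (simp add: x_def)
  have "p / (pi * e) < M" using pos by (simp add: M_def add_nonneg_pos)
  then have "x < e" using M e by (simp add: x_def field_simps)
  have "1 / (pi * x / p) = M" using M pos by (simp add: x_def)
  moreover have "pi * x / p \<le> 1" using M pos by (simp add: x_def)
  ultimately have c1: "M - 1 \<le> cot (pi * x / p)" using cot_lower[of "pi * x / p"] x0 pos by simp
  have h: "1 / 2 < 1 - x" "1 - x < 1" using \<open>x < e\<close> e x0 by auto
  have b: "pi * (1 - x) / p \<le> pi / 2" using h p by (intro pi_fraction_le_half) auto
  have pp: "pi * (1 - x) / p > 0" using h pos by simp
  have c2: "0 \<le> cot (pi * (1 - x) / p)"
  proof (cases "pi * (1 - x) / p = pi / 2")
    case True
    show ?thesis unfolding True by (simp add: cot_def)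
  qed (use b pp cot_gt_zero[of "pi * (1 - x) / p"] in auto)
  have c3: "cot (pi * (1 - x) / p) \<le> p"
  proof -
    have "cot (pi * (1 - x) / p) \<le> 1 / (pi * (1 - x) / p)" using b pp by (rule cot_upper[rotated])
    also have "\<dots> = p / (pi * (1 - x))" by simp
    also have "\<dots> \<le> p / 1" using pi_gt3 h mult_mono[of 2 pi "1/2" "1 - x"] pos by (intro divide_left_mono) auto
    finally show ?thesis by simp
  qed
  have "p\<^sup>2 < a * (a * cot (pi * x / p) - b * cot (pi * (1 - x) / p))" if ab: "\<bar>a\<bar> = 1" "\<bar>b\<bar> \<le> 1" for a b :: real
  proof -
    have "\<bar>(a * b) * cot (pi * (1 - x) / p)\<bar> \<le> 1 * real p"
      unfolding abs_mult using ab c2 c3 by (intro mult_mono) auto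
    moreover have "a * a = 1" using ab(1) by (auto simp: abs_if split: if_splits)
    then have "a * (a * cot (pi * x / p) - b * cot (pi * (1 - x) / p)) = cot (pi * x / p) - (a * b) * cot (pi * (1 - x) / p)"
      by (simp add: right_diff_distrib flip: mult.assoc)
    moreover have "real p ^ 2 + real p < M - 1" using pos e by (simp add: M_def add_pos_pos)
    ultimately show ?thesis using c1 by (simp add: abs_le_iff)
  qed
  then show ?thesis using that[OF x0 \<open>x < e\<close>] by simp
qed

lemma cot_sum_near_0:
  assumes e: "0 < e" "e \<le> 1 / 2"
  obtains x where "0 < x" "x < e" "c 0 * cot_sum p K x > 0"
proof -
  obtain x where x: "0 < x" "x < e" and *: "\<And>a b. \<bar>a\<bar> = 1 \<Longrightarrow> \<bar>b\<bar> \<le> 1 \<Longrightarrow> a * (a * cot (pi * x / p) - b * cot (pi * (1 - x) / p)) > p\<^sup>2"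
    using near_ends[OF e] by metis
  define H where "H = c 0 * cot (pi * x / p) - c (-1) * cot (pi * (1 - x) / p)"
  have "\<bar>cot_sum p K x - H\<bar> \<le> p\<^sup>2" unfolding H_def using x e by (intro cot_sum_ends) auto
  moreover have "c 0 * H > p\<^sup>2" unfolding H_def using c_abs by (intro *) auto
  ultimately have "c 0 * cot_sum p K x > 0" using c_abs(1) by (cases "c 0 = 1") (auto simp: abs_if split: if_splits)
  then show ?thesis using that x by blast
qed

lemma cot_sum_near_1:
  assumes e: "0 < e" "e \<le> 1 / 2"
  obtains x where "1 - e < x" "x < 1" "- c (-1) * cot_sum p K x > 0"
proof -
  obtain x where x: "0 < x" "x < e" and *: "\<And>a b. \<bar>a\<bar> = 1 \<Longrightarrow> \<bar>b\<bar> \<le> 1 \<Longrightarrow> a * (a * cot (pi * x / p) - b * cot (pi * (1 - x) / p)) > p\<^sup>2"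
    using near_ends[OF e] by metis
  define H where "H = c 0 * cot (pi * (1 - x) / p) - c (-1) * cot (pi * (1 - (1 - x)) / p)"
  have "\<bar>cot_sum p K (1 - x) - H\<bar> \<le> p\<^sup>2" unfolding H_def using x e by (intro cot_sum_ends) auto
  moreover have "- c (-1) * H > p\<^sup>2"
    using *[of "- c (-1)" "- c 0"] c_abs(2) c_abs(3)[of 0] by (simp add: H_def algebra_simps)
  ultimately have "- c (-1) * cot_sum p K (1 - x) > 0"
    using c_abs(2) by (cases "c (-1) = 1") (auto simp: abs_if split: if_splits)
  then show ?thesis using that[of "1 - x"] x by simp
qed

lemma cot_sum_continuous: "continuous_on {0<..<1} (cot_sum p K)"
proof -
  have "cot_sum p K = (\<lambda>x. \<Sum>i\<in>{-m..m}. c i * (cos (pi * (x + of_int i) / p) / s x i))"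
    by (simp add: fun_eq_iff cot_sum_def cot_def)
  moreover have "continuous_on {0<..<1} \<dots>"
    using sin_arc_nonzero[OF pos(3)] pos(2) by (intro continuous_intros) auto
  ultimately show ?thesis by (simp only:)
qed

lemma zero_between:
  assumes u: "0 < u" "u < v" "v < 1" and sgn: "cot_sum p K u * cot_sum p K v < 0"
  obtains z where "u < z" "z < v" "z \<in> arc_zeros p K"
proof -
  have cont: "continuous_on {u..v} (cot_sum p K)"
    by (rule continuous_on_subset[OF cot_sum_continuous]) (use u in auto)
  have "\<exists>z. u \<le> z \<and> z \<le> v \<and> cot_sum p K z = 0"
  proof (cases "cot_sum p K u < 0")
    case True
    then have "cot_sum p K v > 0" using sgn by (simp add: mult_less_0_iff)
    then show ?thesis using IVT'[of "cot_sum p K" u 0 v] True u cont by auto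
  next
    case False
    then have "cot_sum p K u > 0" "cot_sum p K v < 0" using sgn by (auto simp: mult_less_0_iff)
    then show ?thesis using IVT2'[of "cot_sum p K" v 0 u] u cont by auto
  qed
  then obtain z where z: "u \<le> z" "z \<le> v" "cot_sum p K z = 0" by blast
  moreover have "z \<noteq> u" "z \<noteq> v" using z sgn by auto
  ultimately show ?thesis using that[of z] u by (auto simp: arc_zeros_def)
qed

text \<open>With equal symbols at the ends the sum runs from one infinity to the other.\<close>
lemma card_arc_zeros_same:
  assumes same: "c 0 = c (-1)"
  shows "card (arc_zeros p K) = 1"
proof -
  obtain x where x: "0 < x" "x < 1 / 2" "c 0 * cot_sum p K x > 0" using cot_sum_near_0[of "1 / 2"] by auto
  obtain y where y: "1 / 2 < y" "y < 1" "- c (-1) * cot_sum p K y > 0" using cot_sum_near_1[of "1 / 2"] by auto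
  have "cot_sum p K x * cot_sum p K y < 0"
    using x(3) y(3) c_abs(1) unfolding same by (cases "c (-1) = 1") (auto simp: abs_if mult_less_0_iff split: if_splits)
  then obtain z where "z \<in> arc_zeros p K" using zero_between[of x y] x y by auto
  then have "card (arc_zeros p K) \<noteq> 0" using fin by auto
  then show ?thesis using card_arc_zeros_le_1[OF same] by simp
qed

text \<open>With opposite symbols the sum tends to the same infinity at both ends, so one sign change inside the arc
  forces a second one.\<close>
lemma card_arc_zeros_opposite:
  assumes opp: "c 0 = - c (-1)"
  shows "0 < y \<Longrightarrow> y < 1 \<Longrightarrow> c 0 * cot_sum p K y < 0 \<Longrightarrow> card (arc_zeros p K) = 2"
    and "(\<And>y. 0 < y \<Longrightarrow> y < 1 \<Longrightarrow> c 0 * cot_sum p K y > 0) \<Longrightarrow> card (arc_zeros p K) = 0"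
proof -
  assume y: "0 < y" "y < 1" "c 0 * cot_sum p K y < 0"
  define e where "e = min y (1 - y) / 2"
  have e: "0 < e" "e \<le> 1 / 2" "e < y" "e < 1 - y" using y by (auto simp: e_def)
  obtain u where u: "0 < u" "u < e" "c 0 * cot_sum p K u > 0" using cot_sum_near_0[OF e(1,2)] by auto
  obtain v where v: "1 - e < v" "v < 1" "- c (-1) * cot_sum p K v > 0" using cot_sum_near_1[OF e(1,2)] by auto
  have "cot_sum p K u * cot_sum p K y < 0" "cot_sum p K y * cot_sum p K v < 0"
    using y(3) u(3) v(3) c_abs(1) unfolding opp
    by (cases "c (-1) = 1"; auto simp: abs_if mult_less_0_iff split: if_splits)+
  then obtain z w where zw: "z < y" "z \<in> arc_zeros p K" "y < w" "w \<in> arc_zeros p K"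
    using zero_between[of u y] zero_between[of y v] u v e y by (metis less_trans diff_less_eq add.commute less_diff_eq)
  then have "card {z, w} \<le> card (arc_zeros p K)" by (intro card_mono fin) auto
  moreover have "card {z, w} = 2" using zw by simp
  ultimately show "card (arc_zeros p K) = 2" using card_arc_zeros_le_2[OF opp] by simp
next
  assume "\<And>y. 0 < y \<Longrightarrow> y < 1 \<Longrightarrow> c 0 * cot_sum p K y > 0"
  then have "arc_zeros p K = {}" by (force simp: arc_zeros_def)
  then show "card (arc_zeros p K) = 0" by simp
qed

end

section \<open>The two arcs at the point 1\<close>

lemma sum_inverse_cubes: "(\<Sum>j=2..m. 1 / (real j) ^ 3) \<le> 1 / 4"
proof -
  have "(\<Sum>j=2..m. 1 / (real j) ^ 3) \<le> 1 / 4 - 1 / (2 * (real m * (real m + 1)))" if "m \<ge> 2"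
    using that
  proof (induction m rule: dec_induct)
    case (step m)
    have "1 / (real (Suc m)) ^ 3 \<le> 1 / (2 * (real m * (real m + 1))) - 1 / (2 * (real (Suc m) * (real (Suc m) + 1)))"
    proof -
      have "1 / (2 * (real m * (real m + 1))) - 1 / (2 * (real (Suc m) * (real (Suc m) + 1)))
         = 1 / (real m * (real m + 1) * (real m + 2))"
        using step by (simp add: divide_simps) (simp add: algebra_simps)
      also have "\<dots> \<ge> 1 / (real (Suc m)) ^ 3"
      proof (rule divide_left_mono)
        show "real m * (real m + 1) * (real m + 2) \<le> real (Suc m) ^ 3" by (simp add: power3_eq_cube algebra_simps)
        have "real m > 0" using step by simp
        then show "0 < real (Suc m) ^ 3 * (real m * (real m + 1) * (real m + 2))" by (intro mult_pos_pos zero_less_power) auto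
      qed simp
      finally show ?thesis .
    qed
    then show ?case using step by simp
  qed simp
  moreover have "1 / (2 * (real m * (real m + 1))) \<ge> 0" by simp
  ultimately show ?thesis by (cases "m \<ge> 2") (linarith, simp)
qed

text \<open>On the arc at $1$ the poles at $\pm j$ are paired. In the variable $S = \sin^2(\pi x/p)$ each pair becomes
  a simple pole at $\sin^2(\pi j/p)$, and the nearest one outweighs the others in the divided difference.\<close>
lemma card_arc_zeros_0:
  assumes p: "prime p" "p \<ge> 11"
  shows "card (arc_zeros p 0) \<le> 1"
proof (rule ccontr)
  assume asm: "\<not> ?thesis"
  have p2: "p > 2" using p by simp
  have "odd p" using p prime_odd_nat[of p] by simp
  have fin: "finite (arc_zeros p 0)" by (rule card_unit_circle_zeros(2)[OF p(1) p2])
  obtain x y where z: "x \<in> arc_zeros p 0" "y \<in> arc_zeros p 0" "x \<noteq> y"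
    using asm card_le_Suc0_iff_eq[OF fin] by auto
  have x: "0 < x" "x < 1" "0 < y" "y < 1" using z by (auto simp: arc_zeros_def)
  define m where "m = p div 2"
  have pm: "real p = 2 * real m + 1" using \<open>odd p\<close> by (auto simp: m_def elim!: oddE)
  define \<sigma> where "\<sigma> = legendre_symbol p (- 1)"
  have \<sigma>: "\<sigma> = 1 \<or> \<sigma> = -1"
    using legendre_symbol_abs[of p "-1"] p by (auto simp: \<sigma>_def abs_if split: if_splits)
  define A where "A x = pi * x / p" for x :: real
  define B where "B j = pi * real j / p" for j :: nat
  define S where "S x = (sin (A x))\<^sup>2" for x
  define s where "s j = (sin (B j))\<^sup>2" for j
  \<comment> \<open>a pair adds up to a multiple of $\sin 2A$ or of $\sin 2B_j$, depending on the symbol of $-1$\<close>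
  define d where "d j = (if \<sigma> = 1 then 1 else sin (2 * B j))" for j
  define F where "F x = (if \<sigma> = 1 then sin (2 * A x) else 1)" for x
  have A: "0 < A u" "A u < B 1" if "0 < u" "u < 1" for u
    using that p by (auto simp: A_def B_def intro!: divide_strict_right_mono)
  have B_half: "B j < pi / 2" if "j \<le> m" for j
  proof -
    have "pi * real j < pi * (real p / 2)" using that pm by (intro mult_strict_left_mono) auto
    then show ?thesis using p by (simp add: B_def field_simps)
  qed
  have m1: "1 \<le> m" using p by (simp add: m_def)
  have B_mono: "B i \<le> B j" if "i \<le> j" for i j
    using that p by (auto simp: B_def intro!: divide_right_mono)
  have B_pos: "0 < B j" if "1 \<le> j" for j using that p by (simp add: B_def)
  have sinB: "0 < sin (B j)" if "1 \<le> j" "j \<le> m" for j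
    using B_pos[OF that(1)] B_half[OF that(2)] by (intro sin_gt_zero) auto
  have s1_le: "sin (B 1) \<le> sin (B j)" if "1 \<le> j" "j \<le> m" for j
    using B_mono[OF that(1)] B_half[OF that(2)] B_half[OF m1] B_pos[of 1] by (subst sin_mono_le_eq) auto
  have S_lt: "S u < s 1" "0 < sin (A u)" "sin (A u) < sin (B 1)" if "0 < u" "u < 1" for u
  proof -
    show 1: "0 < sin (A u)" using A[OF that] B_half[OF m1] by (intro sin_gt_zero) auto
    show 2: "sin (A u) < sin (B 1)" using A[OF that] B_half[OF m1] by (subst sin_mono_less_eq) auto
    show "S u < s 1" unfolding S_def s_def using 1 2 by (intro power_strict_mono) auto
  qed
  have s1_le_s: "s 1 \<le> s j" if "1 \<le> j" "j \<le> m" for j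
    unfolding s_def using s1_le[OF that] sinB[OF order_refl m1] by (intro power_mono) auto
  have s_pos: "s 1 > 0" unfolding s_def using sinB[OF order_refl m1] by simp
  have F0: "F u \<noteq> 0" if "0 < u" "u < 1" for u
    using A[OF that] B_half[OF m1] sin_gt_zero[of "2 * A u"] by (auto simp: F_def)
  have pair: "legendre_symbol p (0 - int j) * cot (pi * (u + of_int (int j)) / p)
      + legendre_symbol p (0 + int j) * cot (pi * (u - of_int (int j)) / p)
      = - F u * (legendre_symbol p (int j) * d j / (s j - S u))"
    if j: "1 \<le> j" "j \<le> m" and u: "0 < u" "u < 1" for j u
  proof -
    have e: "pi * (u + of_int (int j)) / p = A u + B j" "pi * (u - of_int (int j)) / p = A u - B j"
      by (simp_all add: A_def B_def algebra_simps add_divide_distrib diff_divide_distrib)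
    have l: "legendre_symbol p (0 - int j) = \<sigma> * legendre_symbol p (int j)"
      using legendre_symbol_mult[OF p(1) p2, of "-1" "int j"] by (simp add: \<sigma>_def)
    have AB: "A u < B j" "A u + B j < pi" using A[OF u] B_mono[OF j(1)] B_half[OF j(2)] by auto
    have sp: "sin (A u + B j) \<noteq> 0" "sin (A u - B j) \<noteq> 0"
      using sin_gt_zero[of "A u + B j"] sin_gt_zero[of "B j - A u"] AB A[OF u] B_pos[OF j(1)]
        sin_minus[of "A u - B j"] by auto
    have prod: "sin (A u + B j) * sin (A u - B j) = S u - s j"
    proof -
      have "(sin (A u) * cos (B j) + cos (A u) * sin (B j)) * (sin (A u) * cos (B j) - cos (A u) * sin (B j))
        = (sin (A u))\<^sup>2 * (cos (B j))\<^sup>2 - (cos (A u))\<^sup>2 * (sin (B j))\<^sup>2"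
        by (simp add: power2_eq_square algebra_simps)
      then show ?thesis by (simp add: sin_add sin_diff S_def s_def cos_squared_eq algebra_simps)
    qed
    have "\<sigma> * cot (A u + B j) + cot (A u - B j) = F u * d j / (sin (A u + B j) * sin (A u - B j))"
    proof (cases "\<sigma> = 1")
      case True
      have Y: "cot (A u - B j) = - cot (B j - A u)" "sin (A u - B j) = - sin (B j - A u)"
        by (metis cot_minus minus_diff_eq) (metis sin_minus minus_diff_eq)
      have "sin (B j - A u) \<noteq> 0" using sp(2) Y(2) by simp
      then have "cot (A u + B j) - cot (B j - A u) = sin (B j - A u - (A u + B j)) / (sin (A u + B j) * sin (B j - A u))"
        by (rule cot_diff[OF sp(1)])
      moreover have "B j - A u - (A u + B j) = - (2 * A u)" by simp
      ultimately show ?thesis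
        using True by (simp only: Y F_def d_def if_True sin_minus mult_1 mult_1_right mult_minus_right divide_minus_left divide_minus_right)
          simp
    next
      case False
      then have "\<sigma> = -1" using \<sigma> by simp
      moreover have "A u + B j - (A u - B j) = 2 * B j" by simp
      ultimately show ?thesis using cot_diff[OF sp(2) sp(1)] by (simp add: F_def d_def mult.commute)
    qed
    then have "\<sigma> * cot (A u + B j) + cot (A u - B j) = - F u * (d j / (s j - S u))"
      unfolding prod by (metis minus_diff_eq divide_minus_right mult_minus_left times_divide_eq_right)
    then have "legendre_symbol p (int j) * (\<sigma> * cot (A u + B j) + cot (A u - B j))
      = legendre_symbol p (int j) * (- F u * (d j / (s j - S u)))" by (rule arg_cong)
    then show ?thesis unfolding e l by (simp add: algebra_simps)
  qed
  have zero: "(\<Sum>j=1..m. legendre_symbol p (int j) * d j / (s j - S u)) = 0" if u: "u \<in> arc_zeros p 0" for u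
  proof -
    have u01: "0 < u" "u < 1" using u by (auto simp: arc_zeros_def)
    let ?f = "\<lambda>i. legendre_symbol p (0 - i) * cot (pi * (u + of_int i) / p)"
    have split: "{- int m..int m} = insert 0 ({1..int m} \<union> {- int m..-1})" using m1 by auto
    have f0: "?f 0 = 0" by (simp add: legendre_symbol_eq_0_iff)
    have "cot_sum p 0 u = (\<Sum>i\<in>{- int m..int m}. ?f i)" by (simp only: cot_sum_def m_def)
    also have "\<dots> = (\<Sum>i\<in>{1..int m}. ?f i) + (\<Sum>i\<in>{- int m..-1}. ?f i)"
      unfolding split using f0 by (subst sum.insert, simp, simp, subst sum.union_disjoint) auto
    also have "(\<Sum>i\<in>{1..int m}. ?f i) = (\<Sum>j=1..m. ?f (int j))"
      by (rule sum.reindex_bij_witness[of _ int nat]) auto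
    also have "(\<Sum>i\<in>{- int m..-1}. ?f i) = (\<Sum>j=1..m. ?f (- int j))"
      by (rule sum.reindex_bij_witness[of _ "\<lambda>j. - int j" "\<lambda>i. nat (- i)"]) auto
    also have "(\<Sum>j=1..m. ?f (int j)) + (\<Sum>j=1..m. ?f (- int j))
       = (\<Sum>j=1..m. - F u * (legendre_symbol p (int j) * d j / (s j - S u)))"
      unfolding sum.distrib[symmetric] using pair[OF _ _ u01] by (intro sum.cong refl) simp
    also have "\<dots> = - F u * (\<Sum>j=1..m. legendre_symbol p (int j) * d j / (s j - S u))"
      by (simp only: sum_distrib_left)
    finally show ?thesis using F0[OF u01] u by (simp add: arc_zeros_def)
  qed
  define P where "P j = (s j - S x) * (s j - S y)" for j
  have sS: "s j - S u > 0" if "1 \<le> j" "j \<le> m" "0 < u" "u < 1" for j u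
    using s1_le_s[OF that(1,2)] S_lt(1)[OF that(3,4)] by linarith
  have "(\<Sum>j=1..m. legendre_symbol p (int j) * d j / P j) = 0"
  proof -
    have "S x \<noteq> S y"
    proof
      assume "S x = S y"
      then have "sin (A x) = sin (A y)" using S_lt(2)[OF x(1,2)] S_lt(2)[OF x(3,4)] by (simp add: S_def power2_eq_iff_nonneg)
      then have "A x = A y"
        by (rule sin_inj_pi[rotated -1]) (use A[OF x(1,2)] A[OF x(3,4)] B_half[OF m1] in auto)
      then show False using z p by (simp add: A_def)
    qed
    have "(S x - S y) * (\<Sum>j=1..m. legendre_symbol p (int j) * d j / P j)
      = (\<Sum>j=1..m. legendre_symbol p (int j) * d j / (s j - S x)) - (\<Sum>j=1..m. legendre_symbol p (int j) * d j / (s j - S y))"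
      unfolding sum_distrib_left sum_subtractf[symmetric]
    proof (intro sum.cong refl)
      fix j assume "j \<in> {1..m}"
      then have "s j - S x \<noteq> 0" "s j - S y \<noteq> 0" using sS[of j x] sS[of j y] x by auto
      then show "(S x - S y) * (legendre_symbol p (int j) * d j / P j)
        = legendre_symbol p (int j) * d j / (s j - S x) - legendre_symbol p (int j) * d j / (s j - S y)"
        unfolding P_def by (simp add: diff_frac_eq) (simp add: algebra_simps)
    qed
    then show ?thesis using zero[OF z(1)] zero[OF z(2)] \<open>S x \<noteq> S y\<close> by simp
  qed
  moreover have "{1..m} = insert 1 {2..m}" using m1 by auto
  ultimately have eq: "legendre_symbol p 1 * d 1 / P 1 = - (\<Sum>j=2..m. legendre_symbol p (int j) * d j / P j)"
    by simp
  have d_pos: "0 < d j" if "1 \<le> j" "j \<le> m" for j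
    using sin_gt_zero[of "2 * B j"] B_pos[OF that(1)] B_half[OF that(2)] by (auto simp: d_def)
  have P1: "P 1 > 0" using sS[of 1 x] sS[of 1 y] x m1 by (simp add: P_def)
  have ratio: "d j / P j \<le> d 1 / P 1 * (39 / 10 * (1 / (real j) ^ 3))" if j: "j \<in> {2..m}" for j
  proof -
    have j': "1 \<le> j" "j \<le> m" using j by auto
    define r where "r = sin (B 1) / sin (B j)"
    have r0: "r > 0" using sinB[OF j'] sinB[OF order_refl m1] by (simp add: r_def)
    have r1: "r \<le> 1" using s1_le[OF j'] sinB[OF j'] by (simp add: r_def)
    have s1r: "s 1 = r\<^sup>2 * s j" using sinB[OF j'] by (simp add: r_def s_def power_divide)
    have sj: "s j > 0" using sinB[OF j'] by (simp add: s_def)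
    have q: "s 1 - S u \<le> r\<^sup>2 * (s j - S u)" if "0 < u" "u < 1" for u
    proof -
      have "r\<^sup>2 * S u \<le> 1 * S u" using r0 r1 by (intro mult_right_mono power_le_one) (auto simp: S_def)
      then show ?thesis unfolding s1r right_diff_distrib by simp
    qed
    have Pj: "P j > 0" using sS[OF j', of x] sS[OF j', of y] x by (simp add: P_def)
    have "P 1 \<le> (r\<^sup>2 * (s j - S x)) * (r\<^sup>2 * (s j - S y))"
      unfolding P_def using q x sS[of 1 x] sS[of 1 y] sS[OF j', of x] m1 by (intro mult_mono) auto
    also have "\<dots> = r ^ 4 * P j" by (simp add: P_def power2_eq_square power4_eq_xxxx)
    finally have "1 / P j \<le> r ^ 4 / P 1"
      using P1 Pj by (simp add: field_simps)
    then have "d j / P j \<le> d j * r ^ 4 / P 1" using d_pos[OF j'] mult_left_mono[of "1 / P j" "r ^ 4 / P 1" "d j"] by simp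
    also have "d j * r ^ 4 \<le> d 1 * r ^ 3"
    proof (cases "\<sigma> = 1")
      case True
      then show ?thesis using r0 r1 by (simp add: d_def power_decreasing)
    next
      case False
      have "cos (B j) \<le> cos (B 1)"
        using B_mono[OF j'(1)] B_half[OF j'(2)] B_pos[of 1] by (intro cos_monotone_0_pi_le) auto
      then have "2 * sin (B 1) * cos (B j) * r ^ 3 \<le> 2 * sin (B 1) * cos (B 1) * r ^ 3"
        using r0 sinB[OF order_refl m1] by (intro mult_right_mono mult_left_mono) auto
      moreover have "sin (B j) * r = sin (B 1)" using sinB[OF j'] by (simp add: r_def)
      then have "2 * sin (B j) * cos (B j) * r ^ 4 = 2 * sin (B 1) * cos (B j) * r ^ 3"
        by (simp add: power4_eq_xxxx power3_eq_cube mult_ac)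
      moreover have "d j = 2 * sin (B j) * cos (B j)" "d 1 = 2 * sin (B 1) * cos (B 1)"
        using False by (simp_all only: d_def sin_double if_False)
      ultimately show ?thesis by (simp only:)
    qed
    also have "d 1 * r ^ 3 / P 1 \<le> d 1 / P 1 * (39 / 10 * (1 / (real j) ^ 3))"
    proof -
      have "sin (B 1) \<le> pi / p" using sin_x_le_x[of "B 1"] B_pos[of 1] by (simp add: B_def)
      moreover have "2 * real j / p \<le> sin (B j)"
        using sin_arc_lower[OF \<open>odd p\<close>, of 0 "int j"] j' by (simp add: B_def m_def)
      ultimately have "r \<le> (pi / p) / (2 * real j / p)"
        unfolding r_def using j' p sinB[OF order_refl m1] by (intro frac_le) auto
      also have "\<dots> = pi / 2 / j" using p by simp
      finally have "r ^ 3 \<le> (pi / 2 / j) ^ 3" using r0 by (intro power_mono) auto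
      also have "\<dots> = (pi / 2) ^ 3 * (1 / (real j) ^ 3)" by (simp add: power_divide)
      also have "\<dots> \<le> 39 / 10 * (1 / (real j) ^ 3)"
      proof (intro mult_right_mono)
        have "(pi / 2) ^ 3 \<le> (15709 / 10000) ^ 3" using pi_approx by (intro power_mono) auto
        then show "(pi / 2) ^ 3 \<le> 39 / 10" by (simp add: power3_eq_cube)
      qed simp
      finally have "d 1 / P 1 * r ^ 3 \<le> d 1 / P 1 * (39 / 10 * (1 / (real j) ^ 3))"
        using d_pos[OF order_refl m1] P1 by (intro mult_left_mono) auto
      then show ?thesis by simp
    qed
    finally show ?thesis using P1 by (simp add: divide_right_mono)
  qed
  have "d 1 / P 1 = \<bar>legendre_symbol p 1 * d 1 / P 1\<bar>"
    using legendre_symbol_abs[of p 1] p d_pos[OF order_refl m1] P1 by (simp add: abs_mult abs_divide)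
  also have "\<dots> \<le> (\<Sum>j=2..m. \<bar>legendre_symbol p (int j) * d j / P j\<bar>)"
    unfolding eq abs_minus by (rule sum_abs)
  also have "\<dots> \<le> (\<Sum>j=2..m. d 1 / P 1 * (39 / 10 * (1 / (real j) ^ 3)))"
  proof (intro sum_mono)
    fix j assume j: "j \<in> {2..m}"
    have Pj: "P j > 0" using sS[of j x] sS[of j y] x j by (simp add: P_def)
    have "\<bar>legendre_symbol p (int j) * d j / P j\<bar> = \<bar>legendre_symbol p (int j)\<bar> * (d j / P j)"
      using Pj d_pos[of j] j by (simp add: abs_mult abs_divide)
    also have "\<dots> \<le> 1 * (d j / P j)"
      using legendre_symbol_abs_le Pj d_pos[of j] j by (intro mult_right_mono) auto
    finally show "\<bar>legendre_symbol p (int j) * d j / P j\<bar> \<le> d 1 / P 1 * (39 / 10 * (1 / (real j) ^ 3))"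
      using ratio[OF j] by simp
  qed
  also have "\<dots> = d 1 / P 1 * (39 / 10 * (\<Sum>j=2..m. 1 / (real j) ^ 3))" by (simp only: sum_distrib_left)
  also have "\<dots> \<le> d 1 / P 1 * (39 / 10 * (1 / 4))"
    using d_pos[OF order_refl m1] P1 sum_inverse_cubes[of m] by (intro mult_left_mono) auto
  finally have "d 1 / P 1 \<le> d 1 / P 1 * (39 / 40)" by simp
  moreover have "d 1 / P 1 > 0" using d_pos[OF order_refl m1] P1 by simp
  then have "d 1 / P 1 * (39 / 40) < d 1 / P 1 * 1" by (rule mult_strict_left_mono[rotated]) simp
  ultimately show False by (metis mult_1_right not_le)
qed

section \<open>Random signs and equidistribution of sign patterns\<close>

text \<open>A subset \<open>A\<close> of the index set encodes a choice of signs: plus on \<open>A\<close>, minus outside.\<close>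
definition sg :: "int set \<Rightarrow> int \<Rightarrow> real" where "sg A i = (if i \<in> A then 1 else -1)"

text \<open>The expectation for independent fair signs on \<open>W\<close>.\<close>
definition avg :: "int set \<Rightarrow> (int set \<Rightarrow> real) \<Rightarrow> real" where
  "avg W g = (\<Sum>A\<in>Pow W. g A) / 2 ^ card W"

definition sprob :: "int set \<Rightarrow> (int set \<Rightarrow> bool) \<Rightarrow> real" where
  "sprob W h = avg W (\<lambda>A. if h A then 1 else 0)"

lemma sg_cases: "sg A i = 1 \<or> sg A i = -1" by (simp add: sg_def)

lemma avg_mono: "(\<And>A. A \<subseteq> W \<Longrightarrow> g A \<le> g' A) \<Longrightarrow> avg W g \<le> avg W g'"
  unfolding avg_def by (intro divide_right_mono sum_mono) auto

lemma avg_add: "avg W (\<lambda>A. g A + g' A) = avg W g + avg W g'"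
  by (simp add: avg_def sum.distrib add_divide_distrib)

lemma avg_cmult: "avg W (\<lambda>A. c * g A) = c * avg W g"
  by (simp add: avg_def flip: sum_distrib_left)

lemma avg_sum: "avg W (\<lambda>A. \<Sum>m\<in>M. g m A) = (\<Sum>m\<in>M. avg W (g m))"
  unfolding avg_def by (subst sum.swap) (simp add: sum_divide_distrib)

lemma avg_const: "finite W \<Longrightarrow> avg W (\<lambda>A. c) = c"
  by (simp add: avg_def card_Pow)

lemma sprob_mono: "(\<And>A. A \<subseteq> W \<Longrightarrow> h A \<Longrightarrow> h' A) \<Longrightarrow> sprob W h \<le> sprob W h'"
  unfolding sprob_def by (rule avg_mono) auto

lemma sprob_disj: "sprob W (\<lambda>A. h A \<or> h' A) \<le> sprob W h + sprob W h'"
  unfolding sprob_def avg_add[symmetric] by (rule avg_mono) auto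

lemma sprob_card: "finite W \<Longrightarrow> sprob W h = card {A \<in> Pow W. h A} / 2 ^ card W"
  unfolding sprob_def avg_def by (simp flip: sum.inter_filter)

text \<open>Independence of the signs.\<close>
lemma avg_prod:
  assumes "finite W"
  shows "avg W (\<lambda>A. \<Prod>i\<in>W. g i (i \<in> A)) = (\<Prod>i\<in>W. (g i True + g i False) / 2)"
proof -
  have "(\<Prod>i\<in>W. g i True + g i False) = (\<Sum>A\<in>Pow W. (\<Prod>i\<in>A. g i True) * (\<Prod>i\<in>W - A. g i False))"
    by (rule prod_add[OF assms])
  also have "\<dots> = (\<Sum>A\<in>Pow W. \<Prod>i\<in>W. g i (i \<in> A))"
  proof (intro sum.cong refl)
    fix A assume A: "A \<in> Pow W"
    have "(\<Prod>i\<in>W. g i (i \<in> A)) = (\<Prod>i\<in>W - A. g i (i \<in> A)) * (\<Prod>i\<in>A. g i (i \<in> A))"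
      using assms A by (intro prod.subset_diff) auto
    then show "(\<Prod>i\<in>A. g i True) * (\<Prod>i\<in>W - A. g i False) = (\<Prod>i\<in>W. g i (i \<in> A))"
      by (simp add: mult.commute)
  qed
  finally show ?thesis by (simp add: avg_def prod_dividef)
qed

lemma sprob_insert:
  assumes "finite W" "j \<notin> W"
  shows "sprob (insert j W) (\<lambda>A. j \<in> A \<and> h (A - {j})) = sprob W h / 2"
proof -
  have "{A \<in> Pow (insert j W). j \<in> A \<and> h (A - {j})} = insert j ` {A \<in> Pow W. h A}"
  proof (intro equalityI subsetI)
    fix A assume "A \<in> {A \<in> Pow (insert j W). j \<in> A \<and> h (A - {j})}"
    then show "A \<in> insert j ` {A \<in> Pow W. h A}" by (intro image_eqI[of _ _ "A - {j}"]) auto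
  next
    fix A assume "A \<in> insert j ` {A \<in> Pow W. h A}"
    then obtain B where B: "A = insert j B" "B \<subseteq> W" "h B" by auto
    then have "A - {j} = B" using assms by auto
    then show "A \<in> {A \<in> Pow (insert j W). j \<in> A \<and> h (A - {j})}" using B by auto
  qed
  moreover have "inj_on (insert j) {A \<in> Pow W. h A}"
    using assms by (intro inj_onI) (metis (no_types, lifting) Diff_insert_absorb Pow_iff mem_Collect_eq subsetD)
  ultimately show ?thesis using assms by (simp add: sprob_card card_image)
qed

text \<open>The Legendre symbol at $K - i$ relative to the one at $K$. The factor \<open>sgn i\<close> is the sign of $1/(x+i)$, so that
  this is the sign of the cotangent term at $i$ after multiplication by the symbol at $K$; at $i = -1$ the value $1$ means opposite symbols at the ends of the arc.\<close>
definition rel_sign :: "nat \<Rightarrow> int \<Rightarrow> int \<Rightarrow> real" where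
  "rel_sign p K i = of_int (sgn i) * legendre_symbol p K * legendre_symbol p (K - i)"

definition pattern :: "nat \<Rightarrow> int \<Rightarrow> int set \<Rightarrow> int set" where
  "pattern p K W = {i \<in> W. rel_sign p K i = 1}"

definition regular :: "nat \<Rightarrow> int set \<Rightarrow> int \<Rightarrow> bool" where
  "regular p W K \<longleftrightarrow> (\<forall>i\<in>insert 0 W. \<not> int p dvd K - i)"

lemma rel_sign_abs_le: "\<bar>rel_sign p K i\<bar> \<le> 1"
  using legendre_symbol_cases[of p K] legendre_symbol_cases[of p "K - i"]
  by (auto simp: rel_sign_def sgn_if)

lemma rel_sign_regular:
  assumes "regular p W K" "i \<in> W" "0 \<notin> W"
  shows "rel_sign p K i = sg (pattern p K W) i"
proof -
  have "\<not> int p dvd K" "\<not> int p dvd K - i" using assms by (auto simp: regular_def)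
  then have "\<bar>legendre_symbol p K\<bar> = 1" "\<bar>legendre_symbol p (K - i)\<bar> = 1" using legendre_symbol_abs by auto
  moreover have "i \<noteq> 0" using assms by auto
  ultimately show ?thesis using assms(2)
    by (auto simp: sg_def pattern_def rel_sign_def sgn_if abs_if split: if_splits)
qed

lemma card_residue_le_1:
  assumes "p > 0" shows "card {K \<in> {0..<int p}. int p dvd K - i} \<le> 1"
proof -
  have "{K \<in> {0..<int p}. int p dvd K - i} \<subseteq> {i mod int p}"
    using assms by (auto simp: mod_eq_dvd_iff[symmetric])
  from card_mono[OF _ this] show ?thesis by simp
qed

lemma card_irregular:
  assumes "finite W" "p > 0"
  shows "card {K \<in> {0..<int p}. \<not> regular p W K} \<le> card W + 1"
proof -
  have "{K \<in> {0..<int p}. \<not> regular p W K} = (\<Union>i\<in>insert 0 W. {K \<in> {0..<int p}. int p dvd K - i})"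
    by (auto simp: regular_def)
  also have "card \<dots> \<le> (\<Sum>i\<in>insert 0 W. card {K \<in> {0..<int p}. int p dvd K - i})"
    using assms by (intro card_UN_le) auto
  also have "\<dots> \<le> (\<Sum>i\<in>insert 0 W. 1)" using card_residue_le_1[OF assms(2)] by (intro sum_mono) auto
  also have "\<dots> \<le> card W + 1" using assms by (simp add: card_insert_if)
  finally show ?thesis .
qed

lemma odd_primes_at_top_divide_to_0: "((\<lambda>p. c / real p) \<longlongrightarrow> 0) odd_primes_at_top"
proof -
  have "((\<lambda>p. c / real p) \<longlongrightarrow> 0) at_top" by (rule lim_const_over_n)
  then show ?thesis unfolding odd_primes_at_top_def by (rule filterlim_mono[OF _ order_refl inf_le1])
qed

lemma eventually_prime_ge: "eventually (\<lambda>p. prime p \<and> p \<ge> N \<and> p > 2) odd_primes_at_top"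
  unfolding eventually_odd_primes_at_top by (rule exI[of _ N]) auto

text \<open>The factor of $K$ itself survives only in products of odd length, where it becomes one more linear factor.\<close>
lemma rel_sign_product_sum_tendsto:
  assumes T: "finite T" "T \<noteq> {}" "0 \<notin> T"
  shows "((\<lambda>p. (\<Sum>K\<in>{0..<int p}. \<Prod>i\<in>T. rel_sign p K i) / p) \<longlongrightarrow> 0) odd_primes_at_top"
proof -
  define T' where "T' = (if even (card T) then uminus ` T else insert 0 (uminus ` T))"
  have T': "finite T'" "T' \<noteq> {}" using T by (auto simp: T'_def)
  let ?c = "(\<Prod>i\<in>T. of_int (sgn i)) :: real"
  have c: "\<bar>?c\<bar> \<le> 1" unfolding abs_prod by (intro prod_le_1) (auto simp: sgn_if)
  let ?S = "\<lambda>p. \<Sum>K\<in>{0..<int p}. \<Prod>t\<in>T'. legendre_symbol p (K + t)"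
  have main: "\<bar>(\<Sum>K\<in>{0..<int p}. \<Prod>i\<in>T. rel_sign p K i) - ?c * ?S p\<bar> \<le> 1" if p: "prime p" "p > 2" for p
  proof -
    have pw: "legendre_symbol p K ^ n = (if even n then 1 else legendre_symbol p K)" if "\<not> int p dvd K" for K n
      using legendre_symbol_abs[OF that] by (auto simp: abs_if power_minus_odd split: if_splits)
    have e: "(\<Prod>i\<in>T. rel_sign p K i) = ?c * (\<Prod>t\<in>T'. legendre_symbol p (K + t))" if "K \<in> {1..<int p}" for K
    proof -
      have nK: "\<not> int p dvd K" using that zdvd_imp_le[of "int p" K] by auto
      have "(\<Prod>i\<in>T. rel_sign p K i) = ?c * legendre_symbol p K ^ card T * (\<Prod>i\<in>T. legendre_symbol p (K - i))"
        by (simp add: rel_sign_def prod.distrib)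
      also have "(\<Prod>i\<in>T. legendre_symbol p (K - i)) = (\<Prod>t\<in>uminus ` T. legendre_symbol p (K + t))"
        by (subst prod.reindex) auto
      also have "legendre_symbol p K ^ card T = (if even (card T) then 1 else legendre_symbol p K)" by (rule pw[OF nK])
      finally have "(\<Prod>i\<in>T. rel_sign p K i) = ?c * (if even (card T) then 1 else legendre_symbol p K) * (\<Prod>t\<in>uminus ` T. legendre_symbol p (K + t))" .
      moreover have "0 \<notin> uminus ` T" "finite (uminus ` T)" using T by auto
      ultimately show ?thesis by (simp add: T'_def)
    qed
    have A: "{0..<int p} = insert 0 {1..<int p}" using p by auto
    have "(\<Sum>K\<in>{0..<int p}. \<Prod>i\<in>T. rel_sign p K i) - ?c * ?S p
      = (\<Sum>K\<in>{0..<int p}. (\<Prod>i\<in>T. rel_sign p K i) - ?c * (\<Prod>t\<in>T'. legendre_symbol p (K + t)))"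
      by (simp only: sum_subtractf sum_distrib_left)
    also have "\<dots> = (\<Prod>i\<in>T. rel_sign p 0 i) - ?c * (\<Prod>t\<in>T'. legendre_symbol p (0 + t))"
      unfolding A using e by (subst sum.insert) auto
    also have "(\<Prod>i\<in>T. rel_sign p 0 i) = 0"
      using T by (auto simp: rel_sign_def legendre_symbol_eq_0_iff)
    also have "\<bar>0 - ?c * (\<Prod>t\<in>T'. legendre_symbol p (0 + t))\<bar> \<le> 1 * 1"
      unfolding abs_minus_commute[of 0] diff_0_right abs_mult using c legendre_symbol_abs_le
      by (intro mult_mono) (auto simp: abs_prod intro!: prod_le_1 prod_nonneg)
    finally show ?thesis by simp
  qed
  have "((\<lambda>p. (\<Sum>K\<in>{0..<int p}. \<Prod>i\<in>T. rel_sign p K i) / p - ?c * (?S p / p)) \<longlongrightarrow> 0) odd_primes_at_top"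
  proof (rule Lim_null_comparison[OF _ odd_primes_at_top_divide_to_0[of 1]])
    show "\<forall>\<^sub>F p in odd_primes_at_top. norm ((\<Sum>K\<in>{0..<int p}. \<Prod>i\<in>T. rel_sign p K i) / p - ?c * (?S p / p)) \<le> 1 / real p"
      using eventually_prime_ge[of 0]
    proof eventually_elim
      case (elim p)
      have "(\<Sum>K\<in>{0..<int p}. \<Prod>i\<in>T. rel_sign p K i) / p - ?c * (?S p / p) = ((\<Sum>K\<in>{0..<int p}. \<Prod>i\<in>T. rel_sign p K i) - ?c * ?S p) / p"
        by (simp add: diff_divide_distrib)
      then show ?case using main[of p] elim by (simp add: abs_divide divide_right_mono)
    qed
  qed
  moreover have "((\<lambda>p. ?c * (?S p / p)) \<longlongrightarrow> ?c * 0) odd_primes_at_top"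
    by (intro tendsto_mult_left legendre_symbol_product_sum_tendsto T')
  ultimately have "((\<lambda>p. ((\<Sum>K\<in>{0..<int p}. \<Prod>i\<in>T. rel_sign p K i) / p - ?c * (?S p / p)) + ?c * (?S p / p)) \<longlongrightarrow> 0 + ?c * 0) odd_primes_at_top"
    by (rule tendsto_add)
  then show ?thesis by simp
qed

text \<open>The indicator of a pattern is the product of $(1 \pm \varepsilon_i)/2$ over the window. Expanded, only
  the empty product has a mean that does not tend to $0$.\<close>
lemma pattern_equidistributed_single:
  assumes W: "finite W" "0 \<notin> W" "A \<subseteq> W"
  shows "((\<lambda>p. card {K \<in> {0..<int p}. regular p W K \<and> pattern p K W = A} / p) \<longlongrightarrow> 1 / 2 ^ card W) odd_primes_at_top"
proof -
  let ?G = "\<lambda>p K. \<Prod>i\<in>W. (1 + sg A i * rel_sign p K i) / 2"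
  have ex: "(\<Sum>K\<in>{0..<int p}. ?G p K) / p
     = (\<Sum>T\<in>Pow W. (\<Prod>i\<in>T. sg A i) * ((\<Sum>K\<in>{0..<int p}. \<Prod>i\<in>T. rel_sign p K i) / p)) / 2 ^ card W" for p
  proof -
    have "?G p K = (\<Sum>T\<in>Pow W. (\<Prod>i\<in>T. sg A i) * (\<Prod>i\<in>T. rel_sign p K i)) / 2 ^ card W" for K
      using prod_add[OF W(1), of "\<lambda>i. sg A i * rel_sign p K i" "\<lambda>_. 1"]
      by (simp add: prod_dividef prod.distrib add.commute)
    then have "(\<Sum>K\<in>{0..<int p}. ?G p K) = (\<Sum>K\<in>{0..<int p}. \<Sum>T\<in>Pow W. (\<Prod>i\<in>T. sg A i) * (\<Prod>i\<in>T. rel_sign p K i)) / 2 ^ card W"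
      by (simp add: sum_divide_distrib)
    also have "(\<Sum>K\<in>{0..<int p}. \<Sum>T\<in>Pow W. (\<Prod>i\<in>T. sg A i) * (\<Prod>i\<in>T. rel_sign p K i))
       = (\<Sum>T\<in>Pow W. (\<Prod>i\<in>T. sg A i) * (\<Sum>K\<in>{0..<int p}. \<Prod>i\<in>T. rel_sign p K i))"
      by (subst sum.swap) (simp add: sum_distrib_left)
    finally have fin: "(\<Sum>K\<in>{0..<int p}. ?G p K)
       = (\<Sum>T\<in>Pow W. (\<Prod>i\<in>T. sg A i) * (\<Sum>K\<in>{0..<int p}. \<Prod>i\<in>T. rel_sign p K i)) / 2 ^ card W" .
    have "(\<Sum>T\<in>Pow W. (\<Prod>i\<in>T. sg A i) * ((\<Sum>K\<in>{0..<int p}. \<Prod>i\<in>T. rel_sign p K i) / p))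
       = (\<Sum>T\<in>Pow W. (\<Prod>i\<in>T. sg A i) * (\<Sum>K\<in>{0..<int p}. \<Prod>i\<in>T. rel_sign p K i)) / p"
      by (subst sum_divide_distrib) (simp only: times_divide_eq_right)
    then show ?thesis unfolding fin by (simp only: divide_divide_eq_left mult.commute)
  qed
  have lim: "((\<lambda>p. (\<Sum>K\<in>{0..<int p}. ?G p K) / p) \<longlongrightarrow> 1 / 2 ^ card W) odd_primes_at_top"
  proof -
    have "((\<lambda>p. (\<Prod>i\<in>T. sg A i) * ((\<Sum>K\<in>{0..<int p}. \<Prod>i\<in>T. rel_sign p K i) / p)) \<longlongrightarrow> (if T = {} then 1 else 0)) odd_primes_at_top"
      if "T \<in> Pow W" for T
    proof (cases "T = {}")
      case True
      have "\<forall>\<^sub>F p in odd_primes_at_top. (\<Prod>i\<in>T. sg A i) * ((\<Sum>K\<in>{0..<int p}. \<Prod>i\<in>T. rel_sign p K i) / p) = 1"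
        using eventually_prime_ge[of 0] by eventually_elim (simp add: True)
      then show ?thesis using True by (simp add: tendsto_eventually)
    next
      case False
      have "((\<lambda>p. (\<Prod>i\<in>T. sg A i) * ((\<Sum>K\<in>{0..<int p}. \<Prod>i\<in>T. rel_sign p K i) / p)) \<longlongrightarrow> (\<Prod>i\<in>T. sg A i) * 0) odd_primes_at_top"
        using that W False by (intro tendsto_mult_left rel_sign_product_sum_tendsto) (auto intro: finite_subset)
      then show ?thesis using False by simp
    qed
    then have "((\<lambda>p. (\<Sum>T\<in>Pow W. (\<Prod>i\<in>T. sg A i) * ((\<Sum>K\<in>{0..<int p}. \<Prod>i\<in>T. rel_sign p K i) / p)) / 2 ^ card W)
        \<longlongrightarrow> (\<Sum>T\<in>Pow W. if T = {} then 1 else 0) / 2 ^ card W) odd_primes_at_top"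
      by (intro tendsto_divide tendsto_sum tendsto_const) auto
    then show ?thesis unfolding ex using W by (simp add: sum.delta)
  qed
  have G01: "0 \<le> ?G p K \<and> ?G p K \<le> 1" for p K
  proof -
    have "0 \<le> (1 + sg A i * rel_sign p K i) / 2 \<and> (1 + sg A i * rel_sign p K i) / 2 \<le> 1" for i
      using rel_sign_abs_le[of p K i] sg_cases[of A i] by auto
    then show ?thesis by (intro conjI prod_nonneg prod_le_1) auto
  qed
  have Greg: "?G p K = (if pattern p K W = A then 1 else 0)" if "regular p W K" for p K
  proof (cases "pattern p K W = A")
    case True
    have "(1 + sg A i * rel_sign p K i) / 2 = 1" if i: "i \<in> W" for i
      using rel_sign_regular[OF \<open>regular p W K\<close> i W(2)] sg_cases[of A i] True by auto
    then show ?thesis using True by simp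
  next
    case False
    have "pattern p K W \<subseteq> W" by (auto simp: pattern_def)
    then obtain i where i: "i \<in> W" "i \<in> pattern p K W \<longleftrightarrow> i \<notin> A" using False W(3) by blast
    then have "(1 + sg A i * rel_sign p K i) / 2 = 0"
      using rel_sign_regular[OF \<open>regular p W K\<close> i(1) W(2)] by (auto simp: sg_def)
    then have "?G p K = 0" using i(1) W(1) by (intro prod_zero) auto
    then show ?thesis using False by simp
  qed
  have diff: "\<bar>card {K \<in> {0..<int p}. regular p W K \<and> pattern p K W = A} - (\<Sum>K\<in>{0..<int p}. ?G p K)\<bar> \<le> card W + 1"
    if p: "p > 0" for p
  proof -
    have "real (card {K \<in> {0..<int p}. regular p W K \<and> pattern p K W = A})
      = (\<Sum>K\<in>{0..<int p}. if regular p W K \<and> pattern p K W = A then 1 else 0)"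
      by (simp flip: sum.inter_filter)
    then have "\<bar>card {K \<in> {0..<int p}. regular p W K \<and> pattern p K W = A} - (\<Sum>K\<in>{0..<int p}. ?G p K)\<bar>
      = \<bar>\<Sum>K\<in>{0..<int p}. (if regular p W K \<and> pattern p K W = A then 1 else 0) - ?G p K\<bar>"
      by (simp only: sum_subtractf)
    also have "\<dots> \<le> (\<Sum>K\<in>{0..<int p}. \<bar>(if regular p W K \<and> pattern p K W = A then 1 else 0) - ?G p K\<bar>)"
      by (rule sum_abs)
    also have "\<dots> \<le> (\<Sum>K\<in>{0..<int p}. if \<not> regular p W K then 1 else 0)"
    proof (intro sum_mono)
      fix K show "\<bar>(if regular p W K \<and> pattern p K W = A then 1 else 0) - ?G p K\<bar> \<le> (if \<not> regular p W K then 1 else 0)"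
        using Greg[of p K] G01[of p K] by (cases "regular p W K") auto
    qed
    also have "\<dots> = real (card {K \<in> {0..<int p}. \<not> regular p W K})" by (simp flip: sum.inter_filter)
    also have "\<dots> \<le> card W + 1" using card_irregular[OF W(1) p] by simp
    finally show ?thesis .
  qed
  have "((\<lambda>p. card {K \<in> {0..<int p}. regular p W K \<and> pattern p K W = A} / p - (\<Sum>K\<in>{0..<int p}. ?G p K) / p) \<longlongrightarrow> 0) odd_primes_at_top"
  proof (rule Lim_null_comparison[OF _ odd_primes_at_top_divide_to_0[of "card W + 1"]])
    show "\<forall>\<^sub>F p in odd_primes_at_top. norm (card {K \<in> {0..<int p}. regular p W K \<and> pattern p K W = A} / p - (\<Sum>K\<in>{0..<int p}. ?G p K) / p) \<le> real (card W + 1) / real p"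
      using eventually_prime_ge[of 0]
    proof eventually_elim
      case (elim p)
      then show ?case using diff[of p]
        unfolding diff_divide_distrib[symmetric] real_norm_def abs_divide
        by (auto intro!: divide_right_mono)
    qed
  qed
  from tendsto_add[OF this lim] show ?thesis by simp
qed

lemma pattern_equidistributed:
  assumes W: "finite W" "0 \<notin> W"
  shows "((\<lambda>p. card {K \<in> {0..<int p}. regular p W K \<and> h (pattern p K W)} / p) \<longlongrightarrow> sprob W h) odd_primes_at_top"
proof -
  have e: "real (card {K \<in> {0..<int p}. regular p W K \<and> h (pattern p K W)}) / p
     = (\<Sum>A\<in>{A \<in> Pow W. h A}. card {K \<in> {0..<int p}. regular p W K \<and> pattern p K W = A} / p)" for p
  proof -
    have "{K \<in> {0..<int p}. regular p W K \<and> h (pattern p K W)}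
      = (\<Union>A\<in>{A \<in> Pow W. h A}. {K \<in> {0..<int p}. regular p W K \<and> pattern p K W = A})"
      by (auto simp: pattern_def)
    also have "card \<dots> = (\<Sum>A\<in>{A \<in> Pow W. h A}. card {K \<in> {0..<int p}. regular p W K \<and> pattern p K W = A})"
      using W by (intro card_UN_disjoint) (auto intro: finite_subset[of _ "{0..<int p}"])
    finally show ?thesis by (simp add: sum_divide_distrib)
  qed
  have "((\<lambda>p. \<Sum>A\<in>{A \<in> Pow W. h A}. card {K \<in> {0..<int p}. regular p W K \<and> pattern p K W = A} / p)
     \<longlongrightarrow> (\<Sum>A\<in>{A \<in> Pow W. h A}. 1 / 2 ^ card W)) odd_primes_at_top"
    using W by (intro tendsto_sum pattern_equidistributed_single) auto
  then show ?thesis unfolding e using W by (simp add: sprob_card)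
qed

section \<open>Anticoncentration of the model function\<close>

lemma sprob_le_of_separated:
  assumes W: "finite W" "S \<subseteq> W"
    and sep: "\<And>A B. A \<subseteq> W \<Longrightarrow> B \<subseteq> W \<Longrightarrow> h A \<Longrightarrow> h B \<Longrightarrow> A - S = B - S \<Longrightarrow> A = B"
  shows "sprob W h \<le> 1 / 2 ^ card S"
proof -
  have "inj_on (\<lambda>A. A - S) {A \<in> Pow W. h A}" using sep by (intro inj_onI) auto
  moreover have "(\<lambda>A. A - S) ` {A \<in> Pow W. h A} \<subseteq> Pow (W - S)" by auto
  ultimately have "card {A \<in> Pow W. h A} \<le> card (Pow (W - S))"
    using W by (intro card_inj_on_le) auto
  also have "\<dots> = 2 ^ (card W - card S)" using W by (simp add: card_Pow card_Diff_subset finite_subset)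
  finally have "real (card {A \<in> Pow W. h A}) \<le> real (2 ^ (card W - card S))" by (simp only: of_nat_le_iff)
  also have "\<dots> = (2::real) ^ (card W - card S)" by (simp only: of_nat_power of_nat_numeral)
  also have "\<dots> = 2 ^ card W / 2 ^ card S" using W by (intro power_diff card_mono) auto
  finally show ?thesis using W by (simp add: sprob_card field_simps)
qed

text \<open>If the sizes of the coefficients at the chosen indices decay so fast that each exceeds the sum of the later ones
  by \<open>\<delta>\<close>, then two sign patterns differing only at these indices shift the function by at least \<open>2 \<delta>\<close>; so at
  most one of the \<open>2 ^ n\<close> choices can have its infimum in a given interval of length \<open>2 \<delta>\<close>.\<close>
lemma sprob_infimum_in_short_interval:
  fixes j :: "nat \<Rightarrow> int" and w :: "int \<Rightarrow> 'x \<Rightarrow> real" and b :: "'x \<Rightarrow> real"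
  assumes W: "finite W" and j: "inj_on j {..<n}" "j ` {..<n} \<subseteq> W"
    and w: "\<And>x r. x \<in> X \<Longrightarrow> r < n \<Longrightarrow> (\<Sum>l\<in>{r<..<n}. w (j l) x) + \<delta> \<le> w (j r) x"
    and w0: "\<And>x r. x \<in> X \<Longrightarrow> r < n \<Longrightarrow> 0 \<le> w (j r) x"
  defines "F \<equiv> \<lambda>A x. b x + (\<Sum>i\<in>W. sg A i * w i x)"
  shows "sprob W (\<lambda>A. (\<exists>x\<in>X. F A x < \<delta>) \<and> \<not> (\<exists>x\<in>X. F A x < - \<delta>)) \<le> 1 / 2 ^ n"
proof -
  let ?S = "j ` {..<n}"
  have key: False
    if AB: "A \<subseteq> W" "B \<subseteq> W" "A - ?S = B - ?S" and r: "r < n" "j r \<in> A" "j r \<notin> B"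
      and agree: "\<And>l. l < r \<Longrightarrow> j l \<in> A \<longleftrightarrow> j l \<in> B"
      and x: "x \<in> X" "F A x < \<delta>" and B: "\<not> (\<exists>x\<in>X. F B x < - \<delta>)" for A B r x
  proof -
    have "F A x - F B x = (\<Sum>i\<in>W. (sg A i - sg B i) * w i x)"
      unfolding F_def by (simp add: sum_subtractf left_diff_distrib)
    also have "\<dots> = (\<Sum>i\<in>?S. (sg A i - sg B i) * w i x)"
      using AB W j by (intro sum.mono_neutral_right) (auto simp: sg_def)
    also have "\<dots> = (\<Sum>l<n. (sg A (j l) - sg B (j l)) * w (j l) x)" by (simp add: sum.reindex[OF j(1)])
    also have "{..<n} = {..<r} \<union> insert r {r<..<n}" using r by auto
    also have "(\<Sum>l\<in>\<dots>. (sg A (j l) - sg B (j l)) * w (j l) x)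
       = (\<Sum>l<r. (sg A (j l) - sg B (j l)) * w (j l) x) + (2 * w (j r) x + (\<Sum>l\<in>{r<..<n}. (sg A (j l) - sg B (j l)) * w (j l) x))"
      using r by (subst sum.union_disjoint) (auto simp: sg_def)
    also have "(\<Sum>l<r. (sg A (j l) - sg B (j l)) * w (j l) x) = 0" using agree by (intro sum.neutral) (auto simp: sg_def)
    finally have "F A x - F B x = 2 * w (j r) x + (\<Sum>l\<in>{r<..<n}. (sg A (j l) - sg B (j l)) * w (j l) x)" by simp
    moreover have "(\<Sum>l\<in>{r<..<n}. - 2 * w (j l) x) \<le> (\<Sum>l\<in>{r<..<n}. (sg A (j l) - sg B (j l)) * w (j l) x)"
      using w0[OF x(1)] by (intro sum_mono mult_right_mono) (auto simp: sg_def)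
    moreover have "(\<Sum>l\<in>{r<..<n}. - 2 * w (j l) x) = - 2 * (\<Sum>l\<in>{r<..<n}. w (j l) x)" by (simp only: sum_distrib_left)
    ultimately have "F A x - F B x \<ge> 2 * \<delta>" using w[OF x(1) r(1)] by linarith
    then have "F B x < - \<delta>" using x by linarith
    then show False using B x(1) by blast
  qed
  have "sprob W (\<lambda>A. (\<exists>x\<in>X. F A x < \<delta>) \<and> \<not> (\<exists>x\<in>X. F A x < - \<delta>)) \<le> 1 / 2 ^ card ?S"
  proof (rule sprob_le_of_separated[OF W j(2)])
    fix A B
    assume AB: "A \<subseteq> W" "B \<subseteq> W" "A - ?S = B - ?S"
      and A: "(\<exists>x\<in>X. F A x < \<delta>) \<and> \<not> (\<exists>x\<in>X. F A x < - \<delta>)" and B: "(\<exists>x\<in>X. F B x < \<delta>) \<and> \<not> (\<exists>x\<in>X. F B x < - \<delta>)"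
    show "A = B"
    proof (rule ccontr)
      assume "A \<noteq> B"
      then have "\<exists>r. r < n \<and> (j r \<in> A) \<noteq> (j r \<in> B)" using AB(3) by blast
      define r where "r = (LEAST r. r < n \<and> (j r \<in> A) \<noteq> (j r \<in> B))"
      have r: "r < n \<and> (j r \<in> A) \<noteq> (j r \<in> B)"
        unfolding r_def by (rule LeastI_ex) (rule \<open>\<exists>r. r < n \<and> (j r \<in> A) \<noteq> (j r \<in> B)\<close>)
      have min: "\<not> (l < n \<and> (j l \<in> A) \<noteq> (j l \<in> B))" if "l < r" for l
        using that unfolding r_def by (rule not_less_Least)
      have agree: "j l \<in> A \<longleftrightarrow> j l \<in> B" if "l < r" for l
      proof -
        have "l < n" using that r by simp
        then show ?thesis using min[OF that] by blast
      qed
      show False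
      proof (cases "j r \<in> A")
        case True
        obtain x where "x \<in> X" "F A x < \<delta>" using A by blast
        then show False using key[of A B r x] AB r True agree B by auto
      next
        case False
        obtain x where "x \<in> X" "F B x < \<delta>" using B by blast
        then show False using key[of B A r x] AB r False agree A by auto
      qed
    qed
  qed
  then show ?thesis by (simp add: card_image[OF j(1)])
qed

definition window :: "nat \<Rightarrow> int set" where "window J = {- int J - 1..int J} - {-1, 0}"

definition model :: "nat \<Rightarrow> int set \<Rightarrow> real \<Rightarrow> real" where
  "model J A x = 1 / x + 1 / (1 - x) + (\<Sum>i\<in>window J. sg A i / \<bar>x + of_int i\<bar>)"

definition dips :: "nat \<Rightarrow> real \<Rightarrow> int set \<Rightarrow> bool" where
  "dips J t A \<longleftrightarrow> (\<exists>x\<in>{0<..<1}. model J A x < t)"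

lemma finite_window [simp]: "finite (window J)" and zero_notin_window [simp]: "0 \<notin> window J" "-1 \<notin> window J"
  by (auto simp: window_def)

lemma sum_geometric_quarter_tail: "(\<Sum>l\<in>{r<..<n}. 1 / 4 ^ Suc l) \<le> 1 / 4 ^ Suc r / (3 :: real)"
proof -
  have "(\<Sum>l\<in>{r<..<n}. 1 / 4 ^ Suc l) \<le> 1 / 4 ^ Suc r / 3 - (1 / 4 ^ n / 3 :: real)" if "r < n" for n
  proof -
    have "Suc r \<le> n" using that by simp
    then show ?thesis
    proof (induction n rule: dec_induct)
      case base
      have "{r<..<Suc r} = {}" by auto
      then show ?case by simp
    next
      case (step n)
      have "{r<..<Suc n} = insert n {r<..<n}" using step by auto
      then show ?case using step by simp
    qed
  qed
  moreover have "1 / 4 ^ n / 3 \<ge> (0 :: real)" by simp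
  ultimately show ?thesis by (cases "r < n") (smt (verit), simp)
qed

lemma four_powers_window:
  assumes "4 ^ n \<le> J"
  shows "inj_on (\<lambda>r. 4 ^ Suc r :: int) {..<n}" "(\<lambda>r. 4 ^ Suc r :: int) ` {..<n} \<subseteq> window J"
proof -
  show "inj_on (\<lambda>r. 4 ^ Suc r :: int) {..<n}" by (rule inj_onI) (simp add: power_inject_exp)
  show "(\<lambda>r. 4 ^ Suc r :: int) ` {..<n} \<subseteq> window J"
  proof
    fix i :: int assume "i \<in> (\<lambda>r. 4 ^ Suc r) ` {..<n}"
    then obtain r where r: "r < n" "i = 4 ^ Suc r" by auto
    have "(4::int) ^ Suc r \<le> 4 ^ n" using r by (intro power_increasing) auto
    also have "\<dots> \<le> int J" using assms by (metis of_nat_le_iff of_nat_numeral of_nat_power)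
    finally have "i \<le> int J" using r by simp
    moreover have "i > 0" using r by simp
    ultimately show "i \<in> window J" by (simp add: window_def)
  qed
qed

text \<open>Changing the threshold by a small amount changes the probability of a dip only slightly: the signs at $4, 16, 64, \dots$
  spread the minimum.\<close>
lemma sprob_dips_gap:
  assumes "4 ^ n \<le> J"
  shows "sprob (window J) (dips J (1 / 4 ^ Suc n)) \<le> sprob (window J) (dips J (- (1 / 4 ^ Suc n))) + 1 / 2 ^ n"
proof -
  let ?\<delta> = "1 / 4 ^ Suc n :: real"
  let ?F = "\<lambda>A x. (1 / x + 1 / (1 - x)) + (\<Sum>i\<in>window J. sg A i * (1 / \<bar>x + of_int i\<bar>))"
  have F: "?F A x = model J A x" for A x by (simp add: model_def)
  have w: "(4 / 5) * (1 / 4 ^ Suc r) \<le> 1 / \<bar>x + of_int (4 ^ Suc r)\<bar>" "1 / \<bar>x + of_int (4 ^ Suc r)\<bar> \<le> 1 / 4 ^ Suc r"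
    if "x \<in> {0<..<1}" for x :: real and r
  proof -
    have 0: "(4::real) ^ r \<ge> 1" by simp
    then have 1: "(4::real) ^ Suc r \<ge> 4" by simp
    have x: "0 < x" "x < 1" using that by auto
    have "x \<le> 4 ^ r" using x 0 by linarith
    have "(4 / 5) * (1 / 4 ^ Suc r) = 1 / (5 / 4 * 4 ^ Suc r :: real)" by simp
    also have "\<dots> \<le> 1 / (x + 4 ^ Suc r)" using x \<open>x \<le> 4 ^ r\<close> by (intro divide_left_mono) (simp_all add: add_pos_pos)
    finally show "(4 / 5) * (1 / 4 ^ Suc r) \<le> 1 / \<bar>x + of_int (4 ^ Suc r)\<bar>" using x by simp
    show "1 / \<bar>x + of_int (4 ^ Suc r)\<bar> \<le> 1 / 4 ^ Suc r" using x 1 by (intro divide_left_mono) (auto intro!: mult_pos_pos add_pos_pos)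
  qed
  have "sprob (window J) (\<lambda>A. (\<exists>x\<in>{0<..<1}. ?F A x < ?\<delta>) \<and> \<not> (\<exists>x\<in>{0<..<1}. ?F A x < - ?\<delta>)) \<le> 1 / 2 ^ n"
  proof (rule sprob_infimum_in_short_interval[OF finite_window four_powers_window[OF assms]])
    fix x :: real and r assume x: "x \<in> {0<..<1}" and r: "r < n"
    have "(\<Sum>l\<in>{r<..<n}. 1 / \<bar>x + of_int (4 ^ Suc l)\<bar>) \<le> (\<Sum>l\<in>{r<..<n}. 1 / 4 ^ Suc l)"
      using w(2)[OF x] by (intro sum_mono)
    also have "\<dots> \<le> 1 / 4 ^ Suc r / 3" by (rule sum_geometric_quarter_tail)
    finally have 1: "(\<Sum>l\<in>{r<..<n}. 1 / \<bar>x + of_int (4 ^ Suc l)\<bar>) \<le> 1 / 4 ^ Suc r / 3" .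
    have "?\<delta> \<le> 1 / (4 * 4 ^ Suc r)"
    proof -
      have "(4::real) ^ Suc (Suc r) \<le> 4 ^ Suc n" using r by (intro power_increasing) auto
      then show ?thesis by (intro divide_left_mono) auto
    qed
    also have "1 / (4 * 4 ^ Suc r) = 1 / 4 * (1 / 4 ^ Suc r :: real)" by simp
    finally have "?\<delta> \<le> 1 / 4 * (1 / 4 ^ Suc r)" .
    have gen: "s + d \<le> v" if "s \<le> t / 3" "d \<le> 1 / 4 * t" "4 / 5 * t \<le> v" "0 \<le> t" for s d t v :: real
      using that by linarith
    show "(\<Sum>l\<in>{r<..<n}. 1 / \<bar>x + of_int (4 ^ Suc l)\<bar>) + ?\<delta> \<le> 1 / \<bar>x + of_int (4 ^ Suc r)\<bar>"
      by (rule gen[OF 1 \<open>?\<delta> \<le> 1 / 4 * (1 / 4 ^ Suc r)\<close> w(1)[OF x, of r]]) simp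
  qed auto
  then have "sprob (window J) (\<lambda>A. dips J ?\<delta> A \<and> \<not> dips J (- ?\<delta>) A) \<le> 1 / 2 ^ n"
    unfolding F dips_def .
  moreover have "sprob (window J) (dips J ?\<delta>) \<le> sprob (window J) (\<lambda>A. dips J (- ?\<delta>) A \<or> (dips J ?\<delta> A \<and> \<not> dips J (- ?\<delta>) A))"
    by (rule sprob_mono) blast
  ultimately show ?thesis using sprob_disj[of "window J" "dips J (- ?\<delta>)" "\<lambda>A. dips J ?\<delta> A \<and> \<not> dips J (- ?\<delta>) A"] by linarith
qed

lemma dips_mono: "s \<le> t \<Longrightarrow> dips J s A \<Longrightarrow> dips J t A"
  unfolding dips_def by force

section \<open>The distant terms of the cotangent sum\<close>

definition outside :: "nat \<Rightarrow> nat \<Rightarrow> int set" where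
  "outside p J = {- int (p div 2)..int (p div 2)} - {- int J - 1..int J}"

definition tail :: "nat \<Rightarrow> nat \<Rightarrow> int \<Rightarrow> real \<Rightarrow> real" where
  "tail p J K x = pi / p * (\<Sum>i\<in>outside p J. legendre_symbol p (K - i) * cot (pi * (x + of_int i) / p))"

lemma sum_outside_gap: "(\<Sum>i\<in>outside p J. 1 / (of_int (gap i))\<^sup>2) \<le> 2 / (real J + 1 / 2)" if J: "J \<ge> 1"
proof -
  define m where "m = p div 2"
  have half: "(\<Sum>j\<in>{int J + 1..int m}. 1 / (of_int j)\<^sup>2) \<le> (1 / (real J + 1 / 2) :: real)"
  proof -
    have "(\<Sum>j\<in>{int J + 1..int m}. 1 / (of_int j)\<^sup>2) = (\<Sum>j=J + 1..m. 1 / (real j)\<^sup>2)"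
      by (rule sum.reindex_bij_witness[of _ int nat]) auto
    also have "\<dots> \<le> 1 / (real (J + 1) - 1 / 2)" using J by (intro sum_inverse_squares) simp
    finally show ?thesis by (simp add: add.commute)
  qed
  have "outside p J \<subseteq> {int J + 1..int m} \<union> {- int m - 1..- int J - 2}" by (auto simp: outside_def m_def)
  then have "(\<Sum>i\<in>outside p J. 1 / (of_int (gap i))\<^sup>2) \<le> (\<Sum>i\<in>{int J + 1..int m} \<union> {- int m - 1..- int J - 2}. 1 / (of_int (gap i))\<^sup>2 :: real)"
    by (intro sum_mono2) auto
  also have "\<dots> = (\<Sum>i\<in>{int J + 1..int m}. 1 / (of_int (gap i))\<^sup>2) + (\<Sum>i\<in>{- int m - 1..- int J - 2}. 1 / (of_int (gap i))\<^sup>2)"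
    by (intro sum.union_disjoint) auto
  also have "(\<Sum>i\<in>{int J + 1..int m}. 1 / (of_int (gap i))\<^sup>2) = (\<Sum>j\<in>{int J + 1..int m}. 1 / (of_int j)\<^sup>2 :: real)"
    by (intro sum.cong) (auto simp: gap_def)
  also have "(\<Sum>i\<in>{- int m - 1..- int J - 2}. 1 / (of_int (gap i))\<^sup>2) = (\<Sum>j\<in>{int J + 1..int m}. 1 / (of_int j)\<^sup>2 :: real)"
    by (rule sum.reindex_bij_witness[of _ "\<lambda>j. - 1 - j" "\<lambda>i. - 1 - i"]) (auto simp: gap_def)
  finally show ?thesis using half by simp
qed

lemma gap_outside: "i \<in> outside p J \<Longrightarrow> gap i \<ge> int J + 1" by (auto simp: outside_def gap_def)

text \<open>The sum over \<open>K\<close> of the squared tail: distinct shifts of the Legendre symbol are almost orthogonal, and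
  their small negative correlations help.\<close>
lemma legendre_second_moment:
  fixes c :: "int \<Rightarrow> real"
  assumes p: "prime p" "p > 2" and R: "R \<subseteq> {- int (p div 2)..int (p div 2)}"
  shows "(\<Sum>K\<in>{0..<int p}. (\<Sum>i\<in>R. c i * legendre_symbol p (K - i))\<^sup>2) \<le> p * (\<Sum>i\<in>R. (c i)\<^sup>2)"
proof -
  let ?A = "{0..<int p}" and ?l = "legendre_symbol p"
  have fin: "finite R" using R by (rule finite_subset) simp
  have corr: "(\<Sum>K\<in>?A. ?l (K - i) * ?l (K - j)) = (if i = j then real p - 1 else -1)" if "i \<in> R" "j \<in> R" for i j
  proof -
    have n1: "\<not> int p dvd 1" using p by simp
    have "(\<Sum>K\<in>?A. ?l (K - i) * ?l (K - j)) = (\<Sum>K\<in>?A. (\<lambda>x. ?l x * ?l (x + (i - j))) (1 * K + (- i)))"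
      by (intro sum.cong refl) (simp add: algebra_simps)
    also have "\<dots> = (\<Sum>K\<in>?A. ?l K * ?l (K + (i - j)))"
      by (rule sum_residues_affine[OF p(1) n1]) (simp only: legendre_symbol_mod legendre_symbol_mod0)
    also have "\<dots> = (if i = j then real p - 1 else -1)"
    proof (cases "i = j")
      case True
      have A: "?A = insert 0 {1..<int p}" using p by auto
      have "?l K * ?l K = 1" if "K \<in> {1..<int p}" for K
      proof -
        have "\<not> int p dvd K" using that zdvd_imp_le[of "int p" K] by auto
        then show ?thesis using legendre_symbol_abs[of p K] by (simp add: abs_if split: if_splits)
      qed
      then have "(\<Sum>K\<in>{1..<int p}. ?l K * ?l K) = real (card {1..<int p})" by simp
      moreover have "?l 0 = 0" by (simp add: legendre_symbol_eq_0_iff)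
      ultimately show ?thesis unfolding A using True p by (simp add: of_nat_diff)
    next
      case False
      have "i \<in> {- int (p div 2)..int (p div 2)}" "j \<in> {- int (p div 2)..int (p div 2)}" using that R by blast+
      moreover have "2 * int (p div 2) < int p" using p prime_odd_nat[of p] by presburger
      ultimately have "\<bar>i - j\<bar> < int p" by auto
      then have "\<not> int p dvd i - j" using False zdvd_not_zless[of "\<bar>i - j\<bar>" "int p"] by auto
      then show ?thesis using legendre_symbol_correlation[OF p] False by simp
    qed
    finally show ?thesis .
  qed
  have "(\<Sum>K\<in>?A. (\<Sum>i\<in>R. c i * ?l (K - i))\<^sup>2) = (\<Sum>K\<in>?A. \<Sum>i\<in>R. \<Sum>j\<in>R. c i * c j * (?l (K - i) * ?l (K - j)))"
    unfolding power2_eq_square sum_product by (intro sum.cong refl) (simp only: mult_ac)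
  also have "\<dots> = (\<Sum>i\<in>R. \<Sum>K\<in>?A. \<Sum>j\<in>R. c i * c j * (?l (K - i) * ?l (K - j)))" by (rule sum.swap)
  also have "\<dots> = (\<Sum>i\<in>R. \<Sum>j\<in>R. \<Sum>K\<in>?A. c i * c j * (?l (K - i) * ?l (K - j)))"
    by (intro sum.cong refl sum.swap)
  also have "\<dots> = (\<Sum>i\<in>R. \<Sum>j\<in>R. c i * c j * (\<Sum>K\<in>?A. ?l (K - i) * ?l (K - j)))"
    by (simp only: sum_distrib_left)
  also have "\<dots> = (\<Sum>i\<in>R. \<Sum>j\<in>R. (if i = j then real p * (c i)\<^sup>2 else 0) - c i * c j)"
    by (intro sum.cong refl) (auto simp: corr power2_eq_square algebra_simps)
  also have "\<dots> = real p * (\<Sum>i\<in>R. (c i)\<^sup>2) - (\<Sum>i\<in>R. c i)\<^sup>2"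
  proof -
    have "(\<Sum>i\<in>R. \<Sum>j\<in>R. if i = j then real p * (c i)\<^sup>2 else 0) = (\<Sum>i\<in>R. real p * (c i)\<^sup>2)"
      using fin by (intro sum.cong refl) simp
    moreover have "(\<Sum>i\<in>R. c i)\<^sup>2 = (\<Sum>i\<in>R. \<Sum>j\<in>R. c i * c j)"
      by (simp only: power2_eq_square sum_product)
    ultimately show ?thesis by (simp only: sum_subtractf sum_distrib_left)
  qed
  also have "\<dots> \<le> real p * (\<Sum>i\<in>R. (c i)\<^sup>2)" by simp
  finally show ?thesis .
qed

text \<open>Chebyshev's inequality, with the second moment taken over all arcs.\<close>
lemma card_large_tail:
  assumes p: "prime p" "p > 2" and J: "J \<ge> 1" and d: "\<delta> > 0"
  shows "card {K \<in> {0..<int p}. \<bar>tail p J K (1 / 2)\<bar> \<ge> \<delta>} \<le> 5 * p / (J * \<delta>\<^sup>2)"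
proof -
  have "odd p" using p prime_odd_nat by blast
  define c where "c i = pi / p * cot (pi * (1 / 2 + of_int i) / p)" for i :: int
  let ?B = "{K \<in> {0..<int p}. \<bar>tail p J K (1 / 2)\<bar> \<ge> \<delta>}"
  have t: "tail p J K (1 / 2) = (\<Sum>i\<in>outside p J. c i * legendre_symbol p (K - i))" for K
    unfolding tail_def c_def sum_distrib_left by (intro sum.cong) simp_all
  have c: "(c i)\<^sup>2 \<le> 5 / 2 * (1 / (of_int (gap i))\<^sup>2)" if i: "i \<in> outside p J" for i
  proof -
    have g: "real_of_int (gap i) \<ge> 1" using gap_outside[OF i] by auto
    have "2 * of_int (gap i) / p \<le> \<bar>sin (pi * (1 / 2 + of_int i) / p)\<bar>"
      using abs_sin_arc_lower[OF \<open>odd p\<close>, of "1 / 2" i] i by (auto simp: outside_def)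
    then have "\<bar>cot (pi * (1 / 2 + of_int i) / p)\<bar> \<le> 1 / (2 * of_int (gap i) / p)"
      unfolding cot_def using g p by (intro abs_legendre_quotient_le) auto
    then have "\<bar>c i\<bar> \<le> pi / p * (1 / (2 * of_int (gap i) / p))"
      unfolding c_def abs_mult by (intro mult_mono) auto
    also have "\<dots> = pi / 2 * (1 / of_int (gap i))" using p by simp
    finally have "\<bar>c i\<bar>\<^sup>2 \<le> (pi / 2 * (1 / of_int (gap i)))\<^sup>2" by (intro power_mono) auto
    also have "\<dots> = (pi / 2)\<^sup>2 * (1 / (of_int (gap i))\<^sup>2)" by (simp add: power_divide)
    also have "\<dots> \<le> 5 / 2 * (1 / (of_int (gap i))\<^sup>2)"
    proof (intro mult_right_mono)
      have "(pi / 2)\<^sup>2 \<le> (1.575)\<^sup>2" using pi_approx by (intro power_mono) auto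
      then show "(pi / 2)\<^sup>2 \<le> 5 / 2" by (simp add: power2_eq_square)
    qed simp
    finally show ?thesis by simp
  qed
  have "card ?B * \<delta>\<^sup>2 = (\<Sum>K\<in>?B. \<delta>\<^sup>2)" by simp
  also have "\<dots> \<le> (\<Sum>K\<in>?B. (tail p J K (1 / 2))\<^sup>2)"
    using d by (intro sum_mono) (auto simp: abs_le_square_iff[symmetric])
  also have "\<dots> \<le> (\<Sum>K\<in>{0..<int p}. (tail p J K (1 / 2))\<^sup>2)" by (intro sum_mono2) auto
  also have "\<dots> \<le> p * (\<Sum>i\<in>outside p J. (c i)\<^sup>2)"
    unfolding t by (rule legendre_second_moment[OF p]) (auto simp: outside_def)
  also have "\<dots> \<le> p * (\<Sum>i\<in>outside p J. 5 / 2 * (1 / (of_int (gap i))\<^sup>2))"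
    by (intro mult_left_mono sum_mono c) auto
  also have "\<dots> = p * (5 / 2 * (\<Sum>i\<in>outside p J. 1 / (of_int (gap i))\<^sup>2))" by (simp only: sum_distrib_left)
  also have "\<dots> \<le> p * (5 / 2 * (2 / J))"
  proof -
    have "2 / (real J + 1 / 2) \<le> 2 / J" using J by (intro divide_left_mono) auto
    then show ?thesis using sum_outside_gap[OF J, of p] by (intro mult_left_mono) auto
  qed
  finally show ?thesis using d J by (simp add: field_simps)
qed

text \<open>Far from the poles the cotangents are Lipschitz, so it suffices to control the tail at the midpoint of the arc.\<close>
lemma tail_variation:
  assumes p: "prime p" "p > 2" and J: "J \<ge> 1" and x: "0 < x" "x < 1"
  shows "\<bar>tail p J K x - tail p J K (1 / 2)\<bar> \<le> 3 / J"
proof -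
  have "odd p" using p prime_odd_nat by blast
  let ?D = "\<lambda>i. cot (pi * (x + of_int i) / p) - cot (pi * (1 / 2 + of_int i) / p)"
  have D: "\<bar>?D i\<bar> \<le> pi / p * (p\<^sup>2 / 8 * (1 / (of_int (gap i))\<^sup>2))" if i: "i \<in> outside p J" for i
  proof -
    have g: "real_of_int (gap i) \<ge> 1" using gap_outside[OF i] by auto
    let ?s = "sin (pi * (x + of_int i) / p)" and ?t = "sin (pi * (1 / 2 + of_int i) / p)"
    let ?a = "pi * (1 / 2 + of_int i) / p - pi * (x + of_int i) / p"
    have I: "i \<in> {- int (p div 2)..int (p div 2)}" using i by (auto simp: outside_def)
    have st: "2 * of_int (gap i) / p \<le> \<bar>?s\<bar>" "2 * of_int (gap i) / p \<le> \<bar>?t\<bar>"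
      using abs_sin_arc_lower[OF \<open>odd p\<close> x I] abs_sin_arc_lower[OF \<open>odd p\<close> _ _ I, of "1 / 2"] by auto
    have "?D i = sin ?a / (?s * ?t)"
      using sin_arc_nonzero[OF p(2) x, of i] sin_arc_nonzero[OF p(2), of "1 / 2" i] by (intro cot_diff) auto
    also have "\<dots> = pi / (2 * p) * ((sin ?a / (pi / (2 * p))) / (?s * ?t))" using p by simp
    also have "\<bar>\<dots>\<bar> \<le> pi / (2 * p) * (1 / ((2 * of_int (gap i) / p) * (2 * of_int (gap i) / p)))"
      unfolding abs_mult[of "pi / (2 * p)"]
    proof (intro mult_mono abs_legendre_quotient2_le)
      have h: "\<bar>1 / 2 - x\<bar> \<le> 1 / 2" by (rule abs_leI) (use x in linarith)+
      have "?a = pi * (1 / 2 - x) / p" by (simp add: diff_divide_distrib[symmetric] right_diff_distrib[symmetric])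
      then have "\<bar>?a\<bar> = pi * \<bar>1 / 2 - x\<bar> / p" by (simp add: abs_mult)
      also have "\<dots> \<le> pi * (1 / 2) / p" using h by (intro divide_right_mono mult_left_mono) auto
      finally have "\<bar>sin ?a\<bar> \<le> pi / (2 * p)" using abs_sin_x_le_abs_x[of ?a] by simp
      then show "\<bar>sin ?a / (pi / (2 * p))\<bar> \<le> 1" using p(2) by (simp only: abs_divide) (simp add: divide_le_eq field_simps)
    qed (use g p st in auto)
    also have "\<dots> = pi / p * (p\<^sup>2 / 8 * (1 / (of_int (gap i))\<^sup>2))" by (simp add: power2_eq_square)
    finally show ?thesis .
  qed
  have "tail p J K x - tail p J K (1 / 2) = pi / p * (\<Sum>i\<in>outside p J. legendre_symbol p (K - i) * ?D i)"
    unfolding tail_def by (simp add: sum_subtractf right_diff_distrib)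
  also have "\<bar>\<dots>\<bar> \<le> pi / p * (\<Sum>i\<in>outside p J. 1 * (pi / p * (p\<^sup>2 / 8 * (1 / (of_int (gap i))\<^sup>2))))"
    unfolding abs_mult[of "pi / p"]
  proof (intro mult_mono order_trans[OF sum_abs] sum_mono)
    fix i assume "i \<in> outside p J"
    then show "\<bar>legendre_symbol p (K - i) * ?D i\<bar> \<le> 1 * (pi / p * (p\<^sup>2 / 8 * (1 / (of_int (gap i))\<^sup>2)))"
      unfolding abs_mult using legendre_symbol_abs_le D by (intro mult_mono) auto
  qed auto
  also have "\<dots> = pi\<^sup>2 / 8 * (\<Sum>i\<in>outside p J. 1 / (of_int (gap i))\<^sup>2)"
    using p by (simp add: sum_distrib_left power2_eq_square)
  also have "\<dots> \<le> 10 / 8 * (2 / J)"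
  proof (intro mult_mono)
    have "pi\<^sup>2 \<le> (3.15)\<^sup>2" using pi_approx by (intro power_mono) auto
    then show "pi\<^sup>2 / 8 \<le> 10 / 8" by (simp add: power2_eq_square)
    have "2 / (real J + 1 / 2) \<le> 2 / J" using J by (intro divide_left_mono) auto
    then show "(\<Sum>i\<in>outside p J. 1 / (of_int (gap i))\<^sup>2) \<le> 2 / real J" using sum_outside_gap[OF J, of p] by linarith
  qed (auto intro!: sum_nonneg)
  also have "\<dots> \<le> 3 / J" using J by (simp add: field_simps)
  finally show ?thesis .
qed

text \<open>On an arc with opposite signs at its ends, the rescaled cotangent sum is the model function of the sign
  pattern in the window, up to the tail and the error of replacing cotangents by their principal parts.\<close>
lemma cot_sum_model:
  assumes p: "prime p" "p > 2" "p \<ge> 4 * (J + 1)" and J: "J \<ge> 1" and x: "0 < x" "x < 1"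
    and reg: "regular p (insert (-1) (window J)) K" and opp: "rel_sign p K (-1) = 1"
  shows "\<bar>pi / p * (legendre_symbol p K * cot_sum p K x) - model J (pattern p K (window J)) x\<bar>
     \<le> \<bar>tail p J K (1 / 2)\<bar> + 3 / J + 20 * (real J + 1)\<^sup>2 / p\<^sup>2"
proof -
  let ?l = "legendre_symbol p" and ?I = "{- int J - 1..int J}"
  let ?A = "pattern p K (window J)"
  have "odd p" using p prime_odd_nat by blast
  have I: "?I \<subseteq> {- int (p div 2)..int (p div 2)}"
  proof -
    have "2 * (J + 1) \<le> p div 2" using p(3) by linarith
    then have "2 * (int J + 1) \<le> int (p div 2)" by simp
    then show ?thesis by auto
  qed
  have nK: "\<not> int p dvd K" using reg by (simp add: regular_def)
  have ll: "?l K * ?l K = 1" using legendre_symbol_abs[OF nK] by (auto simp: abs_if split: if_splits)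
  have reg': "regular p (window J) K" using reg by (simp add: regular_def)
  define e where "e i = ?l K * ?l (K - i)" for i
  have e0: "e 0 = 1" by (simp add: e_def ll)
  have eneg: "e (-1) = -1" using opp by (simp add: e_def rel_sign_def)
  have ei: "e i = of_int (sgn i) * sg ?A i" if "i \<in> window J" for i
  proof -
    have "sg ?A i = of_int (sgn i) * e i"
      using rel_sign_regular[OF reg' that] by (simp add: rel_sign_def e_def)
    moreover have "i \<noteq> 0" using that by (auto simp: window_def)
    ultimately show ?thesis by (auto simp: sgn_if)
  qed
  have Iw: "?I = insert 0 (insert (-1) (window J))" by (auto simp: window_def)
  have ei_abs: "\<bar>e i\<bar> = 1" if "i \<in> ?I" for i
  proof -
    have "i = 0 \<or> i = -1 \<or> i \<in> window J" using that Iw by auto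
    then show ?thesis using e0 eneg ei[of i] sg_cases[of ?A i] by (auto simp: sgn_if window_def)
  qed
  define S where "S = (\<Sum>i\<in>?I. e i * (pi / p * cot (pi * (x + of_int i) / p) - 1 / (x + of_int i)))"
  have "model J ?A x = (\<Sum>i\<in>?I. e i * (1 / (x + of_int i)))"
  proof -
    have "sg ?A i / \<bar>x + of_int i\<bar> = e i * (1 / (x + of_int i))" if i: "i \<in> window J" for i
    proof (cases "i > 0")
      case True
      then show ?thesis using ei[OF i] x by simp
    next
      case False
      then have "i \<le> -2" using i by (auto simp: window_def)
      then have "x + of_int i < 0" "i < 0" using x by auto
      then have "sg ?A i / \<bar>x + of_int i\<bar> = - (sg ?A i / (x + of_int i))" by (simp only: abs_of_neg divide_minus_right)
      moreover have "e i = - sg ?A i" using ei[OF i] \<open>i < 0\<close> by simp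
      ultimately show ?thesis by simp
    qed
    then have "(\<Sum>i\<in>window J. sg ?A i / \<bar>x + of_int i\<bar>) = (\<Sum>i\<in>window J. e i * (1 / (x + of_int i)))"
      by (rule sum.cong[OF refl])
    moreover have "e (-1) * (1 / (x + of_int (-1))) = 1 / (1 - x)" using x eneg by (simp add: divide_simps)
    ultimately show ?thesis unfolding model_def Iw using e0 by simp
  qed
  moreover have "pi / p * (?l K * cot_sum p K x) = (\<Sum>i\<in>?I. e i * (pi / p * cot (pi * (x + of_int i) / p))) + ?l K * tail p J K x"
  proof -
    have "pi / p * (?l K * cot_sum p K x) = (\<Sum>i\<in>{- int (p div 2)..int (p div 2)}. e i * (pi / p * cot (pi * (x + of_int i) / p)))"
      unfolding cot_sum_def sum_distrib_left by (intro sum.cong refl) (simp add: e_def)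
    also have "\<dots> = (\<Sum>i\<in>outside p J. e i * (pi / p * cot (pi * (x + of_int i) / p))) + (\<Sum>i\<in>?I. e i * (pi / p * cot (pi * (x + of_int i) / p)))"
      unfolding outside_def by (rule sum.subset_diff[OF I]) simp
    also have "(\<Sum>i\<in>outside p J. e i * (pi / p * cot (pi * (x + of_int i) / p))) = ?l K * tail p J K x"
      unfolding tail_def sum_distrib_left by (intro sum.cong refl) (simp add: e_def)
    finally show ?thesis by simp
  qed
  ultimately have eq: "pi / p * (?l K * cot_sum p K x) - model J ?A x = S + ?l K * tail p J K x"
    by (simp add: S_def sum_subtractf right_diff_distrib)
  have "\<bar>S\<bar> \<le> (\<Sum>i\<in>?I. 10 * (real J + 1) / p\<^sup>2)"
    unfolding S_def
  proof (rule order_trans[OF sum_abs], rule sum_mono)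
    fix i assume i: "i \<in> ?I"
    have ir: "- real J - 1 \<le> of_int i" "of_int i \<le> real J"
    proof -
      have "- (int J) - 1 \<le> i" "i \<le> int J" using i by auto
      then have "real_of_int (- (int J) - 1) \<le> of_int i" "real_of_int i \<le> of_int (int J)" by (simp_all only: of_int_le_iff)
      then show "- real J - 1 \<le> of_int i" "of_int i \<le> real J" by simp_all
    qed
    have ax: "\<bar>x + of_int i\<bar> \<le> real J + 1" using ir x by (auto simp: abs_le_iff)
    let ?u = "pi * (x + of_int i) / p"
    have u0: "?u \<noteq> 0" using sin_arc_nonzero[OF p(2) x, of i] by force
    have ua: "\<bar>?u\<bar> = pi * \<bar>x + of_int i\<bar> / p" by (simp add: abs_mult)
    have ub: "\<bar>?u\<bar> \<le> pi * (real J + 1) / p" unfolding ua using ax by (intro divide_right_mono mult_left_mono) auto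
    also have "pi * (real J + 1) / p \<le> 4 * (real J + 1) / p" using pi_less_4 by (intro divide_right_mono mult_right_mono) auto
    also have "\<dots> \<le> 1" using p by (simp add: divide_le_eq)
    finally have "\<bar>cot ?u - 1 / ?u\<bar> \<le> \<bar>?u\<bar>" using u0 by (intro abs_cot_minus_inverse) auto
    then have "pi / p * \<bar>cot ?u - 1 / ?u\<bar> \<le> pi / p * (pi * (real J + 1) / p)"
      using ub by (intro mult_left_mono) auto
    also have "\<dots> = pi\<^sup>2 * (real J + 1) / p\<^sup>2" by (simp add: power2_eq_square)
    also have "\<dots> \<le> 10 * (real J + 1) / p\<^sup>2"
    proof (intro divide_right_mono mult_right_mono)
      have "pi\<^sup>2 \<le> (3.15)\<^sup>2" using pi_approx by (intro power_mono) auto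
      then show "pi\<^sup>2 \<le> 10" by (simp add: power2_eq_square)
    qed auto
    finally have 1: "pi / p * \<bar>cot ?u - 1 / ?u\<bar> \<le> 10 * (real J + 1) / p\<^sup>2" .
    have "pi / p * (1 / ?u) = 1 / (x + of_int i)" using p by simp
    then have "pi / p * cot ?u - 1 / (x + of_int i) = pi / p * (cot ?u - 1 / ?u)" by (simp only: right_diff_distrib)
    then have "\<bar>e i * (pi / p * cot ?u - 1 / (x + of_int i))\<bar> = pi / p * \<bar>cot ?u - 1 / ?u\<bar>"
      unfolding abs_mult ei_abs[OF i] by (simp add: abs_mult)
    then show "\<bar>e i * (pi / p * cot ?u - 1 / (x + of_int i))\<bar> \<le> 10 * (real J + 1) / p\<^sup>2" using 1 by simp
  qed
  also have "(\<Sum>i\<in>?I. 10 * (real J + 1) / p\<^sup>2) = 20 * (real J + 1)\<^sup>2 / p\<^sup>2"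
  proof -
    have "real (card ?I) = 2 * (real J + 1)" by simp
    then have "(\<Sum>i\<in>?I. 10 * (real J + 1) / p\<^sup>2) = 2 * (real J + 1) * (10 * (real J + 1) / p\<^sup>2)" by (simp only: sum_constant)
    then show ?thesis by (simp add: power2_eq_square) (simp add: algebra_simps)
  qed
  finally have "\<bar>S\<bar> \<le> 20 * (real J + 1)\<^sup>2 / (real p)\<^sup>2" by (simp only: of_nat_power)
  moreover have "\<bar>?l K * tail p J K x\<bar> \<le> \<bar>tail p J K (1 / 2)\<bar> + 3 / J"
    using legendre_symbol_abs[OF nK] tail_variation[OF p(1,2) J x, of K] by (simp add: abs_mult)
  ultimately show ?thesis unfolding eq using abs_triangle_ineq[of S "?l K * tail p J K x"] by linarith
qed

section \<open>The density of zeros as a limit\<close>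

lemma regular_arc:
  assumes "prime p" "p \<ge> 11" "regular p (insert (-1) W) K"
  shows "arc p K"
proof
  show "\<not> int p dvd K" using assms(3) by (simp add: regular_def)
  have "\<not> int p dvd K - (-1)" using assms(3) unfolding regular_def by blast
  then show "\<not> int p dvd K + 1" by simp
qed (use assms in auto)

lemma card_arc_zeros_bound:
  assumes p: "prime p" "p \<ge> 11" and K: "K \<in> {0..<int p}"
  shows "card (arc_zeros p K) \<le> 2"
proof -
  consider "K = 0" | "K = int p - 1" | "1 \<le> K" "K \<le> int p - 2" using K by force
  then show ?thesis
  proof cases
    case 1
    then show ?thesis using card_arc_zeros_0[OF p] by simp
  next
    case 2
    then show ?thesis using card_arc_zeros_0[OF p] card_arc_zeros_reflect[OF p(1)] p(2) by simp
  next
    case 3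
    interpret arc p K
      by unfold_locales (use p 3 zdvd_imp_le[of "int p" K] zdvd_imp_le[of "int p" "K + 1"] in auto)
    have "c 0 = c (-1) \<or> c 0 = - c (-1)" using c_abs(1,2) by (auto simp: abs_if split: if_splits)
    then show ?thesis using card_arc_zeros_le_1 card_arc_zeros_le_2 by fastforce
  qed
qed

text \<open>By the convention of \<open>rel_sign\<close>, the index $-1$ is absent from the pattern exactly when the symbols at the ends agree.\<close>
definition same_arcs :: "nat \<Rightarrow> nat \<Rightarrow> int set" where
  "same_arcs p J = {K \<in> {0..<int p}. regular p (insert (-1) (window J)) K \<and> -1 \<notin> pattern p K (insert (-1) (window J))}"

definition opposite_arcs :: "nat \<Rightarrow> nat \<Rightarrow> (int set \<Rightarrow> bool) \<Rightarrow> int set" where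
  "opposite_arcs p J h = {K \<in> {0..<int p}. regular p (insert (-1) (window J)) K \<and>
     (-1 \<in> pattern p K (insert (-1) (window J)) \<and> h (pattern p K (insert (-1) (window J)) - {-1}))}"

definition irregular_arcs :: "nat \<Rightarrow> nat \<Rightarrow> int set" where
  "irregular_arcs p J = {K \<in> {0..<int p}. \<not> regular p (insert (-1) (window J)) K}"

definition large_tail_arcs :: "nat \<Rightarrow> nat \<Rightarrow> real \<Rightarrow> int set" where
  "large_tail_arcs p J \<delta> = {K \<in> {0..<int p}. \<bar>tail p J K (1 / 2)\<bar> \<ge> \<delta>}"

text \<open>An arc that is neither irregular nor has a large tail is counted correctly once the threshold is relaxed by $\delta$ in
  the appropriate direction; every other arc carries at most two zeros.\<close>
lemma zero_count_bounds:
  assumes p: "prime p" "p \<ge> 11" "p \<ge> 4 * (J + 1)" and J: "J \<ge> 1" and d: "\<delta> > 0"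
    and small: "3 / J + 20 * (real J + 1)\<^sup>2 / (real p)\<^sup>2 \<le> \<delta> / 2"
  shows "real (card (unit_circle_zeros p)) \<le> 1 + 2 * real (card (irregular_arcs p J)) + real (card (same_arcs p J))
      + 2 * real (card (opposite_arcs p J (dips J \<delta>))) + 2 * real (card (large_tail_arcs p J (\<delta> / 2)))"
    and "real (card (same_arcs p J)) + 2 * real (card (opposite_arcs p J (dips J (- \<delta>))))
      \<le> real (card (unit_circle_zeros p)) + 2 * real (card (large_tail_arcs p J (\<delta> / 2)))"
proof -
  let ?A = "{0..<int p}"
  let ?Ir = "irregular_arcs p J" and ?Sa = "same_arcs p J" and ?Op = "\<lambda>t. opposite_arcs p J (dips J t)"
    and ?La = "large_tail_arcs p J (\<delta> / 2)"
  note P = p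
  let ?W = "insert (-1) (window J)"
  let ?ind = "\<lambda>X K. if K \<in> X then 1 else 0 :: real"
  have p2: "p > 2" using p by simp
  have pat: "pattern p K ?W - {-1} = pattern p K (window J)" for K by (auto simp: pattern_def window_def)
  have sub: "?Ir \<subseteq> ?A" "?Sa \<subseteq> ?A" "?Op t \<subseteq> ?A" "?La \<subseteq> ?A" for t
    by (auto simp: irregular_arcs_def same_arcs_def opposite_arcs_def large_tail_arcs_def)
  have card: "real (card X) = (\<Sum>K\<in>?A. ?ind X K)" if "X \<subseteq> ?A" for X
  proof -
    have "{K \<in> ?A. K \<in> X} = X" using that by auto
    then show ?thesis by (simp flip: sum.inter_filter)
  qed
  have same: "card (arc_zeros p K) = 1" if K: "K \<in> ?Sa" for K
  proof -
    have reg: "regular p ?W K" and npat: "-1 \<notin> pattern p K ?W" using K by (auto simp: same_arcs_def)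
    interpret arc p K using regular_arc[OF p(1,2) reg] .
    have "rel_sign p K (-1) = -1"
      using rel_sign_regular[OF reg, of "-1"] npat by (simp add: sg_def)
    then have "c 0 * c (-1) = 1" by (simp add: rel_sign_def)
    then have "c 0 = c (-1)" using c_abs(1,2) by (auto simp: abs_if split: if_splits)
    then show ?thesis by (rule card_arc_zeros_same)
  qed
  have opp: "(dips J (- \<delta>) (pattern p K (window J)) \<longrightarrow> card (arc_zeros p K) = 2) \<and>
      (\<not> dips J \<delta> (pattern p K (window J)) \<longrightarrow> card (arc_zeros p K) = 0)"
    if K: "K \<in> opposite_arcs p J (\<lambda>_. True)" "K \<notin> ?La" for K
  proof -
    have KA: "K \<in> ?A" and reg: "regular p ?W K" and npat: "-1 \<in> pattern p K ?W"
      and tl: "\<bar>tail p J K (1 / 2)\<bar> < \<delta> / 2"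
      using K by (auto simp: opposite_arcs_def large_tail_arcs_def)
    interpret arc p K using regular_arc[OF p(1,2) reg] .
    have rs: "rel_sign p K (-1) = 1"
      using rel_sign_regular[OF reg, of "-1"] npat by (simp add: sg_def)
    then have "c 0 * c (-1) = -1" by (simp add: rel_sign_def)
    then have c: "c 0 = - c (-1)" using c_abs(1,2) by (auto simp: abs_if split: if_splits)
    have close: "\<bar>pi / p * (c 0 * cot_sum p K x) - model J (pattern p K (window J)) x\<bar> < \<delta>" if "0 < x" "x < 1" for x
      using cot_sum_model[OF P(1) p2 P(3) J that reg rs] small tl by simp
    have pp: "pi / p > 0" using p by simp
    show ?thesis
    proof (intro conjI impI)
      assume "dips J (- \<delta>) (pattern p K (window J))"
      then obtain y where y: "0 < y" "y < 1" "model J (pattern p K (window J)) y < - \<delta>" by (auto simp: dips_def)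
      then have "pi / p * (c 0 * cot_sum p K y) < 0" using close[OF y(1,2)] by linarith
      then have "c 0 * cot_sum p K y < 0" using pp by (simp only: mult_less_0_iff) auto
      then show "card (arc_zeros p K) = 2" by (rule card_arc_zeros_opposite(1)[OF c y(1,2)])
    next
      assume nd: "\<not> dips J \<delta> (pattern p K (window J))"
      show "card (arc_zeros p K) = 0"
      proof (rule card_arc_zeros_opposite(2)[OF c])
        fix y :: real assume y: "0 < y" "y < 1"
        then have "model J (pattern p K (window J)) y \<ge> \<delta>" using nd by (force simp: dips_def)
        then have "pi / p * (c 0 * cot_sum p K y) > 0" using close[OF y] by linarith
        then show "c 0 * cot_sum p K y > 0" using pp by (simp only: zero_less_mult_iff) auto
      qed
    qed
  qed
  have cases: "K \<in> ?Ir \<or> K \<in> ?Sa \<or> K \<in> opposite_arcs p J (\<lambda>_. True)" if "K \<in> ?A" for K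
    using that by (auto simp: irregular_arcs_def same_arcs_def opposite_arcs_def)
  have Op: "K \<in> ?Op t \<longleftrightarrow> K \<in> opposite_arcs p J (\<lambda>_. True) \<and> dips J t (pattern p K (window J))" for K t
    by (auto simp: opposite_arcs_def pat)
  have disj: "K \<in> ?Sa \<Longrightarrow> K \<notin> opposite_arcs p J (\<lambda>_. True)" for K
    by (auto simp: same_arcs_def opposite_arcs_def)
  have N: "real (card (unit_circle_zeros p)) = 1 + (\<Sum>K\<in>?A. real (card (arc_zeros p K)))"
    using card_unit_circle_zeros(1)[OF p(1) p2] by simp
  have "(\<Sum>K\<in>?A. real (card (arc_zeros p K))) \<le> (\<Sum>K\<in>?A. 2 * ?ind ?Ir K + ?ind ?Sa K + 2 * ?ind (?Op \<delta>) K + 2 * ?ind ?La K)"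
  proof (intro sum_mono)
    fix K assume K: "K \<in> ?A"
    have le2: "real (card (arc_zeros p K)) \<le> 2" using card_arc_zeros_bound[OF p(1,2) K] by simp
    show "real (card (arc_zeros p K)) \<le> 2 * ?ind ?Ir K + ?ind ?Sa K + 2 * ?ind (?Op \<delta>) K + 2 * ?ind ?La K"
    proof (cases "K \<in> ?Ir \<or> K \<in> ?La \<or> K \<in> ?Op \<delta>")
      case True
      then show ?thesis using le2 by (elim disjE) (simp_all add: add_nonneg_nonneg)
    next
      case False
      then show ?thesis using same[of K] opp[of K] cases[OF K] Op[of K \<delta>] by auto
    qed
  qed
  also have "\<dots> = 2 * real (card ?Ir) + real (card ?Sa) + 2 * real (card (?Op \<delta>)) + 2 * real (card ?La)"
    unfolding card[OF sub(1)] card[OF sub(2)] card[OF sub(3)] card[OF sub(4)] by (simp only: sum.distrib sum_distrib_left)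
  finally show "real (card (unit_circle_zeros p)) \<le> 1 + 2 * real (card ?Ir) + real (card ?Sa) + 2 * real (card (?Op \<delta>)) + 2 * real (card ?La)"
    unfolding N by simp
  have "(\<Sum>K\<in>?A. ?ind ?Sa K + 2 * ?ind (?Op (- \<delta>)) K) \<le> (\<Sum>K\<in>?A. real (card (arc_zeros p K)) + 2 * ?ind ?La K)"
  proof (intro sum_mono)
    fix K assume K: "K \<in> ?A"
    show "?ind ?Sa K + 2 * ?ind (?Op (- \<delta>)) K \<le> real (card (arc_zeros p K)) + 2 * ?ind ?La K"
      using same[of K] opp[of K] Op[of K "- \<delta>"] disj[of K] by auto
  qed
  then have "real (card ?Sa) + 2 * real (card (?Op (- \<delta>))) \<le> (\<Sum>K\<in>?A. real (card (arc_zeros p K))) + 2 * real (card ?La)"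
    unfolding card[OF sub(2)] card[OF sub(3)] card[OF sub(4)] by (simp only: sum.distrib sum_distrib_left)
  then show "real (card ?Sa) + 2 * real (card (?Op (- \<delta>))) \<le> real (card (unit_circle_zeros p)) + 2 * real (card ?La)"
    unfolding N by simp
qed

text \<open>The sign at the index $-1$ is one more fair coin, which accounts for the factor $1/2$.\<close>
lemma opposite_arcs_tendsto:
  "((\<lambda>p. card (opposite_arcs p J h) / p) \<longlongrightarrow> sprob (window J) h / 2) odd_primes_at_top"
  using pattern_equidistributed[of "insert (-1) (window J)" "\<lambda>A. -1 \<in> A \<and> h (A - {-1})"]
  by (simp add: opposite_arcs_def sprob_insert)

lemma same_arcs_tendsto:
  "((\<lambda>p. card (same_arcs p J) / p) \<longlongrightarrow> 1 / 2) odd_primes_at_top"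
proof -
  have 1: "((\<lambda>p. card {K \<in> {0..<int p}. regular p (insert (-1) (window J)) K \<and> True} / p) \<longlongrightarrow> sprob (insert (-1) (window J)) (\<lambda>_. True)) odd_primes_at_top"
    by (intro pattern_equidistributed[of "insert (-1) (window J)" "\<lambda>_. True"]) auto
  have t: "sprob W (\<lambda>_. True) = 1" if "finite W" for W
    using avg_const[OF that, of 1] by (simp add: sprob_def)
  have "real (card {K \<in> {0..<int p}. regular p (insert (-1) (window J)) K \<and> True}) / p
      = card (same_arcs p J) / p + card (opposite_arcs p J (\<lambda>_. True)) / p" for p
  proof -
    have "{K \<in> {0..<int p}. regular p (insert (-1) (window J)) K \<and> True} = same_arcs p J \<union> opposite_arcs p J (\<lambda>_. True)"
      by (auto simp: same_arcs_def opposite_arcs_def)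
    moreover have "card (same_arcs p J \<union> opposite_arcs p J (\<lambda>_. True)) = card (same_arcs p J) + card (opposite_arcs p J (\<lambda>_. True))"
      by (intro card_Un_disjoint) (auto simp: same_arcs_def opposite_arcs_def intro: finite_subset[of _ "{0..<int p}"])
    ultimately show ?thesis by (simp add: add_divide_distrib)
  qed
  then have "((\<lambda>p. (card (same_arcs p J) / p + card (opposite_arcs p J (\<lambda>_. True)) / p) - card (opposite_arcs p J (\<lambda>_. True)) / p) \<longlongrightarrow> 1 - 1 / 2) odd_primes_at_top"
    using tendsto_diff[OF 1 opposite_arcs_tendsto[of J "\<lambda>_. True"]] t by simp
  then show ?thesis by simp
qed

text \<open>Equidistribution for a fixed window, together with the second moment of the tail and the anticoncentration at the
  scale $\delta$.\<close>
lemma zero_density_approx: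
  fixes \<delta> :: real
  assumes J: "J \<ge> 1" "4 ^ n \<le> J" and d: "\<delta> = 1 / 4 ^ Suc n" and small: "3 / J \<le> \<delta> / 4" "40 / (J * \<delta>\<^sup>2) \<le> 1 / 2 ^ n"
  shows "\<forall>\<^sub>F p in odd_primes_at_top. \<bar>card (unit_circle_zeros p) / p - (1 / 2 + sprob (window J) (dips J 0))\<bar> \<le> 4 / 2 ^ n"
proof -
  let ?D = "\<lambda>t. sprob (window J) (dips J t)" and ?e = "1 / 2 ^ n :: real"
  have d0: "\<delta> > 0" using d by simp
  have D: "?D (- \<delta>) \<le> ?D 0" "?D 0 \<le> ?D \<delta>" "?D \<delta> \<le> ?D (- \<delta>) + ?e"
    using sprob_dips_gap[OF J(2)] d0 by (auto simp: d intro!: sprob_mono elim: dips_mono[rotated])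
  have e0: "?e / 4 > 0" by simp
  have ev1: "\<forall>\<^sub>F p in odd_primes_at_top. \<bar>card (same_arcs p J) / p - 1 / 2\<bar> < ?e / 4"
    using tendstoD[OF same_arcs_tendsto e0] by (simp add: dist_real_def)
  have ev2: "\<forall>\<^sub>F p in odd_primes_at_top. \<bar>card (opposite_arcs p J (dips J t)) / p - ?D t / 2\<bar> < ?e / 4" for t
    using tendstoD[OF opposite_arcs_tendsto e0] by (simp add: dist_real_def)
  define w where "w = card (insert (-1) (window J))"
  have ev3: "\<forall>\<^sub>F p in odd_primes_at_top. dist ((1 + 2 * (real w + 1)) / real p) 0 < ?e / 4"
    by (rule tendstoD[OF odd_primes_at_top_divide_to_0 e0])
  obtain P0 :: nat where P0: "real P0 > 80 * (real J + 1)\<^sup>2 / \<delta>" using reals_Archimedean2 by blast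
  show ?thesis
    using ev1 ev2[of \<delta>] ev2[of "- \<delta>"] ev3 eventually_prime_ge[of "11 + 4 * (J + 1) + P0"]
  proof eventually_elim
    case (elim p)
    have p: "prime p" "p \<ge> 11" "p \<ge> 4 * (J + 1)" "p > 2" using elim(5) by auto
    have pr: "real p \<ge> 1" using p by simp
    have sm: "3 / J + 20 * (real J + 1)\<^sup>2 / (real p)\<^sup>2 \<le> \<delta> / 2"
    proof -
      have "real P0 \<le> p" using elim(5) by simp
      then have "80 * (real J + 1)\<^sup>2 / \<delta> \<le> p" using P0 by linarith
      then have "80 * (real J + 1)\<^sup>2 \<le> p * \<delta>" using d0 by (simp add: field_simps)
      also have "\<dots> \<le> p * p * \<delta>" using pr d0 by (intro mult_right_mono) auto
      finally have "20 * (real J + 1)\<^sup>2 / (real p)\<^sup>2 \<le> \<delta> / 4" using pr by (simp add: power2_eq_square divide_le_eq field_simps)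
      then show ?thesis using small(1) by linarith
    qed
    have tl: "real (card (large_tail_arcs p J (\<delta> / 2))) / p \<le> ?e / 2"
    proof -
      have "real (card (large_tail_arcs p J (\<delta> / 2))) \<le> 5 * p / (J * (\<delta> / 2)\<^sup>2)"
        unfolding large_tail_arcs_def using card_large_tail[OF p(1,4) J(1), of "\<delta> / 2"] d0 by simp
      also have "\<dots> = p * ((40 / (J * \<delta>\<^sup>2)) / 2)" by (simp add: power2_eq_square mult_ac)
      also have "\<dots> \<le> p * (?e / 2)" using small(2) by (intro mult_left_mono divide_right_mono) auto
      finally show ?thesis using pr by (simp add: divide_le_eq mult.commute)
    qed
    have ir: "(1 + 2 * real (card (irregular_arcs p J))) / p \<le> ?e / 4"
    proof -
      have "card (irregular_arcs p J) \<le> w + 1"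
        unfolding irregular_arcs_def w_def using p by (intro card_irregular) auto
      then have "(1 + 2 * real (card (irregular_arcs p J))) / p \<le> (1 + 2 * (real w + 1)) / real p" by (intro divide_right_mono) auto
      then show ?thesis using elim(4) unfolding dist_real_def diff_0_right by (rule order_trans[OF _ less_imp_le[OF le_less_trans[OF abs_ge_self]]])
    qed
    have u: "card (unit_circle_zeros p) / p \<le> (1 + 2 * real (card (irregular_arcs p J))) / p + card (same_arcs p J) / p
      + 2 * (card (opposite_arcs p J (dips J \<delta>)) / p) + 2 * (real (card (large_tail_arcs p J (\<delta> / 2))) / p)"
      using divide_right_mono[OF zero_count_bounds(1)[OF p(1-3) J(1) d0 sm], of "real p"] by (simp add: add_divide_distrib)
    have l: "card (same_arcs p J) / p + 2 * (card (opposite_arcs p J (dips J (- \<delta>))) / p)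
      \<le> card (unit_circle_zeros p) / p + 2 * (real (card (large_tail_arcs p J (\<delta> / 2))) / p)"
      using divide_right_mono[OF zero_count_bounds(2)[OF p(1-3) J(1) d0 sm], of "real p"] by (simp add: add_divide_distrib)
    have combine: "\<bar>N - (1 / 2 + D0)\<bar> \<le> 4 * e"
      if "\<bar>Sa - 1 / 2\<bar> < e / 4" "\<bar>O1 - D1 / 2\<bar> < e / 4" "\<bar>O2 - D2 / 2\<bar> < e / 4" "La \<le> e / 2" "Ir \<le> e / 4"
        "N \<le> Ir + Sa + 2 * O1 + 2 * La" "Sa + 2 * O2 \<le> N + 2 * La" "D2 \<le> D0" "D0 \<le> D1" "D1 \<le> D2 + e"
      for Sa O1 O2 La Ir N D0 D1 D2 e :: real
      using that by linarith
    show ?case using combine[OF elim(1-3) tl ir u l D] by simp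
  qed
qed

lemma odd_primes_at_top_neq_bot: "odd_primes_at_top \<noteq> bot"
  unfolding trivial_limit_def eventually_odd_primes_at_top
proof
  assume "\<exists>N. \<forall>p\<ge>N. prime (p :: nat) \<longrightarrow> p > 2 \<longrightarrow> False"
  then obtain N where N: "\<And>p :: nat. p \<ge> N \<Longrightarrow> prime p \<Longrightarrow> p > 2 \<Longrightarrow> False" by blast
  obtain p where "prime p" "p > N + 2" using bigger_prime by blast
  then show False using N[of p] by simp
qed

text \<open>Two approximations are close to each other because both are close to $f$ at a common argument; hence the
  approximating constants form a Cauchy sequence.\<close>
lemma convergent_of_eventual_approximations:
  fixes f :: "'a \<Rightarrow> real" and a e :: "nat \<Rightarrow> real"
  assumes F: "F \<noteq> bot" and e: "e \<longlonglongrightarrow> 0"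
    and ev: "\<And>n. \<forall>\<^sub>F p in F. \<bar>f p - a n\<bar> \<le> e n"
  obtains \<kappa> where "(f \<longlongrightarrow> \<kappa>) F" "a \<longlonglongrightarrow> \<kappa>"
proof -
  have ae: "\<bar>a m - a n\<bar> \<le> e m + e n" for m n
  proof -
    have "\<forall>\<^sub>F p in F. \<bar>a m - a n\<bar> \<le> e m + e n" using ev[of m] ev[of n] by eventually_elim linarith
    then show ?thesis using F by simp
  qed
  have "Cauchy a"
  proof (rule metric_CauchyI)
    fix \<epsilon> :: real assume "\<epsilon> > 0"
    then have "\<epsilon> / 2 > 0" by simp
    from LIMSEQ_D[OF e this] obtain N where N: "\<And>n. n \<ge> N \<Longrightarrow> \<bar>e n\<bar> < \<epsilon> / 2" by auto
    show "\<exists>N. \<forall>m\<ge>N. \<forall>n\<ge>N. dist (a m) (a n) < \<epsilon>"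
    proof (intro exI[of _ N] allI impI)
      fix m n assume "m \<ge> N" "n \<ge> N"
      then show "dist (a m) (a n) < \<epsilon>" using ae[of m n] N[of m] N[of n] by (simp add: dist_real_def)
    qed
  qed
  then obtain \<kappa> where k: "a \<longlonglongrightarrow> \<kappa>" by (auto simp: Cauchy_convergent_iff convergent_def)
  have "(f \<longlongrightarrow> \<kappa>) F"
  proof (rule tendstoI)
    fix \<epsilon> :: real assume "\<epsilon> > 0"
    then have e2: "\<epsilon> / 2 > 0" by simp
    obtain N1 where N1: "\<And>n. n \<ge> N1 \<Longrightarrow> \<bar>e n\<bar> < \<epsilon> / 2" using LIMSEQ_D[OF e e2] by auto
    obtain N2 where N2: "\<And>n. n \<ge> N2 \<Longrightarrow> \<bar>a n - \<kappa>\<bar> < \<epsilon> / 2" using LIMSEQ_D[OF k e2] by auto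
    let ?n = "max N1 N2"
    show "\<forall>\<^sub>F p in F. dist (f p) \<kappa> < \<epsilon>"
      using ev[of ?n]
    proof eventually_elim
      case (elim p)
      have "\<bar>e ?n\<bar> < \<epsilon> / 2" "\<bar>a ?n - \<kappa>\<bar> < \<epsilon> / 2" using N1[of ?n] N2[of ?n] by auto
      moreover have "\<bar>f p - \<kappa>\<bar> \<le> \<bar>f p - a ?n\<bar> + \<bar>a ?n - \<kappa>\<bar>"
        using abs_triangle_ineq[of "f p - a ?n" "a ?n - \<kappa>"] by simp
      ultimately show ?case using elim unfolding dist_real_def by linarith
    qed
  qed
  then show ?thesis using that k by blast
qed

text \<open>With $\delta = 4^{-n-1}$ the window must be large compared with $1/\delta$, for the variation of the tail, and
  with $2^n/\delta^2$, for its second moment; $32^n$ is the order of the latter.\<close>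
definition window_size :: "nat \<Rightarrow> nat" where "window_size n = 1000 * 32 ^ n"

lemma zero_density_limit:
  obtains \<kappa> where "((\<lambda>p. card (unit_circle_zeros p) / p) \<longlongrightarrow> \<kappa>) odd_primes_at_top"
    "(\<lambda>n. 1 / 2 + sprob (window (window_size n)) (dips (window_size n) 0)) \<longlonglongrightarrow> \<kappa>"
proof (rule convergent_of_eventual_approximations[OF odd_primes_at_top_neq_bot,
    where f = "\<lambda>p. card (unit_circle_zeros p) / p" and e = "\<lambda>n. 4 / 2 ^ n"
      and a = "\<lambda>n. 1 / 2 + sprob (window (window_size n)) (dips (window_size n) 0)"])
  show "(\<lambda>n. 4 / 2 ^ n :: real) \<longlonglongrightarrow> 0" by (rule LIMSEQ_divide_realpow_zero) simp
  fix n
  let ?J = "window_size n" and ?d = "1 / 4 ^ Suc n :: real"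
  have J: "real ?J = 1000 * 32 ^ n" by (simp add: window_size_def)
  have p432: "(4::real) ^ n \<le> 32 ^ n" by (intro power_mono) auto
  show "\<forall>\<^sub>F p in odd_primes_at_top. \<bar>card (unit_circle_zeros p) / p - (1 / 2 + sprob (window ?J) (dips ?J 0))\<bar> \<le> 4 / 2 ^ n"
  proof (rule zero_density_approx)
    show "1 \<le> ?J" by (simp add: window_size_def)
    have "(4::nat) ^ n \<le> 32 ^ n" by (intro power_mono) auto
    then show "4 ^ n \<le> ?J" by (simp add: window_size_def)
    show "?d = 1 / 4 ^ Suc n" ..
    have "3 / (1000 * 32 ^ n) \<le> 3 / (1000 * (4::real) ^ n)" using p432 by (intro divide_left_mono) auto
    also have "\<dots> \<le> ?d / 4" by (simp add: divide_simps)
    finally show "3 / real ?J \<le> ?d / 4" by (simp only: J)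
    have "32 ^ n * ?d\<^sup>2 = (2 ^ n / 16 :: real)"
    proof -
      have "(32::real) ^ n = 2 ^ n * (4 ^ n * 4 ^ n)" by (simp flip: power_mult_distrib)
      then show ?thesis by (simp add: power2_eq_square)
    qed
    then have "real ?J * ?d\<^sup>2 = 1000 / 16 * 2 ^ n" unfolding J by (simp only: mult.assoc)
    then show "40 / (real ?J * ?d\<^sup>2) \<le> 1 / 2 ^ n" by (simp only:) (simp add: divide_simps)
  qed
qed (use that in blast)

section \<open>Moments of random signed sums and the square wave\<close>

lemma avg_insert:
  assumes "finite W" "j \<notin> W"
  shows "avg (insert j W) g = avg W (\<lambda>A. (g A + g (insert j A)) / 2)"
proof -
  have "(\<Sum>A\<in>Pow (insert j W). g A) = (\<Sum>A\<in>Pow W. g A) + (\<Sum>A\<in>insert j ` Pow W. g A)"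
    unfolding Pow_insert using assms by (intro sum.union_disjoint) auto
  also have "(\<Sum>A\<in>insert j ` Pow W. g A) = (\<Sum>A\<in>Pow W. g (insert j A))"
  proof -
    have "inj_on (insert j) (Pow W)"
      using assms by (intro inj_onI) (metis Diff_insert_absorb PowD subsetD)
    then show ?thesis by (simp add: sum.reindex)
  qed
  finally show ?thesis using assms
    by (simp add: avg_def sum.distrib add_divide_distrib flip: sum_divide_distrib)
qed

definition ssum :: "int set \<Rightarrow> (int \<Rightarrow> real) \<Rightarrow> int set \<Rightarrow> real" where
  "ssum W w A = (\<Sum>i\<in>W. sg A i * w i)"

lemma avg_cong: "(\<And>A. A \<subseteq> W \<Longrightarrow> g A = g' A) \<Longrightarrow> avg W g = avg W g'"
  unfolding avg_def by (intro arg_cong2[of _ _ _ _ "(/)"] sum.cong) auto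

lemma avg_cos_ssum: "finite W \<Longrightarrow> avg W (\<lambda>A. cos (t * ssum W w A)) = (\<Prod>i\<in>W. cos (t * w i))"
proof (induction W rule: finite_induct)
  case empty
  show ?case by (simp add: avg_def ssum_def)
next
  case (insert j W)
  have s: "ssum (insert j W) w A = ssum W w A - w j" "ssum (insert j W) w (insert j A) = ssum W w A + w j"
    if "A \<subseteq> W" for A
  proof -
    have "j \<notin> A" using that insert.hyps by blast
    then show "ssum (insert j W) w A = ssum W w A - w j" using insert.hyps by (simp add: ssum_def sg_def)
    have "(\<Sum>i\<in>W. sg (insert j A) i * w i) = (\<Sum>i\<in>W. sg A i * w i)"
      using insert.hyps by (intro sum.cong) (auto simp: sg_def)
    then show "ssum (insert j W) w (insert j A) = ssum W w A + w j" using insert.hyps by (simp add: ssum_def sg_def)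
  qed
  have "avg (insert j W) (\<lambda>A. cos (t * ssum (insert j W) w A))
    = avg W (\<lambda>A. (cos (t * ssum (insert j W) w A) + cos (t * ssum (insert j W) w (insert j A))) / 2)"
    by (rule avg_insert[OF insert.hyps])
  also have "\<dots> = avg W (\<lambda>A. cos (t * w j) * cos (t * ssum W w A))"
    by (rule avg_cong) (simp add: s right_diff_distrib distrib_left cos_diff cos_add)
  also have "\<dots> = cos (t * w j) * (\<Prod>i\<in>W. cos (t * w i))" by (simp only: avg_cmult insert.IH)
  finally show ?case using insert.hyps by simp
qed

text \<open>The quotient decreases on the positive axis because $\sinh y \le y \cosh y$.\<close>
lemma cosh_le_exp_square: "cosh x \<le> exp (x\<^sup>2 / 2)" for x :: real
proof -
  have main: "cosh x \<le> exp (x\<^sup>2 / 2)" if "x \<ge> 0" for x :: real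
  proof -
    have sc: "sinh y \<le> y * cosh y" if "y \<ge> 0" for y :: real
    proof -
      have "0 * cosh 0 - sinh 0 \<le> y * cosh y - sinh (y :: real)"
      proof (rule DERIV_nonneg_imp_nondecreasing[OF that])
        fix z :: real assume z: "0 \<le> z" "z \<le> y"
        have "DERIV (\<lambda>y. y * cosh y - sinh y) z :> z * sinh z"
          by (auto intro!: derivative_eq_intros)
        then show "\<exists>d. DERIV (\<lambda>y. y * cosh y - sinh y) z :> d \<and> d \<ge> 0" using z by auto
      qed
      then show ?thesis by simp
    qed
    have "cosh x * exp (- (x\<^sup>2 / 2)) \<le> cosh 0 * exp (- (0\<^sup>2 / 2))"
    proof (rule DERIV_nonpos_imp_nonincreasing[OF that])
      fix z :: real assume z: "0 \<le> z" "z \<le> x"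
      have "DERIV (\<lambda>x. cosh x * exp (- (x\<^sup>2 / 2))) z :> (sinh z - z * cosh z) * exp (- (z\<^sup>2 / 2))"
        by (auto intro!: derivative_eq_intros simp: algebra_simps)
      moreover have "(sinh z - z * cosh z) * exp (- (z\<^sup>2 / 2)) \<le> 0" using sc[OF z(1)] by (intro mult_nonpos_nonneg) auto
      ultimately show "\<exists>d. DERIV (\<lambda>x. cosh x * exp (- (x\<^sup>2 / 2))) z :> d \<and> d \<le> 0" by blast
    qed
    then show ?thesis by (simp add: exp_minus field_simps)
  qed
  show ?thesis using main[of x] main[of "-x"] by (cases "x \<ge> 0") auto
qed

lemma avg_exp_ssum: "finite W \<Longrightarrow> avg W (\<lambda>A. exp (t * ssum W w A)) = (\<Prod>i\<in>W. cosh (t * w i))"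
proof -
  assume W: "finite W"
  have "avg W (\<lambda>A. exp (t * ssum W w A)) = avg W (\<lambda>A. \<Prod>i\<in>W. exp (t * ((if i \<in> A then 1 else -1) * w i)))"
    using W by (intro avg_cong) (simp add: ssum_def sum_distrib_left exp_sum sg_def)
  also have "\<dots> = (\<Prod>i\<in>W. (exp (t * ((if True then 1 else -1) * w i)) + exp (t * ((if False then 1 else -1) * w i))) / 2)"
    by (rule avg_prod[OF W])
  finally show ?thesis by (simp add: cosh_def)
qed

lemma ssum_complement: "A \<subseteq> W \<Longrightarrow> ssum W w (W - A) = - ssum W w A"
  unfolding ssum_def sum_negf[symmetric] by (intro sum.cong) (auto simp: sg_def)

lemma avg_complement: "avg W (\<lambda>A. g (W - A)) = avg W g"
proof -
  have "(\<Sum>A\<in>Pow W. g (W - A)) = (\<Sum>A\<in>Pow W. g A)"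
    by (rule sum.reindex_bij_witness[of _ "\<lambda>A. W - A" "\<lambda>A. W - A"]) (auto simp: double_diff)
  then show ?thesis by (simp add: avg_def)
qed

lemma sprob_ssum_symmetric: "sprob W (\<lambda>A. ssum W w A > c) = sprob W (\<lambda>A. ssum W w A < - c)"
proof -
  have "sprob W (\<lambda>A. ssum W w A < - c) = avg W (\<lambda>A. if ssum W w (W - A) < - c then 1 else 0)"
    unfolding sprob_def by (rule avg_complement[symmetric])
  also have "\<dots> = sprob W (\<lambda>A. ssum W w A > c)"
    unfolding sprob_def by (rule avg_cong) (auto simp: ssum_complement)
  finally show ?thesis ..
qed

text \<open>Markov's inequality for the exponential moment.\<close>
lemma chernoff_ssum:
  assumes W: "finite W" and t: "t \<ge> 0"
  shows "sprob W (\<lambda>A. ssum W w A \<le> - c) \<le> exp (- (t * c)) * (\<Prod>i\<in>W. cosh (t * w i))"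
    and "sprob W (\<lambda>A. ssum W w A \<ge> c) \<le> exp (- (t * c)) * (\<Prod>i\<in>W. cosh (t * w i))"
proof -
  have "sprob W (\<lambda>A. ssum W w A \<ge> c) \<le> avg W (\<lambda>A. exp (- (t * c)) * exp (t * ssum W w A))"
    unfolding sprob_def using t by (intro avg_mono) (auto simp: mult_left_mono simp flip: exp_add)
  then show "sprob W (\<lambda>A. ssum W w A \<ge> c) \<le> exp (- (t * c)) * (\<Prod>i\<in>W. cosh (t * w i))"
    by (simp only: avg_cmult avg_exp_ssum[OF W])
  have "sprob W (\<lambda>A. ssum W w A \<le> - c) \<le> avg W (\<lambda>A. exp (- (t * c)) * exp (- t * ssum W w A))"
    unfolding sprob_def using t mult_left_mono[of _ "- c" t] by (intro avg_mono) (auto simp flip: exp_add)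
  then show "sprob W (\<lambda>A. ssum W w A \<le> - c) \<le> exp (- (t * c)) * (\<Prod>i\<in>W. cosh (t * w i))"
    by (simp only: avg_cmult avg_exp_ssum[OF W]) simp
qed

text \<open>Partial sum of the Fourier series of the square wave with the values $\pm\pi/4$.\<close>
definition square_wave :: "nat \<Rightarrow> real \<Rightarrow> real" where
  "square_wave M x = (\<Sum>m<M. (-1) ^ m * cos (real (2 * m + 1) * x) / real (2 * m + 1))"

text \<open>Multiplication by $2 \cos x$ makes the sum telescope.\<close>
lemma alternating_sine_sum:
  "2 * cos x * (\<Sum>m<M. (-1) ^ m * sin (real (2 * m + 1) * x)) = - ((-1) ^ M) * sin (2 * real M * x)"
proof (induction M)
  case (Suc M)
  have "2 * cos x * sin (real (2 * M + 1) * x) = sin (2 * real (Suc M) * x) + sin (2 * real M * x)"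
  proof -
    have e: "2 * real (Suc M) * x = real (2 * M + 1) * x + x" "2 * real M * x = real (2 * M + 1) * x - x"
      by (simp_all add: algebra_simps)
    show ?thesis unfolding e sin_add sin_diff by simp
  qed
  then have "2 * cos x * ((-1) ^ M * sin (real (2 * M + 1) * x)) = (-1) ^ M * (sin (2 * real (Suc M) * x) + sin (2 * real M * x))"
    by (simp only: mult.left_commute mult.assoc)
  then show ?case using Suc by (simp only: sum.lessThan_Suc distrib_left) (simp add: algebra_simps)
qed simp

lemma square_wave_deriv:
  assumes "cos x \<noteq> 0"
  shows "DERIV (square_wave M) x :> (-1) ^ M * sin (2 * real M * x) / (2 * cos x)"
proof -
  have "DERIV (\<lambda>x. (-1) ^ m * cos (real (2 * m + 1) * x) / real (2 * m + 1)) x :> - ((-1) ^ m * sin (real (2 * m + 1) * x))" for m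
    by (rule derivative_eq_intros refl | simp)+
  then have "DERIV (\<lambda>x. \<Sum>m<M. (-1) ^ m * cos (real (2 * m + 1) * x) / real (2 * m + 1)) x
     :> (\<Sum>m<M. - ((-1) ^ m * sin (real (2 * m + 1) * x)))"
    by (intro DERIV_sum)
  moreover have "(\<Sum>m<M. - ((-1) ^ m * sin (real (2 * m + 1) * x))) = (-1) ^ M * sin (2 * real M * x) / (2 * cos x)"
    using alternating_sine_sum[of x M] assms by (simp add: sum_negf field_simps)
  ultimately show ?thesis by (simp add: square_wave_def[abs_def])
qed

text \<open>Adding the leading oscillating term of an integration by parts makes the derivative as small as that of
  $1/(4 M \cos x)$.\<close>
lemma square_wave_near_centre:
  assumes x: "0 \<le> x" "x < pi / 2" and M: "M \<ge> 1"
  shows "\<bar>square_wave M x - square_wave M 0\<bar> \<le> 1 / (2 * real M * cos x)"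
proof -
  define H where "H x = square_wave M x + (-1) ^ M * cos (2 * real M * x) / (4 * real M * cos x)" for x
  define L where "L x = 1 / (4 * real M * cos x)" for x :: real
  have cpos: "cos y > 0" if "0 \<le> y" "y \<le> x" for y using that x by (intro cos_gt_zero_pi) auto
  have Mr: "real M > 0" using M by simp
  have dH: "DERIV H y :> (-1) ^ M * cos (2 * real M * y) * sin y / (4 * real M * (cos y)\<^sup>2)" if "0 \<le> y" "y \<le> x" for y
  proof -
    have c: "cos y \<noteq> 0" using cpos[OF that] by simp
    have "DERIV (\<lambda>x. (-1) ^ M * cos (2 * real M * x) / (4 * real M * cos x)) y
       :> (-1) ^ M * cos (2 * real M * y) * sin y / (4 * real M * (cos y)\<^sup>2) - (-1) ^ M * sin (2 * real M * y) / (2 * cos y)"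
      using c Mr by (auto intro!: derivative_eq_intros simp: divide_simps power2_eq_square) (simp add: algebra_simps)
    from DERIV_add[OF square_wave_deriv[OF c, of M] this] show ?thesis by (simp add: H_def[abs_def])
  qed
  have dL: "DERIV L y :> sin y / (4 * real M * (cos y)\<^sup>2)" if "0 \<le> y" "y \<le> x" for y
    unfolding L_def[abs_def] using cpos[OF that] Mr
    by (auto intro!: derivative_eq_intros simp: divide_simps power2_eq_square)
  have bound: "\<bar>(-1) ^ M * cos (2 * real M * y) * sin y / (4 * real M * (cos y)\<^sup>2)\<bar> \<le> sin y / (4 * real M * (cos y)\<^sup>2)"
    if "0 \<le> y" "y \<le> x" for y
  proof -
    have "0 \<le> sin y" using that x by (intro sin_ge_zero) auto
    then show ?thesis using Mr by (simp add: abs_mult abs_divide power_abs divide_right_mono mult_left_le_one_le)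
  qed
  have "L 0 + H 0 \<le> L x + H x"
  proof (rule DERIV_nonneg_imp_nondecreasing[OF x(1)])
    fix y assume y: "0 \<le> y" "y \<le> x"
    show "\<exists>d. DERIV (\<lambda>a. L a + H a) y :> d \<and> d \<ge> 0"
      using DERIV_add[OF dL[OF y] dH[OF y]] bound[OF y] by (intro exI conjI) (assumption, linarith)
  qed
  moreover have "L 0 - H 0 \<le> L x - H x"
  proof (rule DERIV_nonneg_imp_nondecreasing[OF x(1)])
    fix y assume y: "0 \<le> y" "y \<le> x"
    show "\<exists>d. DERIV (\<lambda>a. L a - H a) y :> d \<and> d \<ge> 0"
      using DERIV_diff[OF dL[OF y] dH[OF y]] bound[OF y] by (intro exI conjI) (assumption, linarith)
  qed
  ultimately have HL: "\<bar>H x - H 0\<bar> \<le> L x - L 0" by linarith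
  have c0: "cos x > 0" by (rule cpos[OF x(1) order_refl])
  have a: "\<bar>(-1) ^ M * cos (2 * real M * x) / (4 * real M * cos x)\<bar> \<le> L x"
    unfolding L_def using c0 Mr by (simp add: abs_mult abs_divide power_abs divide_right_mono)
  have b: "\<bar>(-1) ^ M * cos (2 * real M * 0) / (4 * real M * cos 0)\<bar> \<le> L 0"
    unfolding L_def using Mr by (simp add: abs_mult abs_divide power_abs)
  have "L x + L x = 1 / (2 * real M * cos x)" by (simp add: L_def)
  moreover have "H x = square_wave M x + (-1) ^ M * cos (2 * real M * x) / (4 * real M * cos x)"
    "H 0 = square_wave M 0 + (-1) ^ M * cos (2 * real M * 0) / (4 * real M * cos 0)" by (simp_all only: H_def)
  ultimately show ?thesis using HL a b by linarith
qed

lemma square_wave_0_tendsto: "(\<lambda>M. square_wave M 0) \<longlonglongrightarrow> pi / 4"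
proof -
  have "(\<lambda>k. (-1) ^ k * (1 / real (k * 2 + 1) * 1 ^ (k * 2 + 1))) sums arctan (1 :: real)"
    using summable_arctan_series[of 1] arctan_series[of 1] by (simp add: sums_iff)
  then have "(\<lambda>k. (-1) ^ k * (1 / real (k * 2 + 1))) sums (pi / 4)" by (simp add: arctan_one)
  then show ?thesis unfolding sums_def square_wave_def by (simp add: mult.commute)
qed

lemma square_wave_minus: "square_wave M (- x) = square_wave M x"
  by (simp add: square_wave_def)

lemma square_wave_reflect: "square_wave M (pi - x) = - square_wave M x"
proof -
  have "cos (real (2 * m + 1) * (pi - x)) = - cos (real (2 * m + 1) * x)" for m
  proof -
    have "real (2 * m + 1) * (pi - x) = (pi - real (2 * m + 1) * x) + (2 * pi) * of_int (int m)" by (simp add: algebra_simps)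
    then have "cos (real (2 * m + 1) * (pi - x)) = cos (pi - real (2 * m + 1) * x)"
      by (simp only: cos_add cos_int_2pin sin_int_2pin mult_1_right mult_zero_right diff_0_right)
    then show ?thesis by simp
  qed
  then show ?thesis by (simp add: square_wave_def sum_negf)
qed

lemma square_wave_periodic: "square_wave M (x + (2 * pi) * of_int n) = square_wave M x"
proof -
  have "cos (real (2 * m + 1) * (x + (2 * pi) * of_int n)) = cos (real (2 * m + 1) * x)" for m
  proof -
    have "real (2 * m + 1) * (x + (2 * pi) * of_int n) = real (2 * m + 1) * x + (2 * pi) * of_int (int (2 * m + 1) * n)"
      by (simp add: algebra_simps)
    then show ?thesis by (simp only: cos_add cos_int_2pin sin_int_2pin mult_1_right mult_zero_right diff_0_right)
  qed
  then show ?thesis by (simp only: square_wave_def)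
qed

lemma square_wave_0_le: "\<bar>square_wave M 0\<bar> \<le> 1"
proof -
  have "0 \<le> square_wave (2 * k) 0 \<and> square_wave (2 * k) 0 + 1 / real (4 * k + 1) \<le> 1" for k
  proof (induction k)
    case 0
    show ?case by (simp add: square_wave_def)
  next
    case (Suc k)
    have "square_wave (2 * Suc k) 0 = square_wave (2 * k) 0 + 1 / real (4 * k + 1) - 1 / real (4 * k + 3)"
      by (simp add: square_wave_def algebra_simps)
    moreover have "1 / real (4 * k + 3) \<le> 1 / real (4 * k + 1)" by (intro divide_left_mono) auto
    moreover have "1 / real (4 * Suc k + 1) \<le> 1 / real (4 * k + 3)" by (intro divide_left_mono) auto
    ultimately show ?case using Suc by linarith
  qed
  note even = this
  show ?thesis
  proof (cases "even M")
    case True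
    then obtain k where k: "M = 2 * k" by (elim evenE)
    have "0 \<le> 1 / real (4 * k + 1)" by simp
    then show ?thesis using even[of k] unfolding k by linarith
  next
    case False
    then obtain k where k: "M = 2 * k + 1" by (elim oddE)
    have "square_wave M 0 = square_wave (2 * k) 0 + 1 / real (4 * k + 1)"
      unfolding k by (simp add: square_wave_def)
    moreover have "0 \<le> 1 / real (4 * k + 1)" by simp
    ultimately show ?thesis using even[of k] by linarith
  qed
qed

text \<open>Where $M \cos x$ is at least $1$ the approximation near the centre applies; closer to the jump every term of the sum is
  at most the distance to the jump.\<close>
lemma square_wave_bounded: "\<bar>square_wave M x\<bar> \<le> 2"
proof (cases "M = 0")
  case False
  then have M: "M \<ge> 1" by simp
  have quarter: "\<bar>square_wave M x\<bar> \<le> 2" if x: "0 \<le> x" "x \<le> pi / 2" for x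
  proof (cases "real M * cos x \<ge> 1")
    case True
    then have "cos x > 0" using M by (smt (verit) mult_nonneg_nonpos of_nat_0_le_iff)
    then have "x \<noteq> pi / 2" by (metis cos_pi_half less_irrefl)
    then have "\<bar>square_wave M x - square_wave M 0\<bar> \<le> 1 / (2 * real M * cos x)"
      using x M by (intro square_wave_near_centre) auto
    also have "\<dots> \<le> 1 / 2"
    proof -
      have "1 / (2 * (real M * cos x)) \<le> 1 / (2 * 1)" using True by (intro divide_left_mono) auto
      then show ?thesis by (simp add: mult.assoc)
    qed
    finally show ?thesis using square_wave_0_le[of M] by linarith
  next
    case False
    define y where "y = pi / 2 - x"
    have y: "0 \<le> y" "y \<le> pi / 2" using x by (auto simp: y_def)
    have "2 / pi * y \<le> cos x" using jordan_sin[OF y] by (simp add: y_def sin_diff)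
    then have "real M * (2 / pi * y) \<le> real M * cos x" by (intro mult_left_mono) auto
    then have "real M * (2 / pi * y) \<le> 1" using False by linarith
    then have My: "real M * y \<le> pi / 2" by (simp add: field_simps)
    have "\<bar>square_wave M x\<bar> \<le> (\<Sum>m<M. \<bar>(-1) ^ m * cos (real (2 * m + 1) * x) / real (2 * m + 1)\<bar>)"
      unfolding square_wave_def by (rule sum_abs)
    also have "\<dots> \<le> (\<Sum>m<M. y)"
    proof (intro sum_mono)
      fix m
      have "real (2 * m + 1) * x = - (real (2 * m + 1) * y) + (pi / 2 + real m * pi)"
        by (simp add: y_def algebra_simps)
      moreover have "cos (pi / 2 + real m * pi) = 0" by (simp add: cos_add sin_npi)
      ultimately have "\<bar>cos (real (2 * m + 1) * x)\<bar> = \<bar>sin (real (2 * m + 1) * y)\<bar> * \<bar>sin (pi / 2 + real m * pi)\<bar>"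
        by (simp only: cos_add sin_minus mult_zero_right diff_0 abs_minus_cancel abs_mult mult_minus_left minus_minus) 
      also have "\<dots> \<le> \<bar>real (2 * m + 1) * y\<bar> * 1" by (intro mult_mono abs_sin_x_le_abs_x) auto
      finally have "\<bar>cos (real (2 * m + 1) * x)\<bar> \<le> real (2 * m + 1) * y" using y by simp
      then show "\<bar>(-1) ^ m * cos (real (2 * m + 1) * x) / real (2 * m + 1)\<bar> \<le> y"
        by (simp add: abs_mult power_abs divide_le_eq mult.commute)
    qed
    also have "\<dots> = real M * y" by simp
    finally show ?thesis using My pi_less_4 by linarith
  qed
  have half: "\<bar>square_wave M x\<bar> \<le> 2" if x: "0 \<le> x" "x \<le> pi" for x
    using quarter[of x] quarter[of "pi - x"] square_wave_reflect[of M x] x by (cases "x \<le> pi / 2") auto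
  define n where "n = \<lfloor>x / (2 * pi)\<rfloor>"
  define t where "t = x - (2 * pi) * of_int n"
  have "of_int n \<le> x / (2 * pi)" "x / (2 * pi) < of_int n + 1" unfolding n_def by linarith+
  then have t: "0 \<le> t" "t \<le> 2 * pi" unfolding t_def by (simp_all add: field_simps)
  have "square_wave M x = square_wave M t" using square_wave_periodic[of M t n] by (simp add: t_def)
  moreover have "square_wave M t = square_wave M (2 * pi - t)"
    using square_wave_periodic[of M "- t" 1] square_wave_minus[of M t] by simp
  ultimately show ?thesis using half[of t] half[of "2 * pi - t"] t by (cases "t \<le> pi") auto
qed (simp add: square_wave_def)

text \<open>The partial sums approximate $\pi/4$ times the sign of the cosine away from its zeros.\<close>
lemma square_wave_approx:
  assumes c: "c > 0" and d: "0 < \<delta>" "\<delta> < c" and M: "M \<ge> 1" and u: "\<bar>u\<bar> \<le> 2 * c" "\<delta> \<le> \<bar>\<bar>u\<bar> - c\<bar>"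
  shows "\<bar>square_wave M (pi * u / (2 * c)) - (if \<bar>u\<bar> < c then pi / 4 else - (pi / 4))\<bar>
    \<le> \<bar>square_wave M 0 - pi / 4\<bar> + c / (2 * real M * \<delta>)"
proof -
  have near: "\<bar>square_wave M (pi * v / (2 * c)) - pi / 4\<bar> \<le> \<bar>square_wave M 0 - pi / 4\<bar> + c / (2 * real M * \<delta>)"
    if v: "0 \<le> v" "v \<le> c - \<delta>" for v
  proof -
    let ?x = "pi * v / (2 * c)"
    have x: "?x = pi / 2 - pi * (c - v) / (2 * c)" using c by (simp add: field_simps)
    have y: "0 \<le> pi * (c - v) / (2 * c)" "pi * (c - v) / (2 * c) \<le> pi / 2" "pi * (c - v) / (2 * c) > 0"
      using c v d by (auto simp: field_simps)
    have cosx: "\<delta> / c \<le> cos ?x"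
    proof -
      have "\<delta> / c \<le> (c - v) / c" using v c by (intro divide_right_mono) auto
      also have "\<dots> = 2 / pi * (pi * (c - v) / (2 * c))" using c by (simp add: field_simps)
      also have "\<dots> \<le> sin (pi * (c - v) / (2 * c))" by (rule jordan_sin[OF y(1,2)])
      also have "\<dots> = cos ?x" unfolding x by (simp add: cos_diff)
      finally show ?thesis .
    qed
    have "\<bar>square_wave M ?x - square_wave M 0\<bar> \<le> 1 / (2 * real M * cos ?x)"
      using M c v y x by (intro square_wave_near_centre) auto
    also have "\<dots> \<le> 1 / (2 * real M * (\<delta> / c))"
    proof -
      have "\<delta> / c > 0" using c d by simp
      then show ?thesis using cosx M by (intro divide_left_mono mult_left_mono mult_pos_pos) auto
    qed
    also have "\<dots> = c / (2 * real M * \<delta>)" by simp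
    finally show ?thesis by linarith
  qed
  have even: "square_wave M (pi * u / (2 * c)) = square_wave M (pi * \<bar>u\<bar> / (2 * c))"
    using square_wave_minus[of M "pi * u / (2 * c)"] by (cases "u \<ge> 0") auto
  show ?thesis
  proof (cases "\<bar>u\<bar> < c")
    case True
    then show ?thesis using near[of "\<bar>u\<bar>"] u by (simp add: even)
  next
    case False
    have "pi * \<bar>u\<bar> / (2 * c) = pi - pi * (2 * c - \<bar>u\<bar>) / (2 * c)" using c by (simp add: field_simps)
    then have "square_wave M (pi * \<bar>u\<bar> / (2 * c)) = - square_wave M (pi * (2 * c - \<bar>u\<bar>) / (2 * c))"
      by (simp only: square_wave_reflect)
    moreover have "\<bar>square_wave M (pi * (2 * c - \<bar>u\<bar>) / (2 * c)) - pi / 4\<bar> \<le> \<bar>square_wave M 0 - pi / 4\<bar> + c / (2 * real M * \<delta>)"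
      using False u by (intro near) auto
    ultimately show ?thesis using False by (simp add: even abs_le_iff)
  qed
qed

text \<open>The terms $1/|x+i|$ of the model at $x = 1/2$, halved.\<close>
definition weight :: "int \<Rightarrow> real" where "weight i = 1 / \<bar>of_int (2 * i + 1)\<bar>"

lemma prod_window:
  fixes f :: "real \<Rightarrow> 'a :: comm_monoid_mult"
  shows "(\<Prod>i\<in>window J. f (weight i)) = (\<Prod>j=1..J. f (1 / real (2 * j + 1)) * f (1 / real (2 * j + 1)))"
proof -
  have split: "window J = {1..int J} \<union> {- int J - 1..-2}" by (auto simp: window_def)
  have "(\<Prod>i\<in>window J. f (weight i)) = (\<Prod>i\<in>{1..int J}. f (weight i)) * (\<Prod>i\<in>{- int J - 1..-2}. f (weight i))"
    unfolding split by (intro prod.union_disjoint) auto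
  also have "(\<Prod>i\<in>{1..int J}. f (weight i)) = (\<Prod>j=1..J. f (1 / real (2 * j + 1)))"
    by (rule prod.reindex_bij_witness[of _ int nat]) (auto simp: weight_def add.commute)
  also have "(\<Prod>i\<in>{- int J - 1..-2}. f (weight i)) = (\<Prod>j=1..J. f (1 / real (2 * j + 1)))"
    by (rule prod.reindex_bij_witness[of _ "\<lambda>j. - 1 - int j" "\<lambda>i. nat (- 1 - i)"]) (auto simp: weight_def algebra_simps)
  finally show ?thesis by (simp add: prod.distrib)
qed

lemma sum_window:
  fixes f :: "real \<Rightarrow> real"
  shows "(\<Sum>i\<in>window J. f (weight i)) = 2 * (\<Sum>j=1..J. f (1 / real (2 * j + 1)))"
proof -
  have split: "window J = {1..int J} \<union> {- int J - 1..-2}" by (auto simp: window_def)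
  have "(\<Sum>i\<in>window J. f (weight i)) = (\<Sum>i\<in>{1..int J}. f (weight i)) + (\<Sum>i\<in>{- int J - 1..-2}. f (weight i))"
    unfolding split by (intro sum.union_disjoint) auto
  also have "(\<Sum>i\<in>{1..int J}. f (weight i)) = (\<Sum>j=1..J. f (1 / real (2 * j + 1)))"
    by (rule sum.reindex_bij_witness[of _ int nat]) (auto simp: weight_def add.commute)
  also have "(\<Sum>i\<in>{- int J - 1..-2}. f (weight i)) = (\<Sum>j=1..J. f (1 / real (2 * j + 1)))"
    by (rule sum.reindex_bij_witness[of _ "\<lambda>j. - 1 - int j" "\<lambda>i. nat (- 1 - i)"]) (auto simp: weight_def algebra_simps)
  finally show ?thesis by simp
qed

abbreviation "wsum J \<equiv> ssum (window J) weight"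

text \<open>The characteristic function of the random sum with these weights, at the frequency of the \<open>m\<close>-th Fourier mode of
  the square wave with jumps at $\pm c$. Each factor is squared since the weights at $i$ and $-1-i$ agree.\<close>
definition phi :: "real \<Rightarrow> nat \<Rightarrow> nat \<Rightarrow> real" where
  "phi c J m = (\<Prod>j=1..J. (cos (real (2 * m + 1) * pi / (2 * c) / real (2 * j + 1)))\<^sup>2)"

lemma avg_square_wave: "avg (window J) (\<lambda>A. square_wave M (pi * wsum J A / (2 * c))) = (\<Sum>m<M. (-1) ^ m * phi c J m / real (2 * m + 1))"
proof -
  have "avg (window J) (\<lambda>A. (-1) ^ m / real (2 * m + 1) * cos (real (2 * m + 1) * pi / (2 * c) * wsum J A)) = (-1) ^ m / real (2 * m + 1) * phi c J m" for m
    unfolding avg_cmult avg_cos_ssum[OF finite_window] prod_window[where f = "\<lambda>w. cos (real (2 * m + 1) * pi / (2 * c) * w)"] phi_def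
    by (simp add: power2_eq_square)
  moreover have "square_wave M (pi * u / (2 * c)) = (\<Sum>m<M. (-1) ^ m / real (2 * m + 1) * cos (real (2 * m + 1) * pi / (2 * c) * u))" for u
    unfolding square_wave_def by (intro sum.cong refl) (simp add: mult_ac)
  ultimately show ?thesis by (simp only: avg_sum) simp
qed

lemma prod_cosh_window: "(\<Prod>i\<in>window J. cosh (t * weight i)) \<le> exp (t\<^sup>2 / 4)"
proof -
  have tel: "(\<Sum>j=1..J. (1 / real (2 * j + 1))\<^sup>2) \<le> 1 / 4 - 1 / (4 * (real J + 1))"
  proof (induction J)
    case (Suc J)
    have "(1 / real (2 * Suc J + 1))\<^sup>2 \<le> 1 / (4 * (real J + 1)) - 1 / (4 * (real (Suc J) + 1))"
      by (simp add: divide_simps power2_eq_square) (simp add: algebra_simps)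
    then show ?case using Suc by simp
  qed simp
  have "(\<Prod>i\<in>window J. cosh (t * weight i)) \<le> (\<Prod>i\<in>window J. exp ((t * weight i)\<^sup>2 / 2))"
    by (intro prod_mono conjI cosh_le_exp_square cosh_real_nonneg)
  also have "\<dots> = exp (t\<^sup>2 / 2 * (\<Sum>i\<in>window J. (weight i)\<^sup>2))"
    by (simp add: exp_sum[symmetric] sum_distrib_left power_mult_distrib)
  also have "\<dots> = exp (t\<^sup>2 * (\<Sum>j=1..J. (1 / real (2 * j + 1))\<^sup>2))"
    unfolding sum_window[where f = "\<lambda>w. w\<^sup>2"] by simp
  also have "\<dots> \<le> exp (t\<^sup>2 * (1 / 4))"
  proof -
    have "0 \<le> 1 / (4 * (real J + 1))" by simp
    then have "(\<Sum>j=1..J. (1 / real (2 * j + 1))\<^sup>2) \<le> 1 / 4" using tel by linarith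
    then show ?thesis by (simp only: exp_le_cancel_iff) (intro mult_left_mono, auto)
  qed
  finally show ?thesis by simp
qed

lemma wsum_large_deviation:
  assumes c: "c \<ge> 199 / 100"
  shows "sprob (window J) (\<lambda>A. \<bar>wsum J A\<bar> \<ge> 2 * c) \<le> 2 * exp (- 158 / 10)"
proof -
  \<comment> \<open>the minimiser of $t^2/4 - 2ct$\<close>
  define t where "t = 4 * c"
  have t: "t \<ge> 0" using c by (simp add: t_def)
  have "exp (- (t * (2 * c))) * (\<Prod>i\<in>window J. cosh (t * weight i)) \<le> exp (- (t * (2 * c))) * exp (t\<^sup>2 / 4)"
    by (intro mult_left_mono prod_cosh_window) auto
  also have "\<dots> = exp (- (4 * c\<^sup>2))" by (simp add: t_def power2_eq_square flip: exp_add)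
  also have "\<dots> \<le> exp (- 158 / 10)"
  proof -
    have "(199 / 100)\<^sup>2 \<le> c\<^sup>2" using c by (intro power_mono) auto
    then show ?thesis by (simp add: power2_eq_square)
  qed
  finally have b: "exp (- (t * (2 * c))) * (\<Prod>i\<in>window J. cosh (t * weight i)) \<le> exp (- 158 / 10)" .
  have "sprob (window J) (\<lambda>A. \<bar>wsum J A\<bar> \<ge> 2 * c) \<le> sprob (window J) (\<lambda>A. wsum J A \<le> - (2 * c) \<or> wsum J A \<ge> 2 * c)"
    by (rule sprob_mono) (auto simp: abs_if split: if_splits)
  then show ?thesis
    using sprob_disj[of "window J" "\<lambda>A. wsum J A \<le> - (2 * c)" "\<lambda>A. wsum J A \<ge> 2 * c"] b
      chernoff_ssum[OF finite_window[of J] t, where w = weight and c = "2 * c"] by linarith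
qed

text \<open>The argument of \<open>sprob_infimum_in_short_interval\<close> at a single point.\<close>
lemma wsum_concentration:
  assumes "4 ^ n \<le> J" and d: "\<delta> = 1 / 4 ^ Suc n"
  shows "sprob (window J) (\<lambda>A. - \<delta> \<le> wsum J A + b \<and> wsum J A + b < \<delta>) \<le> 1 / 2 ^ n"
proof -
  let ?F = "\<lambda>A (x :: unit). b + (\<Sum>i\<in>window J. sg A i * weight i)"
  have w: "4 / 9 * (1 / 4 ^ Suc r) \<le> weight (4 ^ Suc r)" "weight (4 ^ Suc r) \<le> 1 / 2 * (1 / 4 ^ Suc r)" for r
  proof -
    have "(1::real) \<le> 4 ^ r" by simp
    have e: "weight (4 ^ Suc r) = 1 / (2 * 4 ^ Suc r + 1)" by (simp add: weight_def)
    show "weight (4 ^ Suc r) \<le> 1 / 2 * (1 / 4 ^ Suc r)" 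
    proof -
      have "1 / (2 * 4 ^ Suc r + 1) \<le> 1 / (2 * 4 ^ Suc r :: real)" by (intro divide_left_mono) (simp_all add: add_pos_pos)
      then show ?thesis unfolding e by simp
    qed
    have "4 / 9 * (1 / 4 ^ Suc r) = 1 / (9 / 4 * 4 ^ Suc r :: real)" by simp
    also have "\<dots> \<le> weight (4 ^ Suc r)" unfolding e using \<open>1 \<le> 4 ^ r\<close> by (intro divide_left_mono) (simp_all add: add_pos_pos)
    finally show "4 / 9 * (1 / 4 ^ Suc r) \<le> weight (4 ^ Suc r)" .
  qed
  have "sprob (window J) (\<lambda>A. (\<exists>x\<in>UNIV. ?F A x < \<delta>) \<and> \<not> (\<exists>x\<in>UNIV. ?F A x < - \<delta>)) \<le> 1 / 2 ^ n"
  proof (rule sprob_infimum_in_short_interval[OF finite_window four_powers_window[OF assms(1)], where w = "\<lambda>i _. weight i"])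
    fix r assume r: "r < n"
    have "(\<Sum>l\<in>{r<..<n}. weight (4 ^ Suc l)) \<le> (\<Sum>l\<in>{r<..<n}. 1 / 2 * (1 / 4 ^ Suc l))"
      by (intro sum_mono w(2))
    also have "\<dots> = 1 / 2 * (\<Sum>l\<in>{r<..<n}. 1 / 4 ^ Suc l)" by (simp only: sum_distrib_left)
    also have "\<dots> \<le> 1 / 2 * (1 / 4 ^ Suc r / 3)" by (intro mult_left_mono sum_geometric_quarter_tail) simp
    finally have 1: "(\<Sum>l\<in>{r<..<n}. weight (4 ^ Suc l)) \<le> 1 / 2 * (1 / 4 ^ Suc r / 3)" .
    have 2: "\<delta> \<le> 1 / 4 * (1 / 4 ^ Suc r)"
    proof -
      have "(4::real) ^ Suc (Suc r) \<le> 4 ^ Suc n" using r by (intro power_increasing) auto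
      then have "1 / (4::real) ^ Suc n \<le> 1 / 4 ^ Suc (Suc r)" by (intro divide_left_mono) auto
      then show ?thesis by (simp add: d)
    qed
    have gen: "s + e \<le> v" if "s \<le> 1 / 2 * (t / 3)" "e \<le> 1 / 4 * t" "4 / 9 * t \<le> v" "0 \<le> t" for s e t v :: real
      using that by linarith
    show "(\<Sum>l\<in>{r<..<n}. weight (4 ^ Suc l)) + \<delta> \<le> weight (4 ^ Suc r)"
      by (rule gen[OF 1 2 w(1)]) simp
  qed (simp add: weight_def)
  then show ?thesis by (simp add: ssum_def not_less conj_commute add.commute)
qed

section \<open>Tail probabilities by Fourier expansion\<close>

definition tail_prob :: "real \<Rightarrow> nat \<Rightarrow> real" where
  "tail_prob c J = sprob (window J) (\<lambda>A. wsum J A < - c)"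

lemma sprob_abs_wsum: "c \<ge> 0 \<Longrightarrow> sprob (window J) (\<lambda>A. \<bar>wsum J A\<bar> > c) = 2 * tail_prob c J"
proof -
  assume c: "c \<ge> 0"
  have "sprob (window J) (\<lambda>A. \<bar>wsum J A\<bar> > c) = sprob (window J) (\<lambda>A. wsum J A < - c) + sprob (window J) (\<lambda>A. wsum J A > c)"
    unfolding sprob_def avg_add[symmetric] using c by (intro avg_cong) auto
  then show ?thesis by (simp add: sprob_ssum_symmetric tail_prob_def)
qed

text \<open>The square wave takes the value $\pi/4$ for $|S| < c$ and $-\pi/4$ for $c < |S| < 2c$. Partial sums of its
  Fourier series are close to these values unless $S$ is near $\pm c$, which is rare by anticoncentration, or
  $|S| \ge 2c$, which is rare by the large deviation bound.\<close>
lemma tail_prob_fourier: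
  assumes c: "199 / 100 \<le> c" and J: "4 ^ n \<le> J" and M: "M \<ge> 1" and d: "\<delta> = 1 / 4 ^ Suc n"
  shows "\<bar>(\<Sum>m<M. (-1) ^ m * phi c J m / real (2 * m + 1)) - pi / 4 * (1 - 4 * tail_prob c J)\<bar>
    \<le> \<bar>square_wave M 0 - pi / 4\<bar> + c / (2 * real M * \<delta>) + 6 / 2 ^ n + 6 * exp (- 158 / 10)"
proof -
  let ?W = "window J" and ?u = "\<lambda>A. wsum J A"
  define e where "e = \<bar>square_wave M 0 - pi / 4\<bar> + c / (2 * real M * \<delta>)"
  have "(4::real) ^ Suc n \<ge> 1" by (rule one_le_power) simp
  then have d01: "0 < \<delta>" "\<delta> \<le> 1" unfolding d by (simp_all del: power_Suc)
  have d': "\<delta> < c" using d01 c by linarith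
  have e0: "e \<ge> 0" unfolding e_def using c d01 by (intro add_nonneg_nonneg divide_nonneg_nonneg) auto
  define near where "near b A \<longleftrightarrow> - \<delta> \<le> ?u A + b \<and> ?u A + b < \<delta>" for b A
  define tgt where "tgt A = (if \<bar>?u A\<bar> > c then - (pi / 4) else pi / 4)" for A
  let ?T = "\<lambda>A. square_wave M (pi * ?u A / (2 * c))"
  let ?ind = "\<lambda>b :: bool. if b then 1 else 0 :: real"
  let ?far = "\<lambda>A. \<bar>?u A\<bar> \<ge> 2 * c"
  have pt: "\<bar>?T A - tgt A\<bar> \<le> e + 3 * ?ind (near c A) + 3 * ?ind (near (- c) A) + 3 * ?ind (?far A)" for A
  proof (cases "near c A \<or> near (- c) A \<or> ?far A")
    case True
    have "\<bar>?T A\<bar> \<le> 2" by (rule square_wave_bounded)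
    moreover have "\<bar>tgt A\<bar> \<le> 1" using pi_less_4 by (simp add: tgt_def)
    ultimately have "\<bar>?T A - tgt A\<bar> \<le> 3" by linarith
    moreover have "3 \<le> e + 3 * ?ind (near c A) + 3 * ?ind (near (- c) A) + 3 * ?ind (?far A)"
      using True e0 by auto
    ultimately show ?thesis by linarith
  next
    case False
    have u: "\<bar>?u A\<bar> \<le> 2 * c" "\<delta> \<le> \<bar>\<bar>?u A\<bar> - c\<bar>" using False c d01 by (auto simp: near_def abs_if split: if_splits)
    have "\<bar>?u A\<bar> \<noteq> c" using u(2) d01 by auto
    then have "tgt A = (if \<bar>?u A\<bar> < c then pi / 4 else - (pi / 4))" by (auto simp: tgt_def)
    then have "\<bar>?T A - tgt A\<bar> \<le> e" using square_wave_approx[OF _ d01(1) d' M u] c unfolding e_def by simp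
    then show ?thesis using False by simp
  qed
  have T: "avg ?W ?T = (\<Sum>m<M. (-1) ^ m * phi c J m / real (2 * m + 1))" by (rule avg_square_wave)
  have tg: "avg ?W tgt = pi / 4 * (1 - 4 * tail_prob c J)"
  proof -
    have "avg ?W tgt = avg ?W (\<lambda>A. pi / 4 + (- (pi / 2)) * ?ind (\<bar>?u A\<bar> > c))"
      by (rule avg_cong) (simp add: tgt_def)
    also have "\<dots> = pi / 4 + (- (pi / 2)) * sprob ?W (\<lambda>A. \<bar>?u A\<bar> > c)"
      by (simp only: avg_add avg_cmult avg_const[OF finite_window] sprob_def)
    also have "sprob ?W (\<lambda>A. \<bar>?u A\<bar> > c) = 2 * tail_prob c J" using c by (intro sprob_abs_wsum) simp
    finally show ?thesis by (simp add: algebra_simps)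
  qed
  let ?B = "\<lambda>A. e + 3 * ?ind (near c A) + 3 * ?ind (near (- c) A) + 3 * ?ind (?far A)"
  have B: "avg ?W ?B = e + 3 * sprob ?W (near c) + 3 * sprob ?W (near (- c)) + 3 * sprob ?W ?far"
    by (simp only: avg_add avg_cmult avg_const[OF finite_window] sprob_def)
  have "avg ?W ?T \<le> avg ?W (\<lambda>A. tgt A + ?B A)" using pt by (intro avg_mono) (simp add: abs_le_iff algebra_simps)
  moreover have "avg ?W tgt \<le> avg ?W (\<lambda>A. ?T A + ?B A)" using pt by (intro avg_mono) (simp add: abs_le_iff algebra_simps)
  ultimately have "\<bar>avg ?W ?T - avg ?W tgt\<bar> \<le> avg ?W ?B" unfolding avg_add[of ?W tgt ?B] avg_add[of ?W ?T ?B] by linarith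
  then have main: "\<bar>(\<Sum>m<M. (-1) ^ m * phi c J m / real (2 * m + 1)) - pi / 4 * (1 - 4 * tail_prob c J)\<bar>
      \<le> e + 3 * sprob ?W (near c) + 3 * sprob ?W (near (- c)) + 3 * sprob ?W ?far"
    unfolding T tg B .
  have near: "sprob ?W (near b) \<le> 1 / 2 ^ n" for b
    unfolding near_def by (rule wsum_concentration[OF J d])
  have far: "sprob ?W ?far \<le> 2 * exp (- 158 / 10)" by (rule wsum_large_deviation[OF c])
  have "e + 3 * sprob ?W (near c) + 3 * sprob ?W (near (- c)) + 3 * sprob ?W ?far
    \<le> e + 3 * (1 / 2 ^ n) + 3 * (1 / 2 ^ n) + 3 * (2 * exp (- 158 / 10))"
    by (intro add_mono mult_left_mono near far) auto
  also have "\<dots> = e + 6 / 2 ^ n + 6 * exp (- 158 / 10)" by simp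
  finally show ?thesis using main unfolding e_def by (rule order_trans[rotated])
qed

lemma exp_minus_158_10: "6 * exp (- 158 / 10 :: real) \<le> 95 / 10 ^ 8"
proof -
  have "(27 / 10 :: real) \<le> exp 1"
  proof -
    have "(1 + 1 / real 100) ^ 100 \<le> exp (1 :: real)" by (rule exp_ge_one_plus_x_over_n_power_n) auto
    moreover have "(27 / 10 :: real) \<le> (1 + 1 / real 100) ^ 100" by (simp add: power_divide)
    ultimately show ?thesis by linarith
  qed
  then have "(27 / 10 :: real) ^ 158 \<le> exp 1 ^ 158" by (intro power_mono) auto
  also have "exp (1::real) ^ 158 = exp (158 / 10) ^ 10"
    by (simp flip: exp_of_nat_mult)
  finally have "(27 / 10 :: real) ^ 158 \<le> exp (158 / 10) ^ 10" .
  moreover have "(65 * 10 ^ 5 :: real) ^ 10 \<le> (27 / 10 :: real) ^ 158" by (simp add: power_divide)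
  ultimately have "(65 * 10 ^ 5 :: real) ^ 10 \<le> exp (158 / 10) ^ 10" by linarith
  then have "65 * 10 ^ 5 \<le> exp (158 / 10 :: real)" by (rule power_mono_iff[THEN iffD1, rotated -1]) auto
  then have "6 * (1 / exp (158 / 10 :: real)) \<le> 6 * (1 / (65 * 10 ^ 5))" by (intro mult_left_mono divide_left_mono) auto
  then show ?thesis by (simp add: exp_minus inverse_eq_divide)
qed

lemma tail_prob_fourier_eventually:
  assumes c: "199 / 100 \<le> c"
  shows "\<forall>\<^sub>F n in sequentially. \<bar>(\<Sum>m<32 ^ n. (-1) ^ m * phi c (window_size n) m / real (2 * m + 1))
    - pi / 4 * (1 - 4 * tail_prob c (window_size n))\<bar> \<le> 1 / 10 ^ 6"
proof -
  have l1: "(\<lambda>n. \<bar>square_wave (32 ^ n) 0 - pi / 4\<bar>) \<longlonglongrightarrow> 0"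
  proof -
    have "filterlim (\<lambda>n. (32::nat) ^ n) sequentially sequentially"
      by (rule filterlim_subseq) (auto simp: strict_mono_def)
    from filterlim_compose[OF square_wave_0_tendsto this] have "(\<lambda>n. square_wave (32 ^ n) 0 - pi / 4) \<longlonglongrightarrow> 0"
      by (rule LIM_zero)
    then show ?thesis by (rule tendsto_rabs_zero)
  qed
  have l2: "(\<lambda>n. 2 * c * (1 / 8) ^ n) \<longlonglongrightarrow> 0"
    by (rule tendsto_mult_right_zero) (rule LIMSEQ_realpow_zero, auto)
  have l3: "(\<lambda>n. 6 / 2 ^ n :: real) \<longlonglongrightarrow> 0" by (rule LIMSEQ_divide_realpow_zero) simp
  have "(\<lambda>n. \<bar>square_wave (32 ^ n) 0 - pi / 4\<bar> + 2 * c * (1 / 8) ^ n + 6 / 2 ^ n) \<longlonglongrightarrow> 0 + 0 + 0"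
    by (intro tendsto_add l1 l2 l3)
  then have "\<forall>\<^sub>F n in sequentially. \<bar>square_wave (32 ^ n) 0 - pi / 4\<bar> + 2 * c * (1 / 8) ^ n + 6 / 2 ^ n < 5 / 10 ^ 8"
    by (intro order_tendstoD(2)) auto
  then show ?thesis
  proof eventually_elim
    case (elim n)
    have "(4::nat) ^ n \<le> 32 ^ n" by (intro power_mono) auto
    then have J: "4 ^ n \<le> window_size n" by (simp add: window_size_def)
    have "\<bar>(\<Sum>m<32 ^ n. (-1) ^ m * phi c (window_size n) m / real (2 * m + 1)) - pi / 4 * (1 - 4 * tail_prob c (window_size n))\<bar>
      \<le> \<bar>square_wave (32 ^ n) 0 - pi / 4\<bar> + c / (2 * real (32 ^ n) * (1 / 4 ^ Suc n)) + 6 / 2 ^ n + 6 * exp (- 158 / 10)"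
      by (rule tail_prob_fourier[OF c J _ refl]) simp
    also have "c / (2 * real (32 ^ n) * (1 / 4 ^ Suc n)) = 2 * c * (1 / 8) ^ n"
    proof -
      have "(32::real) ^ n = 8 ^ n * 4 ^ n" by (simp flip: power_mult_distrib)
      then show ?thesis by (simp add: power_one_over)
    qed
    finally show ?case using elim exp_minus_158_10 by simp
  qed
qed

text \<open>The derivative of $\cos z \, e^{z^2/2}$ has the sign of $z \cos z - \sin z$.\<close>
lemma cos_squared_le_exp:
  assumes "\<bar>z\<bar> \<le> pi / 2" shows "(cos z)\<^sup>2 \<le> exp (- z\<^sup>2)"
proof -
  have main: "(cos z)\<^sup>2 \<le> exp (- z\<^sup>2)" if z: "0 \<le> z" "z \<le> pi / 2" for z :: real
  proof -
    have "cos z * exp (z\<^sup>2 / 2) \<le> cos 0 * exp (0\<^sup>2 / 2)"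
    proof (rule DERIV_nonpos_imp_nonincreasing[OF z(1)])
      fix x assume x: "0 \<le> x" "x \<le> z"
      have "DERIV (\<lambda>z. cos z * exp (z\<^sup>2 / 2)) x :> (x * cos x - sin x) * exp (x\<^sup>2 / 2)"
        by (auto intro!: derivative_eq_intros simp: algebra_simps)
      moreover have "(x * cos x - sin x) * exp (x\<^sup>2 / 2) \<le> 0"
        using x_cos_le_sin[of x] x z by (intro mult_nonpos_nonneg) auto
      ultimately show "\<exists>d. DERIV (\<lambda>z. cos z * exp (z\<^sup>2 / 2)) x :> d \<and> d \<le> 0" by blast
    qed
    then have "cos z \<le> exp (- (z\<^sup>2 / 2))" by (simp add: exp_minus field_simps)
    then have "(cos z)\<^sup>2 \<le> (exp (- (z\<^sup>2 / 2)))\<^sup>2" using z by (intro power_mono cos_ge_zero) auto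
    also have "\<dots> = exp (- z\<^sup>2)" by (simp add: power2_eq_square flip: exp_add)
    finally show ?thesis .
  qed
  show ?thesis using main[of z] main[of "-z"] assms by (cases "z \<ge> 0") auto
qed

text \<open>The derivative of $\cos z \, e^{z^2/2 + z^4/10}$ has the sign of $(z + 2z^3/5) \cos z - \sin z$.\<close>
lemma cos_squared_ge_exp:
  fixes z :: real
  assumes z: "0 \<le> z" "z \<le> 1 / 3" shows "exp (- z\<^sup>2 - z ^ 4 / 5) \<le> (cos z)\<^sup>2"
proof -
  have cpos: "cos y > 0" if "0 \<le> y" "y \<le> 1 / 3" for y :: real
    using that pi_gt3 by (intro cos_gt_zero_pi) auto
  have sc: "sin y \<le> (y + 2 / 5 * y ^ 3) * cos y" if y: "0 \<le> y" "y \<le> 1 / 3" for y :: real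
  proof -
    have "(0 + 2 / 5 * 0 ^ 3) * cos 0 - sin 0 \<le> (y + 2 / 5 * y ^ 3) * cos y - sin y"
    proof (rule DERIV_nonneg_imp_nondecreasing[OF y(1)])
      fix x assume x: "0 \<le> x" "x \<le> y"
      have "DERIV (\<lambda>y. (y + 2 / 5 * y ^ 3) * cos y - sin y) x
        :> 6 / 5 * x\<^sup>2 * cos x - (x + 2 / 5 * x ^ 3) * sin x"
        by (auto intro!: derivative_eq_intros simp: field_simps)
      moreover have "0 \<le> 6 / 5 * x\<^sup>2 * cos x - (x + 2 / 5 * x ^ 3) * sin x"
      proof -
        have "1 - x\<^sup>2 / 2 \<le> cos x"
          using cos_double_sin[of "x/2"] sin_x_le_x[of "x/2"] power_mono[of "sin (x/2)" "x/2" 2] sin_ge_zero[of "x/2"] x y pi_gt3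
          by (simp add: power2_eq_square)
        moreover have xs: "x\<^sup>2 \<le> 1 / 9" using x y power_mono[of x "1/3" 2] by (simp add: power2_eq_square)
        ultimately have "7 / 8 \<le> cos x" by linarith
        then have "6 / 5 * x\<^sup>2 * (7 / 8) \<le> 6 / 5 * x\<^sup>2 * cos x" by (intro mult_left_mono) auto
        moreover have "(x + 2 / 5 * x ^ 3) * sin x \<le> (x + 2 / 5 * x ^ 3) * x"
          using x by (intro mult_left_mono sin_x_le_x) auto
        moreover have "(x + 2 / 5 * x ^ 3) * x = x\<^sup>2 + 2 / 5 * (x\<^sup>2 * x\<^sup>2)" by (simp add: power2_eq_square power3_eq_cube algebra_simps)
        moreover have "x\<^sup>2 * x\<^sup>2 \<le> x\<^sup>2 * (1 / 8)" using xs by (intro mult_left_mono) auto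
        ultimately show ?thesis by linarith
      qed
      ultimately show "\<exists>d. DERIV (\<lambda>y. (y + 2 / 5 * y ^ 3) * cos y - sin y) x :> d \<and> d \<ge> 0" by blast
    qed
    then show ?thesis by simp
  qed
  have "cos 0 * exp (0\<^sup>2 / 2 + 0 ^ 4 / 10) \<le> cos z * exp (z\<^sup>2 / 2 + z ^ 4 / 10)"
  proof (rule DERIV_nonneg_imp_nondecreasing[OF z(1)])
    fix x assume x: "0 \<le> x" "x \<le> z"
    have "DERIV (\<lambda>z. cos z * exp (z\<^sup>2 / 2 + z ^ 4 / 10)) x
      :> ((x + 2 / 5 * x ^ 3) * cos x - sin x) * exp (x\<^sup>2 / 2 + x ^ 4 / 10)"
      by (auto intro!: derivative_eq_intros simp: field_simps)
    moreover have "0 \<le> ((x + 2 / 5 * x ^ 3) * cos x - sin x) * exp (x\<^sup>2 / 2 + x ^ 4 / 10)"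
      using sc[of x] x z by (intro mult_nonneg_nonneg) auto
    ultimately show "\<exists>d. DERIV (\<lambda>z. cos z * exp (z\<^sup>2 / 2 + z ^ 4 / 10)) x :> d \<and> d \<ge> 0" by blast
  qed
  then have "exp (- (z\<^sup>2 / 2 + z ^ 4 / 10)) \<le> cos z" by (simp add: exp_minus field_simps)
  then have "(exp (- (z\<^sup>2 / 2 + z ^ 4 / 10)))\<^sup>2 \<le> (cos z)\<^sup>2" by (intro power_mono) auto
  moreover have "(exp (- (z\<^sup>2 / 2 + z ^ 4 / 10)))\<^sup>2 = exp (- z\<^sup>2 - z ^ 4 / 5)"
    by (simp add: power2_eq_square[of "exp _"] flip: exp_add)
  ultimately show ?thesis by simp
qed

section \<open>Comparison of the model function with its value at the midpoint\<close>

text \<open>At the midpoint the model equals $4 + 2S$.\<close>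
lemma tail_prob_le_dips: "tail_prob 2 J \<le> sprob (window J) (dips J 0)"
  unfolding tail_prob_def
proof (rule sprob_mono)
  fix A assume A: "wsum J A < - 2"
  have "(\<Sum>i\<in>window J. sg A i / \<bar>1 / 2 + of_int i\<bar>) = 2 * wsum J A"
  proof -
    have "sg A i / \<bar>1 / 2 + of_int i\<bar> = 2 * (sg A i * weight i)" for i
    proof -
      have "\<bar>of_int (2 * i + 1)\<bar> = 2 * \<bar>1 / 2 + real_of_int i\<bar>" by (simp add: abs_if)
      then show ?thesis by (simp add: weight_def)
    qed
    then show ?thesis by (simp add: ssum_def sum_distrib_left)
  qed
  then have "model J A (1 / 2) < 0" using A by (simp add: model_def)
  then show "dips J 0 A" by (auto simp: dips_def intro!: bexI[of _ "1 / 2"])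
qed

text \<open>The weights for the event that the signs at $1$ and $-2$ cancel each other in $S$.\<close>
definition weight' :: "int \<Rightarrow> real" where "weight' i = (if i = 1 \<or> i = -2 then 0 else weight i)"

lemma window_split: "J \<ge> 1 \<Longrightarrow> window J = insert 1 (insert (-2) (window J - {1, -2}))"
  by (auto simp: window_def)

lemma sum_weight_squares: "(\<Sum>i\<in>window J. 4 * (weight i)\<^sup>2) \<le> 2" "(\<Sum>i\<in>window J - {1, -2}. 4 * (weight i)\<^sup>2) \<le> 1"
proof -
  have pos: "(\<Sum>j=k..J. 4 * (1 / real (2 * j + 1))\<^sup>2) \<le> 1 / real k" if "k \<ge> 1" for k
  proof -
    have "(\<Sum>j=k..J. 4 * (1 / real (2 * j + 1))\<^sup>2) \<le> 1 / real k - 1 / real (J + 1)" if "k \<le> J + 1"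
      using that
    proof (induction J)
      case (Suc J)
      show ?case
      proof (cases "k = Suc (Suc J)")
        case False
        have "4 * (1 / real (2 * Suc J + 1))\<^sup>2 \<le> 1 / real (J + 1) - 1 / real (Suc J + 1)"
          by (simp add: divide_simps power2_eq_square) (simp add: algebra_simps)
        then show ?thesis using Suc False by simp
      qed simp
    qed (use \<open>k \<ge> 1\<close> in \<open>auto simp: le_Suc_eq\<close>)
    moreover have "0 \<le> 1 / real (J + 1)" by simp
    ultimately show ?thesis by (cases "k \<le> J + 1") (linarith, simp)
  qed
  show 1: "(\<Sum>i\<in>window J. 4 * (weight i)\<^sup>2) \<le> 2"
    unfolding sum_window[where f = "\<lambda>w. 4 * w\<^sup>2"] using pos[of 1] by simp
  show "(\<Sum>i\<in>window J - {1, -2}. 4 * (weight i)\<^sup>2) \<le> 1"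
  proof (cases "J \<ge> 1")
    case True
    have "(\<Sum>i\<in>window J. 4 * (weight i)\<^sup>2) = 4 * (weight 1)\<^sup>2 + (4 * (weight (-2))\<^sup>2 + (\<Sum>i\<in>window J - {1, -2}. 4 * (weight i)\<^sup>2))"
      by (subst window_split[OF True]) simp
    moreover have "(\<Sum>j=1..J. 4 * (1 / real (2 * j + 1))\<^sup>2) = 4 * (1 / 3)\<^sup>2 + (\<Sum>j=2..J. 4 * (1 / real (2 * j + 1))\<^sup>2)"
      using True by (subst sum.atLeast_Suc_atMost) (auto simp: numeral_2_eq_2)
    ultimately show ?thesis
      unfolding sum_window[where f = "\<lambda>w. 4 * w\<^sup>2"] using pos[of 2] by (simp add: weight_def)
  next
    case False
    then have "window J = {}" by (auto simp: window_def)
    then show ?thesis by simp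
  qed
qed

text \<open>Expansion to second order at the midpoint $x = 1/2 + y$: the two main poles contribute at least $4 + 16 y^2$, the
  remainders of the other terms at most $2 y^2$ in total, and the linear term is absorbed by completing the square.\<close>
lemma model_lower_bound:
  assumes x: "x = 1 / 2 + y" "\<bar>y\<bar> < 1 / 2" and V: "\<bar>\<Sum>i\<in>window J. sg A i * of_int (sgn i) * (4 * (weight i)\<^sup>2)\<bar> \<le> V"
  shows "4 + 2 * wsum J A - V\<^sup>2 / 56 \<le> model J A x"
proof -
  define v where "v = (\<Sum>i\<in>window J. sg A i * of_int (sgn i) * (4 * (weight i)\<^sup>2))"
  have x01: "0 < x" "x < 1" using x by auto
  have y2: "y\<^sup>2 < 1 / 4" 
  proof -
    have "(2 * y)\<^sup>2 < 1" unfolding abs_square_less_1 using x(2) by simp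
    then show ?thesis by (simp add: power_mult_distrib)
  qed
  have main: "4 + 16 * y\<^sup>2 \<le> 1 / x + 1 / (1 - x)"
  proof -
    have "x * (1 - x) = 1 / 4 - y\<^sup>2" by (simp add: x power2_eq_square field_simps)
    moreover have "1 / x + 1 / (1 - x) = 1 / (x * (1 - x))" using x01 by (simp add: field_simps)
    moreover have "4 + 16 * y\<^sup>2 \<le> 1 / (1 / 4 - y\<^sup>2)"
    proof -
      have "(4 + 16 * y\<^sup>2) * (1 / 4 - y\<^sup>2) = 1 - 16 * (y\<^sup>2)\<^sup>2" by (simp add: power2_eq_square algebra_simps)
      then have "(4 + 16 * y\<^sup>2) * (1 / 4 - y\<^sup>2) \<le> 1" by simp
      then show ?thesis using y2 by (simp add: le_divide_eq)
    qed
    ultimately show ?thesis by simp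
  qed
  have trm: "2 * (sg A i * weight i) - y * (sg A i * of_int (sgn i) * (4 * (weight i)\<^sup>2)) - y\<^sup>2 * (4 * (weight i)\<^sup>2) \<le> sg A i / \<bar>x + of_int i\<bar>"
    if i: "i \<in> window J" for i
  proof -
    define a where "a = \<bar>of_int (2 * i + 1)\<bar> / (2 :: real)"
    define s where "s = real_of_int (sgn i)"
    have "i \<ge> 1 \<or> i \<le> -2" using i by (auto simp: window_def)
    then have a: "a \<ge> 3 / 2" and s: "s = 1 \<or> s = -1" and xi: "\<bar>x + of_int i\<bar> = a + s * y"
      using x by (auto simp: a_def s_def abs_if sgn_if)
    have w: "weight i = 1 / (2 * a)" by (simp add: weight_def a_def)
    have ay: "a + s * y \<ge> 1" using a s x(2) by (auto simp: abs_if split: if_splits)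
    have id: "1 / (a + s * y) = 1 / a - s * y / a\<^sup>2 + y\<^sup>2 / (a\<^sup>2 * (a + s * y))"
    proof -
      have gen: "1 / b = 1 / a - (b - a) / a\<^sup>2 + (b - a)\<^sup>2 / (a\<^sup>2 * b)" if "a > 0" "b > 0" for a b :: real
        using that by (simp add: divide_simps power2_eq_square) (simp add: algebra_simps)
      have "(s * y)\<^sup>2 = y\<^sup>2" using s by auto
      then show ?thesis using gen[of a "a + s * y"] a ay by simp
    qed
    have r: "y\<^sup>2 / (a\<^sup>2 * (a + s * y)) \<le> y\<^sup>2 / a\<^sup>2" "0 \<le> y\<^sup>2 / (a\<^sup>2 * (a + s * y))"
    proof -
      have "a\<^sup>2 * 1 \<le> a\<^sup>2 * (a + s * y)" using ay by (intro mult_left_mono) auto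
      then show "y\<^sup>2 / (a\<^sup>2 * (a + s * y)) \<le> y\<^sup>2 / a\<^sup>2" using a by (intro divide_left_mono) (auto intro!: mult_pos_pos)
      show "0 \<le> y\<^sup>2 / (a\<^sup>2 * (a + s * y))" using ay by simp
    qed
    have e1: "2 * weight i = 1 / a" "4 * (weight i)\<^sup>2 = 1 / a\<^sup>2" by (simp_all add: w power2_eq_square)
    have "sg A i / \<bar>x + of_int i\<bar> = sg A i * (1 / a) - y * (sg A i * s * (1 / a\<^sup>2)) + sg A i * (y\<^sup>2 / (a\<^sup>2 * (a + s * y)))"
    proof -
      have gen: "g * P = g * u - y * (g * s * q) + g * Q" if "P = u - s * y * q + Q" for g P u q Q :: real
        by (simp add: that algebra_simps)
      have "1 / (a + s * y) = 1 / a - s * y * (1 / a\<^sup>2) + y\<^sup>2 / (a\<^sup>2 * (a + s * y))" using id by simp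
      from gen[OF this, of "sg A i"] show ?thesis unfolding xi by (simp only: times_divide_eq_right mult_1_right)
    qed
    moreover have "- (y\<^sup>2 / a\<^sup>2) \<le> sg A i * (y\<^sup>2 / (a\<^sup>2 * (a + s * y)))"
      using sg_cases[of A i] r by auto
    moreover have "2 * (sg A i * weight i) = sg A i * (1 / a)" unfolding e1(1)[symmetric] by (rule mult.left_commute)
    ultimately show ?thesis unfolding e1(2) s_def[symmetric] by simp
  qed
  have "(\<Sum>i\<in>window J. 2 * (sg A i * weight i) - y * (sg A i * of_int (sgn i) * (4 * (weight i)\<^sup>2)) - y\<^sup>2 * (4 * (weight i)\<^sup>2))
    \<le> (\<Sum>i\<in>window J. sg A i / \<bar>x + of_int i\<bar>)" by (intro sum_mono trm)
  then have s: "2 * wsum J A - y * v - y\<^sup>2 * (\<Sum>i\<in>window J. 4 * (weight i)\<^sup>2) \<le> (\<Sum>i\<in>window J. sg A i / \<bar>x + of_int i\<bar>)"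
    unfolding ssum_def v_def by (simp only: sum_subtractf sum_distrib_left)
  have "y\<^sup>2 * (\<Sum>i\<in>window J. 4 * (weight i)\<^sup>2) \<le> y\<^sup>2 * 2" using sum_weight_squares(1) by (intro mult_left_mono) auto
  moreover have "y * v \<le> 14 * y\<^sup>2 + V\<^sup>2 / 56"
  proof -
    have "0 \<le> (28 * y - v)\<^sup>2" by simp
    then have "56 * (y * v) \<le> 784 * y\<^sup>2 + v\<^sup>2" by (simp add: power2_eq_square algebra_simps)
    moreover have "v\<^sup>2 \<le> V\<^sup>2" using V unfolding v_def[symmetric] by (metis abs_ge_zero abs_le_square_iff abs_of_nonneg order_trans)
    ultimately show ?thesis by simp
  qed
  ultimately show ?thesis using s main unfolding model_def by simp
qed

text \<open>If the signs at the two largest weights agree, their contributions to the linear term of the expansion cancel, since they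
  lie on different sides of the arc; then the linear coefficient is at most $1$ and $S$ must be below
  $-2 + 1/112$. If they differ, they cancel in $S$ instead, so that $S = S'$, while the coefficient $2$ costs $1/28$.\<close>
lemma dips_le_tail_prob:
  assumes J: "J \<ge> 1"
  shows "sprob (window J) (dips J 0) \<le> tail_prob (1991 / 1000) J + sprob (window J) (\<lambda>A. ssum (window J) weight' A \<le> - (1964 / 1000))"
proof -
  have "sprob (window J) (dips J 0) \<le> sprob (window J) (\<lambda>A. wsum J A < - (1991 / 1000) \<or> ssum (window J) weight' A \<le> - (1964 / 1000))"
  proof (rule sprob_mono)
    fix A assume "dips J 0 A"
    then obtain x where x: "0 < x" "x < 1" "model J A x < 0" by (auto simp: dips_def)
    define y where "y = x - 1 / 2"
    have xy: "x = 1 / 2 + y" "\<bar>y\<bar> < 1 / 2" using x by (auto simp: y_def abs_if)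
    let ?t = "\<lambda>i. sg A i * of_int (sgn i) * (4 * (weight i)\<^sup>2)"
    have abs_t: "\<bar>?t i\<bar> \<le> 4 * (weight i)\<^sup>2" for i
      using sg_cases[of A i] by (auto simp: sgn_if abs_mult)
    have ts: "\<bar>\<Sum>i\<in>X. ?t i\<bar> \<le> (\<Sum>i\<in>X. 4 * (weight i)\<^sup>2)" for X
      by (rule order_trans[OF sum_abs]) (intro sum_mono abs_t)
    have w: "weight 1 = 1 / 3" "weight (-2) = 1 / 3" by (simp_all add: weight_def)
    show "wsum J A < - (1991 / 1000) \<or> ssum (window J) weight' A \<le> - (1964 / 1000)"
    proof (cases "sg A 1 = sg A (-2)")
      case True
      have "(\<Sum>i\<in>window J. ?t i) = ?t 1 + (?t (-2) + (\<Sum>i\<in>window J - {1, -2}. ?t i))"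
        by (subst window_split[OF J]) simp
      then have "(\<Sum>i\<in>window J. ?t i) = (\<Sum>i\<in>window J - {1, -2}. ?t i)" using True by (simp add: w)
      then have "\<bar>\<Sum>i\<in>window J. ?t i\<bar> \<le> 1" using ts[of "window J - {1, -2}"] sum_weight_squares(2)[of J] by linarith
      from model_lower_bound[OF xy this] x(3) show ?thesis by simp
    next
      case False
      have "\<bar>\<Sum>i\<in>window J. ?t i\<bar> \<le> 2" using ts[of "window J"] sum_weight_squares(1)[of J] by linarith
      from model_lower_bound[OF xy this] x(3) have ws: "wsum J A \<le> - (1964 / 1000)" by simp
      have "wsum J A = sg A 1 * weight 1 + (sg A (-2) * weight (-2) + (\<Sum>i\<in>window J - {1, -2}. sg A i * weight i))"
        unfolding ssum_def by (subst window_split[OF J]) simp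
      moreover have "sg A 1 * weight 1 + sg A (-2) * weight (-2) = 0" using False by (auto simp: w sg_def split: if_splits)
      moreover have "ssum (window J) weight' A = (\<Sum>i\<in>window J - {1, -2}. sg A i * weight i)"
        unfolding ssum_def by (subst window_split[OF J]) (simp add: weight'_def)
      ultimately have "ssum (window J) weight' A = wsum J A" by simp
      then show ?thesis using ws by simp
    qed
  qed
  then show ?thesis
    using sprob_disj[of "window J" "\<lambda>A. wsum J A < - (1991 / 1000)" "\<lambda>A. ssum (window J) weight' A \<le> - (1964 / 1000)"]
    unfolding tail_prob_def by linarith
qed

section \<open>Cosine products\<close>

text \<open>One real parameter $\rho$ stands for both the mode and the threshold of \<open>phi\<close>.\<close>
definition cprod :: "real \<Rightarrow> nat \<Rightarrow> real" where
  "cprod \<rho> k = (\<Prod>j=1..k. (cos (pi * \<rho> / real (2 * j + 1)))\<^sup>2)"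

lemma phi_eq_cprod: "phi c J m = cprod (real (2 * m + 1) / (2 * c)) J"
proof -
  have "real (2 * m + 1) * pi / (2 * c) = pi * (real (2 * m + 1) / (2 * c))" by simp
  then show ?thesis by (simp only: phi_def cprod_def)
qed

lemma cprod_Suc: "cprod \<rho> (Suc k) = cprod \<rho> k * (cos (pi * \<rho> / real (2 * k + 3)))\<^sup>2"
proof -
  have "2 * Suc k + 1 = 2 * k + 3" by simp
  then show ?thesis by (simp only: cprod_def prod.nat_ivl_Suc') (simp add: mult.commute)
qed

lemma cprod_nonneg: "0 \<le> cprod \<rho> k" and cprod_le_1: "cprod \<rho> k \<le> 1"
  unfolding cprod_def by (auto intro!: prod_nonneg prod_le_1 simp: abs_square_le_1)

text \<open>Shifting the telescoping sum by a small $\alpha$ still bounds the squares from below and is almost sharp.\<close>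
lemma inverse_odd_square_lower:
  fixes x :: real
  assumes "0 \<le> \<alpha>" "1 / 4 \<le> \<alpha> * (2 * x + 1)" "x \<ge> 0"
  shows "(1 / (x + \<alpha>) - 1 / (x + 1 + \<alpha>)) / 4 \<le> 1 / (2 * x + 1)\<^sup>2"
proof -
  have a: "\<alpha> > 0" using assms by (cases "\<alpha> = 0") auto
  have "(1 / (x + \<alpha>) - 1 / (x + 1 + \<alpha>)) / 4 = 1 / (4 * ((x + \<alpha>) * (x + 1 + \<alpha>)))"
    using assms a by (simp add: divide_simps)
  also have "\<dots> \<le> 1 / (2 * x + 1)\<^sup>2"
  proof (rule divide_left_mono)
    have "4 * ((x + \<alpha>) * (x + 1 + \<alpha>)) = (2 * x + 1)\<^sup>2 - 1 + 4 * (\<alpha> * (2 * x + 1)) + 4 * \<alpha>\<^sup>2"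
      by (simp add: power2_eq_square algebra_simps)
    then show "(2 * x + 1)\<^sup>2 \<le> 4 * ((x + \<alpha>) * (x + 1 + \<alpha>))" using assms zero_le_power2[of \<alpha>] by linarith
    show "0 < 4 * ((x + \<alpha>) * (x + 1 + \<alpha>)) * (2 * x + 1)\<^sup>2" using assms a by (intro mult_pos_pos) auto
  qed simp
  finally show ?thesis .
qed

text \<open>From the factor $N+1$ on, arguments are at most $\pi/2$ and each squared cosine is below a Gaussian; the sum of the
  exponents telescopes.\<close>
lemma cprod_upper:
  assumes N: "N \<le> J" and r: "0 \<le> \<rho>" "\<rho> \<le> real N + 3 / 2"
  shows "cprod \<rho> J \<le> cprod \<rho> N * exp (- ((pi * \<rho>)\<^sup>2 / 4 * (1 / (real N + 1 + 1 / (8 * real N + 12)) - 1 / (real J + 1))))"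
proof -
  define \<alpha> where "\<alpha> = 1 / (8 * real N + 12)"
  have a0: "\<alpha> \<ge> 0" by (simp add: \<alpha>_def)
  define E where "E k = (pi * \<rho>)\<^sup>2 / 4 * (1 / (real N + 1 + \<alpha>) - 1 / (real k + 1 + \<alpha>))" for k
  have "cprod \<rho> J \<le> cprod \<rho> N * exp (- E J)"
    using N
  proof (induction J rule: dec_induct)
    case base
    show ?case by (simp add: E_def)
  next
    case (step k)
    let ?z = "pi * \<rho> / real (2 * k + 3)"
    have "\<rho> \<le> real (2 * k + 3) / 2" using r step.hyps by simp
    then have "pi * \<rho> \<le> pi * (real (2 * k + 3) / 2)" by (intro mult_left_mono) auto
    then have "\<bar>?z\<bar> \<le> pi / 2" using r by (simp add: field_simps)
    then have "(cos ?z)\<^sup>2 \<le> exp (- ?z\<^sup>2)" by (rule cos_squared_le_exp)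
    also have "\<dots> \<le> exp (- (E (Suc k) - E k))"
    proof -
      have al: "1 / 4 \<le> \<alpha> * (2 * (real k + 1) + 1)"
      proof -
        have "\<alpha> * (2 * real N + 3) = 1 / 4" by (simp add: \<alpha>_def divide_simps)
        moreover have "\<alpha> * (2 * real N + 3) \<le> \<alpha> * (2 * (real k + 1) + 1)" using step.hyps a0 by (intro mult_left_mono) auto
        ultimately show ?thesis by simp
      qed
      have "E (Suc k) - E k = (pi * \<rho>)\<^sup>2 * ((1 / (real k + 1 + \<alpha>) - 1 / (real k + 1 + 1 + \<alpha>)) / 4)"
      proof -
        have gen: "P / 4 * (u - w) - P / 4 * (u - v) = P * ((v - w) / 4)" for P u v w :: real by (simp add: field_simps)
        have e: "real (Suc k) + 1 + \<alpha> = real k + 1 + 1 + \<alpha>" by simp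
        show ?thesis unfolding E_def e by (rule gen)
      qed
      also have "\<dots> \<le> (pi * \<rho>)\<^sup>2 * (1 / (2 * (real k + 1) + 1)\<^sup>2)"
        by (intro mult_left_mono inverse_odd_square_lower a0 al) auto
      also have "\<dots> = ?z\<^sup>2" by (simp add: power_divide algebra_simps)
      finally show ?thesis by simp
    qed
    finally have c: "(cos ?z)\<^sup>2 \<le> exp (- (E (Suc k) - E k))" .
    have "cprod \<rho> (Suc k) \<le> (cprod \<rho> N * exp (- E k)) * exp (- (E (Suc k) - E k))"
      unfolding cprod_Suc by (intro mult_mono step.IH c mult_nonneg_nonneg cprod_nonneg) auto
    also have "\<dots> = cprod \<rho> N * exp (- E (Suc k))" by (simp add: mult.assoc flip: exp_add)
    finally show ?case .
  qed
  also have "\<dots> \<le> cprod \<rho> N * exp (- ((pi * \<rho>)\<^sup>2 / 4 * (1 / (real N + 1 + \<alpha>) - 1 / (real J + 1))))"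
  proof -
    have "1 / (real J + 1 + \<alpha>) \<le> 1 / (real J + 1)" using a0 by (intro divide_left_mono mult_pos_pos) auto
    then have "(pi * \<rho>)\<^sup>2 / 4 * (1 / (real N + 1 + \<alpha>) - 1 / (real J + 1)) \<le> E J"
      unfolding E_def by (intro mult_left_mono) auto
    then show ?thesis by (intro mult_left_mono cprod_nonneg) simp
  qed
  finally show ?thesis unfolding \<alpha>_def .
qed

text \<open>The Gaussian lower bound carries a quartic correction, which is estimated by its value at $2N+3$ times the quadratic
  sum.\<close>
lemma cprod_lower:
  assumes N: "N \<le> J" and r: "0 \<le> \<rho>" "pi * \<rho> \<le> (2 * real N + 3) / 3"
  shows "cprod \<rho> N * exp (- (((pi * \<rho>)\<^sup>2 + (pi * \<rho>) ^ 4 / (5 * (2 * real N + 3)\<^sup>2)) / (4 * (real N + 1)))) \<le> cprod \<rho> J"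
proof -
  define \<gamma> where "\<gamma> = (pi * \<rho>)\<^sup>2 + (pi * \<rho>) ^ 4 / (5 * (2 * real N + 3)\<^sup>2)"
  have g0: "\<gamma> \<ge> 0" unfolding \<gamma>_def by (intro add_nonneg_nonneg divide_nonneg_nonneg) auto
  define E where "E k = \<gamma> / 4 * (1 / (real N + 1) - 1 / (real k + 1))" for k
  have "cprod \<rho> N * exp (- E J) \<le> cprod \<rho> J"
    using N
  proof (induction J rule: dec_induct)
    case base
    show ?case by (simp add: E_def)
  next
    case (step k)
    let ?w = "real (2 * k + 3)" and ?z = "pi * \<rho> / real (2 * k + 3)"
    have w: "2 * real N + 3 \<le> ?w" using step.hyps by simp
    have "(2 * real N + 3) / 3 \<le> ?w / 3" using w by (rule divide_right_mono) simp
    with r(2) have "pi * \<rho> \<le> ?w / 3" by (rule order_trans)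
    then have z: "0 \<le> ?z" "?z \<le> 1 / 3" using r by (simp_all add: field_simps)
    have "exp (- (E (Suc k) - E k)) \<le> exp (- ?z\<^sup>2 - ?z ^ 4 / 5)"
    proof -
      have "?z\<^sup>2 + ?z ^ 4 / 5 = (pi * \<rho>)\<^sup>2 / ?w\<^sup>2 + (pi * \<rho>) ^ 4 / (5 * ?w\<^sup>2) / ?w\<^sup>2"
        by (simp add: power_divide power2_eq_square power4_eq_xxxx)
      also have "\<dots> \<le> (pi * \<rho>)\<^sup>2 / ?w\<^sup>2 + (pi * \<rho>) ^ 4 / (5 * (2 * real N + 3)\<^sup>2) / ?w\<^sup>2"
        using w by (intro add_left_mono divide_right_mono divide_left_mono mult_left_mono power_mono mult_pos_pos) auto
      also have "\<dots> = \<gamma> * (1 / ?w\<^sup>2)" by (simp add: \<gamma>_def add_divide_distrib)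
      also have "\<dots> \<le> \<gamma> * ((1 / (real k + 1) - 1 / (real (Suc k) + 1)) / 4)"
      proof (intro mult_left_mono g0)
        show "1 / ?w\<^sup>2 \<le> (1 / (real k + 1) - 1 / (real (Suc k) + 1)) / 4"
          by (simp add: divide_simps power2_eq_square) (simp add: algebra_simps)
      qed
      also have "\<dots> = E (Suc k) - E k"
      proof -
        have gen: "P * ((v - w) / 4) = P / 4 * (u - w) - P / 4 * (u - v)" for P u v w :: real by (simp add: field_simps)
        show ?thesis unfolding E_def by (rule gen)
      qed
      finally show ?thesis by simp
    qed
    also have "\<dots> \<le> (cos ?z)\<^sup>2" by (rule cos_squared_ge_exp[OF z])
    finally have c: "exp (- (E (Suc k) - E k)) \<le> (cos ?z)\<^sup>2" .
    have "cprod \<rho> N * exp (- E (Suc k)) = (cprod \<rho> N * exp (- E k)) * exp (- (E (Suc k) - E k))"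
      by (simp add: mult.assoc flip: exp_add)
    also have "\<dots> \<le> cprod \<rho> (Suc k)"
      unfolding cprod_Suc by (intro mult_mono step.IH c cprod_nonneg) auto
    finally show ?case .
  qed
  moreover have "E J \<le> \<gamma> / (4 * (real N + 1))"
  proof -
    have "E J \<le> \<gamma> / 4 * (1 / (real N + 1))" unfolding E_def using g0 by (intro mult_left_mono) auto
    then show ?thesis by simp
  qed
  then have "cprod \<rho> N * exp (- (\<gamma> / (4 * (real N + 1)))) \<le> cprod \<rho> N * exp (- E J)"
    by (intro mult_left_mono cprod_nonneg) simp
  ultimately show ?thesis unfolding \<gamma>_def by linarith
qed

lemma pi_bounds: "3.141592653588 \<le> pi" "pi \<le> 3.1415926535899"
  using pi_approx by simp_all

lemma pi_squared_bounds: "9869604401 / 10 ^ 9 \<le> pi\<^sup>2" "pi\<^sup>2 \<le> 9869604402 / 10 ^ 9"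
proof -
  have "3.141592653588\<^sup>2 \<le> pi\<^sup>2" by (intro power_mono pi_bounds) simp
  then show "9869604401 / 10 ^ 9 \<le> pi\<^sup>2" by (simp add: power2_eq_square)
  have "pi\<^sup>2 \<le> 3.1415926535899\<^sup>2" by (intro power_mono pi_bounds) simp
  then show "pi\<^sup>2 \<le> 9869604402 / 10 ^ 9" by (simp add: power2_eq_square)
qed

lemma exp_1_bounds: "271828182 / 100000000 \<le> exp (1 :: real)" "exp (1 :: real) \<le> 271828183 / 100000000"
proof -
  have e: "\<bar>exp 1 - 5837465777 / 2147483648\<bar> \<le> (1 / 10 ^ 9 :: real)"
    by (rule order_trans[OF e_approx_32]) simp
  show "271828182 / 100000000 \<le> exp (1 :: real)" "exp (1 :: real) \<le> 271828183 / 100000000"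
    using e unfolding abs_le_iff by (simp_all add: algebra_simps)
qed

text \<open>The number of factors whose arguments may exceed $\pi/2$ is about $m/2$; these are bounded by $1$, and the Gaussian
  bound for the remaining ones is already smaller than $e^{-m}$.\<close>
lemma phi_rapid_decay:
  assumes m: "m \<ge> 9" and c: "199 / 100 \<le> c" "c \<le> 2" and J: "1000 * (m + 1) \<le> J"
  shows "phi c J m \<le> (3 / 8) ^ m"
proof -
  define \<rho> where "\<rho> = real (2 * m + 1) / (2 * c)"
  \<comment> \<open>slightly more than $m/2$, as needed for arguments up to $\pi/2$ when $c$ is only close to $2$\<close>
  define N where "N = 11 * m div 20"
  have N: "20 * real N \<le> 11 * real m" "11 * real m \<le> 20 * real N + 19"
  proof -
    have "20 * N \<le> 11 * m" "11 * m \<le> 20 * N + 19" unfolding N_def by linarith+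
    then have "real (20 * N) \<le> real (11 * m)" "real (11 * m) \<le> real (20 * N + 19)" by (simp_all only: of_nat_le_iff)
    then show "20 * real N \<le> 11 * real m" "11 * real m \<le> 20 * real N + 19" by simp_all
  qed
  have "N \<le> 11 * m" unfolding N_def by (rule div_le_dividend)
  also have "11 * m \<le> 1000 * (m + 1)" by simp
  also note J
  finally have NJ: "N \<le> J" .
  have r0: "(2 * real m + 1) / 4 \<le> \<rho>" and r1: "\<rho> \<le> (2 * real m + 1) / (398 / 100)"
  proof -
    have e: "\<rho> = (2 * real m + 1) / (2 * c)" by (simp add: \<rho>_def)
    show "(2 * real m + 1) / 4 \<le> \<rho>" "\<rho> \<le> (2 * real m + 1) / (398 / 100)"
      unfolding e using c by (intro divide_left_mono mult_pos_pos; simp)+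
  qed
  have rN: "\<rho> \<le> real N + 3 / 2"
  proof -
    have "(2 * real m + 1) / (398 / 100) \<le> real N + 3 / 2" using N(2) by (simp add: field_simps)
    then show ?thesis using r1 by linarith
  qed
  have rpos: "0 \<le> \<rho>" using c by (simp add: \<rho>_def)
  define X where "X = (pi * \<rho>)\<^sup>2 / 4 * (1 / (real N + 1 + 1 / (8 * real N + 12)) - 1 / (real J + 1))"
  have "phi c J m \<le> cprod \<rho> N * exp (- X)"
    unfolding phi_eq_cprod \<rho>_def[symmetric] X_def by (rule cprod_upper[OF NJ rpos rN])
  also have "\<dots> \<le> 1 * exp (- X)" by (intro mult_right_mono cprod_le_1) auto
  also have "\<dots> \<le> exp (- real m)"
  proof -
    define D where "D = 55 / 100 * real m + 11 / 10"
    have D: "D > 0" by (simp add: D_def)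
    have d: "999 / 1000 / D \<le> 1 / (real N + 1 + 1 / (8 * real N + 12)) - 1 / (real J + 1)"
    proof -
      have "1 / (8 * real N + 12) \<le> 1 / 10" by (rule divide_left_mono) auto
      then have "real N + 1 + 1 / (8 * real N + 12) \<le> D" using N(1) unfolding D_def by linarith
      then have 1: "1 / D \<le> 1 / (real N + 1 + 1 / (8 * real N + 12))"
        using D by (intro divide_left_mono mult_pos_pos add_pos_pos add_nonneg_pos) auto
      have "real (1000 * (m + 1)) \<le> real J" using J by (simp only: of_nat_le_iff)
      moreover have "9 \<le> real m" using m by simp
      ultimately have "1000 * D \<le> real J + 1" unfolding D_def by simp
      then have 2: "1 / (real J + 1) \<le> 1 / (1000 * D)" using D by (intro divide_left_mono mult_pos_pos) auto
      have "999 / 1000 / D = 1 / D - 1 / (1000 * D)" using D by (simp add: divide_simps)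
      then show ?thesis using 1 2 by linarith
    qed
    have "real m * D \<le> 9869604401 / 10 ^ 9 * ((2 * real m + 1) / 4)\<^sup>2 / 4 * (999 / 1000)"
    proof -
      have "0 \<le> (real m - 9) * real m" using m by (intro mult_nonneg_nonneg) auto
      then show ?thesis unfolding D_def by (simp add: power2_eq_square field_simps)
    qed
    also have "\<dots> \<le> (pi * \<rho>)\<^sup>2 / 4 * (999 / 1000)"
      unfolding power_mult_distrib using r0
      by (intro mult_right_mono divide_right_mono mult_mono pi_squared_bounds power_mono) auto
    finally have "real m \<le> (pi * \<rho>)\<^sup>2 / 4 * (999 / 1000) / D" using D by (simp add: le_divide_eq)
    also have "\<dots> = (pi * \<rho>)\<^sup>2 / 4 * (999 / 1000 / D)" by simp
    also have "\<dots> \<le> X" unfolding X_def by (intro mult_left_mono d) auto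
    finally show ?thesis by simp
  qed
  also have "exp (- real m) = exp (-1) ^ m" by (simp flip: exp_of_nat_mult)
  also have "\<dots> \<le> (3 / 8) ^ m"
  proof (rule power_mono)
    have "8 / 3 \<le> exp (1::real)" using exp_1_bounds(1) by linarith
    then show "exp (-1) \<le> 3 / (8::real)" by (simp add: exp_minus field_simps)
  qed simp
  finally show ?thesis .
qed

lemma phi_nonneg: "0 \<le> phi c J m" unfolding phi_eq_cprod by (rule cprod_nonneg)

lemma fourier_tail:
  assumes m: "m0 \<ge> 9" "m0 \<le> M" and c: "199 / 100 \<le> c" "c \<le> 2" and J: "1000 * M \<le> J"
  shows "\<bar>(\<Sum>m<M. (-1) ^ m * phi c J m / real (2 * m + 1)) - (\<Sum>m<m0. (-1) ^ m * phi c J m / real (2 * m + 1))\<bar>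
    \<le> 8 / 5 * (3 / 8) ^ m0 / real (2 * m0 + 1)"
proof -
  let ?t = "\<lambda>m. (-1) ^ m * phi c J m / real (2 * m + 1)"
  have "(\<Sum>m<M. ?t m) = (\<Sum>m<m0. ?t m) + (\<Sum>m=m0..<M. ?t m)"
    using sum.atLeastLessThan_concat[of 0 m0 M ?t] m(2) by (simp add: lessThan_atLeast0)
  then have "\<bar>(\<Sum>m<M. ?t m) - (\<Sum>m<m0. ?t m)\<bar> = \<bar>\<Sum>m=m0..<M. ?t m\<bar>" by simp
  also have "\<dots> \<le> (\<Sum>m=m0..<M. \<bar>?t m\<bar>)" by (rule sum_abs)
  also have "\<dots> \<le> (\<Sum>m=m0..<M. (3 / 8) ^ m / real (2 * m0 + 1))"
  proof (rule sum_mono)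
    fix m assume mm: "m \<in> {m0..<M}"
    have "phi c J m \<le> (3 / 8) ^ m" using mm m J by (intro phi_rapid_decay c) auto
    then have "phi c J m / real (2 * m + 1) \<le> (3 / 8) ^ m / real (2 * m0 + 1)"
      using mm by (intro frac_le) auto
    then show "\<bar>?t m\<bar> \<le> (3 / 8) ^ m / real (2 * m0 + 1)" by (simp add: abs_mult power_abs phi_nonneg)
  qed
  also have "\<dots> = (\<Sum>m=m0..<M. (3 / 8) ^ m) / real (2 * m0 + 1)" by (simp only: sum_divide_distrib)
  also have "\<dots> \<le> 8 / 5 * (3 / 8) ^ m0 / real (2 * m0 + 1)"
  proof (intro divide_right_mono)
    have "(\<Sum>m=m0..<M. (3 / 8 :: real) ^ m) = 8 / 5 * ((3 / 8) ^ m0 - (3 / 8) ^ M)"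
      using sum_Suc_diff'[OF m(2), of "\<lambda>m. - (8 / 5 * (3 / 8 :: real) ^ m)"] by (simp add: algebra_simps)
    then show "(\<Sum>m=m0..<M. (3 / 8 :: real) ^ m) \<le> 8 / 5 * (3 / 8) ^ m0" by simp
  qed simp
  finally show ?thesis .
qed

section \<open>Cosine products in fixed-point arithmetic\<close>

text \<open>Fixed-point numbers with eight decimals: the integers $t$ and $w$ stand for $t/10^8$ and $w/10^8$, and the result
  for $1 - t w / c$, a step of a Horner scheme, rounded downwards.\<close>
definition down :: "int \<Rightarrow> int \<Rightarrow> int \<Rightarrow> int" where "down c t w = 10 ^ 8 - t * w div (c * 10 ^ 8) - 1"
definition up :: "int \<Rightarrow> int \<Rightarrow> int \<Rightarrow> int" where "up c t w = 10 ^ 8 - t * w div (c * 10 ^ 8)"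

lemma up_correct:
  assumes "0 \<le> t" "0 < c" "of_int w \<le> 10 ^ 8 * W"
  shows "10 ^ 8 * (1 - of_int t / 10 ^ 8 / of_int c * W) \<le> real_of_int (up c t w)"
proof -
  have "real_of_int (t * w div (c * 10 ^ 8)) \<le> real_of_int (t * w) / real_of_int (c * 10 ^ 8)" by (rule real_of_int_div4)
  also have "\<dots> = of_int t * of_int w / (of_int c * 10 ^ 8)" by simp
  also have "\<dots> \<le> of_int t * (10 ^ 8 * W) / (of_int c * 10 ^ 8)" using assms by (intro divide_right_mono mult_left_mono) auto
  finally show ?thesis by (simp add: up_def)
qed

lemma down_correct:
  assumes "0 \<le> t" "0 < c" "10 ^ 8 * W \<le> of_int w"
  shows "real_of_int (down c t w) \<le> 10 ^ 8 * (1 - of_int t / 10 ^ 8 / of_int c * W)"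
proof -
  have "of_int t * (10 ^ 8 * W) / (of_int c * 10 ^ 8) \<le> of_int t * of_int w / (of_int c * 10 ^ 8)"
    using assms by (intro divide_right_mono mult_left_mono) auto
  also have "\<dots> = real_of_int (t * w) / real_of_int (c * 10 ^ 8)" by simp
  also have "\<dots> \<le> real_of_int (t * w div (c * 10 ^ 8)) + 1"
    using real_of_int_div3[of "t * w" "c * 10 ^ 8"] by linarith
  finally show ?thesis by (simp add: down_def)
qed

text \<open>The nested form of the Taylor polynomial of the cosine in $t = x^2$. The rounding alternates because each step reverses
  inequalities.\<close>
definition cos_up :: "int \<Rightarrow> int" where
  "cos_up t = up 2 t (down 12 t (up 30 t (down 56 t (up 90 t (down 132 t (10 ^ 8))))))"
definition cos_down :: "int \<Rightarrow> int" where
  "cos_down t = down 2 t (up 12 t (down 30 t (up 56 t (down 90 t (up 132 t (down 182 t (10 ^ 8)))))))"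

text \<open>Taylor polynomials of the cosine that end with a positive term lie above it, those that end with a negative
  term below it.\<close>
lemma cos_taylor_bounds:
  fixes x :: real
  shows "cos x \<le> 1 - x\<^sup>2 / 2 * (1 - x\<^sup>2 / 12 * (1 - x\<^sup>2 / 30 * (1 - x\<^sup>2 / 56 * (1 - x\<^sup>2 / 90 * (1 - x\<^sup>2 / 132 * 1)))))"
    and "1 - x\<^sup>2 / 2 * (1 - x\<^sup>2 / 12 * (1 - x\<^sup>2 / 30 * (1 - x\<^sup>2 / 56 * (1 - x\<^sup>2 / 90 * (1 - x\<^sup>2 / 132 * (1 - x\<^sup>2 / 182 * 1)))))) \<le> cos x"
proof -
  obtain s where s: "cos x = (\<Sum>m<12. cos_coeff m * x ^ m) + cos (s + 1 / 2 * real 12 * pi) / fact 12 * x ^ 12"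
    using Maclaurin_cos_expansion[of x 12] by blast
  have "cos (s + 1 / 2 * real 12 * pi) / fact 12 * x ^ 12 \<le> 1 / fact 12 * x ^ 12"
    by (intro mult_right_mono divide_right_mono) auto
  then show "cos x \<le> 1 - x\<^sup>2 / 2 * (1 - x\<^sup>2 / 12 * (1 - x\<^sup>2 / 30 * (1 - x\<^sup>2 / 56 * (1 - x\<^sup>2 / 90 * (1 - x\<^sup>2 / 132 * 1)))))"
    unfolding s by (simp add: lessThan_nat_numeral cos_coeff_def fact_numeral right_diff_distrib flip: power_add)
  obtain s where s: "cos x = (\<Sum>m<14. cos_coeff m * x ^ m) + cos (s + 1 / 2 * real 14 * pi) / fact 14 * x ^ 14"
    using Maclaurin_cos_expansion[of x 14] by blast
  have "- 1 / fact 14 * x ^ 14 \<le> cos (s + 1 / 2 * real 14 * pi) / fact 14 * x ^ 14"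
    by (intro mult_right_mono divide_right_mono) auto
  then show "1 - x\<^sup>2 / 2 * (1 - x\<^sup>2 / 12 * (1 - x\<^sup>2 / 30 * (1 - x\<^sup>2 / 56 * (1 - x\<^sup>2 / 90 * (1 - x\<^sup>2 / 132 * (1 - x\<^sup>2 / 182 * 1)))))) \<le> cos x"
    unfolding s by (simp add: lessThan_nat_numeral cos_coeff_def fact_numeral right_diff_distrib flip: power_add)
qed

lemma cos_up_correct:
  assumes "0 \<le> x" "x \<le> pi" "0 \<le> t" "of_int t \<le> 10 ^ 8 * x\<^sup>2"
  shows "10 ^ 8 * cos x \<le> of_int (cos_up t)"
proof -
  define y where "y = sqrt (of_int t / 10 ^ 8)"
  have y2: "y\<^sup>2 = of_int t / 10 ^ 8" using assms by (simp add: y_def)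
  have y0: "0 \<le> y" using assms by (simp add: y_def)
  have "y\<^sup>2 \<le> x\<^sup>2" unfolding y2 using assms by simp
  then have "y \<le> x" using assms(1) by (rule power2_le_imp_le)
  then have "cos x \<le> cos y" using assms y0 by (subst cos_mono_le_eq) auto
  also note cos_taylor_bounds(1)[of y]
  finally have "10 ^ 8 * cos x \<le> 10 ^ 8 * (1 - y\<^sup>2 / 2 * (1 - y\<^sup>2 / 12 * (1 - y\<^sup>2 / 30 * (1 - y\<^sup>2 / 56 * (1 - y\<^sup>2 / 90 * (1 - y\<^sup>2 / 132 * 1))))))" 
    by (intro mult_left_mono) auto
  also have "\<dots> \<le> of_int (cos_up t)"
    unfolding y2 cos_up_def using assms(3)
    by (intro up_correct[of t 2, simplified of_int_numeral] down_correct[of t 12, simplified of_int_numeral] up_correct[of t 30, simplified of_int_numeral]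
        down_correct[of t 56, simplified of_int_numeral] up_correct[of t 90, simplified of_int_numeral] down_correct[of t 132, simplified of_int_numeral]) auto
  finally show ?thesis .
qed

lemma cos_down_correct:
  fixes x :: real
  assumes "0 \<le> x" "of_int t \<ge> 10 ^ 8 * x\<^sup>2" "of_int t \<le> 10 ^ 8 * pi\<^sup>2"
  shows "of_int (cos_down t) \<le> 10 ^ 8 * cos x"
proof -
  have t0: "0 \<le> t"
  proof -
    have "0 \<le> 10 ^ 8 * x\<^sup>2" by simp
    then have "0 \<le> real_of_int t" using assms(2) by linarith
    then show ?thesis by simp
  qed
  define y where "y = sqrt (of_int t / 10 ^ 8)"
  have y2: "y\<^sup>2 = of_int t / 10 ^ 8" using t0 by (simp add: y_def)
  have y0: "0 \<le> y" using t0 by (simp add: y_def)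
  have "x\<^sup>2 \<le> y\<^sup>2" "y\<^sup>2 \<le> pi\<^sup>2" unfolding y2 using assms by simp_all
  then have "x \<le> y" "y \<le> pi" using y0 by (auto intro: power2_le_imp_le)
  then have "cos y \<le> cos x" using assms y0 by (subst cos_mono_le_eq) auto
  with cos_taylor_bounds(2)[of y] have "10 ^ 8 * (1 - y\<^sup>2 / 2 * (1 - y\<^sup>2 / 12 * (1 - y\<^sup>2 / 30 * (1 - y\<^sup>2 / 56 * (1 - y\<^sup>2 / 90 * (1 - y\<^sup>2 / 132 * (1 - y\<^sup>2 / 182 * 1))))))) \<le> 10 ^ 8 * cos x"
    by (intro mult_left_mono) auto
  moreover have "of_int (cos_down t) \<le> 10 ^ 8 * (1 - y\<^sup>2 / 2 * (1 - y\<^sup>2 / 12 * (1 - y\<^sup>2 / 30 * (1 - y\<^sup>2 / 56 * (1 - y\<^sup>2 / 90 * (1 - y\<^sup>2 / 132 * (1 - y\<^sup>2 / 182 * 1)))))))"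
    unfolding y2 cos_down_def using t0
    by (intro up_correct[of t 12, simplified of_int_numeral] down_correct[of t 2, simplified of_int_numeral] up_correct[of t 56, simplified of_int_numeral]
        down_correct[of t 30, simplified of_int_numeral] up_correct[of t 132, simplified of_int_numeral] down_correct[of t 90, simplified of_int_numeral] down_correct[of t 182, simplified of_int_numeral]) auto
  ultimately show ?thesis by linarith
qed

text \<open>Reduction of the argument modulo $\pi$: the numerator of the distance of $a / D$ to the nearest integer.\<close>
definition centre :: "int \<Rightarrow> int \<Rightarrow> int" where "centre a D = min (a mod D) (D - a mod D)"

lemma cos_squared_centre:
  assumes "D > 0"
  shows "(cos (pi * (of_int a / of_int D)))\<^sup>2 = (cos (pi * (of_int (centre a D) / of_int D)))\<^sup>2"
    and "0 \<le> centre a D" "2 * centre a D \<le> D"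
proof -
  have shift: "(cos (pi * x + pi * of_int n))\<^sup>2 = (cos (pi * x))\<^sup>2" for x and n :: int
  proof -
    have "cos (2 * (pi * x + pi * of_int n)) = cos (2 * (pi * x) + (2 * pi) * of_int n)" by (simp add: algebra_simps)
    also have "\<dots> = cos (2 * (pi * x))" by (simp only: cos_add cos_int_2pin sin_int_2pin mult_1_right mult_zero_right diff_0_right)
    finally show ?thesis unfolding cos_double_cos by simp
  qed
  have a: "of_int a / of_int D = of_int (a mod D) / (of_int D :: real) + of_int (a div D)"
  proof -
    have "a = a mod D + D * (a div D)" by simp
    then have "real_of_int a = of_int (a mod D) + of_int D * of_int (a div D)" by (metis of_int_add of_int_mult)
    then show ?thesis using assms by (simp add: field_simps)
  qed
  have 1: "(cos (pi * (of_int a / of_int D)))\<^sup>2 = (cos (pi * (of_int (a mod D) / of_int D)))\<^sup>2"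
    unfolding a distrib_left by (rule shift)
  have 2: "(cos (pi * (of_int (D - a mod D) / of_int D)))\<^sup>2 = (cos (pi * (of_int (a mod D) / of_int D)))\<^sup>2"
  proof -
    have "pi * (of_int (D - a mod D) / of_int D) = pi * (- (of_int (a mod D) / of_int D)) + pi * of_int 1"
      using assms by (simp add: field_simps)
    then show ?thesis using shift[of "- (of_int (a mod D) / of_int D)" 1] by simp
  qed
  show "(cos (pi * (of_int a / of_int D)))\<^sup>2 = (cos (pi * (of_int (centre a D) / of_int D)))\<^sup>2"
    unfolding centre_def min_def using 1 2 by simp
  have "0 \<le> a mod D" "a mod D < D" using assms by simp_all
  then show "0 \<le> centre a D" "2 * centre a D \<le> D" unfolding centre_def min_def by auto
qed

text \<open>The square of the reduced argument $\pi a/D$ in fixed-point form. It is rounded downwards for the upper bound,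
  as the cosine decreases.\<close>
definition square_up :: "int \<Rightarrow> int \<Rightarrow> int" where "square_up a D = 9869604401 * (centre a D)\<^sup>2 div (10 * D\<^sup>2)"
definition square_down :: "int \<Rightarrow> int \<Rightarrow> int" where "square_down a D = 9869604402 * (centre a D)\<^sup>2 div (10 * D\<^sup>2) + 1"

definition step_up :: "int \<Rightarrow> int \<Rightarrow> int \<Rightarrow> int" where "step_up a D B = B * (cos_up (square_up a D))\<^sup>2 div 10 ^ 16 + 1"
definition step_down :: "int \<Rightarrow> int \<Rightarrow> int \<Rightarrow> int" where "step_down a D B = B * (max 0 (cos_down (square_down a D)))\<^sup>2 div 10 ^ 16"

lemma step_up_correct:
  assumes D: "D > 0" and P: "0 \<le> P" "10 ^ 8 * P \<le> of_int B"
  shows "10 ^ 8 * (P * (cos (pi * (of_int a / of_int D)))\<^sup>2) \<le> of_int (step_up a D B)"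
proof -
  define x where "x = pi * (of_int (centre a D) / of_int D)"
  note c = cos_squared_centre[OF D, of a, folded x_def]
  have r: "0 \<le> of_int (centre a D) / (of_int D :: real)" "of_int (centre a D) / (of_int D :: real) \<le> 1 / 2"
  proof -
    show "0 \<le> of_int (centre a D) / (of_int D :: real)" using c(2) D by simp
    have "real_of_int (2 * centre a D) \<le> of_int D" using c(3) by (simp only: of_int_le_iff)
    then show "of_int (centre a D) / (of_int D :: real) \<le> 1 / 2" using D by (simp add: divide_simps)
  qed
  have x: "0 \<le> x" unfolding x_def using r(1) by (intro mult_nonneg_nonneg) auto
  have x': "x \<le> pi / 2" unfolding x_def using mult_left_mono[OF r(2), of pi] by simp
  have sq: "real_of_int (square_up a D) \<le> 10 ^ 8 * x\<^sup>2"
  proof -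
    have "real_of_int (square_up a D) \<le> of_int (9869604401 * (centre a D)\<^sup>2) / of_int (10 * D\<^sup>2)"
      unfolding square_up_def by (rule real_of_int_div4)
    also have "\<dots> = 10 ^ 8 * (9869604401 / 10 ^ 9 * (of_int (centre a D) / of_int D)\<^sup>2)" by (simp add: power_divide)
    also have "\<dots> \<le> 10 ^ 8 * (pi\<^sup>2 * (of_int (centre a D) / of_int D)\<^sup>2)"
      by (intro mult_left_mono mult_right_mono pi_squared_bounds) auto
    finally show ?thesis by (simp only: x_def power_mult_distrib)
  qed
  have sq0: "0 \<le> square_up a D" unfolding square_up_def using D by (simp add: pos_imp_zdiv_nonneg_iff)
  have cu: "10 ^ 8 * cos x \<le> of_int (cos_up (square_up a D))" using x x' sq sq0 pi_ge_zero by (intro cos_up_correct) linarith+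
  have "10 ^ 8 * (P * (cos x)\<^sup>2) = (10 ^ 8 * P) * (10 ^ 8 * cos x)\<^sup>2 / 10 ^ 16" by (simp add: power_mult_distrib)
  also have "\<dots> \<le> of_int B * (of_int (cos_up (square_up a D)))\<^sup>2 / 10 ^ 16"
    using P cu x x' by (intro divide_right_mono mult_mono power_mono) (auto intro!: cos_ge_zero mult_nonneg_nonneg)
  also have "\<dots> = real_of_int (B * (cos_up (square_up a D))\<^sup>2) / real_of_int (10 ^ 16)" by simp
  also have "\<dots> \<le> of_int (step_up a D B)" unfolding step_up_def
    using real_of_int_div3[of "B * (cos_up (square_up a D))\<^sup>2" "10 ^ 16"] by linarith
  finally show ?thesis unfolding c(1) .
qed

lemma step_down_correct:
  assumes D: "D > 0" and P: "0 \<le> B" "of_int B \<le> 10 ^ 8 * P"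
  shows "of_int (step_down a D B) \<le> 10 ^ 8 * (P * (cos (pi * (of_int a / of_int D)))\<^sup>2)" and "0 \<le> step_down a D B"
proof -
  define x where "x = pi * (of_int (centre a D) / of_int D)"
  note c = cos_squared_centre[OF D, of a, folded x_def]
  have r: "0 \<le> of_int (centre a D) / (of_int D :: real)" "of_int (centre a D) / (of_int D :: real) \<le> 1 / 2"
  proof -
    show "0 \<le> of_int (centre a D) / (of_int D :: real)" using c(2) D by simp
    have "real_of_int (2 * centre a D) \<le> of_int D" using c(3) by (simp only: of_int_le_iff)
    then show "of_int (centre a D) / (of_int D :: real) \<le> 1 / 2" using D by (simp add: divide_simps)
  qed
  have x: "0 \<le> x" unfolding x_def using r(1) by (intro mult_nonneg_nonneg) auto
  have x': "x \<le> pi / 2" unfolding x_def using mult_left_mono[OF r(2), of pi] by simp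
  have sq: "10 ^ 8 * x\<^sup>2 \<le> real_of_int (square_down a D)" "real_of_int (square_down a D) \<le> 10 ^ 8 * pi\<^sup>2"
  proof -
    have e: "of_int (9869604402 * (centre a D)\<^sup>2) / of_int (10 * D\<^sup>2) = (10 ^ 8 * (9869604402 / 10 ^ 9 * (of_int (centre a D) / of_int D)\<^sup>2) :: real)"
      by (simp add: power_divide)
    have "10 ^ 8 * x\<^sup>2 = 10 ^ 8 * (pi\<^sup>2 * (of_int (centre a D) / of_int D)\<^sup>2)" by (simp only: x_def power_mult_distrib)
    also have "\<dots> \<le> 10 ^ 8 * (9869604402 / 10 ^ 9 * (of_int (centre a D) / of_int D)\<^sup>2)"
      by (intro mult_left_mono mult_right_mono pi_squared_bounds) auto
    also have "\<dots> \<le> of_int (square_down a D)"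
      using real_of_int_div3[of "9869604402 * (centre a D)\<^sup>2" "10 * D\<^sup>2"] unfolding e square_down_def by simp
    finally show "10 ^ 8 * x\<^sup>2 \<le> real_of_int (square_down a D)" .
    have "real_of_int (square_down a D) \<le> 10 ^ 8 * (9869604402 / 10 ^ 9 * (of_int (centre a D) / of_int D)\<^sup>2) + 1"
      using real_of_int_div4[of "9869604402 * (centre a D)\<^sup>2" "10 * D\<^sup>2"] unfolding e square_down_def by simp
    also have "\<dots> \<le> 10 ^ 8 * (9869604402 / 10 ^ 9 * (1 / 2)\<^sup>2) + 1"
      using r by (intro add_mono mult_left_mono power_mono) auto
    also have "\<dots> \<le> 10 ^ 8 * (9869604401 / 10 ^ 9)" by (simp add: power2_eq_square)
    also have "\<dots> \<le> 10 ^ 8 * pi\<^sup>2" by (intro mult_left_mono pi_squared_bounds) auto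
    finally show "real_of_int (square_down a D) \<le> 10 ^ 8 * pi\<^sup>2" .
  qed
  define v where "v = max 0 (cos_down (square_down a D))"
  have v: "0 \<le> v" "of_int v \<le> 10 ^ 8 * cos x"
    using cos_down_correct[OF x sq] cos_ge_zero[of x] x x' by (auto simp: v_def max_def)
  have "of_int (step_down a D B) \<le> real_of_int (B * v\<^sup>2) / real_of_int (10 ^ 16)"
    unfolding step_down_def v_def[symmetric] by (rule real_of_int_div4)
  also have "\<dots> = of_int B * (of_int v)\<^sup>2 / 10 ^ 16" by simp
  also have "\<dots> \<le> (10 ^ 8 * P) * (10 ^ 8 * cos x)\<^sup>2 / 10 ^ 16"
    using P v by (intro divide_right_mono mult_mono power_mono) (auto intro: order_trans[of _ "of_int B"])
  also have "\<dots> = 10 ^ 8 * (P * (cos x)\<^sup>2)" by (simp add: power_mult_distrib)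
  finally show "of_int (step_down a D B) \<le> 10 ^ 8 * (P * (cos (pi * (of_int a / of_int D)))\<^sup>2)" unfolding c(1) .
  show "0 \<le> step_down a D B" unfolding step_down_def using P by (simp add: pos_imp_zdiv_nonneg_iff)
qed

text \<open>The first \<open>k\<close> factors of \<open>cprod (a / d)\<close>, multiplied with outward rounding after each step.\<close>
primrec chain_up :: "int \<Rightarrow> int \<Rightarrow> nat \<Rightarrow> int" where
  "chain_up a d 0 = 10 ^ 8" |
  "chain_up a d (Suc k) = step_up a (d * (2 * int k + 3)) (chain_up a d k)"

primrec chain_down :: "int \<Rightarrow> int \<Rightarrow> nat \<Rightarrow> int" where
  "chain_down a d 0 = 10 ^ 8" |
  "chain_down a d (Suc k) = step_down a (d * (2 * int k + 3)) (chain_down a d k)"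

lemma cprod_le_chain_up:
  assumes d: "d > 0"
  shows "10 ^ 8 * cprod (of_int a / of_int d) k \<le> of_int (chain_up a d k)"
proof (induction k)
  case 0
  show ?case by (simp add: cprod_def)
next
  case (Suc k)
  have "pi * (of_int a / of_int d) / real (2 * k + 3) = pi * (of_int a / of_int (d * (2 * int k + 3)))" by simp
  then show ?case unfolding cprod_Suc using d
    by (simp only: chain_up.simps) (intro step_up_correct Suc.IH cprod_nonneg mult_pos_pos; simp)
qed

lemma chain_down_le_cprod:
  assumes d: "d > 0"
  shows "of_int (chain_down a d k) \<le> 10 ^ 8 * cprod (of_int a / of_int d) k" and "0 \<le> chain_down a d k"
proof (induction k)
  case 0
  show "of_int (chain_down a d 0) \<le> 10 ^ 8 * cprod (of_int a / of_int d) 0" "0 \<le> chain_down a d 0" by (simp_all add: cprod_def)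
next
  case (Suc k)
  have e: "pi * (of_int a / of_int d) / real (2 * k + 3) = pi * (of_int a / of_int (d * (2 * int k + 3)))" by simp
  have "d * (2 * int k + 3) > 0" using d by simp
  from step_down_correct[OF this Suc(2,1), of a]
  show "of_int (chain_down a d (Suc k)) \<le> 10 ^ 8 * cprod (of_int a / of_int d) (Suc k)" "0 \<le> chain_down a d (Suc k)"
    unfolding cprod_Suc e by simp_all
qed

text \<open>Arguments $(2m+1)/4$ for $c = 2$ and $(2m+1) \cdot 500/1991$ for $c = 1.991$.\<close>
lemma chain_up_values:
  shows "chain_up 1 4 20 = 87130617"
    and "chain_up 5 4 20 = 1091705"
    and "chain_up 9 4 20 = 24197"
    and "chain_up 13 4 20 = 584"
    and "chain_up 17 4 20 = 5"
    and "chain_up 21 4 20 = 3"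
    and "chain_up 1500 1991 20 = 26364521"
    and "chain_up 3500 1991 20 = 146237"
    and "chain_up 5500 1991 20 = 4198"
    and "chain_up 7500 1991 20 = 59"
  by code_simp+

lemma chain_down_values:
  shows "chain_down 3 4 20 = 26707562"
    and "chain_down 7 4 20 = 143424"
    and "chain_down 500 1991 20 = 87021083"
    and "chain_down 2500 1991 20 = 1025766"
  by code_simp+

section \<open>Numerical bounds\<close>

text \<open>The remainder of even order in Taylor's formula is positive, whatever the sign of $x$.\<close>
lemma exp_ge_cubic: "1 + x + x\<^sup>2 / 2 + x ^ 3 / 6 \<le> exp x" for x :: real
proof -
  obtain t where t: "exp x = (\<Sum>m<4. x ^ m / fact m) + exp t / fact 4 * x ^ 4"
    using Maclaurin_exp_le[of x 4] by blast
  have "(0::real) \<le> exp t / fact 4 * x ^ 4" by (intro mult_nonneg_nonneg) auto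
  moreover have "(\<Sum>m<4. x ^ m / fact m) = 1 + x + x\<^sup>2 / 2 + x ^ 3 / 6"
    by (simp add: lessThan_nat_numeral fact_numeral)
  ultimately show ?thesis using t by linarith
qed

text \<open>Twenty factors numerically, the others by \<open>cprod_upper\<close> with $N = 20$; the constant is a lower bound for
  $\pi^2/4 \cdot (172/3613 - 10^{-8})$.\<close>
lemma phi_le_chain:
  fixes a d :: int
  assumes J: "100000000 \<le> J" and c: "real (2 * m + 1) / (2 * c) = of_int a / of_int d" and d: "0 < d"
    and a: "0 \<le> a" "2 * a \<le> 43 * d"
    and B: "chain_up a d 20 = B" and X: "X = 117462 / 1000000 * (of_int a / of_int d)\<^sup>2"
    and v: "of_int B \<le> 100000000 * v * (1 + X + X\<^sup>2 / 2 + X ^ 3 / 6)"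
  shows "phi c J m \<le> v"
proof -
  define \<rho> where "\<rho> = real_of_int a / of_int d"
  have r: "0 \<le> \<rho>" unfolding \<rho>_def using a d by simp
  have "real_of_int (2 * a) \<le> of_int (43 * d)" using a(2) by (simp only: of_int_le_iff)
  then have r2: "\<rho> \<le> real 20 + 3 / 2" unfolding \<rho>_def using d by (simp add: divide_simps)
  have X0: "0 \<le> X" unfolding X by simp
  have Xe: "X \<le> (pi * \<rho>)\<^sup>2 / 4 * (1 / (real 20 + 1 + 1 / (8 * real 20 + 12)) - 1 / (real J + 1))"
  proof -
    have "1 / (real J + 1) \<le> 1 / 100000000" using J by (intro divide_left_mono) auto
    moreover have "1 / (real 20 + 1 + 1 / (8 * real 20 + 12)) = 172 / 3613" by simp
    ultimately have "47605857 / 1000000000 \<le> 1 / (real 20 + 1 + 1 / (8 * real 20 + 12)) - 1 / (real J + 1)" by linarith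
    then have "(9869604401 / 10 ^ 9 * \<rho>\<^sup>2) / 4 * (47605857 / 1000000000)
      \<le> (pi * \<rho>)\<^sup>2 / 4 * (1 / (real 20 + 1 + 1 / (8 * real 20 + 12)) - 1 / (real J + 1))"
      unfolding power_mult_distrib by (intro mult_mono divide_right_mono mult_right_mono pi_squared_bounds) auto
    moreover have "X \<le> (9869604401 / 10 ^ 9 * \<rho>\<^sup>2) / 4 * (47605857 / 1000000000)"
      unfolding X \<rho>_def[symmetric] by simp
    ultimately show ?thesis by linarith
  qed
  have "phi c J m \<le> cprod \<rho> 20 * exp (- ((pi * \<rho>)\<^sup>2 / 4 * (1 / (real 20 + 1 + 1 / (8 * real 20 + 12)) - 1 / (real J + 1))))"
    unfolding phi_eq_cprod c \<rho>_def[symmetric] using J by (intro cprod_upper r r2) simp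
  also have "\<dots> \<le> cprod \<rho> 20 * exp (- X)" using Xe by (intro mult_left_mono cprod_nonneg) simp
  finally have p: "phi c J m * exp X \<le> cprod \<rho> 20" by (simp add: exp_minus field_simps)
  have "100000000 * cprod \<rho> 20 \<le> of_int B"
    using cprod_le_chain_up[OF d, of a 20] unfolding B \<rho>_def[symmetric] by simp
  moreover have "phi c J m * (1 + X + X\<^sup>2 / 2 + X ^ 3 / 6) \<le> phi c J m * exp X"
    by (intro mult_left_mono exp_ge_cubic phi_nonneg)
  ultimately have "phi c J m * (1 + X + X\<^sup>2 / 2 + X ^ 3 / 6) \<le> v * (1 + X + X\<^sup>2 / 2 + X ^ 3 / 6)"
    using v p by linarith
  moreover have "0 < 1 + X + X\<^sup>2 / 2 + X ^ 3 / 6" using X0 by (simp add: add_pos_nonneg)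
  ultimately show ?thesis by (rule mult_right_le_imp_le)
qed

text \<open>Twenty factors numerically, the others by \<open>cprod_lower\<close> with $N = 20$; the constants are upper bounds for
  $\pi^2/84$ and $\pi^4/(5 \cdot 43^2 \cdot 84)$.\<close>
lemma chain_le_phi:
  fixes a d :: int
  assumes J: "100000000 \<le> J" and c: "real (2 * m + 1) / (2 * c) = of_int a / of_int d" and d: "0 < d"
    and a: "0 \<le> a" "a \<le> 4 * d"
    and B: "chain_down a d 20 = B"
    and Y: "Y = 1174954 / 10000000 * (of_int a / of_int d)\<^sup>2 + 1255 / 10000000 * (of_int a / of_int d) ^ 4"
    and v: "0 \<le> v" "100000000 * v \<le> of_int B * (1 - Y + Y\<^sup>2 / 2 - Y ^ 3 / 6)"
  shows "v \<le> phi c J m"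
proof -
  define \<rho> where "\<rho> = real_of_int a / of_int d"
  have r: "0 \<le> \<rho>" unfolding \<rho>_def using a d by simp
  have r2: "pi * \<rho> \<le> (2 * real 20 + 3) / 3"
  proof -
    have "real_of_int a \<le> of_int (4 * d)" using a(2) by (simp only: of_int_le_iff)
    then have "\<rho> \<le> 4" unfolding \<rho>_def using d by (simp add: divide_simps)
    then have "pi * \<rho> \<le> pi * 4" by (intro mult_left_mono) auto
    also have "pi * 4 \<le> (2 * real 20 + 3) / 3" using pi_bounds(2) by simp
    finally show ?thesis .
  qed
  have p4: "(pi * \<rho>) ^ 4 \<le> 9741 / 100 * \<rho> ^ 4"
  proof -
    have "pi ^ 4 = pi\<^sup>2 * pi\<^sup>2" by (simp add: power2_eq_square power4_eq_xxxx)
    also have "\<dots> \<le> (9869604402 / 10 ^ 9) * (9869604402 / 10 ^ 9)" by (intro mult_mono pi_squared_bounds) auto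
    also have "\<dots> \<le> 9741 / 100" by simp
    finally have "pi ^ 4 \<le> 9741 / 100" .
    then show ?thesis unfolding power_mult_distrib by (intro mult_right_mono) auto
  qed
  have p2: "(pi * \<rho>)\<^sup>2 \<le> 9869604402 / 10 ^ 9 * \<rho>\<^sup>2"
    unfolding power_mult_distrib by (intro mult_right_mono pi_squared_bounds) auto
  have Ye: "((pi * \<rho>)\<^sup>2 + (pi * \<rho>) ^ 4 / (5 * (2 * real 20 + 3)\<^sup>2)) / (4 * (real 20 + 1)) \<le> Y"
  proof -
    have "((pi * \<rho>)\<^sup>2 + (pi * \<rho>) ^ 4 / (5 * (2 * real 20 + 3)\<^sup>2)) / (4 * (real 20 + 1))
      \<le> (9869604402 / 10 ^ 9 * \<rho>\<^sup>2 + 9741 / 100 * \<rho> ^ 4 / (5 * (2 * real 20 + 3)\<^sup>2)) / (4 * (real 20 + 1))"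
      by (intro divide_right_mono add_mono p2 p4) auto
    also have "\<dots> = 9869604402 / 84000000000 * \<rho>\<^sup>2 + 9741 / 77658000 * \<rho> ^ 4" by (simp add: add_divide_distrib)
    also have "\<dots> \<le> Y" unfolding Y \<rho>_def[symmetric] by (intro add_mono mult_right_mono) auto
    finally show ?thesis .
  qed
  note ch = chain_down_le_cprod[OF d, of a 20, unfolded B, folded \<rho>_def]
  have "100000000 * v \<le> of_int B * (1 + (- Y) + (- Y)\<^sup>2 / 2 + (- Y) ^ 3 / 6)" using v(2) by simp
  also have "\<dots> \<le> of_int B * exp (- Y)" using chain_down_le_cprod(2)[OF d, of a 20] unfolding B
    by (intro mult_left_mono exp_ge_cubic) simp
  also have "\<dots> \<le> (100000000 * cprod \<rho> 20) * exp (- Y)" using ch(1) by (intro mult_right_mono) auto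
  also have "\<dots> \<le> (100000000 * cprod \<rho> 20) * exp (- (((pi * \<rho>)\<^sup>2 + (pi * \<rho>) ^ 4 / (5 * (2 * real 20 + 3)\<^sup>2)) / (4 * (real 20 + 1))))"
    using Ye by (intro mult_left_mono) (auto intro: cprod_nonneg)
  also have "\<dots> = 100000000 * (cprod \<rho> 20 * exp (- (((pi * \<rho>)\<^sup>2 + (pi * \<rho>) ^ 4 / (5 * (2 * real 20 + 3)\<^sup>2)) / (4 * (real 20 + 1)))))"
    by (rule mult.assoc)
  also have "\<dots> \<le> 100000000 * phi c J m"
    unfolding phi_eq_cprod c \<rho>_def[symmetric] using J by (intro mult_left_mono cprod_lower r r2) auto
  finally show ?thesis by simp
qed

lemma phi_2_bounds:
  assumes J: "100000000 \<le> J"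
  shows "phi 2 J 0 \<le> 86493301 / 100000000" "24998480 / 100000000 \<le> phi 2 J 1" "phi 2 J 2 \<le> 908689 / 100000000"
    "99868 / 100000000 \<le> phi 2 J 3" "phi 2 J 4 \<le> 13395 / 100000000" "phi 2 J 6 \<le> 176 / 100000000"
    "phi 2 J 8 \<le> 1 / 100000000" "phi 2 J 10 \<le> 1 / 100000000"
proof -
  show "phi 2 J 0 \<le> 86493301 / 100000000"
    by (rule phi_le_chain[OF J _ _ _ _ chain_up_values(1) refl]) (simp_all add: power_divide)
  show "24998480 / 100000000 \<le> phi 2 J 1"
    by (rule chain_le_phi[OF J _ _ _ _ chain_down_values(1) refl]) (simp_all add: power_divide)
  show "phi 2 J 2 \<le> 908689 / 100000000"
    by (rule phi_le_chain[OF J _ _ _ _ chain_up_values(2) refl]) (simp_all add: power_divide)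
  show "99868 / 100000000 \<le> phi 2 J 3"
    by (rule chain_le_phi[OF J _ _ _ _ chain_down_values(2) refl]) (simp_all add: power_divide)
  show "phi 2 J 4 \<le> 13395 / 100000000"
    by (rule phi_le_chain[OF J _ _ _ _ chain_up_values(3) refl]) (simp_all add: power_divide)
  show "phi 2 J 6 \<le> 176 / 100000000"
    by (rule phi_le_chain[OF J _ _ _ _ chain_up_values(4) refl]) (simp_all add: power_divide)
  show "phi 2 J 8 \<le> 1 / 100000000"
    by (rule phi_le_chain[OF J _ _ _ _ chain_up_values(5) refl]) (simp_all add: power_divide)
  show "phi 2 J 10 \<le> 1 / 100000000"
    by (rule phi_le_chain[OF J _ _ _ _ chain_up_values(6) refl]) (simp_all add: power_divide)
qed

lemma phi_1991_bounds:
  assumes J: "100000000 \<le> J"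
  shows "86378596 / 100000000 \<le> phi (1991 / 1000) J 0" "phi (1991 / 1000) J 1 \<le> 24664105 / 100000000"
    "851990 / 100000000 \<le> phi (1991 / 1000) J 2" "phi (1991 / 1000) J 3 \<le> 101777 / 100000000"
    "phi (1991 / 1000) J 5 \<le> 1737 / 100000000" "phi (1991 / 1000) J 7 \<le> 13 / 100000000"
proof -
  show "86378596 / 100000000 \<le> phi (1991 / 1000) J 0"
    by (rule chain_le_phi[OF J _ _ _ _ chain_down_values(3) refl]) (simp_all add: power_divide)
  show "phi (1991 / 1000) J 1 \<le> 24664105 / 100000000"
    by (rule phi_le_chain[OF J _ _ _ _ chain_up_values(7) refl]) (simp_all add: power_divide)
  show "851990 / 100000000 \<le> phi (1991 / 1000) J 2"
    by (rule chain_le_phi[OF J _ _ _ _ chain_down_values(4) refl]) (simp_all add: power_divide)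
  show "phi (1991 / 1000) J 3 \<le> 101777 / 100000000"
    by (rule phi_le_chain[OF J _ _ _ _ chain_up_values(8) refl]) (simp_all add: power_divide)
  show "phi (1991 / 1000) J 5 \<le> 1737 / 100000000"
    by (rule phi_le_chain[OF J _ _ _ _ chain_up_values(9) refl]) (simp_all add: power_divide)
  show "phi (1991 / 1000) J 7 \<le> 13 / 100000000"
    by (rule phi_le_chain[OF J _ _ _ _ chain_up_values(10) refl]) (simp_all add: power_divide)
qed

lemma eventually_large_window: "\<forall>\<^sub>F n in sequentially. 100000000 \<le> window_size n \<and> 11 \<le> (32::nat) ^ n"
proof (rule eventually_sequentiallyI[of 4])
  fix n :: nat assume "4 \<le> n"
  then have "(32::nat) ^ 4 \<le> 32 ^ n" by (intro power_increasing) auto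
  then show "100000000 \<le> window_size n \<and> 11 \<le> (32::nat) ^ n" by (simp add: window_size_def)
qed

text \<open>The modes $5$, $7$ and $9$ enter with a negative sign and can be dropped, since \<open>phi\<close> is nonnegative.\<close>
lemma tail_prob_2_lower: "\<forall>\<^sub>F n in sequentially. 6688 / 10000000 \<le> tail_prob 2 (window_size n)"
proof -
  have "199 / 100 \<le> (2::real)" by simp
  from tail_prob_fourier_eventually[OF this] eventually_large_window show ?thesis
  proof eventually_elim
    case (elim n)
    let ?J = "window_size n" and ?t = "\<lambda>m. (-1) ^ m * phi 2 (window_size n) m / real (2 * m + 1)"
    have J: "100000000 \<le> ?J" and M: "11 \<le> (32::nat) ^ n" using elim by auto
    have "\<bar>(\<Sum>m<32 ^ n. ?t m) - (\<Sum>m<11. ?t m)\<bar> \<le> 8 / 5 * (3 / 8) ^ 11 / real (2 * 11 + 1)"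
      by (rule fourier_tail[OF _ M]) (auto simp: window_size_def)
    moreover have "8 / 5 * (3 / 8) ^ 11 / real (2 * 11 + 1) \<le> 145 / 100000000" by (simp add: power_divide)
    ultimately have "(\<Sum>m<32 ^ n. ?t m) \<le> (\<Sum>m<11. ?t m) + 145 / 100000000" by linarith
    moreover have "(\<Sum>m<11. ?t m) \<le> 7832944727 / 10000000000"
    proof -
      have "(\<Sum>m<11. ?t m) = phi 2 ?J 0 - phi 2 ?J 1 / 3 + phi 2 ?J 2 / 5 - phi 2 ?J 3 / 7 + phi 2 ?J 4 / 9
        - phi 2 ?J 5 / 11 + phi 2 ?J 6 / 13 - phi 2 ?J 7 / 15 + phi 2 ?J 8 / 17 - phi 2 ?J 9 / 19 + phi 2 ?J 10 / 21"
        by (simp add: lessThan_nat_numeral)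
      then show ?thesis
        using phi_2_bounds[OF J] phi_nonneg[of 2 ?J 5] phi_nonneg[of 2 ?J 7] phi_nonneg[of 2 ?J 9] by linarith
    qed
    moreover have "P \<le> 783296923 / 1000000000"
      if "\<bar>S - P\<bar> \<le> 1 / 10 ^ 6" "S \<le> S0 + 145 / 100000000" "S0 \<le> 7832944727 / 10000000000" for P S S0 :: real
      using that unfolding abs_le_iff by simp
    ultimately have T: "pi / 4 * (1 - 4 * tail_prob 2 ?J) \<le> 783296923 / 1000000000" using elim(1) by blast
    show ?case
    proof (rule ccontr)
      assume "\<not> ?thesis"
      then have q: "1 - 4 * (6688 / 10000000) \<le> 1 - 4 * tail_prob 2 ?J" by simp
      have "31415926 / 10000000 / 4 * (1 - 4 * (6688 / 10000000)) \<le> pi / 4 * (1 - 4 * tail_prob 2 ?J)"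
        using pi_bounds(1) q by (intro mult_mono divide_right_mono) auto
      then show False using T by simp
    qed
  qed
qed

text \<open>Here the modes $4$, $6$ and $8$ have the favourable sign.\<close>
lemma tail_prob_1991_upper: "\<forall>\<^sub>F n in sequentially. tail_prob (1991 / 1000) (window_size n) \<le> 727 / 1000000"
proof -
  have "199 / 100 \<le> (1991 / 1000 :: real)" by simp
  from tail_prob_fourier_eventually[OF this] eventually_large_window show ?thesis
  proof eventually_elim
    case (elim n)
    let ?J = "window_size n" and ?c = "1991 / 1000 :: real"
    let ?t = "\<lambda>m. (-1) ^ m * phi ?c ?J m / real (2 * m + 1)"
    have J: "100000000 \<le> ?J" and M: "9 \<le> (32::nat) ^ n" using elim by auto
    have "\<bar>(\<Sum>m<32 ^ n. ?t m) - (\<Sum>m<9. ?t m)\<bar> \<le> 8 / 5 * (3 / 8) ^ 9 / real (2 * 9 + 1)"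
      by (rule fourier_tail[OF _ M]) (auto simp: window_size_def)
    moreover have "8 / 5 * (3 / 8) ^ 9 / real (2 * 9 + 1) \<le> 125 / 10000000" by (simp add: power_divide)
    ultimately have "(\<Sum>m<9. ?t m) - 125 / 10000000 \<le> (\<Sum>m<32 ^ n. ?t m)" by linarith
    moreover have "783129273 / 1000000000 \<le> (\<Sum>m<9. ?t m)"
    proof -
      have "(\<Sum>m<9. ?t m) = phi ?c ?J 0 - phi ?c ?J 1 / 3 + phi ?c ?J 2 / 5 - phi ?c ?J 3 / 7 + phi ?c ?J 4 / 9
        - phi ?c ?J 5 / 11 + phi ?c ?J 6 / 13 - phi ?c ?J 7 / 15 + phi ?c ?J 8 / 17"
        by (simp add: lessThan_nat_numeral)
      then show ?thesis
        using phi_1991_bounds[OF J] phi_nonneg[of ?c ?J 4] phi_nonneg[of ?c ?J 6] phi_nonneg[of ?c ?J 8] by linarith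
    qed
    moreover have "783115 / 1000000 \<le> P"
      if "\<bar>S - P\<bar> \<le> 1 / 10 ^ 6" "S0 - 125 / 10000000 \<le> S" "783129273 / 1000000000 \<le> S0" for P S S0 :: real
      using that unfolding abs_le_iff by simp
    ultimately have T: "783115 / 1000000 \<le> pi / 4 * (1 - 4 * tail_prob ?c ?J)" using elim(1) by blast
    show ?case
    proof (rule ccontr)
      assume "\<not> ?thesis"
      then have q: "1 - 4 * tail_prob ?c ?J \<le> 1 - 4 * (727 / 1000000)" by simp
      have "pi / 4 * (1 - 4 * tail_prob ?c ?J) \<le> pi / 4 * (1 - 4 * (727 / 1000000))"
        using q by (intro mult_left_mono) auto
      also have "\<dots> \<le> 31415927 / 10000000 / 4 * (1 - 4 * (727 / 1000000))"
        using pi_bounds(2) by (intro mult_right_mono divide_right_mono) auto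
      finally show False using T by simp
    qed
  qed
qed

lemma exp_fraction_le:
  assumes "(271828183 / 100000000) ^ a \<le> v ^ k" "0 \<le> v" "k > 0"
  shows "exp (real a / real k) \<le> v"
proof -
  have "exp (real a / real k) ^ k = exp 1 ^ a" using assms(3) by (simp flip: exp_of_nat_mult)
  also have "\<dots> \<le> (271828183 / 100000000) ^ a" by (intro power_mono exp_1_bounds) auto
  also have "\<dots> \<le> v ^ k" by (rule assms)
  finally show ?thesis using assms by (simp add: power_mono_iff)
qed

lemma cosh_fraction_le:
  assumes "(271828183 / 100000000) ^ a \<le> v ^ k" "1 \<le> v" "k > 0"
  shows "cosh (real a / real k) \<le> (v + 1 / v) / 2"
proof -
  let ?x = "exp (real a / real k)"
  have x: "1 \<le> ?x" "?x \<le> v" using assms exp_fraction_le[of a v k] by auto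
  have "0 \<le> (v - ?x) * (1 - 1 / (v * ?x))"
  proof (intro mult_nonneg_nonneg)
    have "1 * 1 \<le> v * ?x" using x assms by (intro mult_mono) auto
    then show "0 \<le> 1 - 1 / (v * ?x)" by simp
  qed (use x in simp)
  also have "\<dots> = v + 1 / v - (?x + 1 / ?x)" using x assms by (simp add: field_simps)
  finally show ?thesis by (simp add: cosh_def exp_minus inverse_eq_divide)
qed

text \<open>Exponential moment at $t = 10$: four factors are estimated individually, all later ones by Gaussians.\<close>
lemma weight'_tail: "sprob (window J) (\<lambda>A. ssum (window J) weight' A \<le> - (1964 / 1000)) \<le> 84 / 1000000" if J: "J \<ge> 5"
proof -
  define f where "f w = cosh (10 * (if w = 1 / 3 then 0 else w))" for w :: real
  define K where "K = cosh (10 / 5) * cosh (10 / 7) * cosh (10 / 9) * cosh (10 / 11 :: real)"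
  have fw: "cosh (10 * weight' i) = f (weight i)" for i
  proof -
    have "\<bar>of_int (2 * i + 1)\<bar> = (3 :: real) \<longleftrightarrow> i = 1 \<or> i = -2"
    proof -
      have "\<bar>of_int (2 * i + 1)\<bar> = (3 :: real) \<longleftrightarrow> \<bar>2 * i + 1\<bar> = 3"
        by (metis of_int_abs of_int_eq_numeral_iff)
      also have "\<dots> \<longleftrightarrow> i = 1 \<or> i = -2" by arith
      finally show ?thesis .
    qed
    then have "weight i = 1 / 3 \<longleftrightarrow> i = 1 \<or> i = -2" by (simp only: weight_def) (simp add: divide_simps)
    then show ?thesis by (simp add: f_def weight'_def)
  qed
  have tail: "(\<Prod>j=1..J. f (1 / real (2 * j + 1)) * f (1 / real (2 * j + 1))) \<le> K\<^sup>2 * exp (25 * (1 / 6 - 1 / (real J + 1)))"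
    using J
  proof (induction J rule: dec_induct)
    case base
    have "{1..5::nat} = {1,2,3,4,5}" by auto
    then have "(\<Prod>j=1..5. f (1 / real (2 * j + 1)) * f (1 / real (2 * j + 1))) = K\<^sup>2"
      by (simp add: f_def K_def power2_eq_square)
    then show ?case by simp
  next
    case (step k)
    let ?z = "10 / real (2 * Suc k + 1)"
    have f: "f (1 / real (2 * Suc k + 1)) = cosh ?z" using step.hyps by (simp add: f_def)
    have "cosh ?z * cosh ?z \<le> exp (?z\<^sup>2 / 2) * exp (?z\<^sup>2 / 2)"
      by (intro mult_mono cosh_le_exp_square cosh_real_nonneg) auto
    also have "\<dots> = exp (?z\<^sup>2)" by (simp flip: exp_add)
    also have "\<dots> \<le> exp (25 * (1 / (real k + 1) - 1 / (real (Suc k) + 1)))"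
      by (simp add: divide_simps power2_eq_square) (simp add: algebra_simps)
    finally have s: "cosh ?z * cosh ?z \<le> exp (25 * (1 / (real k + 1) - 1 / (real (Suc k) + 1)))" .
    have "(\<Prod>j=1..Suc k. f (1 / real (2 * j + 1)) * f (1 / real (2 * j + 1)))
      = (\<Prod>j=1..k. f (1 / real (2 * j + 1)) * f (1 / real (2 * j + 1))) * (cosh ?z * cosh ?z)"
      by (simp only: prod.nat_ivl_Suc' f[symmetric]) (simp add: mult.commute)
    also have "\<dots> \<le> (K\<^sup>2 * exp (25 * (1 / 6 - 1 / (real k + 1)))) * exp (25 * (1 / (real k + 1) - 1 / (real (Suc k) + 1)))"
      by (intro mult_mono step.IH s) auto
    also have "\<dots> = K\<^sup>2 * exp (25 * (1 / 6 - 1 / (real (Suc k) + 1)))"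
      by (simp only: mult.assoc exp_add[symmetric]) (simp add: algebra_simps)
    finally show ?case .
  qed
  have c: "cosh (10 / 5) \<le> (37623 / 10000 :: real)" "cosh (10 / 7) \<le> (22063 / 10000 :: real)"
    "cosh (10 / 9) \<le> (16835 / 10000 :: real)" "cosh (10 / 11) \<le> (14425 / 10000 :: real)"
  proof -
    have "cosh (real 10 / real 5) \<le> (73891 / 10000 + 1 / (73891 / 10000)) / 2"
      by (rule cosh_fraction_le) (simp_all add: power_divide)
    then show "cosh (10 / 5) \<le> (37623 / 10000 :: real)" by simp
    have "cosh (real 10 / real 7) \<le> (41728 / 10000 + 1 / (41728 / 10000)) / 2"
      by (rule cosh_fraction_le) (simp_all add: power_divide)
    then show "cosh (10 / 7) \<le> (22063 / 10000 :: real)" by simp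
    have "cosh (real 10 / real 9) \<le> (30378 / 10000 + 1 / (30378 / 10000)) / 2"
      by (rule cosh_fraction_le) (simp_all add: power_divide)
    then show "cosh (10 / 9) \<le> (16835 / 10000 :: real)" by simp
    have "cosh (real 10 / real 11) \<le> (24821 / 10000 + 1 / (24821 / 10000)) / 2"
      by (rule cosh_fraction_le) (simp_all add: power_divide)
    then show "cosh (10 / 11) \<le> (14425 / 10000 :: real)" by simp
  qed
  have "K \<le> (37623 / 10000) * (22063 / 10000) * (16835 / 10000) * (14425 / 10000)"
    unfolding K_def by (intro mult_mono c mult_nonneg_nonneg cosh_real_nonneg) auto
  then have K: "K \<le> 20158 / 1000" by simp
  have K0: "0 \<le> K" unfolding K_def by simp
  have E: "4876000 \<le> exp (77 / 5 :: real)"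
  proof -
    have "(59874 :: real) \<le> (271828182 / 100000000) ^ 11" by (simp add: power_divide)
    also have "\<dots> \<le> exp 1 ^ 11" by (intro power_mono exp_1_bounds) auto
    finally have "(59874 :: real) ^ 7 \<le> (exp 1 ^ 11) ^ 7" by (intro power_mono) auto
    moreover have "(4876000 :: real) ^ 5 \<le> 59874 ^ 7" by simp
    ultimately have "(4876000 :: real) ^ 5 \<le> exp 1 ^ 77" by (simp flip: power_mult)
    also have "\<dots> = exp (77 / 5 :: real) ^ 5" by (simp flip: exp_of_nat_mult)
    finally show ?thesis by (rule power_mono_iff[THEN iffD1, rotated -1]) auto
  qed
  have "sprob (window J) (\<lambda>A. ssum (window J) weight' A \<le> - (1964 / 1000))
    \<le> exp (- (10 * (1964 / 1000))) * (\<Prod>i\<in>window J. cosh (10 * weight' i))"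
    by (rule chernoff_ssum) auto
  also have "\<dots> \<le> exp (- (10 * (1964 / 1000))) * (K\<^sup>2 * exp (25 * (1 / 6 - 1 / (real J + 1))))"
    unfolding fw prod_window[where f = f] by (intro mult_left_mono tail) auto
  also have "\<dots> \<le> exp (- (10 * (1964 / 1000))) * (K\<^sup>2 * exp (25 / 6))"
    by (intro mult_left_mono) auto
  also have "\<dots> = K\<^sup>2 * exp (25 / 6 - 10 * (1964 / 1000))" by (simp flip: exp_add)
  also have "\<dots> \<le> (20158 / 1000)\<^sup>2 * exp (- (77 / 5))" by (intro mult_mono power_mono K K0) auto
  also have "\<dots> \<le> (20158 / 1000)\<^sup>2 * (1 / 4876000)"
    unfolding exp_minus inverse_eq_divide using E by (intro mult_left_mono divide_left_mono) auto
  also have "\<dots> \<le> 84 / 1000000" by (simp add: power2_eq_square)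
  finally show ?thesis .
qed

theorem mainTheorem4:
  "\<exists>\<kappa>\<^sub>0 :: real.
     ((\<lambda>p. 1 / real p * real (card (unit_circle_zeros p))) \<longlongrightarrow> \<kappa>\<^sub>0) odd_primes_at_top \<and>
     0.500813 > \<kappa>\<^sub>0 \<and> \<kappa>\<^sub>0 > 0.500668"
proof -
  obtain \<kappa> where k: "((\<lambda>p. card (unit_circle_zeros p) / p) \<longlongrightarrow> \<kappa>) odd_primes_at_top"
    and D: "(\<lambda>n. 1 / 2 + sprob (window (window_size n)) (dips (window_size n) 0)) \<longlonglongrightarrow> \<kappa>"
    by (rule zero_density_limit)
  have "\<forall>\<^sub>F n in sequentially. 5006688 / 10000000 \<le> 1 / 2 + sprob (window (window_size n)) (dips (window_size n) 0)"
    using tail_prob_2_lower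
  proof eventually_elim
    case (elim n)
    then show ?case using tail_prob_le_dips[of "window_size n"] by simp
  qed
  with D have lower: "5006688 / 10000000 \<le> \<kappa>" by (rule tendsto_lowerbound) simp
  have "\<forall>\<^sub>F n in sequentially. 1 / 2 + sprob (window (window_size n)) (dips (window_size n) 0) \<le> 500811 / 1000000"
    using tail_prob_1991_upper eventually_large_window
  proof eventually_elim
    case (elim n)
    have "1 \<le> window_size n" "5 \<le> window_size n" using elim(2) by simp_all
    then show ?case using dips_le_tail_prob[of "window_size n"] weight'_tail[of "window_size n"] elim(1) by simp
  qed
  with D have upper: "\<kappa> \<le> 500811 / 1000000" by (rule tendsto_upperbound) simp
  have "((\<lambda>p. 1 / real p * real (card (unit_circle_zeros p))) \<longlongrightarrow> \<kappa>) odd_primes_at_top" using k by simp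
  then show ?thesis using lower upper by (intro exI[of _ \<kappa>]) simp
qed

end
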